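(* Let $n\ge1$ and $G/K=\mathrm U(2n)/\mathrm{Sp}(n)$. The algebra $(\bigwedge\mathfrak p)^K$ is isomorphic to the exterior algebra $\bigwedge(\mathcal P_\wedge(\mathfrak p))$, where $\mathcal P_\wedge(\mathfrak p)\cong\mathfrak a$ is a graded subspace whose degrees are $4i-3$, $1\le i\le n$.
   Context: $\mathfrak g=\mathfrak k\oplus\mathfrak p$ is the decomposition of the complexified Lie algebra of $G$ into the $(+1)$- and $(-1)$-eigenspaces of the involution defining the symmetric space $G/K$; $\mathfrak k$ is the complexified Lie algebra of $K$. $\mathfrak t$ is the complexification of a Cartan subalgebra of the Lie algebra of $K$ and $\mathfrak a$ is the centralizer of $\mathfrak t$ in $\mathfrak p$ (it has dimension $n$). $B$ is the nondegenerate invariant symmetric bilinear form on $\mathfrak g$ obtained by extending the Killing form over the center (one may take the trace form $\operatorname{tr}XY$); it induces a bilinear form on $\bigwedge\mathfrak p$. Superscript $K$ means invariants for the adjoint action. Let $(\bigwedge\mathfrak p)^K_+$ be the augmentation ideal (span of the invariants of positive degree). $\mathcal P_\wedge(\mathfrak p)$ is the subspace of $(\bigwedge\mathfrak p)^K_+$ orthogonal with respect to $B$ to the square $((\bigwedge\mathfrak p)^K_+)^2$ of the augmentation ideal. The isomorphism $\mathcal P_\wedge(\mathfrak p)\cong\mathfrak a$ is one of vector spaces; "degrees" are degrees of a homogeneous basis in $\bigwedge\mathfrak p$. *)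

theory Defs
  imports "HOL-Analysis.Analysis" "HOL-Library.Poly_Mapping"
begin

section \<open>Complex vector spaces and algebras\<close>

class complex_vector = ab_group_add +
  fixes scaleC :: "complex \<Rightarrow> 'a \<Rightarrow> 'a" (infixr \<open>*\<^sub>C\<close> 75)
  assumes scaleC_add_right: "c *\<^sub>C (x + y) = c *\<^sub>C x + c *\<^sub>C y"
    and scaleC_add_left: "(c + d) *\<^sub>C x = c *\<^sub>C x + d *\<^sub>C x"
    and scaleC_scaleC: "c *\<^sub>C d *\<^sub>C x = (c * d) *\<^sub>C x"
    and scaleC_one: "1 *\<^sub>C x = x"

global_interpretation cvs: vector_space "scaleC :: complex \<Rightarrow> 'a \<Rightarrow> 'a::complex_vector"
  by unfold_locales (simp_all add: scaleC_add_right scaleC_add_left scaleC_scaleC scaleC_one)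

class complex_algebra_1 = complex_vector + ring_1 +
  assumes mult_scaleC_left: "(c *\<^sub>C x) * y = c *\<^sub>C (x * y)"
    and mult_scaleC_right: "x * (c *\<^sub>C y) = c *\<^sub>C (x * y)"

instantiation complex :: complex_algebra_1
begin
definition scaleC_complex :: "complex \<Rightarrow> complex \<Rightarrow> complex"
  where "scaleC_complex = (*)"
instance by standard (simp_all add: scaleC_complex_def algebra_simps)
end

instantiation vec :: (complex_vector, finite) complex_vector
begin
definition scaleC_vec :: "complex \<Rightarrow> ('a, 'b) vec \<Rightarrow> ('a, 'b) vec"
  where "scaleC_vec c x = (\<chi> i. c *\<^sub>C x $ i)"
instance
  by standard (simp_all add: scaleC_vec_def vec_eq_iff scaleC_add_right scaleC_add_left
      scaleC_scaleC scaleC_one)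
end

lemma scaleC_vec_nth [simp]: "(c *\<^sub>C x) $ i = c *\<^sub>C (x $ i)"
  by (simp add: scaleC_vec_def)


section \<open>The exterior algebra of a complex vector space\<close>

text \<open>The tensor algebra \<open>T(V)\<close> is presented as a quotient of the free associative algebra on the
  underlying set of \<open>V\<close>, i.e. the monoid algebra of the free monoid of words over \<open>V\<close>.\<close>

instantiation list :: (type) monoid_add
begin
definition zero_list :: "'a list" where "zero_list = []"
definition plus_list :: "'a list \<Rightarrow> 'a list \<Rightarrow> 'a list" where "plus_list = (@)"
instance by standard (simp_all add: zero_list_def plus_list_def)
end

type_synonym 'v words = "'v list \<Rightarrow>\<^sub>0 complex"

abbreviation letter :: "'v \<Rightarrow> 'v words"
  where "letter v \<equiv> Poly_Mapping.single [v] 1"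

abbreviation const_word :: "complex \<Rightarrow> 'v words"
  where "const_word c \<equiv> Poly_Mapping.single [] c"

text \<open>The first two families of relations make \<open>letter\<close> linear (giving \<open>T(V)\<close>), the third one
  passes from \<open>T(V)\<close> to the exterior algebra.\<close>

definition ext_relations :: "'v::complex_vector words set" where
  "ext_relations =
     {letter (x + y) - letter x - letter y | x y. True} \<union>
     {letter (c *\<^sub>C x) - const_word c * letter x | c x. True} \<union>
     {letter x * letter x | x. True}"

inductive_set ext_ideal :: "'v::complex_vector words set" where
  zero: "0 \<in> ext_ideal"
| gen: "r \<in> ext_relations \<Longrightarrow> a * r * b \<in> ext_ideal"
| add: "p \<in> ext_ideal \<Longrightarrow> q \<in> ext_ideal \<Longrightarrow> p + q \<in> ext_ideal"

definition ext_rel :: "'v::complex_vector words \<Rightarrow> 'v words \<Rightarrow> bool"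
  where "ext_rel p q \<longleftrightarrow> p - q \<in> ext_ideal"

lemma ext_ideal_mult_left: "p \<in> ext_ideal \<Longrightarrow> a * p \<in> ext_ideal"
proof (induction rule: ext_ideal.induct)
  case (gen r b c)
  then show ?case using ext_ideal.gen[of r "a * b" c] by (simp add: mult.assoc)
qed (auto simp: distrib_left intro: ext_ideal.intros)

lemma ext_ideal_mult_right: "p \<in> ext_ideal \<Longrightarrow> p * a \<in> ext_ideal"
proof (induction rule: ext_ideal.induct)
  case (gen r b c)
  then show ?case using ext_ideal.gen[of r b "c * a"] by (simp add: mult.assoc)
qed (auto simp: distrib_right intro: ext_ideal.intros)

lemma ext_ideal_uminus: "p \<in> ext_ideal \<Longrightarrow> - p \<in> ext_ideal"
  using ext_ideal_mult_left[of p "- 1"] by simp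

lemma ext_ideal_diff: "p \<in> ext_ideal \<Longrightarrow> q \<in> ext_ideal \<Longrightarrow> p - q \<in> ext_ideal"
  using ext_ideal.add[of p "- q"] ext_ideal_uminus[of q] by simp

lemma ext_relations_in_ideal: "r \<in> ext_relations \<Longrightarrow> r \<in> ext_ideal"
  using ext_ideal.gen[of r 1 1] by simp

lemma lookup_mult_Nil:
  fixes p q :: "'v words"
  shows "Poly_Mapping.lookup (p * q) [] = Poly_Mapping.lookup p [] * Poly_Mapping.lookup q []"
proof -
  have *: "(\<Sum>r. Poly_Mapping.lookup q r when ([]::'v list) = l + r) = (Poly_Mapping.lookup q [] when l = [])" for l
  proof (cases "l = []")
    case True
    have "(\<Sum>r. Poly_Mapping.lookup q r when ([]::'v list) = l + r) = (\<Sum>r. Poly_Mapping.lookup q r when r = [])"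
      using True by (intro Sum_any.cong) (auto simp: plus_list_def when_def)
    then show ?thesis using True by simp
  next
    case False
    then show ?thesis by (simp add: plus_list_def)
  qed
  have "Poly_Mapping.lookup (p * q) [] = (\<Sum>l. Poly_Mapping.lookup p l * (Poly_Mapping.lookup q [] when l = []))"
    by (simp add: lookup_mult *)
  also have "\<dots> = (\<Sum>l. Poly_Mapping.lookup p l * Poly_Mapping.lookup q [] when l = [])"
    by (simp add: mult_when)
  finally show ?thesis by simp
qed

lemma ext_ideal_lookup_Nil: "p \<in> ext_ideal \<Longrightarrow> Poly_Mapping.lookup p [] = 0"
  by (induction rule: ext_ideal.induct)
    (auto simp: lookup_mult_Nil lookup_add ext_relations_def lookup_minus lookup_single)

lemma one_notin_ext_ideal: "1 \<notin> ext_ideal"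
  using ext_ideal_lookup_Nil[of 1] by (auto simp: lookup_one zero_list_def)

lemma equivp_ext_rel: "equivp (ext_rel :: 'v::complex_vector words \<Rightarrow> _)"
proof (rule equivpI)
  show "reflp (ext_rel :: 'v words \<Rightarrow> _)"
    by (rule reflpI) (simp add: ext_rel_def ext_ideal.zero)
  show "symp (ext_rel :: 'v words \<Rightarrow> _)"
    by (rule sympI) (use ext_ideal_uminus in \<open>fastforce simp: ext_rel_def\<close>)
  show "transp (ext_rel :: 'v words \<Rightarrow> _)"
  proof (rule transpI)
    fix p q r :: "'v words" assume "ext_rel p q" "ext_rel q r"
    then show "ext_rel p r" using ext_ideal.add[of "p - q" "q - r"] by (simp add: ext_rel_def)
  qed
qed

quotient_type (overloaded) 'v ext = "'v::complex_vector words" / ext_rel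
  by (rule equivp_ext_rel)

lemma const_word_commute: "p * const_word c = const_word c * (p :: 'v words)"
proof (induction p rule: update_induct)
  case (update f a b)
  have "Poly_Mapping.update a b f = f + Poly_Mapping.single a b"
    using update.hyps(1)
    by (intro poly_mapping_eqI)
       (auto simp: lookup_update lookup_add lookup_single when_def in_keys_iff)
  then show ?case using update.IH
    by (simp add: distrib_left distrib_right mult_single plus_list_def mult.commute)
qed auto

instantiation ext :: (complex_vector) complex_algebra_1
begin

lift_definition zero_ext :: "'a ext" is 0 .
lift_definition one_ext :: "'a ext" is 1 .

lift_definition plus_ext :: "'a ext \<Rightarrow> 'a ext \<Rightarrow> 'a ext" is "(+)"
proof -
  fix a b c d :: "'a words" assume "ext_rel a b" "ext_rel c d"
  then have "(a - b) + (c - d) \<in> ext_ideal" unfolding ext_rel_def by (rule ext_ideal.add)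
  then show "ext_rel (a + c) (b + d)" by (simp add: ext_rel_def algebra_simps)
qed

lift_definition uminus_ext :: "'a ext \<Rightarrow> 'a ext" is uminus
  using ext_ideal_uminus by (fastforce simp: ext_rel_def)

lift_definition minus_ext :: "'a ext \<Rightarrow> 'a ext \<Rightarrow> 'a ext" is "(-)"
proof -
  fix a b c d :: "'a words" assume "ext_rel a b" "ext_rel c d"
  then have "(a - b) - (c - d) \<in> ext_ideal" unfolding ext_rel_def by (rule ext_ideal_diff)
  then show "ext_rel (a - c) (b - d)" by (simp add: ext_rel_def algebra_simps)
qed

lift_definition times_ext :: "'a ext \<Rightarrow> 'a ext \<Rightarrow> 'a ext" is "(*)"
proof -
  fix a b c d :: "'a words" assume "ext_rel a b" "ext_rel c d"
  then have "(a - b) * c + b * (c - d) \<in> ext_ideal"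
    by (intro ext_ideal.add ext_ideal_mult_left ext_ideal_mult_right) (auto simp: ext_rel_def)
  then show "ext_rel (a * c) (b * d)" by (simp add: ext_rel_def algebra_simps)
qed

lift_definition scaleC_ext :: "complex \<Rightarrow> 'a ext \<Rightarrow> 'a ext" is "\<lambda>c p. const_word c * p"
  unfolding ext_rel_def using ext_ideal_mult_left by (metis right_diff_distrib)

instance
proof
  have refl: "ext_rel p p" for p :: "'a words" by (simp add: ext_rel_def ext_ideal.zero)
  have eq: "ext_rel p q" if "p = q" for p q :: "'a words" using that refl by simp
  fix a b c :: "'a ext" and s t :: complex
  show "a + b + c = a + (b + c)" by transfer (rule eq, simp add: algebra_simps)
  show "a + b = b + a" by transfer (rule eq, simp add: algebra_simps)
  show "0 + a = a" by transfer (rule eq, simp)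
  show "- a + a = 0" by transfer (rule eq, simp)
  show "a - b = a + - b" by transfer (rule eq, simp)
  show "a * b * c = a * (b * c)" by transfer (rule eq, simp add: mult.assoc)
  show "(a + b) * c = a * c + b * c" by transfer (rule eq, simp add: algebra_simps)
  show "a * (b + c) = a * b + a * c" by transfer (rule eq, simp add: algebra_simps)
  show "1 * a = a" by transfer (rule eq, simp)
  show "a * 1 = a" by transfer (rule eq, simp)
  show "(0::'a ext) \<noteq> 1"
  proof transfer
    show "\<not> ext_rel 0 (1 :: 'a words)"
      using ext_ideal_uminus[of "0 - (1 :: 'a words)"] one_notin_ext_ideal
      by (auto simp: ext_rel_def)
  qed
  show "s *\<^sub>C (a + b) = s *\<^sub>C a + s *\<^sub>C b" by transfer (rule eq, simp add: algebra_simps)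
  show "(s + t) *\<^sub>C a = s *\<^sub>C a + t *\<^sub>C a"
    by transfer (rule eq, simp add: algebra_simps single_add)
  show "s *\<^sub>C t *\<^sub>C a = (s * t) *\<^sub>C a"
    by transfer (rule eq, simp add: mult.assoc[symmetric] mult_single plus_list_def)
  show "1 *\<^sub>C a = a"
    by transfer (rule eq, metis mult_1 single_one zero_list_def)
  show "(s *\<^sub>C a) * b = s *\<^sub>C (a * b)" by transfer (rule eq, simp add: mult.assoc)
  show "a * (s *\<^sub>C b) = s *\<^sub>C (a * b)"
    by transfer (rule eq, metis const_word_commute mult.assoc)
qed

end

lift_definition ext_inc :: "'v::complex_vector \<Rightarrow> 'v ext" is letter .

definition wedge :: "'v::complex_vector list \<Rightarrow> 'v ext"
  where "wedge xs = prod_list (map ext_inc xs)"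

text \<open>For a subspace \<open>V\<close> of the ambient space, \<open>\<And>V\<close> is identified with the subalgebra of the
  exterior algebra of the ambient space that is generated by \<open>V\<close> (over a field the canonical map
  between the two exterior algebras is injective).\<close>

definition ext_power :: "'v::complex_vector set \<Rightarrow> nat \<Rightarrow> 'v ext set"
  where "ext_power V k = cvs.span {wedge xs | xs. set xs \<subseteq> V \<and> length xs = k}"

definition ext_algebra :: "'v::complex_vector set \<Rightarrow> 'v ext set"
  where "ext_algebra V = cvs.span {wedge xs | xs. set xs \<subseteq> V}"

subsection \<open>Induced algebra homomorphisms and bilinear forms\<close>

definition words_extend :: "('v list \<Rightarrow> 'a::complex_vector) \<Rightarrow> 'v words \<Rightarrow> 'a"
  where "words_extend f p = (\<Sum>w\<in>Poly_Mapping.keys p. Poly_Mapping.lookup p w *\<^sub>C f w)"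

lemma words_extend_superset:
  assumes "finite S" "Poly_Mapping.keys p \<subseteq> S"
  shows "words_extend f p = (\<Sum>w\<in>S. Poly_Mapping.lookup p w *\<^sub>C f w)"
  unfolding words_extend_def using assms
  by (intro sum.mono_neutral_left) (auto simp: in_keys_iff)

lemma words_extend_zero [simp]: "words_extend f 0 = 0"
  by (simp add: words_extend_def)

lemma words_extend_single [simp]: "words_extend f (Poly_Mapping.single w c) = c *\<^sub>C f w"
  by (subst words_extend_superset[of "{w}"]) auto

lemma words_extend_add: "words_extend f (p + q) = words_extend f p + words_extend f q"
proof -
  let ?S = "Poly_Mapping.keys p \<union> Poly_Mapping.keys q"
  have "words_extend f r = (\<Sum>w\<in>?S. Poly_Mapping.lookup r w *\<^sub>C f w)" if "r \<in> {p, q, p + q}" for r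
    using that keys_add[of p q] by (intro words_extend_superset) auto
  then show ?thesis by (simp add: lookup_add scaleC_add_left sum.distrib)
qed

lemma words_extend_uminus: "words_extend f (- p) = - words_extend f p"
  using words_extend_add[of f p "- p"] by (simp add: eq_neg_iff_add_eq_0 add.commute)

lemma words_extend_diff: "words_extend f (p - q) = words_extend f p - words_extend f q"
  using words_extend_add[of f p "- q"] by (simp add: words_extend_uminus)

lemma words_induct [case_names zero single add]:
  assumes "P 0" "\<And>w c. P (Poly_Mapping.single w c)" "\<And>p q. P p \<Longrightarrow> P q \<Longrightarrow> P (p + q)"
  shows "P (p :: 'v words)"
proof (induction p rule: update_induct)
  case (update f a b)
  have "Poly_Mapping.update a b f = f + Poly_Mapping.single a b"
    using update.hyps(1)
    by (intro poly_mapping_eqI)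
       (auto simp: lookup_update lookup_add lookup_single when_def in_keys_iff)
  then show ?case using update.IH assms by simp
qed (use assms in auto)

lemma words_extend_mult:
  fixes f :: "'v list \<Rightarrow> 'a::complex_algebra_1"
  assumes "\<And>u v. f (u @ v) = f u * f v"
  shows "words_extend f (p * q) = words_extend f p * words_extend f q"
proof (induction p rule: words_induct)
  case (single u c)
  show ?case
  proof (induction q rule: words_induct)
    case (single v d)
    then show ?case
      by (simp add: mult_single plus_list_def assms mult_scaleC_left mult_scaleC_right
          scaleC_scaleC)
  qed (simp_all add: distrib_left words_extend_add)
qed (simp_all add: distrib_right words_extend_add)

text \<open>\<open>ext_lift\<close> and \<open>ext_form\<close> evaluate on a chosen representative; \<open>ext_lift_abs\<close> and
  \<open>ext_form_abs\<close> below show independence of that choice when \<open>f\<close> is linear with squares zero,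
  respectively when \<open>b\<close> is bilinear.\<close>

definition ext_lift :: "('v \<Rightarrow> 'a) \<Rightarrow> 'v::complex_vector ext \<Rightarrow> 'a::complex_algebra_1"
  where "ext_lift f x = words_extend (\<lambda>w. prod_list (map f w)) (rep_ext x)"

definition ext_map :: "('v \<Rightarrow> 'w) \<Rightarrow> 'v::complex_vector ext \<Rightarrow> 'w::complex_vector ext"
  where "ext_map f = ext_lift (\<lambda>v. ext_inc (f v))"

definition gram_det :: "('v \<Rightarrow> 'v \<Rightarrow> complex) \<Rightarrow> 'v list \<Rightarrow> 'v list \<Rightarrow> complex"
  where "gram_det b u v =
    (if length u = length v
     then \<Sum>\<pi> | \<pi> permutes {..<length u}. of_int (sign \<pi>) * (\<Prod>i<length u. b (u ! i) (v ! \<pi> i))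
     else 0)"

text \<open>The form induced by \<open>b\<close> on the exterior algebra: different degrees are orthogonal and
  \<open>(x\<^sub>1 \<and> ... \<and> x\<^sub>k, y\<^sub>1 \<and> ... \<and> y\<^sub>k) = det (b x\<^sub>i y\<^sub>j)\<close>.\<close>

definition ext_form ::
    "('v \<Rightarrow> 'v \<Rightarrow> complex) \<Rightarrow> 'v::complex_vector ext \<Rightarrow> 'v ext \<Rightarrow> complex"
  where "ext_form b x y =
    words_extend (\<lambda>u. words_extend (\<lambda>v. gram_det b u v) (rep_ext y)) (rep_ext x)"

lemma words_extend_ext_ideal:
  fixes f :: "'v::complex_vector \<Rightarrow> 'a::complex_algebra_1"
  assumes "Vector_Spaces.linear scaleC scaleC f" "\<And>x. f x * f x = 0" "p \<in> ext_ideal"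
  shows "words_extend (\<lambda>w. prod_list (map f w)) p = 0"
proof -
  interpret f: Vector_Spaces.linear scaleC scaleC f by fact
  let ?E = "words_extend (\<lambda>w. prod_list (map f w))"
  have mult: "?E (p * q) = ?E p * ?E q" for p q by (rule words_extend_mult) simp
  from assms(3) show ?thesis
  proof (induction rule: ext_ideal.induct)
    case (gen r a b)
    then have "?E r = 0"
      using assms(2)
      by (auto simp: ext_relations_def mult words_extend_diff f.add f.scale scaleC_one
          mult_scaleC_left)
    then show ?case by (simp add: mult)
  qed (auto simp: words_extend_add)
qed

lemma ext_lift_abs:
  fixes f :: "'v::complex_vector \<Rightarrow> 'a::complex_algebra_1"
  assumes "Vector_Spaces.linear scaleC scaleC f" "\<And>x. f x * f x = 0"
  shows "ext_lift f (abs_ext p) = words_extend (\<lambda>w. prod_list (map f w)) p"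
proof -
  have "ext_rel (rep_ext (abs_ext p)) p"
    using Quotient3_ext Quotient3_rep_abs equivp_reflp[OF equivp_ext_rel] by metis
  then show ?thesis
    using words_extend_ext_ideal[OF assms, of "rep_ext (abs_ext p) - p"]
    by (simp add: ext_lift_def ext_rel_def words_extend_diff)
qed

lemma abs_ext_cases [cases type: ext]: obtains p where "x = abs_ext p"
  using Quotient3_abs_rep[OF Quotient3_ext] by metis

lemma
  fixes f :: "'v::complex_vector \<Rightarrow> 'a::complex_algebra_1"
  assumes "Vector_Spaces.linear scaleC scaleC f" "\<And>x. f x * f x = 0"
  shows ext_lift_ext_inc: "ext_lift f (ext_inc v) = f v"
    and ext_lift_one: "ext_lift f 1 = 1"
    and ext_lift_add: "ext_lift f (x + y) = ext_lift f x + ext_lift f y"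
    and ext_lift_mult: "ext_lift f (x * y) = ext_lift f x * ext_lift f y"
    and ext_lift_scaleC: "ext_lift f (c *\<^sub>C x) = c *\<^sub>C ext_lift f x"
proof -
  obtain p q where pq: "x = abs_ext p" "y = abs_ext q" by (cases x, cases y) auto
  have mult: "words_extend (\<lambda>w. prod_list (map f w)) (p * q) =
      words_extend (\<lambda>w. prod_list (map f w)) p * words_extend (\<lambda>w. prod_list (map f w)) q" for p q
    by (rule words_extend_mult) simp
  note [simp] = ext_lift_abs[OF assms]
  show "ext_lift f (ext_inc v) = f v"
    by (simp add: ext_inc.abs_eq scaleC_one)
  show "ext_lift f 1 = 1"
    by (simp add: one_ext.abs_eq flip: single_one) (simp add: zero_list_def scaleC_one)
  show "ext_lift f (x + y) = ext_lift f x + ext_lift f y"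
    by (simp add: pq plus_ext.abs_eq words_extend_add)
  show "ext_lift f (x * y) = ext_lift f x * ext_lift f y"
    by (simp add: pq times_ext.abs_eq mult)
  show "ext_lift f (c *\<^sub>C x) = c *\<^sub>C ext_lift f x"
    by (simp add: pq scaleC_ext.abs_eq mult mult_scaleC_left)
qed

lemma linear_ext_inc: "Vector_Spaces.linear scaleC scaleC ext_inc"
proof (unfold_locales, goal_cases)
  case (1 x y)
  show ?case
  proof transfer
    fix x y :: 'a
    have "letter (x + y) - letter x - letter y \<in> ext_ideal"
      by (intro ext_relations_in_ideal) (auto simp: ext_relations_def)
    then show "ext_rel (letter (x + y)) (letter x + letter y)"
      by (simp add: ext_rel_def algebra_simps)
  qed
next
  case (2 c x)
  show ?case
  proof transfer
    fix c and x :: 'a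
    show "ext_rel (letter (c *\<^sub>C x)) (const_word c * letter x)"
      unfolding ext_rel_def by (intro ext_relations_in_ideal) (auto simp: ext_relations_def)
  qed
qed

lemma ext_inc_square: "ext_inc x * ext_inc x = 0"
proof transfer
  fix x :: 'a
  have "letter x * letter x \<in> ext_ideal"
    by (intro ext_relations_in_ideal) (auto simp: ext_relations_def)
  then show "ext_rel (letter x * letter x) 0" by (simp add: ext_rel_def)
qed

lemma ext_map_wedge:
  fixes f :: "'v::complex_vector \<Rightarrow> 'w::complex_vector"
  assumes "Vector_Spaces.linear scaleC scaleC f"
  shows "ext_map f (wedge xs) = wedge (map f xs)"
proof -
  have lin: "Vector_Spaces.linear scaleC scaleC (\<lambda>v. ext_inc (f v))"
    using Vector_Spaces.linear_compose[OF assms linear_ext_inc] by (simp add: o_def)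
  note L = lin ext_inc_square
  show ?thesis
    by (induction xs)
      (simp_all add: ext_map_def wedge_def ext_lift_one[OF L] ext_lift_mult[OF L]
        ext_lift_ext_inc[OF L])
qed

lemma gram_det_expand:
  assumes "length (u1 @ z # u2) = length v"
  shows "gram_det b (u1 @ z # u2) v =
    (\<Sum>\<pi> | \<pi> permutes {..<length v}. of_int (sign \<pi>) * b z (v ! \<pi> (length u1)) *
      (\<Prod>i\<in>{..<length v} - {length u1}. b ((u1 @ undefined # u2) ! i) (v ! \<pi> i)))"
proof -
  have j: "length u1 \<in> {..<length v}" using assms by simp
  have nth: "(u1 @ z # u2) ! i = (u1 @ undefined # u2) ! i" if "i \<noteq> length u1" for i
    using that by (cases "i < length u1") (auto simp: nth_append nth_Cons split: nat.splits)
  have "(\<Prod>i<length v. b ((u1 @ z # u2) ! i) (v ! \<pi> i)) = b z (v ! \<pi> (length u1)) *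
      (\<Prod>i\<in>{..<length v} - {length u1}. b ((u1 @ undefined # u2) ! i) (v ! \<pi> i))" for \<pi> :: "nat \<Rightarrow> nat"
    by (subst prod.remove[OF _ j]) (simp_all add: nth)
  then show ?thesis using assms by (simp add: gram_det_def mult.assoc)
qed

lemma gram_det_add:
  assumes "\<And>x y z. b (x + y) z = b x z + b y z"
  shows "gram_det b (u1 @ (x + y) # u2) v = gram_det b (u1 @ x # u2) v + gram_det b (u1 @ y # u2) v"
proof (cases "length (u1 @ x # u2) = length v")
  case True
  then show ?thesis
    using gram_det_expand[of u1 _ u2 v b]
    by (simp add: assms distrib_left distrib_right sum.distrib)
qed (simp add: gram_det_def)

lemma gram_det_scaleC:
  assumes "\<And>c x z. b (c *\<^sub>C x) z = c * b x z"
  shows "gram_det b (u1 @ (c *\<^sub>C x) # u2) v = c * gram_det b (u1 @ x # u2) v"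
proof (cases "length (u1 @ x # u2) = length v")
  case True
  then show ?thesis
    using gram_det_expand[of u1 _ u2 v b]
    by (simp add: assms sum_distrib_left mult_ac)
qed (simp add: gram_det_def)

lemma gram_det_alternating: "gram_det b (u1 @ x # x # u2) v = 0"
proof (cases "length (u1 @ x # x # u2) = length v")
  case True
  define w k j where "w = u1 @ x # x # u2" and "k = length v" and "j = length u1"
  define t where "t = Transposition.transpose j (Suc j)"
  have t: "t permutes {..<k}" unfolding t_def
    using True by (intro permutes_swap_id) (auto simp: k_def j_def)
  have wt: "w ! t i = w ! i" for i
    by (auto simp: w_def t_def Transposition.transpose_def j_def nth_append)
  have sgn: "sign (\<pi> \<circ> t) = - sign \<pi>" if "\<pi> permutes {..<k}" for \<pi>
  proof -
    have "sign t = - 1" unfolding t_def by (subst sign_swap_id) auto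
    moreover have "permutation \<pi>" "permutation t"
      using that t permutation_permutes by blast+
    ultimately show ?thesis by (simp add: sign_compose)
  qed
  have prd: "(\<Prod>i<k. b (w ! i) (v ! (\<pi> \<circ> t) i)) = (\<Prod>i<k. b (w ! i) (v ! \<pi> i))" for \<pi>
    using prod.permute[OF t, of "\<lambda>i. b (w ! i) (v ! \<pi> i)"] by (simp add: wt o_def)
  let ?f = "\<lambda>\<pi>. of_int (sign \<pi>) * (\<Prod>i<k. b (w ! i) (v ! \<pi> i)) :: complex"
  have "sum ?f {\<pi>. \<pi> permutes {..<k}} = (\<Sum>\<pi> | \<pi> permutes {..<k}. ?f (\<pi> \<circ> t))"
    by (rule sum_permutations_compose_right[OF t])
  also have "\<dots> = (\<Sum>\<pi> | \<pi> permutes {..<k}. - ?f \<pi>)"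
    by (rule sum.cong) (simp_all add: sgn prd del: o_apply)
  also have "\<dots> = - sum ?f {\<pi>. \<pi> permutes {..<k}}" by (rule sum_negf)
  finally have "sum ?f {\<pi>. \<pi> permutes {..<k}} = 0" by simp
  then show ?thesis using True by (simp add: gram_det_def w_def k_def)
qed (simp add: gram_det_def)

lemma gram_det_flip: "gram_det b u v = gram_det (\<lambda>x y. b y x) v u"
proof (cases "length u = length v")
  case True
  define k where "k = length v"
  have "(\<Sum>\<pi> | \<pi> permutes {..<k}. of_int (sign \<pi>) * (\<Prod>i<k. b (u ! i) (v ! \<pi> i))) =
    (\<Sum>\<pi> | \<pi> permutes {..<k}. of_int (sign (inv \<pi>)) * (\<Prod>i<k. b (u ! i) (v ! inv \<pi> i)))"
    by (rule sum_permutations_inverse)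
  also have "\<dots> = (\<Sum>\<pi> | \<pi> permutes {..<k}. of_int (sign \<pi>) * (\<Prod>i<k. b (u ! \<pi> i) (v ! i)))"
  proof (rule sum.cong, rule refl, goal_cases)
    case (1 \<pi>)
    then have p: "\<pi> permutes {..<k}" by simp
    have "sign (inv \<pi>) = sign \<pi>" using p by (intro sign_inverse permutation_permutes[THEN iffD2]) auto
    moreover have "(\<Prod>i<k. b (u ! i) (v ! inv \<pi> i)) = (\<Prod>i<k. b (u ! \<pi> i) (v ! i))"
      using prod.permute[OF p, of "\<lambda>i. b (u ! i) (v ! inv \<pi> i)"]
      by (simp add: o_def permutes_inverses[OF p])
    ultimately show ?case by simp
  qed
  finally show ?thesis using True by (simp add: gram_det_def k_def)
qed (simp add: gram_det_def)

lemma words_extend_gram_ideal: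
  fixes b :: "'v::complex_vector \<Rightarrow> 'v \<Rightarrow> complex"
  assumes "\<And>y. Vector_Spaces.linear scaleC scaleC (\<lambda>x. b x y)" and "p \<in> ext_ideal"
  shows "words_extend (\<lambda>u. gram_det b u v) p = 0"
  using assms(2)
proof (induction rule: ext_ideal.induct)
  case (gen r l m)
  have add: "b (x + y) z = b x z + b y z" for x y z
    using assms(1) by (simp add: Vector_Spaces.linear_iff)
  have scale: "b (c *\<^sub>C x) z = c * b x z" for c x z
    using assms(1) by (simp add: Vector_Spaces.linear_iff scaleC_complex_def)
  show ?case
  proof (induction l rule: words_induct)
    case (single l c)
    show ?case
    proof (induction m rule: words_induct)
      case (single m d)
      consider
          (1) x y where "r = letter (x + y) - letter x - letter y"
        | (2) c x where "r = letter (c *\<^sub>C x) - const_word c * letter x"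
        | (3) x where "r = letter x * letter x"
        using gen(1) unfolding ext_relations_def by blast
      then show ?case
        by cases
          (simp_all add: right_diff_distrib left_diff_distrib mult_single plus_list_def
            words_extend_diff scaleC_complex_def gram_det_add[of b, OF add]
            gram_det_scaleC[of b, OF scale] gram_det_alternating distrib_left)
    qed (simp_all add: distrib_left words_extend_add)
  qed (simp_all add: distrib_right words_extend_add)
qed (simp_all add: words_extend_add)

lemma wedge_abs: "wedge xs = abs_ext (Poly_Mapping.single xs 1)"
proof (induction xs)
  case Nil
  then show ?case by (simp add: wedge_def one_ext.abs_eq zero_list_def flip: single_one)
next
  case (Cons x xs)
  then show ?case
    by (simp add: wedge_def ext_inc.abs_eq times_ext.abs_eq mult_single plus_list_def)
qed

lemma ext_form_abs:
  fixes b :: "'v::complex_vector \<Rightarrow> 'v \<Rightarrow> complex"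
  assumes "\<And>y. Vector_Spaces.linear scaleC scaleC (\<lambda>x. b x y)"
    and "\<And>x. Vector_Spaces.linear scaleC scaleC (b x)"
  shows "ext_form b (abs_ext p) (abs_ext q) =
    words_extend (\<lambda>u. words_extend (\<lambda>v. gram_det b u v) q) p"
proof -
  let ?G = "\<lambda>p q. words_extend (\<lambda>u. words_extend (\<lambda>v. gram_det b u v) q) p"
  let ?p = "rep_ext (abs_ext p)" and ?q = "rep_ext (abs_ext q)"
  have rel: "rep_ext (abs_ext r) - r \<in> ext_ideal" for r :: "'v words"
    using Quotient3_ext Quotient3_rep_abs equivp_reflp[OF equivp_ext_rel] ext_rel_def by metis
  have swap: "?G p q = words_extend (\<lambda>v. words_extend (\<lambda>u. gram_det b u v) p) q" for p q
    unfolding words_extend_def scaleC_complex_def sum_distrib_left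
    by (subst sum.swap) (simp add: mult_ac)
  have right: "words_extend (\<lambda>v. gram_det b u v) ?q = words_extend (\<lambda>v. gram_det b u v) q" for u
    using words_extend_gram_ideal[of "\<lambda>x y. b y x" "?q - q" u] assms(2) rel
    by (simp add: words_extend_diff gram_det_flip[of b])
  have left: "words_extend (\<lambda>u. gram_det b u v) ?p = words_extend (\<lambda>u. gram_det b u v) p" for v
    using words_extend_gram_ideal[of b "?p - p" v] assms(1) rel
    by (simp add: words_extend_diff)
  have "ext_form b (abs_ext p) (abs_ext q) = ?G ?p q" by (simp add: ext_form_def right)
  also have "\<dots> = ?G p q" unfolding swap by (simp add: left)
  finally show ?thesis .
qed

lemma
  fixes b :: "'v::complex_vector \<Rightarrow> 'v \<Rightarrow> complex"
  assumes "\<And>y. Vector_Spaces.linear scaleC scaleC (\<lambda>x. b x y)"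
    and "\<And>x. Vector_Spaces.linear scaleC scaleC (b x)"
  shows ext_form_wedge: "ext_form b (wedge xs) (wedge ys) = gram_det b xs ys"
    and ext_form_add_left: "ext_form b (x + x') y = ext_form b x y + ext_form b x' y"
    and ext_form_add_right: "ext_form b x (y + y') = ext_form b x y + ext_form b x y'"
    and ext_form_scaleC_left: "ext_form b (c *\<^sub>C x) y = c * ext_form b x y"
    and ext_form_scaleC_right: "ext_form b x (c *\<^sub>C y) = c * ext_form b x y"
proof -
  obtain p p' q q' where [simp]: "x = abs_ext p" "x' = abs_ext p'" "y = abs_ext q" "y' = abs_ext q'"
    by (cases x, cases x', cases y, cases y') auto
  have const: "words_extend f (const_word c * p) = c * words_extend f p"
    for f :: "'v list \<Rightarrow> complex" and p
    by (induction p rule: words_induct)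
      (simp_all add: mult_single plus_list_def words_extend_add distrib_left scaleC_complex_def)
  note [simp] = ext_form_abs[OF assms]
  show "ext_form b (wedge xs) (wedge ys) = gram_det b xs ys"
    by (simp add: wedge_abs scaleC_one)
  show "ext_form b (x + x') y = ext_form b x y + ext_form b x' y"
    by (simp add: plus_ext.abs_eq words_extend_add)
  show "ext_form b x (y + y') = ext_form b x y + ext_form b x y'"
    by (simp add: plus_ext.abs_eq words_extend_add)
       (simp add: words_extend_def sum.distrib scaleC_add_right)
  show "ext_form b (c *\<^sub>C x) y = c * ext_form b x y"
    by (simp add: scaleC_ext.abs_eq const)
  show "ext_form b x (c *\<^sub>C y) = c * ext_form b x y"
    by (simp add: scaleC_ext.abs_eq const)
       (simp add: words_extend_def scaleC_complex_def sum_distrib_left mult_ac)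
qed

subsection \<open>Isomorphisms between subspaces and between unital subalgebras\<close>

definition vs_iso_on ::
    "'a::complex_vector set \<Rightarrow> 'b::complex_vector set \<Rightarrow> ('a \<Rightarrow> 'b) \<Rightarrow> bool"
  where "vs_iso_on V W f \<longleftrightarrow> bij_betw f V W \<and>
    (\<forall>x\<in>V. \<forall>y\<in>V. f (x + y) = f x + f y) \<and> (\<forall>c. \<forall>x\<in>V. f (c *\<^sub>C x) = c *\<^sub>C f x)"

definition alg_iso_on ::
    "'a::complex_algebra_1 set \<Rightarrow> 'b::complex_algebra_1 set \<Rightarrow> ('a \<Rightarrow> 'b) \<Rightarrow> bool"
  where "alg_iso_on A B f \<longleftrightarrow> vs_iso_on A B f \<and> f 1 = 1 \<and>
    (\<forall>x\<in>A. \<forall>y\<in>A. f (x * y) = f x * f y)"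


section \<open>Lie algebras of matrices\<close>

type_synonym 'm cmat = "complex^'m^'m"

definition bracket :: "'m::finite cmat \<Rightarrow> 'm cmat \<Rightarrow> 'm cmat"
  where "bracket X Y = X ** Y - Y ** X"

definition conj_transpose :: "'m::finite cmat \<Rightarrow> 'm cmat"
  where "conj_transpose X = transpose (map_matrix cnj X)"

definition trace_form :: "'m::finite cmat \<Rightarrow> 'm cmat \<Rightarrow> complex"
  where "trace_form X Y = trace (X ** Y)"

primrec lower_central :: "'m::finite cmat set \<Rightarrow> nat \<Rightarrow> 'm cmat set"
  where
    "lower_central h 0 = h"
  | "lower_central h (Suc k) = span {bracket X Y | X Y. X \<in> h \<and> Y \<in> lower_central h k}"

text \<open>Cartan subalgebra of a \<^emph>\<open>real\<close> Lie algebra of matrices: a nilpotent subalgebra which is its own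
  normalizer (\<open>span\<close> and \<open>subspace\<close> are over the reals).\<close>

definition cartan_subalgebra :: "'m::finite cmat set \<Rightarrow> 'm cmat set \<Rightarrow> bool"
  where "cartan_subalgebra g h \<longleftrightarrow>
    subspace h \<and> h \<subseteq> g \<and> (\<forall>X\<in>h. \<forall>Y\<in>h. bracket X Y \<in> h) \<and>
    (\<exists>k. lower_central h k = {0}) \<and>
    {X \<in> g. \<forall>Y\<in>h. bracket X Y \<in> h} = h"


section \<open>The symmetric space U(2n)/Sp(n)\<close>

text \<open>Here \<open>n = CARD('n)\<close>, and \<open>'n + 'n\<close> indexes the \<open>2n\<close> coordinates. The matrix \<open>J\<close> is
  \<open>(0, 1; -1, 0)\<close>, so \<open>J\<inverse> = -J\<close>.\<close>

definition J_mat :: "('n::finite + 'n) cmat"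
  where "J_mat = (\<chi> i j. case (i, j) of
      (Inl a, Inr b) \<Rightarrow> if a = b then 1 else 0
    | (Inr a, Inl b) \<Rightarrow> if a = b then - 1 else 0
    | _ \<Rightarrow> 0)"

definition unitary_group :: "'m::finite cmat set"
  where "unitary_group = {g. conj_transpose g ** g = mat 1}"

definition group_involution :: "('n::finite + 'n) cmat \<Rightarrow> ('n + 'n) cmat"
  where "group_involution g = J_mat ** map_matrix cnj g ** matrix_inv J_mat"

definition Sp_group :: "('n::finite + 'n) cmat set"
  where "Sp_group = {g \<in> unitary_group. group_involution g = g}"

text \<open>The complex-linear extension to \<open>gl(2n, C)\<close> of the differential of \<open>group_involution\<close> on
  \<open>u(2n)\<close> (where \<open>map_matrix cnj X = - transpose X\<close>).\<close>

definition involution :: "('n::finite + 'n) cmat \<Rightarrow> ('n + 'n) cmat"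
  where "involution X = - (J_mat ** transpose X ** matrix_inv J_mat)"

definition p_space :: "('n::finite + 'n) cmat set"
  where "p_space = {X. involution X = - X}"

lemma J_mat_mult_J_mat: "J_mat ** J_mat = - (mat 1 :: ('n::finite + 'n) cmat)"
proof -
  have "(J_mat ** J_mat :: ('n + 'n) cmat) $ i $ j = (- mat 1) $ i $ j" for i j
  proof -
    have UN: "(UNIV :: ('n + 'n) set) = range Inl \<union> range Inr" by (rule UNIV_sum)
    have S: "(\<Sum>k\<in>UNIV. f k) = (\<Sum>a\<in>UNIV. f (Inl a)) + (\<Sum>a\<in>UNIV. f (Inr a))"
      for f :: "'n + 'n \<Rightarrow> complex"
      unfolding UN by (subst sum.union_disjoint) (auto simp: sum.reindex)
    show ?thesis
      by (cases i; cases j) (auto simp: matrix_matrix_mult_def S J_mat_def mat_def if_distrib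
          if_distribR cong: if_cong)
  qed
  then show ?thesis by (simp add: vec_eq_iff)
qed

lemma matrix_neg_mult: "(- A) ** B = - (A ** (B :: 'm::finite cmat))"
  and matrix_mult_neg: "A ** (- B) = - (A ** (B :: 'm::finite cmat))"
  by (simp_all add: matrix_matrix_mult_def vec_eq_iff sum_negf)

lemma matrix_inv_J_mat: "matrix_inv J_mat = - (J_mat :: ('n::finite + 'n) cmat)"
proof -
  let ?J = "J_mat :: ('n + 'n) cmat"
  have J: "?J ** (- ?J) = mat 1 \<and> (- ?J) ** ?J = mat 1"
    by (simp add: matrix_neg_mult matrix_mult_neg J_mat_mult_J_mat)
  then have "matrix_inv ?J ** ?J = mat 1"
    unfolding matrix_inv_def by (rule someI2) simp
  then show ?thesis
    using J by (metis matrix_mul_assoc matrix_mul_lid matrix_mul_rid)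
qed

lemma involution_eq_group_involution:
  assumes "conj_transpose X = - X"
  shows "involution X = group_involution X"
proof -
  have "transpose X = - map_matrix cnj X"
    using arg_cong[OF assms, of transpose]
    by (simp add: conj_transpose_def vec_eq_iff transpose_def)
  then show ?thesis
    by (simp add: involution_def group_involution_def matrix_neg_mult matrix_mult_neg)
qed

text \<open>The real Lie algebra of the compact group \<open>Sp(n)\<close>.\<close>

definition sp_lie :: "('n::finite + 'n) cmat set"
  where "sp_lie = {X. conj_transpose X = - X \<and> involution X = X}"

text \<open>The complexification of a real subspace of \<open>u(2n)\<close> is its complex span in \<open>gl(2n, C)\<close>.\<close>

definition centralizer_in_p :: "('n::finite + 'n) cmat set \<Rightarrow> ('n + 'n) cmat set"
  where "centralizer_in_p t0 = {X \<in> p_space. \<forall>H\<in>cvs.span t0. bracket H X = 0}"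

definition Ad :: "'m::finite cmat \<Rightarrow> 'm cmat \<Rightarrow> 'm cmat"
  where "Ad g X = g ** X ** matrix_inv g"

lemma cmat_scaleC_mult: "(c *\<^sub>C A) ** B = c *\<^sub>C (A ** (B :: 'm::finite cmat))"
  and cmat_add_mult: "(A + A') ** B = A ** B + A' ** (B :: 'm::finite cmat)"
  and cmat_mult_scaleC: "A ** (c *\<^sub>C B) = c *\<^sub>C (A ** (B :: 'm::finite cmat))"
  by (simp_all add: matrix_matrix_mult_def vec_eq_iff scaleC_complex_def sum_distrib_left
      sum.distrib distrib_left mult_ac)

lemma linear_Ad: "Vector_Spaces.linear scaleC scaleC (Ad g)"
  by unfold_locales
    (simp_all add: Ad_def matrix_add_ldistrib cmat_add_mult cmat_scaleC_mult cmat_mult_scaleC)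

lemma linear_trace_form:
  "Vector_Spaces.linear scaleC scaleC (\<lambda>X. trace_form X Y)"
  "Vector_Spaces.linear scaleC scaleC (trace_form X)"
  by (unfold_locales; simp add: trace_form_def matrix_add_ldistrib cmat_add_mult
      cmat_scaleC_mult cmat_mult_scaleC trace_add; simp add: trace_def scaleC_complex_def
      sum_distrib_left)+

definition ext_p_inv :: "('n::finite + 'n) cmat ext set"
  where "ext_p_inv = {x \<in> ext_algebra p_space. \<forall>g\<in>Sp_group. ext_map (Ad g) x = x}"

text \<open>The augmentation ideal of the invariants and its square.\<close>

definition ext_p_inv_plus :: "('n::finite + 'n) cmat ext set"
  where "ext_p_inv_plus = cvs.span (\<Union>k\<in>{1..}. ext_p_inv \<inter> ext_power p_space k)"

definition ext_p_inv_plus_sq :: "('n::finite + 'n) cmat ext set"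
  where "ext_p_inv_plus_sq = cvs.span {x * y | x y. x \<in> ext_p_inv_plus \<and> y \<in> ext_p_inv_plus}"

definition P_wedge :: "('n::finite + 'n) cmat ext set"
  where "P_wedge = {x \<in> ext_p_inv_plus. \<forall>y\<in>ext_p_inv_plus_sq. ext_form trace_form x y = 0}"

end

theory Submission
  imports Defs
begin

text \<open>Write \<open>V\<close> for the space of column vectors of length \<open>2n\<close>. The map \<open>A \<mapsto> A J\<close> identifies the
skew-symmetric matrices, on which \<open>g\<close> acts by \<open>A \<mapsto> g A g\<^sup>T\<close>, with the space \<open>p\<close>; so
\<open>p\<close> is \<open>\<And>\<^sup>2 V\<close> as a representation of \<open>K = Sp(n)\<close>.

\<^bold>\<open>Generators.\<close> Pairing an invariant of degree \<open>k\<close> with products of \<open>k\<close> standard generators of \<open>p\<close>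
gives a function of \<open>2k\<close> indices that is invariant under the symplectic Lie algebra. By the first
fundamental theorem for \<open>Sp(2n)\<close> (\<open>first_fundamental_theorem_Sp\<close>) it is a combination of products
of the symplectic form over the perfect matchings of the \<open>2k\<close> positions. That theorem has a short
proof by positivity: on an invariant tensor orthogonal to all such products the Casimir operator of
\<open>gl(2n)\<close>, which is a sum of operators \<open>E\<^sup>* E\<close>, acts as a negative scalar. A matching joins
the \<open>k\<close> generators to closed chains, so every invariant is a polynomial in the traces of powers of the
generic element \<open>X\<close> of \<open>p\<close>, a matrix with anticommuting entries (\<open>contraction_in_trace_span\<close>,
\<open>invariants_in_trace_span\<close>). Cyclicity and transposition make \<open>tr X\<^sup>j\<close> vanish unless
\<open>j mod 4 = 1\<close>, and the Amitsur-Levitzki identity \<open>X\<close> to the power \<open>4n\<close> equals \<open>0\<close>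
(\<open>gen_power_vanish\<close>) leaves the \<open>n\<close> traces \<open>t\<^sub>i\<close> of degrees \<open>4i - 3\<close>, where \<open>1 \<le> i \<le> n\<close>.

\<^bold>\<open>Relations.\<close> These degrees add up to \<open>n (2n - 1) = dim p\<close>. The top exterior power of \<open>p\<close>
is invariant, hence it is a nonzero polynomial in the \<open>t\<^sub>i\<close>, and for reasons of degree it can only be
a multiple of their product (\<open>aprod_full_nonzero\<close>). Anticommuting elements whose product is not
zero satisfy no further relations (\<open>aprod_independent\<close>), so the invariants are an exterior algebra.

\<^bold>\<open>Primitive elements.\<close> On the real span of products of Hermitian elements of \<open>p\<close> the form is
positive definite, hence it is nondegenerate on the complex span of real elements of one degree
(\<open>form_nondegenerate_on_real_span\<close>), and the \<open>t\<^sub>i\<close> are real (\<open>power_trace_real\<close>). Therefore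
each \<open>t\<^sub>i\<close> can be corrected by decomposable invariants of the same degree to an element orthogonal to the
square of the augmentation ideal. The \<open>n\<close> corrected elements form a basis of \<open>P_wedge\<close> and still
generate, and \<open>\<And>(P_wedge)\<close> is mapped isomorphically to the invariants.

\<^bold>\<open>The centralizer.\<close> A Cartan subalgebra of the compact algebra \<open>sp(n)\<close> is commutative, and its joint
eigenvectors form an orthonormal frame \<open>v\<^sub>i, j v\<^sub>i\<close>, where \<open>j\<close> is the quaternionic structure. A matrix
commuting with it is diagonal in this frame, and it lies in \<open>p\<close> only if the entries for \<open>v\<^sub>i\<close> and
\<open>j v\<^sub>i\<close> agree. This leaves \<open>n\<close> parameters (\<open>centralizer_eq\<close>), as many as \<open>P_wedge\<close> has.\<close>

section \<open>The symplectic form in coordinates\<close>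

text \<open>Row \<open>i\<close> of \<open>J\<close> has a single nonzero entry, namely \<open>eps i\<close> in column \<open>hat i\<close>.\<close>

fun hat :: "'n + 'n \<Rightarrow> 'n + 'n" where
  "hat (Inl a) = Inr a" | "hat (Inr a) = Inl a"

fun eps :: "'n + 'n \<Rightarrow> complex" where
  "eps (Inl a) = 1" | "eps (Inr a) = - 1"

lemma hat_hat [simp]: "hat (hat i) = i" by (cases i) auto
lemma hat_eq_iff: "hat i = j \<longleftrightarrow> i = hat j" by (cases i; cases j) auto
lemma hat_neq [simp]: "hat i \<noteq> i" "i \<noteq> hat i" by (cases i; simp)+
lemma eps_hat [simp]: "eps (hat i) = - eps i" by (cases i) auto
lemma eps_eps [simp]: "eps i * eps i = 1" "eps i * (eps i * c) = c" by (cases i; simp)+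
lemma cnj_eps [simp]: "cnj (eps i) = eps i" by (cases i) auto

lemma J_nth: "J_mat $ i $ j = (if j = hat i then eps i else 0)"
  by (cases i; cases j) (auto simp: J_mat_def)

section \<open>The first fundamental theorem for the symplectic group\<close>

text \<open>Gram-Schmidt without a basis: the induction adds one point \<open>w\<close> to the finite index set. Projecting to
the members of \<open>P\<close> that vanish at \<open>w\<close> is the induction hypothesis; if some \<open>g0\<close> in \<open>P\<close> does not vanish
there, its component orthogonal to those members is the only further direction.\<close>

lemma orthogonal_projection_exists:
  fixes P :: "('x \<Rightarrow> complex) \<Rightarrow> bool"
  assumes "finite \<Omega>" and "P (\<lambda>x. 0)" and "\<And>f g. P f \<Longrightarrow> P g \<Longrightarrow> P (\<lambda>x. f x + g x)"
    and "\<And>c f. P f \<Longrightarrow> P (\<lambda>x. c * f x)"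
  shows "\<exists>b. P b \<and> (\<forall>g. P g \<longrightarrow> (\<Sum>w\<in>\<Omega>. (f w - b w) * cnj (g w)) = 0)"
  using assms
proof (induction \<Omega> arbitrary: P f rule: finite_induct)
  case empty
  then show ?case by auto
next
  case (insert w \<Omega>)
  let ?ip = "\<lambda>f g. \<Sum>w\<in>\<Omega>. f w * cnj (g w)"
  define P' where "P' g \<longleftrightarrow> P g \<and> g w = 0" for g
  have "\<exists>b. P' b \<and> (\<forall>g. P' g \<longrightarrow> ?ip (\<lambda>w. f w - b w) g = 0)" for f
    by (rule insert.IH) (auto simp: P'_def insert.prems)
  then have proj: "\<exists>b. P' b \<and> (\<forall>g. P' g \<longrightarrow> (\<Sum>w\<in>insert w \<Omega>. (f w - b w) * cnj (g w)) = 0)" for f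
    using insert.hyps by (simp add: P'_def)
  have sub: "P (\<lambda>x. f x - g x)" if "P f" "P g" for f g
    using insert.prems(2)[OF that(1) insert.prems(3)[OF that(2), of "- 1"]] by simp
  show ?case
  proof (cases "\<exists>g. P g \<and> g w \<noteq> 0")
    case False
    then have "P' = P" by (auto simp: P'_def fun_eq_iff)
    then show ?thesis using proj by simp
  next
    case True
    then obtain g0 where g0: "P g0" "g0 w \<noteq> 0" by blast
    obtain b0 where b0: "P' b0"
        "\<And>g. P' g \<Longrightarrow> (\<Sum>w\<in>insert w \<Omega>. (g0 w - b0 w) * cnj (g w)) = 0"
      using proj[of g0] by blast
    define g1 where "g1 = (\<lambda>x. g0 x - b0 x)"
    have g1: "P g1" "g1 w = g0 w" using g0 b0 sub by (auto simp: g1_def P'_def)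
    have g1o: "(\<Sum>w\<in>insert w \<Omega>. g1 w * cnj (g w)) = 0" if "P' g" for g
      using b0(2)[OF that] by (simp add: g1_def)
    have g1o': "(\<Sum>w\<in>insert w \<Omega>. g w * cnj (g1 w)) = 0" if "P' g" for g
      using arg_cong[OF g1o[OF that], of cnj] by (simp add: mult.commute)
    define n where "n = (\<Sum>w\<in>insert w \<Omega>. g1 w * cnj (g1 w))"
    have "n = of_real (\<Sum>w\<in>insert w \<Omega>. (cmod (g1 w))\<^sup>2)"
      unfolding n_def by (simp add: complex_norm_square[symmetric] del: of_real_power)
    moreover have "(\<Sum>w\<in>insert w \<Omega>. (cmod (g1 w))\<^sup>2) > 0"
      by (rule sum_pos2[of _ w]) (use insert.hyps g1 g0 in auto)
    ultimately have n: "n \<noteq> 0" by (metis less_irrefl of_real_eq_0_iff)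
    obtain b1 where b1: "P' b1"
        "\<And>g. P' g \<Longrightarrow> (\<Sum>w\<in>insert w \<Omega>. (f w - b1 w) * cnj (g w)) = 0"
      using proj[of f] by blast
    define c where "c = (\<Sum>w\<in>insert w \<Omega>. f w * cnj (g1 w)) / n"
    define b where "b = (\<lambda>x. b1 x + c * g1 x)"
    have Pb: "P b" using b1(1) g1 insert.prems by (auto simp: b_def P'_def)
    have o1: "(\<Sum>w\<in>insert w \<Omega>. (f w - b w) * cnj (g1 w)) = 0"
    proof -
      have "(\<Sum>w\<in>insert w \<Omega>. (f w - b w) * cnj (g1 w)) =
        (\<Sum>w\<in>insert w \<Omega>. f w * cnj (g1 w)) - (\<Sum>w\<in>insert w \<Omega>. b1 w * cnj (g1 w)) - c * n"
        unfolding n_def b_def sum_distrib_left sum_subtractf[symmetric]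
        by (intro sum.cong refl) (simp add: algebra_simps)
      then show ?thesis using g1o'[OF b1(1)] n by (simp add: c_def del: sum.insert)
    qed
    have o2: "(\<Sum>w\<in>insert w \<Omega>. (f w - b w) * cnj (g w)) = 0" if "P' g" for g
    proof -
      have "(\<Sum>w\<in>insert w \<Omega>. (f w - b w) * cnj (g w)) =
        (\<Sum>w\<in>insert w \<Omega>. (f w - b1 w) * cnj (g w)) - c * (\<Sum>w\<in>insert w \<Omega>. g1 w * cnj (g w))"
        unfolding b_def sum_distrib_left sum_subtractf[symmetric]
        by (intro sum.cong refl) (simp add: algebra_simps)
      then show ?thesis using b1(2)[OF that] g1o[OF that] by (simp del: sum.insert)
    qed
    have "(\<Sum>w\<in>insert w \<Omega>. (f w - b w) * cnj (g w)) = 0" if "P g" for g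
    proof -
      define k where "k = g w / g1 w"
      define s where "s = (\<lambda>x. g x - k * g1 x)"
      have "P s" unfolding s_def by (intro sub that insert.prems(3) g1(1))
      moreover have "s w = 0" using g0 g1 by (simp add: s_def k_def)
      ultimately have "P' s" by (simp add: P'_def)
      have "(\<Sum>w\<in>insert w \<Omega>. (f w - b w) * cnj (g w)) =
        (\<Sum>w\<in>insert w \<Omega>. (f w - b w) * cnj (s w)) + cnj k * (\<Sum>w\<in>insert w \<Omega>. (f w - b w) * cnj (g1 w))"
        unfolding s_def sum_distrib_left sum.distrib[symmetric]
        by (intro sum.cong refl) (simp add: algebra_simps)
      then show ?thesis using o1 o2[OF \<open>P' s\<close>] by (simp del: sum.insert)
    qed
    then show ?thesis using Pb by blast
  qed
qed

text \<open>A tensor is given by its coefficients, which are indexed by all assignments of indices to positions; only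
the positions in \<open>D\<close> matter. In this form a contraction just forgets two positions, and the remaining
ones keep their names.\<close>

definition depends_on :: "'p set \<Rightarrow> (('p \<Rightarrow> 'i) \<Rightarrow> 'c) \<Rightarrow> bool"
  where "depends_on D f \<longleftrightarrow> (\<forall>x y. (\<forall>t\<in>D. x t = y t) \<longrightarrow> f x = f y)"

lemma depends_onD: "depends_on D f \<Longrightarrow> (\<And>t. t \<in> D \<Longrightarrow> x t = y t) \<Longrightarrow> f x = f y"
  unfolding depends_on_def by blast

text \<open>The matrix unit with entry in row \<open>p\<close> and column \<open>r\<close>, acting on tensors as a derivation.\<close>

definition elem_act :: "'p set \<Rightarrow> 'i \<Rightarrow> 'i \<Rightarrow> (('p \<Rightarrow> 'i) \<Rightarrow> complex) \<Rightarrow> ('p \<Rightarrow> 'i) \<Rightarrow> complex"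
  where "elem_act D p r f x = (\<Sum>t\<in>D. if x t = p then f (x(t := r)) else 0)"

text \<open>The differences of the two matrix units in this condition span \<open>sp(2n)\<close>.\<close>

definition sp_invariant :: "'p set \<Rightarrow> (('p \<Rightarrow> 'n + 'n) \<Rightarrow> complex) \<Rightarrow> bool"
  where "sp_invariant D f \<longleftrightarrow>
    (\<forall>p r x. elem_act D p r f x = eps p * eps r * elem_act D (hat r) (hat p) f x)"

text \<open>The span of the products of symplectic forms over the perfect matchings of \<open>D\<close>; it is zero when \<open>D\<close>
has an odd number of elements.\<close>

inductive pairing_span :: "'p set \<Rightarrow> (('p \<Rightarrow> 'n::finite + 'n) \<Rightarrow> complex) \<Rightarrow> bool" where
  const: "pairing_span {} (\<lambda>x. c)"
| pair: "pairing_span D h \<Longrightarrow> s \<noteq> t \<Longrightarrow> s \<notin> D \<Longrightarrow> t \<notin> D \<Longrightarrow>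
    pairing_span (insert s (insert t D)) (\<lambda>x. J_mat $ x s $ x t * h x)"
| zero: "pairing_span D (\<lambda>x. 0)"
| add: "pairing_span D f \<Longrightarrow> pairing_span D g \<Longrightarrow> pairing_span D (\<lambda>x. f x + g x)"
| scale: "pairing_span D f \<Longrightarrow> pairing_span D (\<lambda>x. c * f x)"

lemma pairing_span_depends: "pairing_span D f \<Longrightarrow> depends_on D f"
proof (induction rule: pairing_span.induct)
  case (pair D h s t)
  show ?case unfolding depends_on_def
  proof safe
    fix x y :: "'a \<Rightarrow> 'b + 'b" assume *: "\<forall>u\<in>insert s (insert t D). x u = y u"
    then have "h x = h y" by (intro depends_onD[OF pair.IH]) auto
    then show "J_mat $ x s $ x t * h x = J_mat $ y s $ y t * h y" using * by simp
  qed
next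
  case (add D f g)
  show ?case unfolding depends_on_def
  proof safe
    fix x y :: "'a \<Rightarrow> 'b + 'b" assume *: "\<forall>u\<in>D. x u = y u"
    show "f x + g x = f y + g y"
      using depends_onD[OF add.IH(1), of x y] depends_onD[OF add.IH(2), of x y] * by simp
  qed
qed (auto simp: depends_on_def)

lemma elem_act_add: "elem_act D p r (\<lambda>x. f x + g x) x = elem_act D p r f x + elem_act D p r g x"
  unfolding elem_act_def sum.distrib[symmetric] by (intro sum.cong) auto

lemma elem_act_scale: "elem_act D p r (\<lambda>x. c * f x) x = c * elem_act D p r f x"
  unfolding elem_act_def sum_distrib_left by (intro sum.cong) auto

lemma sp_invariant_add: "sp_invariant D f \<Longrightarrow> sp_invariant D g \<Longrightarrow> sp_invariant D (\<lambda>x. f x + g x)"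
  unfolding sp_invariant_def elem_act_add distrib_left by metis

lemma sp_invariant_scale: "sp_invariant D f \<Longrightarrow> sp_invariant D (\<lambda>x. c * f x)"
  unfolding sp_invariant_def elem_act_scale by (metis mult.left_commute)

text \<open>The symplectic form is itself invariant: the terms that come from the new pair are invariant on their own,
which is the identity \<open>Z\<close>.\<close>

lemma pairing_span_sp_invariant: "pairing_span D f \<Longrightarrow> finite D \<Longrightarrow> sp_invariant D f"
proof (induction rule: pairing_span.induct)
  case (pair D h s t)
  have act: "elem_act (insert s (insert t D)) p r (\<lambda>x. J_mat $ x s $ x t * h x) x =
     J_mat $ x s $ x t * elem_act D p r h x +
     ((if x s = p then J_mat $ r $ x t else 0) + (if x t = p then J_mat $ x s $ r else 0)) * h x" for p r x
  proof -
    have 1: "(\<Sum>u\<in>D. if x u = p then J_mat $ (x(u := r)) s $ (x(u := r)) t * h (x(u := r)) else 0)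
      = J_mat $ x s $ x t * elem_act D p r h x"
      unfolding elem_act_def sum_distrib_left using pair.hyps by (intro sum.cong) auto
    have 2: "h (x(s := r)) = h x" "h (x(t := r)) = h x" for r
      using pairing_span_depends[OF pair.hyps(1)] pair.hyps by (auto intro!: depends_onD[of D h])
    show ?thesis
      using pair.hyps pair.prems 1 2 by (simp add: elem_act_def distrib_right)
  qed
  have "finite D" using pair.prems by simp
  then have inv: "elem_act D p r h x = eps p * eps r * elem_act D (hat r) (hat p) h x" for p r x
    using pair.IH unfolding sp_invariant_def by blast
  have Z: "((if xs = p then J_mat $ r $ xt else 0) + (if xt = p then J_mat $ xs $ r else 0)) =
     eps p * eps r * ((if xs = hat r then J_mat $ hat p $ xt else 0) + (if xt = hat r then J_mat $ xs $ hat p else 0))"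
     for xs xt p r :: "'b + 'b"
    by (cases xs; cases xt; cases p; cases r) (auto simp: J_nth)
  show ?case unfolding sp_invariant_def act
  proof (intro allI)
    fix p r x
    show "J_mat $ x s $ x t * elem_act D p r h x +
        ((if x s = p then J_mat $ r $ x t else 0) + (if x t = p then J_mat $ x s $ r else 0)) * h x =
      eps p * eps r * (J_mat $ x s $ x t * elem_act D (hat r) (hat p) h x +
        ((if x s = hat r then J_mat $ hat p $ x t else 0) + (if x t = hat r then J_mat $ x s $ hat p else 0)) * h x)"
      unfolding inv[of p r x] Z[of "x s" p r "x t"] by (simp only: distrib_left mult_ac)
  qed
qed (auto simp: sp_invariant_add sp_invariant_scale, auto simp: sp_invariant_def elem_act_def)

lemma elem_act_adjoint:
  fixes f g :: "('p \<Rightarrow> 'i::finite) \<Rightarrow> complex"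
  assumes "finite D"
  shows "(\<Sum>x\<in>PiE D (\<lambda>_. UNIV). elem_act D r p f x * cnj (g x)) =
         (\<Sum>x\<in>PiE D (\<lambda>_. UNIV). f x * cnj (elem_act D p r g x))"
proof -
  have fin: "finite (PiE D (\<lambda>_. UNIV :: 'i set))" using assms by (intro finite_PiE) auto
  have "(\<Sum>x\<in>PiE D (\<lambda>_. UNIV). (if x t = r then f (x(t := p)) else 0) * cnj (g x)) =
        (\<Sum>x\<in>PiE D (\<lambda>_. UNIV). f x * cnj (if x t = p then g (x(t := r)) else 0))" (is "?l = ?r")
    if "t \<in> D" for t
  proof -
    have "?l = (\<Sum>x\<in>{x \<in> PiE D (\<lambda>_. UNIV). x t = r}. f (x(t := p)) * cnj (g x))"
      using fin by (intro sum.mono_neutral_cong_right) auto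
    also have "\<dots> = (\<Sum>x\<in>{x \<in> PiE D (\<lambda>_. UNIV). x t = p}. f x * cnj (g (x(t := r))))"
      using that by (intro sum.reindex_bij_witness[of _ "\<lambda>x. x(t := r)" "\<lambda>x. x(t := p)"])
        (auto simp: PiE_iff extensional_def fun_upd_idem)
    also have "\<dots> = ?r"
      using fin by (intro sum.mono_neutral_cong_left) auto
    finally show ?thesis .
  qed
  then have "(\<Sum>t\<in>D. \<Sum>x\<in>PiE D (\<lambda>_. UNIV). (if x t = r then f (x(t := p)) else 0) * cnj (g x)) =
        (\<Sum>t\<in>D. \<Sum>x\<in>PiE D (\<lambda>_. UNIV). f x * cnj (if x t = p then g (x(t := r)) else 0))"
    by (rule sum.cong[OF refl])
  then show ?thesis
    unfolding elem_act_def sum_distrib_right cnj_sum sum_distrib_left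
    by (subst (asm) sum.swap, subst (asm) (2) sum.swap)
qed

lemma sum_rotate3: "(\<Sum>p\<in>A. \<Sum>r\<in>B. \<Sum>x\<in>C. F p r x) = (\<Sum>x\<in>C. \<Sum>p\<in>A. \<Sum>r\<in>B. F p r x)"
proof -
  have "(\<Sum>p\<in>A. \<Sum>r\<in>B. \<Sum>x\<in>C. F p r x) = (\<Sum>p\<in>A. \<Sum>x\<in>C. \<Sum>r\<in>B. F p r x)"
    by (rule sum.cong[OF refl], rule sum.swap)
  also have "\<dots> = (\<Sum>x\<in>C. \<Sum>p\<in>A. \<Sum>r\<in>B. F p r x)" by (rule sum.swap)
  finally show ?thesis .
qed

definition contract_pos :: "'p \<Rightarrow> 'p \<Rightarrow> (('p \<Rightarrow> 'n::finite + 'n) \<Rightarrow> complex) \<Rightarrow> ('p \<Rightarrow> 'n + 'n) \<Rightarrow> complex"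
  where "contract_pos t s f x = (\<Sum>p\<in>UNIV. eps p * f (x(t := p, s := hat p)))"

text \<open>For an invariant \<open>f\<close> the summands on the left are \<open>E\<^sub>r\<^sub>p E\<^sub>p\<^sub>r f\<close>, so the sum is the Casimir operator of
\<open>gl(2n)\<close>. Where both factors act at the same position they contribute \<open>- f\<close>; where they act at different
positions \<open>t\<close> and \<open>s\<close>, these are contracted and joined again by the form.\<close>

lemma casimir_expand:
  fixes f :: "('p \<Rightarrow> 'n::finite + 'n) \<Rightarrow> complex"
  assumes "finite D"
  shows "(\<Sum>p\<in>UNIV. \<Sum>r\<in>UNIV. eps p * eps r * elem_act D r p (elem_act D (hat r) (hat p) f) x) =
    - of_nat (card D) * f x + (\<Sum>t\<in>D. \<Sum>s\<in>D - {t}. J_mat $ x t $ x s * contract_pos t s f x)"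
proof -
  have "(\<Sum>p\<in>UNIV. \<Sum>r\<in>UNIV. eps p * eps r * elem_act D r p (elem_act D (hat r) (hat p) f) x) =
    (\<Sum>p\<in>UNIV. \<Sum>r\<in>UNIV. \<Sum>t\<in>D. if r = x t then eps p * eps r * elem_act D (hat r) (hat p) f (x(t := p)) else 0)"
    unfolding elem_act_def[of D _ _ "elem_act D _ _ _"] sum_distrib_left
    by (intro sum.cong refl) auto
  also have "\<dots> = (\<Sum>t\<in>D. \<Sum>p\<in>UNIV. \<Sum>r\<in>UNIV. if r = x t then eps p * eps r * elem_act D (hat r) (hat p) f (x(t := p)) else 0)"
    by (rule sum_rotate3)
  also have "\<dots> = (\<Sum>t\<in>D. \<Sum>p\<in>UNIV. eps p * eps (x t) * elem_act D (hat (x t)) (hat p) f (x(t := p)))"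
    by simp
  also have "\<dots> = (\<Sum>t\<in>D. - f x + (\<Sum>s\<in>D - {t}. J_mat $ x t $ x s * contract_pos t s f x))"
  proof (intro sum.cong refl)
    fix t assume t: "t \<in> D"
    have "(\<Sum>p\<in>UNIV. eps p * eps (x t) * elem_act D (hat (x t)) (hat p) f (x(t := p))) =
      (\<Sum>p\<in>UNIV. \<Sum>s\<in>D. eps p * eps (x t) * (if (x(t := p)) s = hat (x t) then f (x(t := p, s := hat p)) else 0))"
      unfolding elem_act_def sum_distrib_left by simp
    also have "\<dots> = (\<Sum>s\<in>D. \<Sum>p\<in>UNIV. eps p * eps (x t) * (if (x(t := p)) s = hat (x t) then f (x(t := p, s := hat p)) else 0))"
      by (rule sum.swap)
    also have "\<dots> = (\<Sum>p\<in>UNIV. eps p * eps (x t) * (if p = hat (x t) then f (x(t := hat p)) else 0)) +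
       (\<Sum>s\<in>D - {t}. \<Sum>p\<in>UNIV. eps p * eps (x t) * (if x s = hat (x t) then f (x(t := p, s := hat p)) else 0))"
      using assms t
      by (subst sum.remove[of _ t], simp_all, intro sum.cong refl arg_cong2[of _ _ _ _ "(+)"])
        (auto cong: if_cong)
    also have "(\<Sum>p\<in>UNIV. eps p * eps (x t) * (if p = hat (x t) then f (x(t := hat p)) else 0)) = - f x"
      by (simp add: if_distrib[of "\<lambda>z. _ * z"] cong: if_cong)
    also have "(\<Sum>s\<in>D - {t}. \<Sum>p\<in>UNIV. eps p * eps (x t) * (if x s = hat (x t) then f (x(t := p, s := hat p)) else 0)) =
       (\<Sum>s\<in>D - {t}. J_mat $ x t $ x s * contract_pos t s f x)"
      by (intro sum.cong refl) (auto simp: J_nth contract_pos_def sum_distrib_left mult_ac)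
    finally show "(\<Sum>p\<in>UNIV. eps p * eps (x t) * elem_act D (hat (x t)) (hat p) f (x(t := p))) =
      - f x + (\<Sum>s\<in>D - {t}. J_mat $ x t $ x s * contract_pos t s f x)" .
  qed
  also have "\<dots> = - of_nat (card D) * f x + (\<Sum>t\<in>D. \<Sum>s\<in>D - {t}. J_mat $ x t $ x s * contract_pos t s f x)"
    by (simp add: sum_subtractf)
  finally show ?thesis .
qed

lemma sum_hat_delta:
  fixes F :: "'n::finite + 'n \<Rightarrow> complex"
  shows "(\<Sum>c\<in>UNIV. if hat c = p then F c else 0) = F (hat p)"
  by (simp add: hat_eq_iff)

text \<open>Compared with the action on all positions in \<open>D\<close>, the action on the contraction lacks the terms at \<open>s\<close>
and \<open>t\<close>; they are collected in \<open>E\<close>, which satisfies the invariance condition by itself.\<close>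

lemma contract_pos_invariant:
  fixes f :: "('p \<Rightarrow> 'n::finite + 'n) \<Rightarrow> complex"
  assumes D: "finite D" and inv: "sp_invariant D f" and st: "s \<in> D" "t \<in> D" "s \<noteq> t"
  shows "sp_invariant (D - {s, t}) (contract_pos t s f)"
proof -
  define E where "E p r x = eps p * f (x(t := r, s := hat p)) - eps p * f (x(t := hat p, s := r))" for p r x
  have DD: "D = insert s (insert t (D - {s, t}))" using st by auto
  have full: "elem_act D p r f (x(t := c, s := hat c)) =
      (if hat c = p then f (x(t := c, s := r)) else 0) + (if c = p then f (x(t := r, s := hat c)) else 0) +
      (\<Sum>u\<in>D - {s, t}. if x u = p then f (x(u := r, t := c, s := hat c)) else 0)" for p r x c
  proof -
    have *: "(\<Sum>u\<in>D - {s, t}. if (x(t := c, s := hat c)) u = p then f (x(t := c, s := hat c, u := r)) else 0) =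
       (\<Sum>u\<in>D - {s, t}. if x u = p then f (x(u := r, t := c, s := hat c)) else 0)"
      by (intro sum.cong refl) (auto simp: fun_upd_twist)
    have "elem_act D p r f y = (if y s = p then f (y(s := r)) else 0) + ((if y t = p then f (y(t := r)) else 0) +
        (\<Sum>u\<in>D - {s, t}. if y u = p then f (y(u := r)) else 0))" for y
      unfolding elem_act_def by (subst DD) (use st D in \<open>simp add: insert_Diff_if\<close>)
    then show ?thesis
      unfolding *[symmetric] using st by (auto simp: fun_upd_twist)
  qed
  have act: "elem_act (D - {s, t}) p r (contract_pos t s f) x =
    (\<Sum>c\<in>UNIV. eps c * elem_act D p r f (x(t := c, s := hat c))) - E p r x" for p r x
  proof -
    have "(\<Sum>c\<in>UNIV. eps c * elem_act D p r f (x(t := c, s := hat c))) =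
      (\<Sum>c\<in>UNIV. if hat c = p then eps c * f (x(t := c, s := r)) else 0) +
      (\<Sum>c\<in>UNIV. if c = p then eps c * f (x(t := r, s := hat c)) else 0) +
      (\<Sum>c\<in>UNIV. \<Sum>u\<in>D - {s, t}. if x u = p then eps c * f (x(u := r, t := c, s := hat c)) else 0)"
      unfolding full sum.distrib[symmetric]
      by (intro sum.cong refl) (simp add: distrib_left sum_distrib_left if_distrib[of "\<lambda>z. _ * z"] cong: if_cong)
    also have "(\<Sum>c\<in>UNIV. \<Sum>u\<in>D - {s, t}. if x u = p then eps c * f (x(u := r, t := c, s := hat c)) else 0) =
      elem_act (D - {s, t}) p r (contract_pos t s f) x"
      unfolding elem_act_def contract_pos_def by (subst sum.swap) (intro sum.cong refl, auto)
    finally show ?thesis by (simp add: E_def sum_hat_delta algebra_simps del: fun_upd_apply)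
  qed
  have E: "E p r x = eps p * eps r * E (hat r) (hat p) x" for p r x
    by (simp add: E_def algebra_simps)
  have f: "elem_act D p r f x = eps p * eps r * elem_act D (hat r) (hat p) f x" for p r x
    using inv unfolding sp_invariant_def by blast
  show ?thesis
    unfolding sp_invariant_def act
    by (subst f, subst E) (simp add: sum_distrib_left algebra_simps)
qed

lemma contract_pos_depends:
  assumes "depends_on D f"
  shows "depends_on (D - {s, t}) (contract_pos t s f)"
  unfolding depends_on_def contract_pos_def
  by (intro allI impI sum.cong refl arg_cong2[of _ _ _ _ "(*)"] depends_onD[OF assms]) auto

text \<open>Let \<open>h\<close> be the component of \<open>f\<close> orthogonal to the pairing tensors. By induction the contractions of \<open>h\<close>
are pairing tensors, so all terms of \<open>casimir_expand\<close> except \<open>- |D| h\<close> are orthogonal to \<open>h\<close>. But the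
Casimir operator is a sum of operators \<open>E\<^sup>* E\<close> and so it cannot be negative at \<open>h\<close>; hence \<open>h = 0\<close>.\<close>

theorem first_fundamental_theorem_Sp:
  fixes f :: "('p \<Rightarrow> 'n::finite + 'n) \<Rightarrow> complex"
  assumes "finite D" "depends_on D f" "sp_invariant D f"
  shows "pairing_span D f"
  using assms
proof (induction "card D" arbitrary: D f rule: less_induct)
  case less
  note fin = \<open>finite D\<close>
  show ?case
  proof (cases "D = {}")
    case True
    then have "f = (\<lambda>x. f undefined)" using less.prems(2) by (auto simp: depends_on_def)
    then show ?thesis using True pairing_span.const by metis
  next
    case False
    let ?X = "PiE D (\<lambda>_. UNIV :: ('n + 'n) set)"
    have "finite ?X" using fin by (intro finite_PiE) auto
    then have "\<exists>b. pairing_span D b \<and> (\<forall>g. pairing_span D g \<longrightarrow> (\<Sum>x\<in>?X. (f x - b x) * cnj (g x)) = 0)"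
      by (rule orthogonal_projection_exists) (rule pairing_span.intros; assumption?)+
    then obtain b where b: "pairing_span D b"
        "\<And>g. pairing_span D g \<Longrightarrow> (\<Sum>x\<in>?X. (f x - b x) * cnj (g x)) = 0"
      by blast
    define h where "h = (\<lambda>x. f x + (- 1) * b x)"
    have h_inv: "sp_invariant D h"
      unfolding h_def
      by (intro sp_invariant_add less.prems sp_invariant_scale pairing_span_sp_invariant[OF b(1) fin])
    have h_dep: "depends_on D h"
      using less.prems(2) pairing_span_depends[OF b(1)] unfolding depends_on_def h_def by metis
    have pair: "pairing_span D (\<lambda>x. J_mat $ x t $ x s * contract_pos t s h x)"
      if "t \<in> D" "s \<in> D - {t}" for s t
    proof -
      have "card (D - {s, t}) < card D" using that fin by (intro psubset_card_mono) auto
      then have "pairing_span (D - {s, t}) (contract_pos t s h)"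
        using less.hyps fin contract_pos_depends[OF h_dep] contract_pos_invariant[OF fin h_inv] that
        by (metis DiffD1 DiffD2 finite_Diff singletonI)
      then have "pairing_span (insert t (insert s (D - {s, t}))) (\<lambda>x. J_mat $ x t $ x s * contract_pos t s h x)"
        using that by (intro pairing_span.pair) auto
      moreover have "insert t (insert s (D - {s, t})) = D" using that by auto
      ultimately show ?thesis by simp
    qed
    have sumspan: "pairing_span D (\<lambda>x. \<Sum>i\<in>I. F i x)" if "finite I" "\<And>i. i \<in> I \<Longrightarrow> pairing_span D (F i)" for I :: "'p set" and F
      using that by (induction I rule: finite_induct) (auto intro: pairing_span.intros)
    define S where "S x = (\<Sum>t\<in>D. \<Sum>s\<in>D - {t}. J_mat $ x t $ x s * contract_pos t s h x)" for x
    have S: "pairing_span D S"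
      unfolding S_def by (intro sumspan fin finite_Diff pair) auto
    have hS: "(\<Sum>x\<in>?X. h x * cnj (S x)) = 0"
      using b(2)[OF S] by (simp add: h_def)
    have "(\<Sum>p\<in>UNIV. \<Sum>r\<in>UNIV. \<Sum>x\<in>?X. elem_act D p r h x * cnj (elem_act D p r h x)) =
      (\<Sum>p\<in>UNIV. \<Sum>r\<in>UNIV. \<Sum>x\<in>?X. h x * cnj (elem_act D r p (elem_act D p r h) x))"
      by (simp only: elem_act_adjoint[OF fin, of _ _ h])
    also have "\<dots> = (\<Sum>x\<in>?X. h x * cnj (\<Sum>p\<in>UNIV. \<Sum>r\<in>UNIV. elem_act D r p (elem_act D p r h) x))"
      unfolding cnj_sum sum_distrib_left by (rule sum_rotate3)
    also have "\<dots> = (\<Sum>x\<in>?X. h x * cnj (- of_nat (card D) * h x + S x))"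
    proof -
      have eq: "elem_act D p r h = (\<lambda>x. (eps p * eps r) * elem_act D (hat r) (hat p) h x)" for p r
        by (rule ext) (use h_inv in \<open>unfold sp_invariant_def, blast\<close>)
      have "elem_act D r p (elem_act D p r h) x = eps p * eps r * elem_act D r p (elem_act D (hat r) (hat p) h) x" for p r x
        by (subst eq, rule elem_act_scale)
      then have "(\<Sum>p\<in>UNIV. \<Sum>r\<in>UNIV. elem_act D r p (elem_act D p r h) x) = - of_nat (card D) * h x + S x" for x
        unfolding S_def casimir_expand[OF fin, symmetric] by (intro sum.cong refl)
      then show ?thesis by (simp only:)
    qed
    also have "\<dots> = - of_nat (card D) * (\<Sum>x\<in>?X. h x * cnj (h x))"
    proof -
      have "h x * cnj (- of_nat (card D) * h x + S x) = - of_nat (card D) * (h x * cnj (h x)) + h x * cnj (S x)" for x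
        by (simp add: algebra_simps)
      then show ?thesis by (simp only: sum.distrib hS sum_distrib_left[symmetric] add_0_right)
    qed
    finally have eq: "(\<Sum>p\<in>UNIV. \<Sum>r\<in>UNIV. \<Sum>x\<in>?X. elem_act D p r h x * cnj (elem_act D p r h x)) =
      - of_nat (card D) * (\<Sum>x\<in>?X. h x * cnj (h x))" .
    have "complex_of_real (\<Sum>p\<in>UNIV. \<Sum>r\<in>UNIV. \<Sum>x\<in>?X. (cmod (elem_act D p r h x))\<^sup>2) =
      complex_of_real (- of_nat (card D) * (\<Sum>x\<in>?X. (cmod (h x))\<^sup>2))"
      by (simp only: of_real_sum of_real_mult of_real_minus of_real_of_nat_eq complex_norm_square eq)
    then have "(\<Sum>p\<in>UNIV. \<Sum>r\<in>UNIV. \<Sum>x\<in>?X. (cmod (elem_act D p r h x))\<^sup>2) =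
       - of_nat (card D) * (\<Sum>x\<in>?X. (cmod (h x))\<^sup>2)"
      using of_real_eq_iff by blast
    moreover have "(\<Sum>p\<in>UNIV. \<Sum>r\<in>UNIV. \<Sum>x\<in>?X. (cmod (elem_act D p r h x))\<^sup>2) \<ge> 0"
      by (intro sum_nonneg) auto
    ultimately have "(\<Sum>x\<in>?X. (cmod (h x))\<^sup>2) \<le> 0"
      using False fin card_gt_0_iff[of D] by (auto simp: mult_le_0_iff)
    then have "(\<Sum>x\<in>?X. (cmod (h x))\<^sup>2) = 0" by (intro antisym sum_nonneg) auto
    then have h0: "h x = 0" if "x \<in> ?X" for x
      using that \<open>finite ?X\<close> by (simp add: sum_nonneg_eq_0_iff)
    have "h x = 0" for x
    proof -
      have "h x = h (restrict x D)" by (rule depends_onD[OF h_dep]) auto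
      then show ?thesis using h0 by auto
    qed
    then have "f = b" by (auto simp: h_def fun_eq_iff)
    then show ?thesis using b(1) by simp
  qed
qed

section \<open>Exterior algebras\<close>

lemma wedge_Nil [simp]: "wedge [] = 1"
  and wedge_Cons [simp]: "wedge (x # xs) = ext_inc x * wedge xs"
  and wedge_append: "wedge (xs @ ys) = wedge xs * wedge ys"
  by (simp_all add: wedge_def)

lemma scaleC_eq_0 [simp]: "c *\<^sub>C (0::'a::complex_vector) = 0"
  by (rule cvs.scale_zero_right)

lemma abs_ext_single: "abs_ext (Poly_Mapping.single w c) = c *\<^sub>C wedge w"
  by (simp add: wedge_abs scaleC_ext.abs_eq mult_single plus_list_def)

lemma ext_induct [case_names scale add]:
  fixes x :: "'v::complex_vector ext"
  assumes "\<And>c xs. P (c *\<^sub>C wedge xs)" and "\<And>x y. P x \<Longrightarrow> P y \<Longrightarrow> P (x + y)"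
  shows "P x"
proof (cases x)
  case (1 p)
  have "P (abs_ext p)"
  proof (induction p rule: words_induct)
    case zero
    show ?case using assms(1)[of 0] by (simp add: zero_ext_def[symmetric])
  qed (simp_all add: abs_ext_single assms plus_ext.abs_eq[symmetric])
  then show ?thesis using 1 by simp
qed

lemma ext_inc_anticommute: "ext_inc x * ext_inc y = - (ext_inc y * ext_inc x)"
proof -
  interpret Vector_Spaces.linear scaleC scaleC ext_inc by (rule linear_ext_inc)
  have "0 = ext_inc (x + y) * ext_inc (x + y)" by (rule ext_inc_square[symmetric])
  also have "\<dots> = ext_inc x * ext_inc y + ext_inc y * ext_inc x"
    by (simp add: add algebra_simps ext_inc_square)
  finally show ?thesis by (metis add_eq_0_iff minus_minus)
qed

lemma ext_power_subspace: "cvs.subspace (ext_power V k)"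
  unfolding ext_power_def by (rule cvs.subspace_span)

lemma wedge_in_ext_power: "set xs \<subseteq> V \<Longrightarrow> length xs = k \<Longrightarrow> wedge xs \<in> ext_power V k"
  unfolding ext_power_def by (intro cvs.span_base) auto

lemma ext_power_induct [consumes 1, case_names zero wedge add scale]:
  assumes "x \<in> ext_power V k" and "P 0" and "\<And>xs. set xs \<subseteq> V \<Longrightarrow> length xs = k \<Longrightarrow> P (wedge xs)"
    and "\<And>x y. P x \<Longrightarrow> P y \<Longrightarrow> P (x + y)" and "\<And>c x. P x \<Longrightarrow> P (c *\<^sub>C x)"
  shows "P x"
proof -
  have "x \<in> Collect P"
    by (rule cvs.span_induct[OF assms(1)[unfolded ext_power_def]])
      (use assms in \<open>auto simp: cvs.subspace_def\<close>)
  then show ?thesis by simp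
qed

lemma ext_power_mult:
  assumes "x \<in> ext_power V j" "y \<in> ext_power V k"
  shows "x * y \<in> ext_power V (j + k)"
proof -
  note sub = ext_power_subspace[of V "j + k"]
  show ?thesis using assms(1)
  proof (induction rule: ext_power_induct)
    case (wedge xs)
    show ?case using assms(2)
    proof (induction rule: ext_power_induct)
      case (wedge ys)
      then show ?case using \<open>set xs \<subseteq> V\<close> \<open>length xs = j\<close>
        by (auto simp: wedge_append[symmetric] intro!: wedge_in_ext_power)
    qed (simp_all add: distrib_left mult_scaleC_right cvs.subspace_add[OF sub]
        cvs.subspace_scale[OF sub] cvs.subspace_0[OF sub])
  qed (simp_all add: distrib_right mult_scaleC_left cvs.subspace_add[OF sub]
        cvs.subspace_scale[OF sub] cvs.subspace_0[OF sub])
qed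

lemma one_in_ext_power: "1 \<in> ext_power V 0"
  using wedge_in_ext_power[of "[]" V 0] by simp

lemma ext_power_mono: "V \<subseteq> W \<Longrightarrow> ext_power V k \<subseteq> ext_power W k"
  unfolding ext_power_def by (rule cvs.span_mono) auto

lemma ext_inc_wedge_commute: "ext_inc x * wedge ys = (- 1) ^ length ys * (wedge ys * ext_inc x)"
proof (induction ys)
  case (Cons y ys)
  have "ext_inc x * wedge (y # ys) = - (ext_inc y * (ext_inc x * wedge ys))"
    by (simp add: mult.assoc[symmetric] ext_inc_anticommute[of x y])
  also have "\<dots> = - (ext_inc y * ((- 1) ^ length ys * (wedge ys * ext_inc x)))" by (simp only: Cons)
  also have "\<dots> = (- 1) ^ length (y # ys) * (wedge (y # ys) * ext_inc x)"
    by (cases "even (length ys)") (simp_all add: mult.assoc)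
  finally show ?case .
qed simp

lemma wedge_commute: "wedge xs * wedge ys = (- 1) ^ (length xs * length ys) * (wedge ys * wedge xs)"
proof (induction xs)
  case (Cons x xs)
  have "wedge (x # xs) * wedge ys = ext_inc x * (wedge xs * wedge ys)" by (simp add: mult.assoc)
  also have "\<dots> = (- 1) ^ (length xs * length ys) * ((ext_inc x * wedge ys) * wedge xs)"
    unfolding Cons by (cases "even (length xs * length ys)") (simp_all add: mult.assoc)
  also have "\<dots> = (- 1) ^ (length xs * length ys) * ((- 1) ^ length ys * (wedge ys * ext_inc x) * wedge xs)"
    unfolding ext_inc_wedge_commute ..
  also have "\<dots> = (- 1) ^ (length (x # xs) * length ys) * (wedge ys * wedge (x # xs))"
    by (simp add: mult.assoc power_add mult.commute)
       (cases "even (length ys)"; cases "even (length xs * length ys)"; simp)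
  finally show ?case .
qed simp

lemma ext_power_commute:
  assumes "x \<in> ext_power V j" "y \<in> ext_power W k"
  shows "x * y = (- 1) ^ (j * k) * (y * x)"
  using assms(1)
proof (induction rule: ext_power_induct)
  case (wedge xs)
  show ?case using assms(2)
  proof (induction rule: ext_power_induct)
    case (wedge ys)
    then show ?case using wedge_commute[of xs ys] \<open>length xs = j\<close> by simp
  qed (simp_all add: distrib_left distrib_right mult_scaleC_right mult_scaleC_left)
qed (simp_all add: distrib_left distrib_right mult_scaleC_right mult_scaleC_left)

lemma double_eq_0_ext: "x = - x \<Longrightarrow> x = (0 :: 'a::complex_vector)"
proof -
  assume "x = - x"
  then have "x + x = 0" by (metis add.right_inverse)
  then have "(2::complex) *\<^sub>C x = 0" using scaleC_add_left[of 1 1 x] by (simp add: scaleC_one)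
  then have "(1/2) *\<^sub>C (2::complex) *\<^sub>C x = 0" by simp
  then show "x = 0" by (simp add: scaleC_scaleC scaleC_one)
qed

section \<open>The induced form on an exterior algebra\<close>

locale bilinear_form =
  fixes b :: "'v::complex_vector \<Rightarrow> 'v \<Rightarrow> complex"
  assumes lin_l: "\<And>y. Vector_Spaces.linear scaleC scaleC (\<lambda>x. b x y)"
    and lin_r: "\<And>x. Vector_Spaces.linear scaleC scaleC (b x)"
begin

lemmas form_add_left = ext_form_add_left[OF lin_l lin_r]
lemmas form_add_right = ext_form_add_right[OF lin_l lin_r]
lemmas form_scale_left = ext_form_scaleC_left[OF lin_l lin_r]
lemmas form_scale_right = ext_form_scaleC_right[OF lin_l lin_r]
lemmas form_wedge = ext_form_wedge[OF lin_l lin_r]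

lemma form_zero_left [simp]: "ext_form b 0 y = 0"
  using form_scale_left[of 0 0 y] by (simp add: cvs.scale_zero_left)
lemma form_zero_right [simp]: "ext_form b y 0 = 0"
  using form_scale_right[of y 0 0] by (simp add: cvs.scale_zero_left)

lemma form_sum_left: "ext_form b (\<Sum>i\<in>I. f i) y = (\<Sum>i\<in>I. ext_form b (f i) y)"
  by (induction I rule: infinite_finite_induct) (simp_all add: form_add_left)
lemma form_sum_right: "ext_form b y (\<Sum>i\<in>I. f i) = (\<Sum>i\<in>I. ext_form b y (f i))"
  by (induction I rule: infinite_finite_induct) (simp_all add: form_add_right)

lemma form_diff_left: "ext_form b (x - x') y = ext_form b x y - ext_form b x' y"
  using form_add_left[of "x - x'" x' y] by simp

lemma form_degree:
  assumes "x \<in> ext_power V j" "y \<in> ext_power W k" "j \<noteq> k"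
  shows "ext_form b x y = 0"
  using assms(1)
proof (induction rule: ext_power_induct)
  case (wedge xs)
  show ?case using assms(2)
  proof (induction rule: ext_power_induct)
    case (wedge ys)
    then show ?case using \<open>length xs = j\<close> assms(3) by (simp add: form_wedge gram_det_def)
  qed (simp_all add: form_add_right form_scale_right)
qed (simp_all add: form_add_left form_scale_left)

end

context
  fixes f :: "'v::complex_vector \<Rightarrow> 'w::complex_vector"
  assumes lin: "Vector_Spaces.linear scaleC scaleC f"
begin

lemma ext_map_linear_aux: "Vector_Spaces.linear scaleC scaleC (\<lambda>v. ext_inc (f v))"
  using Vector_Spaces.linear_compose[OF lin linear_ext_inc] by (simp add: o_def)

lemmas ext_map_rules =
  ext_lift_ext_inc[OF ext_map_linear_aux ext_inc_square, folded ext_map_def]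
  ext_lift_one[OF ext_map_linear_aux ext_inc_square, folded ext_map_def]
  ext_lift_add[OF ext_map_linear_aux ext_inc_square, folded ext_map_def]
  ext_lift_mult[OF ext_map_linear_aux ext_inc_square, folded ext_map_def]
  ext_lift_scaleC[OF ext_map_linear_aux ext_inc_square, folded ext_map_def]

lemma ext_map_zero: "ext_map f 0 = 0"
  using ext_map_rules(5)[of 0 0] by (simp add: cvs.scale_zero_left)

lemma ext_map_sum: "ext_map f (\<Sum>i\<in>I. x i) = (\<Sum>i\<in>I. ext_map f (x i))"
  by (induction I rule: infinite_finite_induct) (simp_all add: ext_map_rules ext_map_zero)

lemma ext_map_power: "x \<in> ext_power V k \<Longrightarrow> ext_map f x \<in> ext_power (f ` V) k"
proof (induction rule: ext_power_induct)
  case (wedge xs)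
  show ?case unfolding ext_map_wedge[OF lin]
    by (rule wedge_in_ext_power) (use wedge in auto)
qed (auto simp: ext_map_zero ext_map_rules intro: cvs.subspace_0 cvs.subspace_add cvs.subspace_scale ext_power_subspace)

end

lemma (in bilinear_form) form_ext_map:
  assumes lin: "Vector_Spaces.linear scaleC scaleC g" and "\<And>x y. b (g x) (g y) = b x y"
  shows "ext_form b (ext_map g x) (ext_map g y) = ext_form b x y"
proof (induction x rule: ext_induct)
  case (scale c xs)
  show ?case
  proof (induction y rule: ext_induct)
    case (scale d ys)
    have "gram_det b (map g xs) (map g ys) = gram_det b xs ys"
    proof (cases "length xs = length ys")
      case True
      have "(\<Prod>i<length ys. b (map g xs ! i) (map g ys ! p i)) = (\<Prod>i<length ys. b (xs ! i) (ys ! p i))"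
        if "p permutes {..<length ys}" for p
        using permutes_in_image[OF that] True by (intro prod.cong) (auto simp: assms)
      then show ?thesis using True by (simp add: gram_det_def)
    qed (simp add: gram_det_def)
    then show ?case
      by (simp add: ext_map_rules[OF lin] ext_map_wedge[OF lin] form_scale_left form_scale_right form_wedge)
  qed (simp add: ext_map_rules[OF lin] form_add_right)
qed (simp add: ext_map_rules[OF lin] form_add_left)

section \<open>Permuting factors and expanding in dual families\<close>

lemma wedge_swap: "wedge (l1 @ x # l2 @ y # l3) = - wedge (l1 @ y # l2 @ x # l3)"
proof -
  have e: "wedge l2 * ext_inc z = (- 1) ^ length l2 * (ext_inc z * wedge l2)" for z
    unfolding ext_inc_wedge_commute by (cases "even (length l2)") simp_all
  have "ext_inc x * (wedge l2 * ext_inc y) = (- 1) ^ length l2 * (ext_inc x * ext_inc y * wedge l2)"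
    unfolding e by (cases "even (length l2)") (simp_all add: mult.assoc)
  also have "\<dots> = - ((- 1) ^ length l2 * (ext_inc y * ext_inc x * wedge l2))"
    by (subst ext_inc_anticommute) simp
  also have "\<dots> = - (ext_inc y * (wedge l2 * ext_inc x))"
    unfolding e by (cases "even (length l2)") (simp_all add: mult.assoc)
  finally have "ext_inc x * (wedge l2 * ext_inc y) = - (ext_inc y * (wedge l2 * ext_inc x))" .
  then have "wedge l1 * (ext_inc x * (wedge l2 * ext_inc y)) * wedge l3 =
     wedge l1 * (- (ext_inc y * (wedge l2 * ext_inc x))) * wedge l3" by (simp only:)
  then show ?thesis by (simp add: wedge_append mult.assoc)
qed

lemma map_upt_split2:
  assumes "a < b" "b < k"
  shows "map X [0..<k] = map X [0..<a] @ X a # map X [Suc a..<b] @ X b # map X [Suc b..<k]"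
proof -
  have "[0..<k] = [0..<a] @ [a..<k]" using assms upt_add_eq_append[of 0 a "k - a"] by simp
  also have "[a..<k] = a # [Suc a..<k]" using assms by (simp add: upt_conv_Cons)
  also have "[Suc a..<k] = [Suc a..<b] @ [b..<k]"
    using assms upt_add_eq_append[of "Suc a" b "k - b"] by simp
  also have "[b..<k] = b # [Suc b..<k]" using assms by (simp add: upt_conv_Cons)
  finally show ?thesis by simp
qed

lemma wedge_transpose:
  assumes "a < k" "b < k" "a \<noteq> b"
  shows "wedge (map (\<lambda>i. X (Transposition.transpose a b i)) [0..<k]) = - wedge (map X [0..<k])"
proof -
  have *: "wedge (map (\<lambda>i. X (Transposition.transpose a b i)) [0..<k]) = - wedge (map X [0..<k])"
    if "a < b" "b < k" for a b
  proof -
    have m: "map (\<lambda>i. X (Transposition.transpose a b i)) [0..<a] = map X [0..<a]"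
       "map (\<lambda>i. X (Transposition.transpose a b i)) [Suc a..<b] = map X [Suc a..<b]"
       "map (\<lambda>i. X (Transposition.transpose a b i)) [Suc b..<k] = map X [Suc b..<k]"
      using that by (auto simp: Transposition.transpose_def)
    have m': "X (Transposition.transpose a b a) = X b" "X (Transposition.transpose a b b) = X a"
      by simp_all
    show ?thesis unfolding map_upt_split2[OF that] m m' by (rule wedge_swap)
  qed
  show ?thesis using assms *[of a b] *[of b a] by (cases "a < b") (auto simp: transpose_commute)
qed

lemma wedge_permute:
  assumes "p permutes {..<k}"
  shows "wedge (map (\<lambda>i. X (p i)) [0..<k]) = of_int (sign p) *\<^sub>C wedge (map X [0..<k])"
  using assms finite_lessThan[of k]
proof (induction arbitrary: X rule: permutes_induct)
  case id
  then show ?case by (simp add: scaleC_one)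
next
  case (swap a b p)
  show ?case
  proof (cases "a = b")
    case True
    then show ?thesis using swap by simp
  next
    case False
    have "sign (Transposition.transpose a b \<circ> p) = - sign p"
      using swap False finite_lessThan[of k]
      by (subst sign_compose) (auto simp: sign_swap_id permutation_swap_id intro: permutation_permutes[THEN iffD2])
    then show ?thesis
      using swap.IH[of "\<lambda>i. X (Transposition.transpose a b i)"] wedge_transpose[of a k b X] swap.hyps False
      by (simp add: cvs.scale_minus_left o_def)
  qed
qed

lemma wedge_repeated:
  assumes "a < k" "b < k" "a \<noteq> b" "X a = X b"
  shows "wedge (map X [0..<k]) = 0"
proof -
  have "(\<lambda>i. X (Transposition.transpose a b i)) = X"
    using assms(4) by (auto simp: Transposition.transpose_def)
  then show ?thesis using wedge_transpose[OF assms(1-3), of X] by (intro double_eq_0_ext) simp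
qed

lemma sum_PiE_insert:
  fixes F :: "('p \<Rightarrow> 'i) \<Rightarrow> 'c::comm_monoid_add"
  assumes "t \<notin> S" "finite S"
  shows "(\<Sum>x\<in>PiE (insert t S) (\<lambda>_. A). F x) = (\<Sum>x\<in>PiE S (\<lambda>_. A). \<Sum>i\<in>A. F (x(t := i)))"
proof -
  have "(\<Sum>x\<in>PiE S (\<lambda>_. A). \<Sum>i\<in>A. F (x(t := i))) = (\<Sum>(x, i)\<in>PiE S (\<lambda>_. A) \<times> A. F (x(t := i)))"
    by (simp add: sum.cartesian_product)
  also have "\<dots> = (\<Sum>x\<in>PiE (insert t S) (\<lambda>_. A). F x)"
    using assms(1)
    by (intro sum.reindex_bij_witness[of _ "\<lambda>x. (x(t := undefined), x t)" "\<lambda>(x, i). x(t := i)"])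
      (auto simp: PiE_iff extensional_def fun_eq_iff)
  finally show ?thesis ..
qed

lemma sum_scaleC_left: "(\<Sum>i\<in>I. f i) *\<^sub>C x = (\<Sum>i\<in>I. f i *\<^sub>C (x :: 'a::complex_vector))"
  by (rule cvs.scale_sum_left)
lemma sum_scaleC_right: "c *\<^sub>C (\<Sum>i\<in>I. f i) = (\<Sum>i\<in>I. c *\<^sub>C (f i :: 'a::complex_vector))"
  by (rule cvs.scale_sum_right)

lemma prod_list_sum_expand:
  fixes a :: "'p \<Rightarrow> 'i \<Rightarrow> 'a::complex_algebra_1"
  assumes "distinct js"
  shows "prod_list (map (\<lambda>j. \<Sum>i\<in>A. c j i *\<^sub>C a j i) js) =
    (\<Sum>h\<in>PiE (set js) (\<lambda>_. A). (\<Prod>j\<in>set js. c j (h j)) *\<^sub>C prod_list (map (\<lambda>j. a j (h j)) js))"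
  using assms
proof (induction js)
  case Nil
  then show ?case by (simp add: scaleC_one)
next
  case (Cons t js)
  have m: "map (\<lambda>j. a j ((h(t := i)) j)) js = map (\<lambda>j. a j (h j)) js"
          "(\<Prod>j\<in>set js. c j ((h(t := i)) j)) = (\<Prod>j\<in>set js. c j (h j))" for h i
    using Cons.prems by (auto intro!: prod.cong)
  have "prod_list (map (\<lambda>j. \<Sum>i\<in>A. c j i *\<^sub>C a j i) (t # js)) =
    (\<Sum>h\<in>PiE (set js) (\<lambda>_. A). \<Sum>i\<in>A. (c t i * (\<Prod>j\<in>set js. c j (h j))) *\<^sub>C (a t i * prod_list (map (\<lambda>j. a j (h j)) js)))"
    using Cons by (simp add: sum_distrib_left sum_distrib_right mult_scaleC_left mult_scaleC_right scaleC_scaleC mult.commute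
        sum_scaleC_right)
  also have "\<dots> = (\<Sum>h\<in>PiE (set (t # js)) (\<lambda>_. A). (\<Prod>j\<in>set (t # js). c j (h j)) *\<^sub>C prod_list (map (\<lambda>j. a j (h j)) (t # js)))"
    using Cons.prems by (simp add: sum_PiE_insert m del: fun_upd_apply) (simp del: fun_upd_apply add: fun_upd_same)
  finally show ?case .
qed

text \<open>Expand every factor of a wedge product of \<open>k\<close> vectors in the dual families. In the Gram determinant each
of the \<open>k!\<close> permutations of the factors contributes its own copy of the product, with the sign of the
permutation occurring twice; this is where the factor \<open>k!\<close> comes from.\<close>

lemma (in bilinear_form) reconstruct:
  fixes u v :: "'i \<Rightarrow> 'v"
  assumes fin: "finite A" and dual: "\<And>y. y \<in> V \<Longrightarrow> (\<Sum>i\<in>A. b y (u i) *\<^sub>C v i) = y"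
    and x: "x \<in> ext_power V k"
  shows "(\<Sum>h\<in>PiE {..<k} (\<lambda>_. A).
      ext_form b x (wedge (map (\<lambda>i. u (h i)) [0..<k])) *\<^sub>C wedge (map (\<lambda>i. v (h i)) [0..<k])) = of_nat (fact k) *\<^sub>C x"
  using x
proof (induction rule: ext_power_induct)
  case (wedge xs)
  define X where "X i = xs ! i" for i
  have xs: "xs = map X [0..<k]"
    using wedge(2) unfolding X_def by (simp add: list_eq_iff_nth_eq)
  have XV: "X i \<in> V" if "i < k" for i using wedge that by (auto simp: X_def)
  have gd: "ext_form b (wedge xs) (wedge (map (\<lambda>i. u (h i)) [0..<k])) =
    (\<Sum>p | p permutes {..<k}. of_int (sign p) * (\<Prod>j<k. b (X (p j)) (u (h j))))" for h
  proof -
    have "ext_form b (wedge xs) (wedge (map (\<lambda>i. u (h i)) [0..<k])) =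
       gram_det (\<lambda>x y. b y x) (map (\<lambda>i. u (h i)) [0..<k]) xs"
      unfolding form_wedge by (subst gram_det_flip) simp
    also have "\<dots> = (\<Sum>p | p permutes {..<k}. of_int (sign p) * (\<Prod>j<k. b (X (p j)) (u (h j))))"
      using wedge(2) by (simp add: gram_det_def X_def)
    finally show ?thesis .
  qed
  have fx: "wedge (map (\<lambda>j. X (p j)) [0..<k]) =
     (\<Sum>h\<in>PiE {..<k} (\<lambda>_. A). (\<Prod>j<k. b (X (p j)) (u (h j))) *\<^sub>C wedge (map (\<lambda>i. v (h i)) [0..<k]))"
    if p: "p permutes {..<k}" for p
  proof -
    have "wedge (map (\<lambda>j. X (p j)) [0..<k]) = prod_list (map (\<lambda>j. \<Sum>i\<in>A. b (X (p j)) (u i) *\<^sub>C ext_inc (v i)) [0..<k])"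
    proof -
      interpret Vector_Spaces.linear scaleC scaleC ext_inc by (rule linear_ext_inc)
      have "ext_inc (X (p j)) = (\<Sum>i\<in>A. b (X (p j)) (u i) *\<^sub>C ext_inc (v i))" if "j < k" for j
      proof -
        have "X (p j) = (\<Sum>i\<in>A. b (X (p j)) (u i) *\<^sub>C v i)"
          using permutes_in_image[OF p, of j] that XV[of "p j"] dual by simp
        then have "ext_inc (X (p j)) = ext_inc (\<Sum>i\<in>A. b (X (p j)) (u i) *\<^sub>C v i)" by simp
        then show ?thesis by (simp only: sum scale)
      qed
      then show ?thesis unfolding wedge_def map_map o_def
        by (intro arg_cong[of _ _ prod_list] map_cong) auto
    qed
    also have "\<dots> = (\<Sum>h\<in>PiE {..<k} (\<lambda>_. A). (\<Prod>j<k. b (X (p j)) (u (h j))) *\<^sub>C wedge (map (\<lambda>i. v (h i)) [0..<k]))"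
      by (subst prod_list_sum_expand) (simp_all add: wedge_def o_def atLeast0LessThan)
    finally show ?thesis .
  qed
  have "(\<Sum>h\<in>PiE {..<k} (\<lambda>_. A).
      ext_form b (wedge xs) (wedge (map (\<lambda>i. u (h i)) [0..<k])) *\<^sub>C wedge (map (\<lambda>i. v (h i)) [0..<k])) =
    (\<Sum>p | p permutes {..<k}. of_int (sign p) *\<^sub>C (\<Sum>h\<in>PiE {..<k} (\<lambda>_. A).
       (\<Prod>j<k. b (X (p j)) (u (h j))) *\<^sub>C wedge (map (\<lambda>i. v (h i)) [0..<k])))"
    unfolding gd sum_scaleC_left sum_scaleC_right scaleC_scaleC by (rule sum.swap)
  also have "\<dots> = (\<Sum>p | p permutes {..<k}. of_int (sign p) *\<^sub>C of_int (sign p) *\<^sub>C wedge xs)"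
    by (intro sum.cong refl) (simp add: fx[symmetric] wedge_permute xs)
  also have "\<dots> = (\<Sum>p | p permutes {..<k}. wedge xs)"
    by (intro sum.cong refl) (simp add: scaleC_scaleC scaleC_one sign_idempotent flip: of_int_mult)
  also have "\<dots> = of_nat (fact k) *\<^sub>C wedge xs"
  proof -
    have "(\<Sum>p | p permutes {..<k}. wedge xs) = (\<Sum>p | p permutes {..<k}. (1::complex) *\<^sub>C wedge xs)"
      by (simp add: scaleC_one)
    also have "\<dots> = (\<Sum>p | p permutes {..<k}. 1::complex) *\<^sub>C wedge xs"
      by (simp only: sum_scaleC_left)
    finally show ?thesis using card_permutations[of "{..<k}" k] by simp
  qed
  finally show ?case .
next
  case (add x y)
  then show ?case by (simp add: form_add_left scaleC_add_left scaleC_add_right sum.distrib)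
next
  case (scale c x)
  have "c *\<^sub>C (\<Sum>h\<in>PiE {..<k} (\<lambda>_. A).
      ext_form b x (wedge (map (\<lambda>i. u (h i)) [0..<k])) *\<^sub>C wedge (map (\<lambda>i. v (h i)) [0..<k])) = c *\<^sub>C of_nat (fact k) *\<^sub>C x"
    using scale by simp
  then show ?case by (simp only: form_scale_left sum_scaleC_right scaleC_scaleC mult.commute)
qed (simp add: cvs.scale_zero_left)

section \<open>Matrices and the space p\<close>

lemma scaleC_complex [simp]: "c *\<^sub>C (z :: complex) = c * z"
  by (simp add: scaleC_complex_def)

lemma scaleR_scaleC_cmat: "r *\<^sub>R A = of_real r *\<^sub>C (A :: 'm::finite cmat)"
  by (simp add: vec_eq_iff scaleR_conv_of_real[where 'a = complex])

lemma sum_cmat_nth: "(\<Sum>i\<in>I. A i) $ a $ b = (\<Sum>i\<in>I. (A i :: 'm::finite cmat) $ a $ b)"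
  by (induction I rule: infinite_finite_induct) auto

lemma cmat_diff_mult: "(A - A') ** B = A ** B - A' ** (B :: 'm::finite cmat)"
  and cmat_mult_diff: "B ** (A - A') = B ** A - B ** (A' :: 'm::finite cmat)"
  by (simp_all add: matrix_matrix_mult_def vec_eq_iff sum_subtractf algebra_simps)

definition munit :: "'m::finite \<Rightarrow> 'm \<Rightarrow> 'm cmat"
  where "munit a b = (\<chi> i j. if i = a \<and> j = b then 1 else 0)"

lemma munit_nth: "munit a b $ i $ j = (if i = a then if j = b then 1 else 0 else 0)"
  by (simp add: munit_def)

lemma transpose_munit: "transpose (munit a b) = munit b a"
  by (auto simp: munit_def transpose_def vec_eq_iff)

lemma mult_munit_mult: "(A ** munit a b ** B) $ i $ j = A $ i $ a * B $ b $ j"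
  by (simp add: matrix_matrix_mult_def munit_nth if_distrib[of "\<lambda>z. _ * z"] if_distrib[of "\<lambda>z. z * _"]
      cong: if_cong)

lemma trace_munit: "trace (A ** munit a b) = A $ b $ a"
  by (simp add: trace_def matrix_matrix_mult_def munit_nth if_distrib[of "\<lambda>z. _ * z"] cong: if_cong)

lemma cmat_munit_expand: "(\<Sum>a\<in>UNIV. \<Sum>b\<in>UNIV. A $ a $ b *\<^sub>C munit a b) = (A :: 'm::finite cmat)"
proof -
  have "(\<Sum>a\<in>UNIV. \<Sum>b\<in>UNIV. A $ a $ b *\<^sub>C munit a b) $ i $ j = A $ i $ j" for i j
  proof -
    have "(\<Sum>b\<in>UNIV. (A $ a $ b *\<^sub>C munit a b) $ i $ j) = (if i = a then A $ a $ j else 0)" for a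
      by (cases "i = a") (simp_all add: munit_nth if_distrib[of "\<lambda>z. _ * z"] cong: if_cong)
    then show ?thesis by (simp only: sum_cmat_nth) simp
  qed
  then show ?thesis by (simp add: vec_eq_iff)
qed

lemma map_cnj_mult: "map_matrix cnj (A ** B) = map_matrix cnj A ** map_matrix cnj (B :: 'm::finite cmat)"
  by (simp add: map_matrix_def matrix_matrix_mult_def vec_eq_iff)

lemma map_cnj_cnj [simp]: "map_matrix cnj (map_matrix cnj A) = (A :: 'm::finite cmat)"
  by (simp add: map_matrix_def vec_eq_iff)

lemma conj_transpose_nth [simp]: "conj_transpose A $ i $ j = cnj (A $ j $ i)"
  by (simp add: conj_transpose_def transpose_def map_matrix_def)

lemma conj_transpose_mult: "conj_transpose (A ** B) = conj_transpose B ** conj_transpose (A :: 'm::finite cmat)"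
  by (simp add: conj_transpose_def map_cnj_mult matrix_transpose_mul)

lemma conj_transpose_conj_transpose [simp]: "conj_transpose (conj_transpose A) = (A :: 'm::finite cmat)"
  by (simp add: vec_eq_iff)

lemma conj_transpose_add: "conj_transpose (A + B) = conj_transpose A + conj_transpose (B :: 'm::finite cmat)"
  and conj_transpose_diff: "conj_transpose (A - B) = conj_transpose A - conj_transpose (B :: 'm::finite cmat)"
  and conj_transpose_scaleC: "conj_transpose (c *\<^sub>C A) = cnj c *\<^sub>C conj_transpose (A :: 'm::finite cmat)"
  and conj_transpose_scaleR: "conj_transpose (r *\<^sub>R A) = r *\<^sub>R conj_transpose (A :: 'm::finite cmat)"
  by (simp_all add: vec_eq_iff)

lemma transpose_J: "transpose J_mat = - (J_mat :: ('n::finite + 'n) cmat)"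
  by (auto simp: vec_eq_iff transpose_def J_nth hat_eq_iff)

lemma map_cnj_J: "map_matrix cnj J_mat = (J_mat :: ('n::finite + 'n) cmat)"
  by (auto simp: vec_eq_iff map_matrix_def J_nth)

lemma JJ_left: "J_mat ** (J_mat ** A) = - (A :: ('n::finite + 'n) cmat)"
  and JJ_right: "A ** J_mat ** J_mat = - (A :: ('n::finite + 'n) cmat)"
  by (simp add: matrix_mul_assoc J_mat_mult_J_mat matrix_neg_mult)
     (simp add: matrix_mul_assoc[symmetric] J_mat_mult_J_mat matrix_mult_neg)

lemma involution_eq: "involution X = J_mat ** transpose X ** (J_mat :: ('n::finite + 'n) cmat)"
  by (simp add: involution_def matrix_inv_J_mat matrix_mult_neg)

lemma p_space_iff: "X \<in> p_space \<longleftrightarrow> J_mat ** transpose X = X ** (J_mat :: ('n::finite + 'n) cmat)"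
proof
  assume "X \<in> p_space"
  then have "J_mat ** transpose X ** J_mat ** J_mat = (- X) ** J_mat"
    by (simp add: p_space_def involution_eq)
  then show "J_mat ** transpose X = X ** J_mat" by (simp add: JJ_right matrix_neg_mult)
next
  assume "J_mat ** transpose X = X ** J_mat"
  then show "X \<in> p_space" by (simp add: p_space_def involution_eq JJ_right)
qed

lemma transpose_add: "transpose (A + B) = transpose A + transpose (B :: 'm::finite cmat)"
  and transpose_diff: "transpose (A - B) = transpose A - transpose (B :: 'm::finite cmat)"
  and transpose_neg: "transpose (- B) = - transpose (B :: 'm::finite cmat)"
  and transpose_scaleC: "transpose (c *\<^sub>C A) = c *\<^sub>C transpose (A :: 'm::finite cmat)"
  and transpose_scaleR: "transpose (r *\<^sub>R A) = r *\<^sub>R transpose (A :: 'm::finite cmat)"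
  by (simp_all add: vec_eq_iff transpose_def)

lemma cmat_scaleR_mult: "(r *\<^sub>R A) ** B = r *\<^sub>R ((A :: 'm::finite cmat) ** (B :: 'm cmat))"
  and cmat_mult_scaleR: "(A :: 'm cmat) ** (r *\<^sub>R B) = r *\<^sub>R (A ** (B :: 'm cmat))"
  unfolding scaleR_scaleC_cmat by (rule cmat_scaleC_mult cmat_mult_scaleC)+

lemma matrix_mult_0 [simp]: "A ** 0 = (0 :: 'm::finite cmat)" "0 ** A = (0 :: 'm::finite cmat)"
  by (simp_all add: matrix_matrix_mult_def vec_eq_iff)

lemma transpose_0 [simp]: "transpose 0 = (0 :: 'm::finite cmat)"
  by (simp add: vec_eq_iff transpose_def)

lemma p_space_subspace: "cvs.subspace (p_space :: ('n::finite + 'n) cmat set)"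
  unfolding cvs.subspace_def
  by (simp add: p_space_iff transpose_add transpose_scaleC matrix_add_ldistrib cmat_add_mult
      cmat_scaleC_mult cmat_mult_scaleC)

interpretation tf: bilinear_form "trace_form :: 'm::finite cmat \<Rightarrow> _"
  by (rule bilinear_form.intro) (rule linear_trace_form)+

lemma trace_form_sym: "trace_form X Y = trace_form Y X"
  unfolding trace_form_def by (rule trace_mul_sym)

text \<open>Under \<open>A \<mapsto> A J\<close> the generator \<open>p_gen a b\<close> comes from the skew-symmetric matrix \<open>e\<^sub>a \<and> e\<^sub>b\<close>. Up to a
factor the elements \<open>p_gen_dual a b\<close> are dual to these generators for the trace form.\<close>

definition p_gen :: "'n::finite + 'n \<Rightarrow> 'n + 'n \<Rightarrow> ('n + 'n) cmat"
  where "p_gen a b = (munit a b - munit b a) ** J_mat"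

definition p_gen_dual :: "'n::finite + 'n \<Rightarrow> 'n + 'n \<Rightarrow> ('n + 'n) cmat"
  where "p_gen_dual a b = J_mat ** (munit a b - munit b a)"

lemma p_gen_in_p: "p_gen a b \<in> p_space" "p_gen_dual a b \<in> p_space"
proof -
  show "p_gen a b \<in> p_space"
    unfolding p_space_iff p_gen_def matrix_transpose_mul transpose_J JJ_right
    by (simp add: transpose_diff transpose_munit matrix_neg_mult matrix_mult_neg JJ_left)
  show "p_gen_dual a b \<in> p_space"
    unfolding p_space_iff p_gen_dual_def matrix_transpose_mul transpose_J
    by (simp add: transpose_diff transpose_munit matrix_mult_neg matrix_mul_assoc cmat_mult_diff cmat_diff_mult)
qed

text \<open>If \<open>y = A J\<close>, then pairing with \<open>p_gen_dual a b\<close> gives twice the entry of \<open>A\<close>, and the sum over all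
pairs of indices meets every entry of a skew-symmetric matrix twice; this explains the factor \<open>1/4\<close>.\<close>

lemma p_dual_expansion:
  assumes "y \<in> (p_space :: ('n::finite + 'n) cmat set)"
  shows "(\<Sum>i\<in>UNIV. trace_form y (p_gen_dual (fst i) (snd i)) *\<^sub>C ((1/4) *\<^sub>C p_gen (fst i) (snd i))) = y"
proof -
  define A where "A = - (y ** J_mat)"
  have AJ: "A ** J_mat = y" by (simp add: A_def matrix_neg_mult JJ_right)
  have At: "transpose A = - A"
    using assms by (simp add: A_def transpose_neg matrix_transpose_mul transpose_J matrix_neg_mult p_space_iff)
  have Aba: "A $ b $ a = - A $ a $ b" for a b
  proof -
    have "transpose A $ a $ b = (- A) $ a $ b" unfolding At ..
    then show ?thesis by (simp add: transpose_def)
  qed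
  have tr: "trace_form y (p_gen_dual a b) = 2 * A $ a $ b" for a b
  proof -
    have "y ** p_gen_dual a b = - (A ** munit a b - A ** munit b a)"
      unfolding p_gen_dual_def AJ[symmetric]
      by (simp add: matrix_mul_assoc[symmetric] JJ_left matrix_mult_neg cmat_mult_diff)
    then have "trace_form y (p_gen_dual a b) = - (trace (A ** munit a b) - trace (A ** munit b a))"
      by (simp add: trace_form_def trace_def sum_negf sum_subtractf)
    then show ?thesis by (simp add: trace_munit Aba[of b a])
  qed
  have "(\<Sum>i\<in>UNIV. trace_form y (p_gen_dual (fst i) (snd i)) *\<^sub>C ((1/4) *\<^sub>C p_gen (fst i) (snd i))) =
     (\<Sum>a\<in>UNIV. \<Sum>b\<in>UNIV. trace_form y (p_gen_dual a b) *\<^sub>C ((1/4) *\<^sub>C p_gen a b))"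
    by (simp add: UNIV_Times_UNIV[symmetric] sum.cartesian_product case_prod_beta del: UNIV_Times_UNIV)
  also have "\<dots> = (\<Sum>a\<in>UNIV. \<Sum>b\<in>UNIV. ((1/2) *\<^sub>C (A $ a $ b *\<^sub>C munit a b)) ** J_mat + ((1/2) *\<^sub>C (A $ b $ a *\<^sub>C munit b a)) ** J_mat)"
  proof (intro sum.cong refl)
    fix a b
    show "trace_form y (p_gen_dual a b) *\<^sub>C (1/4) *\<^sub>C p_gen a b =
      ((1/2) *\<^sub>C A $ a $ b *\<^sub>C munit a b) ** J_mat + ((1/2) *\<^sub>C A $ b $ a *\<^sub>C munit b a) ** J_mat"
      unfolding Aba[of b a] tr p_gen_def
      by (simp add: cmat_diff_mult cmat_scaleC_mult scaleC_scaleC cvs.scale_right_diff_distrib cvs.scale_minus_left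
          matrix_neg_mult)
  qed
  also have "\<dots> = y"
  proof -
    let ?S = "\<Sum>a\<in>UNIV. \<Sum>b\<in>UNIV. ((1/2) *\<^sub>C (A $ a $ b *\<^sub>C munit a b)) ** J_mat"
    have smult: "(\<Sum>i\<in>I. F i) ** J_mat = (\<Sum>i\<in>I. F i ** J_mat)" for F :: "'z \<Rightarrow> ('n + 'n) cmat" and I
      by (induction I rule: infinite_finite_induct) (auto simp: cmat_add_mult)
    have "(1/2) *\<^sub>C y = ((1/2) *\<^sub>C (\<Sum>a\<in>UNIV. \<Sum>b\<in>UNIV. A $ a $ b *\<^sub>C munit a b)) ** J_mat"
      by (simp add: cmat_munit_expand AJ cmat_scaleC_mult)
    then have S: "?S = (1/2) *\<^sub>C y"
      by (simp add: sum_scaleC_right smult)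
    have "(\<Sum>a\<in>UNIV. \<Sum>b\<in>UNIV. ((1/2) *\<^sub>C (A $ b $ a *\<^sub>C munit b a)) ** J_mat) = ?S" by (rule sum.swap)
    then show ?thesis
      by (simp only: sum.distrib S scaleC_add_left[symmetric]) (simp add: scaleC_one)
  qed
  finally show ?thesis .
qed

section \<open>The compact symplectic group\<close>

lemma Sp_groupD:
  assumes "g \<in> (Sp_group :: ('n::finite + 'n) cmat set)"
  shows "conj_transpose g ** g = mat 1" "g ** conj_transpose g = mat 1"
    "matrix_inv g = conj_transpose g"
    "J_mat ** map_matrix cnj g = g ** J_mat" "J_mat ** g = map_matrix cnj g ** J_mat"
    "J_mat ** conj_transpose g = transpose g ** J_mat"
    "g ** J_mat ** transpose g = J_mat"
proof -
  show 1: "conj_transpose g ** g = mat 1" using assms by (simp add: Sp_group_def unitary_group_def)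
  then show 2: "g ** conj_transpose g = mat 1" by (simp add: matrix_left_right_inverse)
  show "matrix_inv g = conj_transpose g"
    unfolding matrix_inv_def
  proof (rule some_equality)
    show "g ** conj_transpose g = mat 1 \<and> conj_transpose g ** g = mat 1" using 1 2 by simp
    fix h assume "g ** h = mat 1 \<and> h ** g = mat 1"
    then have "h ** g ** conj_transpose g = conj_transpose g" by (simp only: matrix_mul_lid)
    then show "h = conj_transpose g" by (simp add: matrix_mul_assoc[symmetric] 2)
  qed
  have "J_mat ** map_matrix cnj g ** matrix_inv J_mat = g"
    using assms by (simp add: Sp_group_def group_involution_def)
  then have "J_mat ** map_matrix cnj g ** (- J_mat) ** J_mat = g ** J_mat" by (simp add: matrix_inv_J_mat)
  then show 3: "J_mat ** map_matrix cnj g = g ** J_mat"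
    by (simp add: matrix_mult_neg matrix_neg_mult JJ_right)
  show 4: "J_mat ** g = map_matrix cnj g ** J_mat"
    using arg_cong[OF 3, of "map_matrix cnj"] by (simp add: map_cnj_mult map_cnj_J)
  show "J_mat ** conj_transpose g = transpose g ** J_mat"
    using arg_cong[OF 4, of transpose]
    by (simp add: matrix_transpose_mul transpose_J matrix_neg_mult matrix_mult_neg conj_transpose_def)
  have "map_matrix cnj g ** transpose g = mat 1"
  proof -
    have "map_matrix cnj (g ** conj_transpose g) = map_matrix cnj (mat 1)" by (simp only: 2)
    moreover have "map_matrix cnj (conj_transpose g) = transpose g"
      by (simp add: vec_eq_iff map_matrix_def transpose_def)
    moreover have "map_matrix cnj (mat 1) = (mat 1 :: ('n + 'n) cmat)"
      by (auto simp: vec_eq_iff map_matrix_def mat_def)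
    ultimately show ?thesis by (simp add: map_cnj_mult)
  qed
  then show "g ** J_mat ** transpose g = J_mat"
    unfolding 3[symmetric] by (simp add: matrix_mul_assoc[symmetric])
qed

lemma Sp_groupI:
  assumes "conj_transpose g ** g = mat 1" "J_mat ** map_matrix cnj g = g ** (J_mat :: ('n::finite + 'n) cmat)"
  shows "g \<in> Sp_group"
  using assms by (simp add: Sp_group_def unitary_group_def group_involution_def matrix_inv_J_mat
      matrix_mult_neg JJ_right)

lemma Sp_group_mult:
  assumes g: "g \<in> Sp_group" and h: "h \<in> (Sp_group :: ('n::finite + 'n) cmat set)"
  shows "g ** h \<in> Sp_group"
proof (rule Sp_groupI)
  have "conj_transpose (g ** h) ** (g ** h) = conj_transpose h ** (conj_transpose g ** g) ** h"
    by (simp only: conj_transpose_mult matrix_mul_assoc)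
  then show "conj_transpose (g ** h) ** (g ** h) = mat 1" by (simp add: Sp_groupD(1)[OF g] Sp_groupD(1)[OF h])
  have "J_mat ** map_matrix cnj (g ** h) = (J_mat ** map_matrix cnj g) ** map_matrix cnj h"
    by (simp only: map_cnj_mult matrix_mul_assoc)
  also have "\<dots> = g ** (J_mat ** map_matrix cnj h)"
    by (simp only: Sp_groupD(4)[OF g] matrix_mul_assoc)
  finally show "J_mat ** map_matrix cnj (g ** h) = (g ** h) ** J_mat"
    by (simp only: Sp_groupD(4)[OF h] matrix_mul_assoc)
qed

lemma Sp_group_cnj: "g \<in> Sp_group \<Longrightarrow> map_matrix cnj g \<in> (Sp_group :: ('n::finite + 'n) cmat set)"
proof (rule Sp_groupI)
  assume g: "g \<in> Sp_group"
  have "map_matrix cnj (conj_transpose g ** g) = map_matrix cnj (mat 1)" using Sp_groupD(1)[OF g] by simp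
  moreover have "map_matrix cnj (conj_transpose g) = conj_transpose (map_matrix cnj g)"
    by (simp add: vec_eq_iff map_matrix_def)
  moreover have "map_matrix cnj (mat 1) = (mat 1 :: ('n + 'n) cmat)"
    by (auto simp: vec_eq_iff map_matrix_def mat_def)
  ultimately show "conj_transpose (map_matrix cnj g) ** map_matrix cnj g = mat 1" by (simp add: map_cnj_mult)
  show "J_mat ** map_matrix cnj (map_matrix cnj g) = map_matrix cnj g ** J_mat"
    using Sp_groupD(5)[OF g] by simp
qed

lemma trace_form_Ad:
  assumes "g \<in> (Sp_group :: ('n::finite + 'n) cmat set)"
  shows "trace_form (Ad g X) (Ad g Y) = trace_form X Y"
proof -
  have "Ad g X ** Ad g Y = g ** X ** (conj_transpose g ** g) ** Y ** conj_transpose g"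
    unfolding Ad_def Sp_groupD(3)[OF assms] by (simp only: matrix_mul_assoc)
  also have "\<dots> = (g ** (X ** Y)) ** conj_transpose g"
    unfolding Sp_groupD(1)[OF assms] by (simp add: matrix_mul_assoc)
  finally have "trace (Ad g X ** Ad g Y) = trace ((g ** (X ** Y)) ** conj_transpose g)"
    by (rule arg_cong)
  also have "\<dots> = trace (conj_transpose g ** (g ** (X ** Y)))" by (rule trace_mul_sym)
  finally have "trace (Ad g X ** Ad g Y) = trace (conj_transpose g ** (g ** (X ** Y)))" .
  then show ?thesis
    by (simp add: trace_form_def matrix_mul_assoc Sp_groupD(1)[OF assms])
qed

lemma mult_munit_transpose:
  fixes A :: "'m::finite cmat"
  shows "A ** munit a b ** transpose A = (\<Sum>c\<in>UNIV. \<Sum>d\<in>UNIV. (A $ c $ a * A $ d $ b) *\<^sub>C munit c d)"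
  using cmat_munit_expand[of "A ** munit a b ** transpose A"]
  by (simp add: mult_munit_mult transpose_def)

lemma mult_munit_transpose_diff:
  fixes A :: "'m::finite cmat"
  shows "A ** (munit a b - munit b a) ** transpose A =
    (\<Sum>c\<in>UNIV. \<Sum>d\<in>UNIV. (A $ c $ a * A $ d $ b) *\<^sub>C (munit c d - munit d c))"
proof -
  have E: "A ** munit b a ** transpose A = (\<Sum>c\<in>UNIV. \<Sum>d\<in>UNIV. (A $ c $ a * A $ d $ b) *\<^sub>C munit d c)"
    unfolding mult_munit_transpose by (subst sum.swap) (simp add: mult.commute)
  show ?thesis
    unfolding cmat_mult_diff cmat_diff_mult E mult_munit_transpose[of A a b]
    by (simp add: sum_subtractf cvs.scale_right_diff_distrib)
qed

lemma cmat_sum_mult: "(\<Sum>i\<in>I. F i) ** B = (\<Sum>i\<in>I. F i ** (B :: 'm::finite cmat))"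
  and cmat_mult_sum: "B ** (\<Sum>i\<in>I. F i) = (\<Sum>i\<in>I. B ** F i)"
  by (induction I rule: infinite_finite_induct) (auto simp: cmat_add_mult matrix_add_ldistrib)

lemma Ad_p_gen:
  assumes "g \<in> (Sp_group :: ('n::finite + 'n) cmat set)"
  shows "Ad g (p_gen a b) = (\<Sum>c\<in>UNIV. \<Sum>d\<in>UNIV. (g $ c $ a * g $ d $ b) *\<^sub>C p_gen c d)"
proof -
  have "Ad g (p_gen a b) = g ** (munit a b - munit b a) ** transpose g ** J_mat"
    unfolding Ad_def p_gen_def Sp_groupD(3)[OF assms]
    by (simp only: matrix_mul_assoc[symmetric] Sp_groupD(6)[OF assms])
  then show ?thesis
    unfolding mult_munit_transpose_diff by (simp add: cmat_sum_mult p_gen_def cmat_scaleC_mult)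
qed

lemma Ad_p_gen_dual:
  assumes "g \<in> (Sp_group :: ('n::finite + 'n) cmat set)"
  shows "Ad g (p_gen_dual a b) = (\<Sum>c\<in>UNIV. \<Sum>d\<in>UNIV. (cnj (g $ c $ a) * cnj (g $ d $ b)) *\<^sub>C p_gen_dual c d)"
proof -
  have ct: "conj_transpose g = transpose (map_matrix cnj g)"
    by (simp add: conj_transpose_def)
  have "Ad g (p_gen_dual a b) = J_mat ** (map_matrix cnj g ** (munit a b - munit b a) ** transpose (map_matrix cnj g))"
    unfolding Ad_def p_gen_dual_def Sp_groupD(3)[OF assms] ct[symmetric]
    by (simp only: matrix_mul_assoc Sp_groupD(4)[OF assms])
  then show ?thesis
    unfolding mult_munit_transpose_diff
    by (simp add: cmat_mult_sum p_gen_dual_def cmat_mult_scaleC map_matrix_def)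
qed

lemma Ad_p_space:
  assumes "g \<in> Sp_group" "y \<in> (p_space :: ('n::finite + 'n) cmat set)"
  shows "Ad g y \<in> p_space"
proof -
  interpret Ad: Vector_Spaces.linear scaleC scaleC "Ad g" by (rule linear_Ad)
  note sub = p_space_subspace
  show ?thesis
    by (subst p_dual_expansion[OF assms(2), symmetric])
       (auto simp: Ad.sum Ad.scale Ad_p_gen[OF assms(1)]
        intro!: cvs.subspace_sum[OF sub] cvs.subspace_scale[OF sub] p_gen_in_p)
qed

section \<open>A Hermitian orthonormal basis of p\<close>

text \<open>On this real form of \<open>p\<close> the trace form is the Euclidean inner product of matrices.\<close>

definition herm_p :: "('n::finite + 'n) cmat set"
  where "herm_p = {X \<in> p_space. conj_transpose X = X}"

lemma herm_p_subspace: "subspace (herm_p :: ('n::finite + 'n) cmat set)"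
  unfolding subspace_def herm_p_def
  by (auto simp: p_space_iff transpose_add transpose_scaleR matrix_add_ldistrib cmat_add_mult
      cmat_scaleR_mult cmat_mult_scaleR conj_transpose_add conj_transpose_scaleR) (simp add: vec_eq_iff)

lemma trace_form_herm:
  assumes "conj_transpose X = X" "conj_transpose Y = Y"
  shows "trace_form X Y = of_real (X \<bullet> (Y :: 'm::finite cmat))"
proof -
  have Y: "Y $ j $ i = cnj (Y $ i $ j)" for i j
    using assms(2) by (metis conj_transpose_nth)
  have X: "X $ j $ i = cnj (X $ i $ j)" for i j
    using assms(1) by (metis conj_transpose_nth)
  have eq: "trace_form X Y = (\<Sum>i\<in>UNIV. \<Sum>j\<in>UNIV. X $ i $ j * cnj (Y $ i $ j))"
    unfolding trace_form_def trace_def matrix_matrix_mult_def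
    by (simp only: vec_lambda_beta) (intro sum.cong refl arg_cong[of _ _ "(*) _"] Y)
  have "cnj (trace_form X Y) = trace_form Y X"
    unfolding trace_form_def trace_def matrix_matrix_mult_def
    by (simp add: X[symmetric] Y[symmetric]) (simp add: mult.commute)
  then have "Im (trace_form X Y) = 0"
    using trace_form_sym[of X Y] by (metis Reals_cnj_iff complex_is_Real_iff)
  moreover have "Re (trace_form X Y) = X \<bullet> Y"
    unfolding eq by (simp add: inner_vec_def inner_complex_def)
  ultimately show ?thesis by (simp add: complex_eq_iff)
qed

lemma herm_p_complexify:
  assumes "y \<in> (p_space :: ('n::finite + 'n) cmat set)"
  obtains h k where "h \<in> herm_p" "k \<in> herm_p" "y = h + \<i> *\<^sub>C k"
proof -
  have ct: "conj_transpose y \<in> p_space"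
  proof -
    have "J_mat ** map_matrix cnj (transpose y) = map_matrix cnj y ** J_mat"
      using arg_cong[OF assms[unfolded p_space_iff], of "map_matrix cnj"] by (simp add: map_cnj_mult map_cnj_J)
    then have "transpose (J_mat ** map_matrix cnj (transpose y)) = transpose (map_matrix cnj y ** J_mat)" by simp
    moreover have "transpose (map_matrix cnj (transpose y)) = map_matrix cnj y"
      by (simp add: vec_eq_iff transpose_def map_matrix_def)
    ultimately have "map_matrix cnj y ** J_mat = J_mat ** conj_transpose y"
      by (simp add: matrix_transpose_mul transpose_J matrix_neg_mult matrix_mult_neg conj_transpose_def)
    moreover have "transpose (conj_transpose y) = map_matrix cnj y"
      by (simp add: vec_eq_iff transpose_def map_matrix_def)
    ultimately have "J_mat ** map_matrix cnj y ** J_mat ** J_mat = J_mat ** (J_mat ** conj_transpose y) ** J_mat"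
      and t: "transpose (conj_transpose y) = map_matrix cnj y"
      by (simp_all add: matrix_mul_assoc[symmetric])
    then show ?thesis
      unfolding p_space_iff t JJ_left JJ_right by (simp add: matrix_neg_mult)
  qed
  note sub = p_space_subspace
  have s: "c *\<^sub>C y + d *\<^sub>C conj_transpose y \<in> p_space" for c d
    by (intro cvs.subspace_add[OF sub] cvs.subspace_scale[OF sub] assms ct)
  show ?thesis
  proof (rule that)
    show "(1/2) *\<^sub>C y + (1/2) *\<^sub>C conj_transpose y \<in> herm_p"
      using s by (simp add: herm_p_def conj_transpose_add conj_transpose_scaleC add.commute)
    have "conj_transpose ((- \<i>/2) *\<^sub>C y + (\<i>/2) *\<^sub>C conj_transpose y) = (- \<i>/2) *\<^sub>C y + (\<i>/2) *\<^sub>C conj_transpose y"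
      by (simp add: vec_eq_iff)
    then show "(- \<i>/2) *\<^sub>C y + (\<i>/2) *\<^sub>C conj_transpose y \<in> herm_p"
      using s[of "- \<i>/2" "\<i>/2"] unfolding herm_p_def by blast
    show "y = (1/2) *\<^sub>C y + (1/2) *\<^sub>C conj_transpose y + \<i> *\<^sub>C ((- \<i>/2) *\<^sub>C y + (\<i>/2) *\<^sub>C conj_transpose y)"
      by (simp add: vec_eq_iff algebra_simps)
  qed
qed

definition herm_basis :: "('n::finite + 'n) cmat list \<Rightarrow> bool"
  where "herm_basis bs \<longleftrightarrow> length bs = CARD('n) * (2 * CARD('n) - 1) \<and> set bs \<subseteq> herm_p \<and>
    (\<forall>i<length bs. \<forall>j<length bs. trace_form (bs ! i) (bs ! j) = (if i = j then 1 else 0)) \<and>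
    (\<forall>y\<in>p_space. (\<Sum>i<length bs. trace_form y (bs ! i) *\<^sub>C bs ! i) = y)"

text \<open>An orthonormal basis of the real form spans \<open>p\<close> over the complex numbers. Its length is the trace of the
orthogonal projection onto \<open>p\<close>, which can also be read off the entries of that projection.\<close>

lemma herm_basis_exists: "\<exists>bs :: ('n::finite + 'n) cmat list. herm_basis bs"
proof -
  obtain B :: "('n + 'n) cmat set" where B: "B \<subseteq> herm_p" "pairwise orthogonal B" "\<And>x. x \<in> B \<Longrightarrow> norm x = 1"
     "independent B" "span B = herm_p"
    using orthonormal_basis_subspace[OF herm_p_subspace] by metis
  have fin: "finite B" using B(4) by (rule independent_imp_finite)
  obtain bs where bs: "set bs = B" "distinct bs" using finite_distinct_list[OF fin] by blast
  have Bh: "conj_transpose b = b" "b \<in> p_space" if "b \<in> B" for b using B(1) that by (auto simp: herm_p_def)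
  have on: "trace_form a b = (if a = b then 1 else 0)" if "a \<in> B" "b \<in> B" for a b
    using trace_form_herm[of a b] Bh that B(2,3)
    by (auto simp: pairwise_def orthogonal_def norm_eq_1)
  have exp_h: "(\<Sum>b\<in>B. trace_form y b *\<^sub>C b) = y" if "y \<in> herm_p" for y
  proof -
    have "y \<in> range (\<lambda>u. \<Sum>b\<in>B. u b *\<^sub>R b)" using that span_finite[OF fin] B(5) by simp
    then obtain u where u: "y = (\<Sum>b\<in>B. u b *\<^sub>R b)" by blast
    have "trace_form y b = of_real (u b)" if "b \<in> B" for b
    proof -
      interpret L: Vector_Spaces.linear scaleC scaleC "\<lambda>X. trace_form X b" by (rule linear_trace_form)
      have "trace_form y b = (\<Sum>a\<in>B. of_real (u a) *\<^sub>C trace_form a b)"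
        unfolding u scaleR_scaleC_cmat by (simp only: L.sum L.scale)
      also have "\<dots> = (\<Sum>a\<in>B. if a = b then of_real (u a) else 0)"
        using on that by (intro sum.cong) (auto simp: scaleC_complex_def)
      finally show ?thesis using that fin by simp
    qed
    then show ?thesis unfolding u scaleR_scaleC_cmat by (intro sum.cong) auto
  qed
  have exp: "(\<Sum>b\<in>B. trace_form y b *\<^sub>C b) = y" if y: "y \<in> p_space" for y
  proof -
    obtain h k where hk: "h \<in> herm_p" "k \<in> herm_p" "y = h + \<i> *\<^sub>C k" by (rule herm_p_complexify[OF y])
    have "trace_form y b = trace_form h b + \<i> * trace_form k b" for b
      unfolding hk(3) using linear_trace_form(1)[of b] by (simp add: Vector_Spaces.linear_iff scaleC_complex_def)
    then have "(\<Sum>b\<in>B. trace_form y b *\<^sub>C b) = (\<Sum>b\<in>B. trace_form h b *\<^sub>C b) + \<i> *\<^sub>C (\<Sum>b\<in>B. trace_form k b *\<^sub>C b)"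
      by (simp add: scaleC_add_left sum.distrib sum_scaleC_right scaleC_scaleC)
    then show ?thesis using exp_h hk by simp
  qed
  \<comment> \<open>The projection \<open>pr\<close> of the matrix units to \<open>p\<close> has the diagonal coefficients \<open>1/2 (1 - J\<^sub>a\<^sub>c\<^sup>2)\<close>.\<close>
  have card: "card B = CARD('n) * (2 * CARD('n) - 1)"
  proof -
    define N where "N = CARD('n + 'n)"
    define pr where "pr a c = (1/2) *\<^sub>C (munit a c - J_mat ** munit c a ** J_mat)" for a c :: "'n + 'n"
    have pr_p: "pr a c \<in> p_space" for a c
      unfolding p_space_iff pr_def
      by (simp add: transpose_scaleC transpose_diff matrix_transpose_mul transpose_munit transpose_J
          cmat_scaleC_mult cmat_mult_scaleC cmat_mult_diff cmat_diff_mult matrix_neg_mult matrix_mult_neg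
          JJ_left JJ_right matrix_mul_assoc)
         (simp add: matrix_mul_assoc[symmetric] JJ_left matrix_mult_neg matrix_neg_mult)
    have tr: "trace_form (pr a c) b = b $ c $ a" if "b \<in> p_space" for a b c
    proof -
      have bt: "J_mat ** b ** J_mat = - transpose b"
      proof -
        have "J_mat ** b ** J_mat = J_mat ** (J_mat ** transpose b)"
          using that by (simp add: p_space_iff matrix_mul_assoc)
        then show ?thesis by (simp only: JJ_left)
      qed
      have "trace_form (pr a c) b = trace_form b (pr a c)" by (rule trace_form_sym)
      also have "\<dots> = (1/2) * (trace (b ** munit a c) - trace (b ** J_mat ** munit c a ** J_mat))"
        by (simp add: trace_form_def pr_def cmat_mult_scaleC cmat_mult_diff matrix_mul_assoc)
           (simp add: trace_def sum_subtractf sum_distrib_left[symmetric] sum_divide_distrib[symmetric])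
      also have "trace (b ** J_mat ** munit c a ** J_mat) = trace (J_mat ** b ** J_mat ** munit c a)"
        by (metis matrix_mul_assoc trace_mul_sym)
      also have "\<dots> = - b $ c $ a"
        unfolding bt by (simp add: trace_munit transpose_def)
      finally show ?thesis by (simp add: trace_munit)
    qed
    have "(\<Sum>a\<in>UNIV. \<Sum>c\<in>UNIV. pr a c $ a $ c) = (\<Sum>a\<in>UNIV. \<Sum>c\<in>UNIV. \<Sum>b\<in>B. b $ c $ a * b $ a $ c)"
    proof (intro sum.cong refl)
      fix a c
      have "pr a c $ a $ c = (\<Sum>b\<in>B. trace_form (pr a c) b *\<^sub>C b) $ a $ c" using exp[OF pr_p] by simp
      also have "\<dots> = (\<Sum>b\<in>B. b $ c $ a * b $ a $ c)"
        unfolding sum_cmat_nth by (intro sum.cong) (auto simp: tr Bh(2))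
      finally show "pr a c $ a $ c = (\<Sum>b\<in>B. b $ c $ a * b $ a $ c)" .
    qed
    also have "\<dots> = (\<Sum>b\<in>B. \<Sum>a\<in>UNIV. \<Sum>c\<in>UNIV. b $ c $ a * b $ a $ c)" by (rule sum_rotate3)
    also have "\<dots> = (\<Sum>b\<in>B. trace_form b b)"
      unfolding trace_form_def trace_def matrix_matrix_mult_def by (simp add: mult.commute)
    also have "\<dots> = of_nat (card B)" using on by simp
    finally have 1: "(\<Sum>a\<in>UNIV. \<Sum>c\<in>UNIV. pr a c $ a $ c) = of_nat (card B)" .
    have "(\<Sum>a\<in>UNIV. \<Sum>c\<in>UNIV. pr a c $ a $ c) =
       (\<Sum>a\<in>(UNIV :: ('n + 'n) set). \<Sum>c\<in>UNIV. 1/2 - (if c = hat a then 1/2 else 0))"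
      by (intro sum.cong refl) (simp add: pr_def mult_munit_mult munit_nth J_nth)
    also have "\<dots> = (\<Sum>a\<in>(UNIV :: ('n + 'n) set). of_nat N / 2 - 1/2)"
      by (simp add: sum_subtractf N_def)
    also have "\<dots> = of_nat N * (of_nat N - 1) / 2" by (simp add: N_def algebra_simps diff_divide_distrib)
    finally have "of_nat (card B) = (of_nat N * (of_nat N - 1) / 2 :: complex)" using 1 by simp
    moreover have N: "N = 2 * CARD('n)" by (simp add: N_def)
    ultimately have "(of_nat (card B) :: complex) = of_nat CARD('n) * (2 * of_nat CARD('n) - 1)"
      by simp
    also have "\<dots> = of_nat (CARD('n) * (2 * CARD('n) - 1))"
      using zero_less_card_finite[where 'a = 'n] by (simp add: of_nat_diff)
    finally show ?thesis using of_nat_eq_iff by blast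
  qed
  have "bij_betw (\<lambda>i. bs ! i) {..<length bs} B" using bij_betw_nth[OF bs(2) refl bs(1)[symmetric]] .
  then have "(\<Sum>i<length bs. trace_form y (bs ! i) *\<^sub>C bs ! i) = (\<Sum>b\<in>B. trace_form y b *\<^sub>C b)" for y
    using sum.reindex_bij_betw[of "\<lambda>i. bs ! i" "{..<length bs}" B "\<lambda>b. trace_form y b *\<^sub>C b"] by simp
  moreover have "length bs = card B" using bs distinct_card by metis
  ultimately have "herm_basis bs"
    unfolding herm_basis_def using card exp B(1) bs on by (auto simp: nth_eq_iff_index_eq)
  then show ?thesis ..
qed

section \<open>One-parameter subgroups\<close>

definition outer :: "complex^'m \<Rightarrow> complex^'m \<Rightarrow> 'm::finite cmat"
  where "outer u v = (\<chi> i j. u $ i * cnj (v $ j))"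

definition herm_prod :: "complex^'m \<Rightarrow> complex^'m::finite \<Rightarrow> complex"
  where "herm_prod u v = (\<Sum>i\<in>UNIV. u $ i * cnj (v $ i))"

text \<open>The quaternionic structure \<open>v \<mapsto> J (cnj v)\<close>, an antilinear map with square \<open>-1\<close>.\<close>

definition jvec :: "complex^('n + 'n) \<Rightarrow> complex^('n + 'n::finite)"
  where "jvec v = (\<chi> i. eps i * cnj (v $ hat i))"

lemma outer_nth [simp]: "outer u v $ i $ j = u $ i * cnj (v $ j)" by (simp add: outer_def)
lemma jvec_nth [simp]: "jvec v $ i = eps i * cnj (v $ hat i)" by (simp add: jvec_def)

lemma sum_hat: "(\<Sum>i\<in>UNIV. F (hat i)) = (\<Sum>i\<in>UNIV. F (i :: 'n::finite + 'n))"
  by (rule sum.reindex_bij_witness[of _ hat hat]) auto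

lemma herm_prod_jvec_jvec: "herm_prod (jvec u) (jvec v) = herm_prod v u"
proof -
  have "herm_prod (jvec u) (jvec v) = (\<Sum>i\<in>UNIV. v $ hat i * cnj (u $ hat i))"
    unfolding herm_prod_def by (intro sum.cong refl) (simp add: mult_ac)
  then show ?thesis unfolding herm_prod_def by (simp add: sum_hat[of "\<lambda>i. v $ i * cnj (u $ i)"])
qed

lemma herm_prod_cnj: "cnj (herm_prod u v) = herm_prod v u"
  by (simp add: herm_prod_def mult.commute)

lemma herm_prod_jvec_self: "herm_prod v (jvec v) = 0" "herm_prod (jvec v) v = 0"
proof -
  have "herm_prod v (jvec v) = (\<Sum>i\<in>UNIV. v $ hat i * (eps (hat i) * v $ i))"
    unfolding herm_prod_def using sum_hat[of "\<lambda>i. v $ i * cnj (jvec v $ i)"] by simp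
  also have "\<dots> = - herm_prod v (jvec v)"
    unfolding herm_prod_def sum_negf[symmetric] by (intro sum.cong refl) simp
  finally show 1: "herm_prod v (jvec v) = 0" by simp
  show "herm_prod (jvec v) v = 0" using arg_cong[OF 1, of cnj] by (simp add: herm_prod_cnj)
qed

lemma outer_mult: "outer u v ** outer w z = herm_prod w v *\<^sub>C outer u z"
  by (simp add: vec_eq_iff matrix_matrix_mult_def herm_prod_def sum_distrib_left sum_distrib_right mult_ac)

lemma conj_transpose_outer: "conj_transpose (outer u v) = outer v u"
  by (simp add: vec_eq_iff mult.commute)

lemma J_mult_nth: "(J_mat ** A) $ i $ j = eps i * A $ hat i $ j"
  by (simp add: matrix_matrix_mult_def J_nth if_distrib[of "\<lambda>z. z * _"] cong: if_cong)

lemma mult_J_nth: "(A ** J_mat) $ i $ j = - eps j * A $ i $ hat j"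
  by (simp add: matrix_matrix_mult_def J_nth hat_eq_iff if_distrib[of "\<lambda>z. _ * z"] eq_commute[of j]
      cong: if_cong)

lemma J_outer: "J_mat ** map_matrix cnj (outer u v) = outer (jvec u) (jvec v) ** J_mat"
  by (simp add: vec_eq_iff J_mult_nth mult_J_nth map_matrix_def mult_ac)

lemma outer_jvec_jvec: "outer (jvec (jvec u)) (jvec (jvec v)) = outer u v"
  by (simp add: vec_eq_iff)

text \<open>For a unit vector \<open>v\<close> this is multiplication by \<open>z\<close> on \<open>v\<close> and by \<open>cnj z\<close> on \<open>jvec v\<close>, and the
identity on the orthogonal complement of both.\<close>

definition rot :: "complex \<Rightarrow> complex^('n + 'n) \<Rightarrow> ('n::finite + 'n) cmat"
  where "rot z v = mat 1 + (z - 1) *\<^sub>C outer v v + (cnj z - 1) *\<^sub>C outer (jvec v) (jvec v)"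

lemma rot_mult:
  assumes "herm_prod v v = 1"
  shows "rot z v ** rot w v = rot (z * w) v"
proof -
  have j: "herm_prod (jvec v) (jvec v) = 1" using assms by (simp add: herm_prod_jvec_jvec)
  have "rot z v ** rot w v = mat 1 + (w - 1) *\<^sub>C outer v v + (cnj w - 1) *\<^sub>C outer (jvec v) (jvec v)
      + ((z - 1) *\<^sub>C outer v v + ((z - 1) * (w - 1)) *\<^sub>C outer v v)
      + ((cnj z - 1) *\<^sub>C outer (jvec v) (jvec v) + ((cnj z - 1) * (cnj w - 1)) *\<^sub>C outer (jvec v) (jvec v))"
    unfolding rot_def
    by (simp add: cmat_add_mult matrix_add_ldistrib cmat_scaleC_mult cmat_mult_scaleC outer_mult assms j
        herm_prod_jvec_self scaleC_one scaleC_scaleC cvs.scale_zero_left)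
       (simp add: scaleC_add_right scaleC_scaleC mult_ac add_ac)
  also have "\<dots> = rot (z * w) v"
    by (simp add: vec_eq_iff rot_def algebra_simps)
  finally show ?thesis .
qed

lemma rot_in_Sp:
  assumes "herm_prod v v = 1" "z * cnj z = 1"
  shows "rot z v \<in> Sp_group"
proof (rule Sp_groupI)
  have "conj_transpose (rot z v) = rot (cnj z) v"
    by (simp add: rot_def conj_transpose_add conj_transpose_scaleC conj_transpose_outer)
       (auto simp: vec_eq_iff mat_def)
  then show "conj_transpose (rot z v) ** rot z v = mat 1"
    using assms by (simp add: rot_mult mult.commute) (simp add: rot_def cvs.scale_zero_left)
  have c: "map_matrix cnj (rot z v) = mat 1 + (cnj z - 1) *\<^sub>C map_matrix cnj (outer v v)
     + (z - 1) *\<^sub>C map_matrix cnj (outer (jvec v) (jvec v))"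
    by (auto simp: vec_eq_iff map_matrix_def rot_def mat_def)
  show "J_mat ** map_matrix cnj (rot z v) = rot z v ** J_mat"
    unfolding c unfolding rot_def
    by (simp add: cmat_add_mult matrix_add_ldistrib cmat_scaleC_mult cmat_mult_scaleC J_outer outer_jvec_jvec
        add.commute add.left_commute)
qed

text \<open>The squares contain the one-parameter subgroups \<open>rot\<close>, which generate enough of the Lie algebra for the first
fundamental theorem. On the other hand a character with values \<open>1\<close> and \<open>-1\<close> is trivial on squares, so
they fix the top exterior power of \<open>p\<close>.\<close>

definition Sp_squares :: "('n::finite + 'n) cmat set"
  where "Sp_squares = {h ** h | h. h \<in> Sp_group}"

lemma rot_in_squares:
  assumes "herm_prod v v = 1"
  shows "rot (cis \<theta>) v \<in> Sp_squares"
proof -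
  have "rot (cis \<theta>) v = rot (cis (\<theta>/2)) v ** rot (cis (\<theta>/2)) v"
    using assms by (simp add: rot_mult cis_mult)
  moreover have "rot (cis (\<theta>/2)) v \<in> Sp_group"
    using assms by (intro rot_in_Sp) (simp_all add: cis_cnj cis_mult)
  ultimately show ?thesis unfolding Sp_squares_def by blast
qed

lemma Sp_squares_subset: "Sp_squares \<subseteq> Sp_group"
  by (auto simp: Sp_squares_def Sp_group_mult)

lemma Sp_squares_cnj: "g \<in> Sp_squares \<Longrightarrow> map_matrix cnj g \<in> Sp_squares"
  unfolding Sp_squares_def by (auto simp: map_cnj_mult intro: Sp_group_cnj)

definition lie_act :: "'p set \<Rightarrow> 'i::finite cmat \<Rightarrow> (('p \<Rightarrow> 'i) \<Rightarrow> complex) \<Rightarrow> ('p \<Rightarrow> 'i) \<Rightarrow> complex"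
  where "lie_act D M f x = (\<Sum>t\<in>D. \<Sum>j\<in>UNIV. M $ j $ x t * f (x(t := j)))"

lemma lie_act_add: "lie_act D (M + M') f x = lie_act D M f x + lie_act D M' f x"
  by (simp add: lie_act_def distrib_right sum.distrib)
lemma lie_act_scale: "lie_act D (c *\<^sub>C M) f x = c * lie_act D M f x"
  by (simp add: lie_act_def sum_distrib_left mult_ac)

lemma lie_act_munit: "lie_act D (munit a b) f x = elem_act D b a f x"
  unfolding lie_act_def elem_act_def
  by (intro sum.cong refl) (simp add: munit_nth if_distrib[of "\<lambda>z. z * _"] cong: if_cong)

text \<open>Differentiate the invariance under \<open>rot (cis \<theta>) v\<close> at \<open>\<theta> = 0\<close>.\<close>

lemma lie_act_deriv_zero:
  fixes f :: "('p \<Rightarrow> 'n::finite + 'n) \<Rightarrow> complex"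
  assumes D: "finite D" and dep: "depends_on D f"
    and inv: "\<And>g x. g \<in> Sp_squares \<Longrightarrow> (\<Sum>y\<in>PiE D (\<lambda>_. UNIV). (\<Prod>t\<in>D. g $ y t $ x t) * f y) = f x"
    and v: "herm_prod v v = 1"
  shows "lie_act D (outer v v + (- 1) *\<^sub>C outer (jvec v) (jvec v)) f x = 0"
proof -
  define Z where "Z = \<i> *\<^sub>C (outer v v + (- 1) *\<^sub>C outer (jvec v) (jvec v))"
  have entry: "((\<lambda>\<theta>. rot (cis \<theta>) v $ i $ j) has_derivative (\<lambda>h. of_real h * Z $ i $ j)) (at 0)" for i j
  proof -
    have "rot (cis \<theta>) v $ i $ j = mat 1 $ i $ j + (exp (\<i> * of_real \<theta>) - 1) * outer v v $ i $ j
        + (exp (- (\<i> * of_real \<theta>)) - 1) * outer (jvec v) (jvec v) $ i $ j" for \<theta>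
      by (simp add: rot_def cis_conv_exp exp_cnj)
    note eq = this
    have "((\<lambda>\<theta>. rot (cis \<theta>) v $ i $ j) has_vector_derivative Z $ i $ j) (at 0)"
      unfolding Z_def eq
      by (auto intro!: derivative_eq_intros has_vector_derivative_real_field simp: exp_cnj[symmetric] algebra_simps)
    then show ?thesis
      by (simp add: has_vector_derivative_def scaleR_conv_of_real)
  qed
  have rot0: "rot (cis 0) v = mat 1" by (simp add: rot_def cvs.scale_zero_left)
  let ?F = "\<lambda>\<theta>. \<Sum>y\<in>PiE D (\<lambda>_. UNIV). (\<Prod>t\<in>D. rot (cis \<theta>) v $ y t $ x t) * f y"
  let ?F' = "\<lambda>h. \<Sum>y\<in>PiE D (\<lambda>_. UNIV). (\<Sum>t\<in>D. of_real h * Z $ y t $ x t *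
       (\<Prod>s\<in>D - {t}. rot (cis 0) v $ y s $ x s)) * f y"
  have "(?F has_derivative ?F') (at 0)"
    by (intro has_derivative_sum has_derivative_mult_left has_derivative_prod entry)
  moreover have "?F = (\<lambda>\<theta>. f x)" using inv[OF rot_in_squares[OF v]] by (intro ext) simp
  ultimately have "((\<lambda>\<theta>::real. f x) has_derivative ?F') (at 0)" by simp
  then have "?F' = (\<lambda>h. 0)" using has_derivative_unique[OF _ has_derivative_const] by blast
  then have F1: "?F' 1 = 0" by metis
  have "?F' 1 = (\<Sum>t\<in>D. \<Sum>y\<in>PiE D (\<lambda>_. UNIV). Z $ y t $ x t * (\<Prod>s\<in>D - {t}. rot (cis 0) v $ y s $ x s) * f y)"
    by (subst sum.swap) (simp add: sum_distrib_right)
  also have "\<dots> = (\<Sum>t\<in>D. \<Sum>j\<in>UNIV. Z $ j $ x t * f (x(t := j)))"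
  proof (rule sum.cong[OF refl])
    fix t assume t: "t \<in> D"
    let ?E = "D - {t}"
    have fin: "finite (PiE ?E (\<lambda>_. UNIV :: ('n + 'n) set))" using D by (intro finite_PiE) auto
    have "(\<Sum>y\<in>PiE D (\<lambda>_. UNIV). Z $ y t $ x t * (\<Prod>s\<in>?E. rot (cis 0) v $ y s $ x s) * f y) =
      (\<Sum>y\<in>PiE (insert t ?E) (\<lambda>_. UNIV). Z $ y t $ x t * (\<Prod>s\<in>?E. rot (cis 0) v $ y s $ x s) * f y)"
      using t by (simp add: insert_absorb)
    also have "\<dots> = (\<Sum>y\<in>PiE ?E (\<lambda>_. UNIV). \<Sum>j\<in>UNIV.
        Z $ j $ x t * (\<Prod>s\<in>?E. rot (cis 0) v $ y s $ x s) * f (y(t := j)))"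
      using D by (subst sum_PiE_insert) (auto intro!: sum.cong prod.cong arg_cong2[of _ _ _ _ "(*)"])
    also have "\<dots> = (\<Sum>y\<in>{restrict x ?E}. \<Sum>j\<in>UNIV.
        Z $ j $ x t * (\<Prod>s\<in>?E. rot (cis 0) v $ y s $ x s) * f (y(t := j)))"
    proof (rule sum.mono_neutral_right[OF fin])
      show "{restrict x ?E} \<subseteq> PiE ?E (\<lambda>_. UNIV)" by auto
      show "\<forall>y\<in>PiE ?E (\<lambda>_. UNIV) - {restrict x ?E}. (\<Sum>j\<in>UNIV.
        Z $ j $ x t * (\<Prod>s\<in>?E. rot (cis 0) v $ y s $ x s) * f (y(t := j))) = 0"
      proof
        fix y assume y: "y \<in> PiE ?E (\<lambda>_. UNIV) - {restrict x ?E}"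
        then obtain s where "s \<in> ?E" "y s \<noteq> x s"
          by (auto simp: PiE_iff extensional_def fun_eq_iff restrict_def split: if_splits)
        then have "(\<Prod>s\<in>?E. rot (cis 0) v $ y s $ x s) = 0"
          unfolding rot0 using D by (intro prod_zero) (auto simp: mat_def)
        then show "(\<Sum>j\<in>UNIV. Z $ j $ x t * (\<Prod>s\<in>?E. rot (cis 0) v $ y s $ x s) * f (y(t := j))) = 0" by simp
      qed
    qed
    also have "\<dots> = (\<Sum>j\<in>UNIV. Z $ j $ x t * f (x(t := j)))"
    proof -
      have "f ((restrict x ?E)(t := j)) = f (x(t := j))" for j
        by (rule depends_onD[OF dep]) (auto simp: restrict_def)
      moreover have "(\<Prod>s\<in>?E. rot (cis 0) v $ restrict x ?E s $ x s) = 1"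
        unfolding rot0 by (intro prod.neutral) (auto simp: mat_def)
      ultimately show ?thesis by (simp del: fun_upd_apply)
    qed
    finally show "(\<Sum>y\<in>PiE D (\<lambda>_. UNIV). Z $ y t $ x t * (\<Prod>s\<in>?E. rot (cis 0) v $ y s $ x s) * f y) =
      (\<Sum>j\<in>UNIV. Z $ j $ x t * f (x(t := j)))" .
  qed
  finally have "lie_act D Z f x = 0" using F1 by (simp add: lie_act_def)
  then show ?thesis unfolding Z_def lie_act_scale by simp
qed

text \<open>The derivatives are quadratic in \<open>v\<close>. Polarizing with the four fourth roots of unity recovers the
sesquilinear form behind them, whose values on the standard basis are the spanning elements of \<open>sp(2n)\<close>.\<close>

theorem invariant_under_squares_imp_sp_invariant:
  fixes f :: "('p \<Rightarrow> 'n::finite + 'n) \<Rightarrow> complex"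
  assumes D: "finite D" and dep: "depends_on D f"
    and inv: "\<And>g x. g \<in> Sp_squares \<Longrightarrow> (\<Sum>y\<in>PiE D (\<lambda>_. UNIV). (\<Prod>t\<in>D. g $ y t $ x t) * f y) = f x"
  shows "sp_invariant D f"
proof -
  define Q where "Q v = outer v v + (- 1) *\<^sub>C outer (jvec v) (jvec v)" for v :: "complex^('n + 'n)"
  have Q: "lie_act D (Q v) f x = 0" for v x
  proof (cases "v = 0")
    case True
    then have "Q v = 0 *\<^sub>C 0" by (simp add: Q_def vec_eq_iff)
    then show ?thesis by (simp only: lie_act_scale) simp
  next
    case False
    define r where "r = norm v"
    have r: "r > 0" using False by (simp add: r_def)
    have r2: "r\<^sup>2 = (\<Sum>i\<in>UNIV. (cmod (v $ i))\<^sup>2)"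
      by (simp add: r_def norm_vec_def L2_set_def sum_nonneg)
    have "herm_prod v v = of_real (r\<^sup>2)"
      unfolding r2 herm_prod_def by (simp only: of_real_sum complex_norm_square)
    define u where "u = (1 / complex_of_real r) *\<^sub>C v"
    have cuu: "herm_prod u u = 1"
    proof -
      have "herm_prod u u = (1 / complex_of_real r)^2 * herm_prod v v"
        by (simp add: herm_prod_def u_def sum_distrib_left power2_eq_square mult_ac sum_divide_distrib)
      then show ?thesis using \<open>herm_prod v v = _\<close> r by (simp add: power2_eq_square)
    qed
    have "Q v = (of_real (r\<^sup>2)) *\<^sub>C Q u"
      using r by (simp add: vec_eq_iff Q_def u_def power2_eq_square field_simps)
    then show ?thesis
      using lie_act_deriv_zero[OF D dep inv cuu] by (simp add: lie_act_scale Q_def)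
  qed
  define a where "a p = (axis p 1 :: complex^('n + 'n))" for p
  have pol: "4 *\<^sub>C (munit p r + (- (eps p * eps r)) *\<^sub>C munit (hat r) (hat p)) =
     Q (a p + a r) + \<i> *\<^sub>C Q (a p + \<i> *\<^sub>C a r) + (- 1) *\<^sub>C Q (a p + (- 1) *\<^sub>C a r) + (- \<i>) *\<^sub>C Q (a p + (- \<i>) *\<^sub>C a r)"
    for p r
  proof -
    have "Q (u + w) + \<i> *\<^sub>C Q (u + \<i> *\<^sub>C w) + (- 1) *\<^sub>C Q (u + (- 1) *\<^sub>C w) + (- \<i>) *\<^sub>C Q (u + (- \<i>) *\<^sub>C w)
      = 4 *\<^sub>C (outer u w + (- 1) *\<^sub>C outer (jvec w) (jvec u))" for u w
      by (simp add: vec_eq_iff Q_def algebra_simps)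
    moreover have "outer (a p) (a r) = munit p r"
      by (auto simp: vec_eq_iff a_def munit_nth axis_def)
    moreover have "outer (jvec (a r)) (jvec (a p)) = (eps p * eps r) *\<^sub>C munit (hat r) (hat p)"
      by (auto simp: vec_eq_iff a_def munit_nth axis_def hat_eq_iff mult.commute)
    ultimately show ?thesis by (simp add: scaleC_scaleC)
  qed
  have "elem_act D r p f x = eps p * eps r * elem_act D (hat p) (hat r) f x" for p r x
  proof -
    have "lie_act D (4 *\<^sub>C (munit p r + (- (eps p * eps r)) *\<^sub>C munit (hat r) (hat p))) f x = 0"
      unfolding pol by (simp only: lie_act_add lie_act_scale Q) simp
    then show ?thesis by (simp only: lie_act_add lie_act_scale lie_act_munit) simp
  qed
  then show ?thesis unfolding sp_invariant_def by (metis mult.commute)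
qed

section \<open>The generic element and its power traces\<close>

type_synonym 'm extmat = "(('m cmat ext)^'m^'m)"

text \<open>Set \<open>X = gen_mat J\<close>, the generic element of \<open>p\<close> with entries of degree one. Below, \<open>gen_power k\<close> is
\<open>X\<^sup>k gen_mat\<close>, so that \<open>X\<close> to the power \<open>k + 1\<close> is \<open>gen_power k J\<close>. Leaving out the last factor \<open>J\<close>
makes both matrix indices vectors of the same kind and the transposition rule symmetric.\<close>

definition gen_mat :: "('n::finite + 'n) extmat"
  where "gen_mat = (\<chi> a b. ext_inc (p_gen a b))"

definition scalar_mat :: "'m::finite cmat \<Rightarrow> 'm extmat"
  where "scalar_mat A = (\<chi> i j. (A $ i $ j) *\<^sub>C 1)"

lemma scalar_mat_nth [simp]: "scalar_mat A $ i $ j = (A $ i $ j) *\<^sub>C 1" by (simp add: scalar_mat_def)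

lemma mult_scalar_mat_nth: "(M ** scalar_mat A) $ i $ j = (\<Sum>k\<in>UNIV. A $ k $ j *\<^sub>C M $ i $ k)"
  by (simp add: matrix_matrix_mult_def mult_scaleC_right)

lemma scalar_mat_mult_nth: "(scalar_mat A ** M) $ i $ j = (\<Sum>k\<in>UNIV. A $ i $ k *\<^sub>C M $ k $ j)"
  by (simp add: matrix_matrix_mult_def mult_scaleC_left)

lemma scalar_mat_mult: "scalar_mat A ** scalar_mat B = scalar_mat (A ** B)"
  unfolding vec_eq_iff mult_scalar_mat_nth
  by (simp add: matrix_matrix_mult_def sum_scaleC_left scaleC_scaleC mult.commute)

abbreviation J_ext :: "('n::finite + 'n) extmat" where "J_ext \<equiv> scalar_mat J_mat"

primrec gen_power :: "nat \<Rightarrow> ('n::finite + 'n) extmat" where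
  "gen_power 0 = gen_mat"
| "gen_power (Suc k) = gen_power k ** J_ext ** gen_mat"

lemma gen_power_mult: "gen_power j ** J_ext ** gen_power k = gen_power (Suc (j + k))"
  by (induction k) (simp_all add: matrix_mul_assoc)

lemma triple_nth: "(A ** J_ext ** B) $ a $ b =
    (\<Sum>c\<in>UNIV. \<Sum>d\<in>UNIV. J_mat $ c $ d *\<^sub>C (A $ a $ c * B $ d $ b))"
proof -
  have "(A ** J_ext ** B) $ a $ b = (\<Sum>d\<in>UNIV. (A ** J_ext) $ a $ d * B $ d $ b)"
    by (simp add: matrix_matrix_mult_def)
  also have "\<dots> = (\<Sum>d\<in>UNIV. \<Sum>c\<in>UNIV. J_mat $ c $ d *\<^sub>C (A $ a $ c * B $ d $ b))"
    by (simp add: mult_scalar_mat_nth sum_distrib_right mult_scaleC_left)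
  finally show ?thesis by (subst sum.swap)
qed

lemma gen_mat_degree: "gen_mat $ a $ b \<in> ext_power p_space 1"
  using wedge_in_ext_power[of "[p_gen a b]" p_space 1] p_gen_in_p(1)[of a b] by (simp add: gen_mat_def)

lemma gen_power_degree: "gen_power k $ a $ b \<in> ext_power p_space (Suc k)"
proof (induction k arbitrary: a b)
  case 0
  show ?case using gen_mat_degree by simp
next
  case (Suc k)
  show ?case unfolding gen_power.simps triple_nth
    using ext_power_mult[OF Suc gen_mat_degree]
    by (intro cvs.subspace_sum cvs.subspace_scale ext_power_subspace) simp
qed

lemma gen_power_commute:
  "gen_power j $ a $ b * gen_power k $ c $ d = (- 1) ^ (Suc j * Suc k) * (gen_power k $ c $ d * gen_power j $ a $ b)"
  by (rule ext_power_commute[OF gen_power_degree gen_power_degree])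

lemma J_antisym: "J_mat $ c $ d = - J_mat $ d $ c" by (auto simp: J_nth hat_eq_iff)

text \<open>The sign of reversing \<open>k + 1\<close> anticommuting factors, multiplied by the signs from the skew-symmetry of
\<open>k + 1\<close> factors \<open>gen_mat\<close> and \<open>k\<close> factors \<open>J\<close>.\<close>

primrec transpose_sign :: "nat \<Rightarrow> complex" where
  "transpose_sign 0 = - 1"
| "transpose_sign (Suc k) = (- 1) ^ Suc k * transpose_sign k"

lemma gen_mat_antisym: "gen_mat $ b $ a = - gen_mat $ a $ b"
proof -
  interpret Vector_Spaces.linear scaleC scaleC ext_inc by (rule linear_ext_inc)
  have "p_gen b a = - p_gen a b" by (simp add: p_gen_def cmat_diff_mult)
  then show ?thesis by (simp add: gen_mat_def neg)
qed

lemma minus_one_power_scaleC: "(- 1) ^ k * (x :: 'v::complex_vector ext) = ((- 1) ^ k) *\<^sub>C x"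
  by (cases "even k") (simp_all add: scaleC_one cvs.scale_minus_left)

lemma gen_power_transpose: "gen_power k $ b $ a = transpose_sign k *\<^sub>C gen_power k $ a $ b"
proof (induction k arbitrary: a b)
  case 0
  then show ?case by (simp add: gen_mat_antisym[of b a] cvs.scale_minus_left scaleC_one)
next
  case (Suc k)
  have eq: "gen_power (Suc k) = gen_power 0 ** J_ext ** gen_power k"
    unfolding gen_power_mult by simp
  have "gen_power (Suc k) $ b $ a = (\<Sum>c\<in>UNIV. \<Sum>d\<in>UNIV. J_mat $ c $ d *\<^sub>C (gen_power k $ b $ c * gen_mat $ d $ a))"
    by (simp add: triple_nth)
  also have "\<dots> = (\<Sum>c\<in>UNIV. \<Sum>d\<in>UNIV. transpose_sign (Suc k) *\<^sub>C J_mat $ d $ c *\<^sub>C (gen_mat $ a $ d * gen_power k $ c $ b))"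
  proof (intro sum.cong refl)
    fix c d
    have "gen_power k $ b $ c * gen_mat $ d $ a = - transpose_sign k *\<^sub>C (gen_power k $ c $ b * gen_mat $ a $ d)"
      by (simp add: Suc[of b c] gen_mat_antisym[of d a] mult_scaleC_left cvs.scale_minus_left)
    also have "gen_power k $ c $ b * gen_mat $ a $ d = ((- 1) ^ Suc k) *\<^sub>C (gen_mat $ a $ d * gen_power k $ c $ b)"
      using gen_power_commute[of k c b 0 a d] by (simp add: minus_one_power_scaleC cvs.scale_minus_left)
    finally show "J_mat $ c $ d *\<^sub>C (gen_power k $ b $ c * gen_mat $ d $ a) = transpose_sign (Suc k) *\<^sub>C J_mat $ d $ c *\<^sub>C (gen_mat $ a $ d * gen_power k $ c $ b)"
      by (simp add: J_antisym[of c d] scaleC_scaleC mult_ac)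
  qed
  also have "\<dots> = transpose_sign (Suc k) *\<^sub>C gen_power (Suc k) $ a $ b"
    unfolding eq triple_nth sum_scaleC_right[symmetric] by (subst sum.swap) simp
  finally show ?case .
qed

text \<open>Up to sign the trace of \<open>X\<close> to the power \<open>k + 1\<close>, an element of degree \<open>k + 1\<close>.\<close>

definition power_trace :: "nat \<Rightarrow> ('n::finite + 'n) cmat ext"
  where "power_trace k = (\<Sum>a\<in>UNIV. \<Sum>b\<in>UNIV. J_mat $ a $ b *\<^sub>C gen_power k $ a $ b)"

lemma power_trace_degree: "power_trace k \<in> ext_power p_space (Suc k)"
  unfolding power_trace_def by (intro cvs.subspace_sum cvs.subspace_scale ext_power_subspace gen_power_degree)

lemma power_trace_swapped: "(\<Sum>a\<in>UNIV. \<Sum>b\<in>UNIV. J_mat $ a $ b *\<^sub>C gen_power k $ b $ a) = - power_trace k"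
  unfolding power_trace_def sum_negf[symmetric]
  by (subst sum.swap) (intro sum.cong refl, subst J_antisym, simp add: cvs.scale_minus_left)

lemma power_trace_transpose_sign: "power_trace k = (- transpose_sign k) *\<^sub>C power_trace k"
proof -
  have "- power_trace k = (\<Sum>a\<in>UNIV. \<Sum>b\<in>UNIV. J_mat $ a $ b *\<^sub>C transpose_sign k *\<^sub>C gen_power k $ a $ b)"
    unfolding power_trace_swapped[symmetric] by (intro sum.cong refl) (subst gen_power_transpose, simp)
  also have "\<dots> = transpose_sign k *\<^sub>C power_trace k"
    unfolding power_trace_def sum_scaleC_right scaleC_scaleC by (simp add: mult.commute)
  finally show ?thesis by (metis cvs.scale_minus_left minus_minus)
qed

lemma sum_rotate4:
  "(\<Sum>a\<in>A. \<Sum>b\<in>B. \<Sum>c\<in>C. \<Sum>d\<in>E. F a b c d) = (\<Sum>c\<in>C. \<Sum>d\<in>E. \<Sum>b\<in>B. \<Sum>a\<in>A. F a b c d)"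
proof -
  have "(\<Sum>a\<in>A. \<Sum>b\<in>B. \<Sum>c\<in>C. \<Sum>d\<in>E. F a b c d) = (\<Sum>c\<in>C. \<Sum>a\<in>A. \<Sum>b\<in>B. \<Sum>d\<in>E. F a b c d)"
    by (rule sum_rotate3)
  also have "\<dots> = (\<Sum>c\<in>C. \<Sum>d\<in>E. \<Sum>a\<in>A. \<Sum>b\<in>B. F a b c d)"
    by (rule sum.cong[OF refl], rule sum_rotate3)
  also have "\<dots> = (\<Sum>c\<in>C. \<Sum>d\<in>E. \<Sum>b\<in>B. \<Sum>a\<in>A. F a b c d)"
    by (rule sum.cong[OF refl], rule sum.cong[OF refl], rule sum.swap)
  finally show ?thesis .
qed

text \<open>Moving the first factor \<open>X\<close> of a power with an even number of factors to the end passes an odd element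
across an odd element. The trace is cyclic up to this sign, so it equals its own negative.\<close>

lemma power_trace_odd: "odd k \<Longrightarrow> power_trace k = 0"
proof -
  assume "odd k"
  then obtain m where m: "k = Suc m" "even m" by (metis even_Suc oddE Suc_eq_plus1 even_mult_iff dvd_triv_left)
  have "power_trace k = (\<Sum>a\<in>UNIV. \<Sum>b\<in>UNIV. \<Sum>c\<in>UNIV. \<Sum>d\<in>UNIV. J_mat $ a $ b *\<^sub>C J_mat $ c $ d *\<^sub>C (gen_power 0 $ a $ c * gen_power m $ d $ b))"
  proof -
    have eq: "gen_power (Suc m) = gen_power 0 ** J_ext ** gen_power m" by (simp only: gen_power_mult add_0)
    show ?thesis unfolding power_trace_def m eq triple_nth sum_scaleC_right ..
  qed
  also have "\<dots> = (\<Sum>a\<in>UNIV. \<Sum>b\<in>UNIV. \<Sum>c\<in>UNIV. \<Sum>d\<in>UNIV. J_mat $ c $ d *\<^sub>C J_mat $ b $ a *\<^sub>C (gen_power m $ d $ b * gen_power 0 $ a $ c))"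
  proof (intro sum.cong refl)
    fix a b c d
    have "gen_power 0 $ a $ c * gen_power m $ d $ b = - (gen_power m $ d $ b * gen_power 0 $ a $ c)"
      using gen_power_commute[of 0 a c m d b] m by simp
    then show "J_mat $ a $ b *\<^sub>C J_mat $ c $ d *\<^sub>C (gen_power 0 $ a $ c * gen_power m $ d $ b) =
      J_mat $ c $ d *\<^sub>C J_mat $ b $ a *\<^sub>C (gen_power m $ d $ b * gen_power 0 $ a $ c)"
      by (simp add: J_antisym[of a b] scaleC_scaleC mult.commute cvs.scale_minus_left)
  qed
  also have "\<dots> = (\<Sum>c\<in>UNIV. \<Sum>d\<in>UNIV. \<Sum>b\<in>UNIV. \<Sum>a\<in>UNIV. J_mat $ c $ d *\<^sub>C J_mat $ b $ a *\<^sub>C (gen_power m $ d $ b * gen_power 0 $ a $ c))"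
    by (rule sum_rotate4)
  also have "\<dots> = (\<Sum>c\<in>UNIV. \<Sum>d\<in>UNIV. J_mat $ c $ d *\<^sub>C gen_power k $ d $ c)"
    unfolding m gen_power.simps triple_nth sum_scaleC_right ..
  also have "\<dots> = - power_trace k" by (rule power_trace_swapped)
  finally show ?thesis by (rule double_eq_0_ext)
qed

lemma transpose_sign_period: "transpose_sign (Suc (Suc (Suc (Suc k)))) = transpose_sign k"
  by simp

text \<open>Cyclicity excludes odd \<open>k\<close>, and transposition excludes those where \<open>transpose_sign k\<close> is \<open>1\<close>.\<close>

lemma power_trace_zero: "k mod 4 \<noteq> 0 \<Longrightarrow> power_trace k = 0"
proof -
  assume k: "k mod 4 \<noteq> 0"
  have per: "transpose_sign (4 * q + r) = transpose_sign r" for q r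
    by (induction q) (simp_all add: transpose_sign_period numeral_eq_Suc del: transpose_sign.simps)
  show ?thesis
  proof (cases "odd k")
    case True
    then show ?thesis by (rule power_trace_odd)
  next
    case False
    then have "k mod 4 = 2" using k by presburger
    then have "k = 4 * (k div 4) + 2" by presburger
    then have "transpose_sign k = transpose_sign 2" using per[of "k div 4" 2] by metis
    then have "transpose_sign k = 1" by (simp add: numeral_eq_Suc)
    then have "power_trace k = - power_trace k" using power_trace_transpose_sign[of k] by (simp add: cvs.scale_minus_left scaleC_one)
    then show ?thesis by (rule double_eq_0_ext)
  qed
qed

section \<open>Invariance of the power traces\<close>

text \<open>The group acts on \<open>gen_mat\<close> by \<open>A \<mapsto> g\<^sup>T A g\<close>, and the inner occurrences of \<open>g\<close> cancel because of
\<open>g J g\<^sup>T = J\<close>.\<close>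

lemma gen_power_Ad:
  assumes g: "g \<in> (Sp_group :: ('n::finite + 'n) cmat set)"
  shows "map_matrix (ext_map (Ad g)) (gen_power k) = scalar_mat (transpose g) ** gen_power k ** scalar_mat g"
proof -
  note r = ext_map_rules[OF linear_Ad, of g] and s = ext_map_sum[OF linear_Ad, of g]
  have mult: "map_matrix (ext_map (Ad g)) (A ** B) = map_matrix (ext_map (Ad g)) A ** map_matrix (ext_map (Ad g)) B"
    for A B :: "('n + 'n) extmat"
    by (simp add: vec_eq_iff map_matrix_def matrix_matrix_mult_def s r)
  have e: "map_matrix (ext_map (Ad g)) (scalar_mat A) = scalar_mat A" for A
    by (simp add: vec_eq_iff map_matrix_def r)
  have Y: "map_matrix (ext_map (Ad g)) gen_mat = scalar_mat (transpose g) ** gen_mat ** scalar_mat g"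
  proof -
    interpret Vector_Spaces.linear scaleC scaleC ext_inc by (rule linear_ext_inc)
    have "ext_inc (Ad g (p_gen a b)) = (\<Sum>d\<in>UNIV. g $ d $ b *\<^sub>C (\<Sum>c\<in>UNIV. g $ c $ a *\<^sub>C ext_inc (p_gen c d)))" for a b
      by (simp only: Ad_p_gen[OF g] sum scale sum_scaleC_right scaleC_scaleC)
         (subst sum.swap, simp add: mult.commute)
    then show ?thesis
      by (simp add: vec_eq_iff map_matrix_def gen_mat_def r mult_scalar_mat_nth scalar_mat_mult_nth transpose_def)
  qed
  show ?thesis
  proof (induction k)
    case 0
    then show ?case using Y by simp
  next
    case (Suc k)
    have "map_matrix (ext_map (Ad g)) (gen_power (Suc k)) =
      scalar_mat (transpose g) ** gen_power k ** scalar_mat g ** J_ext ** (scalar_mat (transpose g) ** gen_mat ** scalar_mat g)"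
      by (simp add: mult Suc e Y)
    also have "\<dots> = scalar_mat (transpose g) ** gen_power k ** (scalar_mat g ** J_ext ** scalar_mat (transpose g)) ** gen_mat ** scalar_mat g"
      by (simp only: matrix_mul_assoc)
    also have "scalar_mat g ** J_ext ** scalar_mat (transpose g) = J_ext"
      by (simp add: scalar_mat_mult Sp_groupD(7)[OF g])
    finally show ?case by (simp add: matrix_mul_assoc)
  qed
qed

lemma power_trace_invariant:
  assumes g: "g \<in> (Sp_group :: ('n::finite + 'n) cmat set)"
  shows "ext_map (Ad g) (power_trace k) = power_trace k"
proof -
  note r = ext_map_rules[OF linear_Ad, of g] and s = ext_map_sum[OF linear_Ad, of g]
  have W: "ext_map (Ad g) (gen_power k $ a $ b) = (\<Sum>c\<in>UNIV. \<Sum>d\<in>UNIV. (g $ c $ a * g $ d $ b) *\<^sub>C gen_power k $ c $ d)" for a b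
  proof -
    have "ext_map (Ad g) (gen_power k $ a $ b) = (scalar_mat (transpose g) ** gen_power k ** scalar_mat g) $ a $ b"
      unfolding gen_power_Ad[OF g, symmetric] by (simp add: map_matrix_def)
    also have "\<dots> = (\<Sum>d\<in>UNIV. \<Sum>c\<in>UNIV. (g $ c $ a * g $ d $ b) *\<^sub>C gen_power k $ c $ d)"
      by (simp add: mult_scalar_mat_nth scalar_mat_mult_nth transpose_def sum_scaleC_right scaleC_scaleC mult.commute)
    finally show ?thesis by (subst sum.swap)
  qed
  have gJg: "(\<Sum>a\<in>UNIV. \<Sum>b\<in>UNIV. J_mat $ a $ b * (g $ c $ a * g $ d $ b)) = J_mat $ c $ d" for c d
  proof -
    have "J_mat $ c $ d = (g ** J_mat ** transpose g) $ c $ d" by (simp add: Sp_groupD(7)[OF g])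
    also have "\<dots> = (\<Sum>b\<in>UNIV. \<Sum>a\<in>UNIV. J_mat $ a $ b * (g $ c $ a * g $ d $ b))"
      by (simp add: matrix_matrix_mult_def transpose_def sum_distrib_right sum_distrib_left mult_ac)
    finally show ?thesis by (subst sum.swap) simp
  qed
  have "ext_map (Ad g) (power_trace k) = (\<Sum>a\<in>UNIV. \<Sum>b\<in>UNIV. \<Sum>c\<in>UNIV. \<Sum>d\<in>UNIV.
      (J_mat $ a $ b * (g $ c $ a * g $ d $ b)) *\<^sub>C gen_power k $ c $ d)"
    unfolding power_trace_def s r W sum_scaleC_right scaleC_scaleC ..
  also have "\<dots> = (\<Sum>c\<in>UNIV. \<Sum>a\<in>UNIV. \<Sum>b\<in>UNIV. \<Sum>d\<in>UNIV.
      (J_mat $ a $ b * (g $ c $ a * g $ d $ b)) *\<^sub>C gen_power k $ c $ d)"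
    by (rule sum_rotate3)
  also have "\<dots> = (\<Sum>c\<in>UNIV. \<Sum>d\<in>UNIV. \<Sum>a\<in>UNIV. \<Sum>b\<in>UNIV.
      (J_mat $ a $ b * (g $ c $ a * g $ d $ b)) *\<^sub>C gen_power k $ c $ d)"
    by (rule sum.cong[OF refl], rule sum_rotate3)
  also have "\<dots> = power_trace k"
    unfolding sum_scaleC_left[symmetric] gJg power_trace_def ..
  finally show ?thesis .
qed

section \<open>Contraction along a pairing\<close>

definition trace_span :: "('n::finite + 'n) cmat ext set"
  where "trace_span = cvs.span {prod_list (map power_trace ks) | ks. True}"

lemma trace_span_subspace: "cvs.subspace trace_span"
  unfolding trace_span_def by (rule cvs.subspace_span)

lemma trace_span_power_trace_mult:
  fixes x :: "('n::finite + 'n) cmat ext"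
  assumes "x \<in> trace_span"
  shows "power_trace k * x \<in> trace_span"
proof -
  let ?S = "{prod_list (map power_trace ks) | ks. True} :: ('n + 'n) cmat ext set"
  have sub: "cvs.subspace {x. power_trace k * x \<in> cvs.span ?S}"
    unfolding cvs.subspace_def
    by (auto simp: distrib_left mult_scaleC_right intro: cvs.span_add cvs.span_scale cvs.span_zero)
  have base: "power_trace k * y \<in> cvs.span ?S" if y: "y \<in> ?S" for y
  proof -
    from y obtain ks where "y = prod_list (map power_trace ks)" by blast
    then have "power_trace k * y = prod_list (map power_trace (k # ks))" by simp
    then show ?thesis by (intro cvs.span_base) blast
  qed
  show ?thesis
    using cvs.span_induct[OF assms[unfolded trace_span_def] sub base] unfolding trace_span_def by blast
qed

text \<open>An entry \<open>(s, t, k)\<close> stands for the entry of \<open>gen_power k\<close> in the row assigned to the position \<open>s\<close> and the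
column assigned to the position \<open>t\<close>. Lists of such entries are the words in which a pairing is contracted.\<close>

type_synonym 'p slots = "('p \<times> 'p \<times> nat) list"

definition slot_prod :: "'p slots \<Rightarrow> ('p \<Rightarrow> 'n::finite + 'n) \<Rightarrow> ('n + 'n) cmat ext"
  where "slot_prod L x = prod_list (map (\<lambda>(s, t, k). gen_power k $ x s $ x t) L)"

definition slot_positions :: "'p slots \<Rightarrow> 'p list"
  where "slot_positions L = concat (map (\<lambda>(s, t, k). [s, t]) L)"

lemma slot_prod_Nil [simp]: "slot_prod [] x = 1"
  and slot_prod_Cons [simp]: "slot_prod ((s, t, k) # L) x = gen_power k $ x s $ x t * slot_prod L x"
  and slot_prod_append: "slot_prod (L @ L') x = slot_prod L x * slot_prod L' x"
  by (simp_all add: slot_prod_def)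

lemma slot_positions_simps [simp]: "slot_positions [] = []"
   "slot_positions ((s, t, k) # L) = s # t # slot_positions L"
   "slot_positions (L @ L') = slot_positions L @ slot_positions L'"
  by (simp_all add: slot_positions_def)

lemma slot_prod_power: "slot_prod L x \<in> ext_power p_space (sum_list (map (\<lambda>(s, t, k). Suc k) L))"
proof (induction L)
  case (Cons p L)
  then show ?case using ext_power_mult[OF gen_power_degree Cons] by (cases p) auto
qed (simp add: one_in_ext_power)

lemma slot_prod_depends: "(\<And>t. t \<in> set (slot_positions L) \<Longrightarrow> x t = y t) \<Longrightarrow> slot_prod L x = slot_prod L y"
  by (induction L) auto

lemma slot_prod_to_front:
  fixes L1 :: "'p slots"
  shows "\<exists>c. \<forall>x :: 'p \<Rightarrow> 'n::finite + 'n. slot_prod (L1 @ p # L2) x = c *\<^sub>C slot_prod (p # L1 @ L2) x"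
proof -
  obtain s t k where p: "p = (s, t, k)" by (cases p)
  let ?m = "sum_list (map (\<lambda>(s, t, k). Suc k) L1)"
  have "slot_prod (L1 @ p # L2) x = ((- 1) ^ (?m * Suc k)) *\<^sub>C slot_prod (p # L1 @ L2) x" for x :: "'p \<Rightarrow> 'n + 'n"
  proof -
    have "slot_prod (L1 @ p # L2) x = (slot_prod L1 x * gen_power k $ x s $ x t) * slot_prod L2 x"
      by (simp add: p slot_prod_append mult.assoc)
    also have "slot_prod L1 x * gen_power k $ x s $ x t = ((- 1) ^ (?m * Suc k)) *\<^sub>C (gen_power k $ x s $ x t * slot_prod L1 x)"
      unfolding ext_power_commute[OF slot_prod_power gen_power_degree] by (rule minus_one_power_scaleC)
    finally show ?thesis by (simp add: p slot_prod_append mult.assoc mult_scaleC_left)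
  qed
  then show ?thesis by blast
qed

lemma slot_prod_flip: "slot_prod ((s, t, k) # L) x = transpose_sign k *\<^sub>C slot_prod ((t, s, k) # L) x"
  by (simp add: gen_power_transpose[of k "x s" "x t"] mult_scaleC_left)

text \<open>Up to a constant, which does not depend on the indices, any position can be made the first index of the
first factor: factors commute up to sign, and so does transposition.\<close>

lemma slot_front:
  assumes "s \<in> set (slot_positions L)"
  obtains u k L' c where "\<And>x :: 'p \<Rightarrow> 'n::finite + 'n. slot_prod L x = c *\<^sub>C slot_prod ((s, u, k) # L') x"
    and "mset (slot_positions L) = mset (slot_positions ((s, u, k) # L'))"
proof -
  obtain p where p: "p \<in> set L" "s = fst p \<or> s = fst (snd p)"
    using assms by (auto simp: slot_positions_def)
  obtain L1 L2 where L: "L = L1 @ p # L2" using split_list[OF p(1)] by blast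
  obtain c where c: "\<And>x :: 'p \<Rightarrow> 'n + 'n. slot_prod L x = c *\<^sub>C slot_prod (p # L1 @ L2) x"
    using slot_prod_to_front[of L1 p L2] L by blast
  obtain a b k where pe: "p = (a, b, k)" by (cases p)
  show thesis
  proof (cases "s = a")
    case True
    show thesis by (rule that[of c b k "L1 @ L2"]) (use c True in \<open>auto simp: pe L\<close>)
  next
    case False
    then have "s = b" using p pe by simp
    show thesis
      by (rule that[of "c * transpose_sign k" a k "L1 @ L2"])
         (use c \<open>s = b\<close> in \<open>auto simp: pe L slot_prod_flip[of a b k] scaleC_scaleC simp del: slot_prod_Cons\<close>)
  qed
qed

text \<open>A pair of positions either consists of both indices of one factor, and then the contraction splits off a
power trace, or it joins two factors, and then the contraction fuses them to a single higher power.\<close>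

lemma contraction_in_trace_span:
  fixes f :: "('p \<Rightarrow> 'n::finite + 'n) \<Rightarrow> complex"
  assumes "pairing_span D f" "finite D" "distinct (slot_positions L)" "set (slot_positions L) = D"
  shows "(\<Sum>x\<in>PiE D (\<lambda>_. UNIV). f x *\<^sub>C slot_prod L x) \<in> trace_span"
  using assms
proof (induction arbitrary: L rule: pairing_span.induct)
  case (const c)
  then have "L = []" by (cases L) auto
  have "1 \<in> (trace_span :: ('n + 'n) cmat ext set)"
    unfolding trace_span_def by (rule cvs.span_base) (auto intro: exI[of _ "[]"])
  then show ?case using \<open>L = []\<close> by (simp add: cvs.subspace_scale[OF trace_span_subspace])
next
  case (pair D h s t)
  have D: "finite D" using pair.prems by simp
  have dep: "h (x(t := b, s := a)) = h x" for x a b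
    using pairing_span_depends[OF pair.hyps(1)] pair.hyps by (intro depends_onD[of D h]) auto
  have expand: "(\<Sum>x\<in>PiE (insert s (insert t D)) (\<lambda>_. UNIV). (J_mat $ x s $ x t * h x) *\<^sub>C F x) =
     (\<Sum>x\<in>PiE D (\<lambda>_. UNIV). h x *\<^sub>C (\<Sum>b\<in>UNIV. \<Sum>a\<in>UNIV. J_mat $ a $ b *\<^sub>C F (x(t := b, s := a))))"
    for F :: "('p \<Rightarrow> 'n + 'n) \<Rightarrow> ('n + 'n) cmat ext"
  proof -
    have "(\<Sum>x\<in>PiE (insert s (insert t D)) (\<lambda>_. UNIV). (J_mat $ x s $ x t * h x) *\<^sub>C F x) =
      (\<Sum>x\<in>PiE D (\<lambda>_. UNIV). \<Sum>b\<in>UNIV. \<Sum>a\<in>UNIV.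
        (J_mat $ (x(t := b, s := a)) s $ (x(t := b, s := a)) t * h (x(t := b, s := a))) *\<^sub>C F (x(t := b, s := a)))"
      using pair.hyps D by (subst sum_PiE_insert, simp, simp, subst sum_PiE_insert) simp_all
    also have "\<dots> = (\<Sum>x\<in>PiE D (\<lambda>_. UNIV). h x *\<^sub>C (\<Sum>b\<in>UNIV. \<Sum>a\<in>UNIV. J_mat $ a $ b *\<^sub>C F (x(t := b, s := a))))"
      unfolding dep sum_scaleC_right scaleC_scaleC using pair.hyps(2)
      by (intro sum.cong refl) (simp add: mult.commute)
    finally show ?thesis .
  qed
  have "s \<in> set (slot_positions L)" using pair.prems by simp
  then obtain u j L1 c where L1: "\<And>x :: 'p \<Rightarrow> 'n + 'n. slot_prod L x = c *\<^sub>C slot_prod ((s, u, j) # L1) x"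
      "mset (slot_positions L) = mset (slot_positions ((s, u, j) # L1))"
    using slot_front[of s L] by metis
  have dist1: "distinct (slot_positions ((s, u, j) # L1))" and set1: "set (slot_positions ((s, u, j) # L1)) = insert s (insert t D)"
    using mset_eq_imp_distinct_iff[OF L1(2)] mset_eq_setD[OF L1(2)] pair.prems by auto
  have L1sum: "(\<Sum>x\<in>PiE (insert s (insert t D)) (\<lambda>_. UNIV). (J_mat $ x s $ x t * h x) *\<^sub>C slot_prod L x) =
      c *\<^sub>C (\<Sum>x\<in>PiE D (\<lambda>_. UNIV). h x *\<^sub>C (\<Sum>b\<in>UNIV. \<Sum>a\<in>UNIV. J_mat $ a $ b *\<^sub>C slot_prod ((s, u, j) # L1) (x(t := b, s := a))))"
    unfolding expand L1(1) by (simp add: sum_scaleC_right scaleC_scaleC mult_ac del: slot_prod_Cons)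
  show ?case
  proof (cases "u = t")
    case True
    have pos: "set (slot_positions L1) = D" using dist1 set1 pair.hyps True by auto
    have "(\<Sum>b\<in>UNIV. \<Sum>a\<in>UNIV. J_mat $ a $ b *\<^sub>C slot_prod ((s, u, j) # L1) (x(t := b, s := a))) = power_trace j * slot_prod L1 x" for x :: "'p \<Rightarrow> 'n + 'n"
    proof -
      have m: "slot_prod L1 (x(t := b, s := a)) = slot_prod L1 x" for a b
        using pos pair.hyps by (intro slot_prod_depends) auto
      show ?thesis using pair.hyps(2) True unfolding power_trace_def sum_distrib_right
        by (subst sum.swap) (simp add: m mult_scaleC_left)
    qed
    then have "(\<Sum>x\<in>PiE (insert s (insert t D)) (\<lambda>_. UNIV). (J_mat $ x s $ x t * h x) *\<^sub>C slot_prod L x) =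
      c *\<^sub>C (power_trace j * (\<Sum>x\<in>PiE D (\<lambda>_. UNIV). h x *\<^sub>C slot_prod L1 x))"
      unfolding L1sum by (simp only: sum_distrib_left mult_scaleC_right)
    note eq = this
    have "(\<Sum>x\<in>PiE D (\<lambda>_. UNIV). h x *\<^sub>C slot_prod L1 x) \<in> trace_span"
      using pair.IH[OF D _ pos] dist1 by simp
    then show ?thesis
      unfolding eq by (intro cvs.subspace_scale[OF trace_span_subspace] trace_span_power_trace_mult)
  next
    case False
    have "t \<in> set (slot_positions L1)" using set1 False pair.hyps by auto
    then obtain w k L2 d where L2: "\<And>x :: 'p \<Rightarrow> 'n + 'n. slot_prod L1 x = d *\<^sub>C slot_prod ((t, w, k) # L2) x"
        "mset (slot_positions L1) = mset (slot_positions ((t, w, k) # L2))"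
      using slot_front[of t L1] by metis
    have m2: "mset (slot_positions ((s, u, j) # L1)) = mset (slot_positions ((s, u, j) # (t, w, k) # L2))"
      using L2(2) by simp
    have dist2: "distinct (slot_positions ((s, u, j) # (t, w, k) # L2))"
      and set2: "set (slot_positions ((s, u, j) # (t, w, k) # L2)) = insert s (insert t D)"
      using mset_eq_imp_distinct_iff[OF m2] mset_eq_setD[OF m2] dist1 set1 by metis+
    have pos: "set (slot_positions ((u, w, Suc (j + k)) # L2)) = D" "distinct (slot_positions ((u, w, Suc (j + k)) # L2))"
      using dist2 set2 pair.hyps by auto
    have "(\<Sum>b\<in>UNIV. \<Sum>a\<in>UNIV. J_mat $ a $ b *\<^sub>C slot_prod ((s, u, j) # L1) (x(t := b, s := a))) =
      (d * transpose_sign j) *\<^sub>C slot_prod ((u, w, Suc (j + k)) # L2) x" for x :: "'p \<Rightarrow> 'n + 'n"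
    proof -
      have m: "slot_prod L2 (x(t := b, s := a)) = slot_prod L2 x" for a b
        using pos dist2 by (intro slot_prod_depends) auto
      have ne: "u \<noteq> s" "u \<noteq> t" "w \<noteq> s" "w \<noteq> t" "s \<noteq> t" using dist2 by auto
      have "(\<Sum>b\<in>UNIV. \<Sum>a\<in>UNIV. J_mat $ a $ b *\<^sub>C slot_prod ((s, u, j) # L1) (x(t := b, s := a))) =
        (\<Sum>b\<in>UNIV. \<Sum>a\<in>UNIV. (d * transpose_sign j) *\<^sub>C (J_mat $ a $ b *\<^sub>C (gen_power j $ x u $ a * gen_power k $ b $ x w) * slot_prod L2 x))"
        using ne by (intro sum.cong refl)
          (simp add: L2(1) m gen_power_transpose[of j _ "x u"] mult_scaleC_left mult_scaleC_right scaleC_scaleC mult_ac mult.assoc)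
      also have "\<dots> = (d * transpose_sign j) *\<^sub>C ((gen_power j ** J_ext ** gen_power k) $ x u $ x w * slot_prod L2 x)"
        unfolding triple_nth sum_distrib_right sum_scaleC_right by (subst sum.swap) simp
      finally show ?thesis by (simp only: gen_power_mult slot_prod_Cons)
    qed
    then have "(\<Sum>x\<in>PiE (insert s (insert t D)) (\<lambda>_. UNIV). (J_mat $ x s $ x t * h x) *\<^sub>C slot_prod L x) =
      (c * (d * transpose_sign j)) *\<^sub>C (\<Sum>x\<in>PiE D (\<lambda>_. UNIV). h x *\<^sub>C slot_prod ((u, w, Suc (j + k)) # L2) x)"
      unfolding L1sum by (simp only: sum_scaleC_right scaleC_scaleC mult_ac)
    then show ?thesis
      using pair.IH[OF D pos(2,1)] by (simp only: cvs.subspace_scale[OF trace_span_subspace])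
  qed
next
  case (zero D)
  then show ?case by (simp add: cvs.scale_zero_left cvs.subspace_0[OF trace_span_subspace])
next
  case (add D f g)
  then show ?case by (simp add: scaleC_add_left sum.distrib cvs.subspace_add[OF trace_span_subspace])
next
  case (scale D f c)
  have "(\<Sum>x\<in>PiE D (\<lambda>_. UNIV). (c * f x) *\<^sub>C slot_prod L x) = c *\<^sub>C (\<Sum>x\<in>PiE D (\<lambda>_. UNIV). f x *\<^sub>C slot_prod L x)"
    by (simp add: sum_scaleC_right scaleC_scaleC)
  then show ?case using scale by (simp add: cvs.subspace_scale[OF trace_span_subspace])
qed

section \<open>Invariants are polynomials in the power traces\<close>

lemma ext_algebra_decompose:
  assumes "x \<in> ext_algebra V"
  obtains X N where "\<And>k. X k \<in> ext_power V k" "\<And>k. k \<ge> N \<Longrightarrow> X k = 0" "x = (\<Sum>k<N. X k)"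
proof -
  let ?P = "\<lambda>x. \<exists>X N. (\<forall>k. X k \<in> ext_power V k) \<and> (\<forall>k\<ge>N. X k = 0) \<and> x = (\<Sum>k<N. X k)"
  have ext: "(\<Sum>k<N. X k) = (\<Sum>k<M. X k)" if "\<forall>k\<ge>N. X k = 0" "N \<le> M" for X :: "nat \<Rightarrow> 'a ext" and N M
    using that by (intro sum.mono_neutral_left) auto
  note sub = ext_power_subspace
  have 1: "cvs.subspace {x. ?P x}"
    unfolding cvs.subspace_def mem_Collect_eq
  proof (intro conjI allI ballI)
    show "?P 0" by (intro exI[of _ "\<lambda>_. 0"] exI[of _ 0]) (simp add: cvs.subspace_0[OF sub])
  next
    fix x y assume "x \<in> {x. ?P x}" "y \<in> {x. ?P x}"
    then obtain X N Y M where X: "\<forall>k. X k \<in> ext_power V k" "\<forall>k\<ge>N. X k = 0" "x = (\<Sum>k<N. X k)"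
      and Y: "\<forall>k. Y k \<in> ext_power V k" "\<forall>k\<ge>M. Y k = 0" "y = (\<Sum>k<M. Y k)" by blast
    have "x + y = (\<Sum>k<max N M. X k + Y k)"
      unfolding X(3) Y(3) sum.distrib
      using ext[OF X(2), of "max N M"] ext[OF Y(2), of "max N M"] by simp
    then show "?P (x + y)"
      using X Y by (intro exI[of _ "\<lambda>k. X k + Y k"] exI[of _ "max N M"]) (simp add: cvs.subspace_add[OF sub])
  next
    fix c x assume "x \<in> {x. ?P x}"
    then obtain X N where X: "\<forall>k. X k \<in> ext_power V k" "\<forall>k\<ge>N. X k = 0" "x = (\<Sum>k<N. X k)" by blast
    then show "?P (c *\<^sub>C x)"
      by (intro exI[of _ "\<lambda>k. c *\<^sub>C X k"] exI[of _ N]) (simp add: cvs.subspace_scale[OF sub] sum_scaleC_right)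
  qed
  have 2: "?P (wedge xs)" if "set xs \<subseteq> V" for xs
  proof (intro exI conjI)
    let ?X = "\<lambda>k. if k = length xs then wedge xs else 0"
    show "\<forall>k. ?X k \<in> ext_power V k" using that by (simp add: wedge_in_ext_power cvs.subspace_0[OF sub])
    show "\<forall>k\<ge>Suc (length xs). ?X k = 0" by simp
    show "wedge xs = (\<Sum>k<Suc (length xs). ?X k)" by simp
  qed
  have "?P x"
    by (rule cvs.span_induct[OF assms[unfolded ext_algebra_def] 1]) (use 2 in blast)
  then show thesis using that by blast
qed

lemma ext_power_in_algebra: "ext_power V k \<subseteq> ext_algebra V"
  unfolding ext_power_def ext_algebra_def by (rule cvs.span_mono) auto

lemma sum_PiE_bool:
  fixes G :: "('s \<Rightarrow> 'i \<times> 'i) \<Rightarrow> 'c::comm_monoid_add"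
  assumes "\<And>h h'. (\<And>i. i \<in> S \<Longrightarrow> h i = h' i) \<Longrightarrow> G h = G h'"
  shows "(\<Sum>y\<in>PiE (S \<times> (UNIV :: bool set)) (\<lambda>_. UNIV). G (\<lambda>i. (y (i, False), y (i, True)))) =
     (\<Sum>h\<in>PiE S (\<lambda>_. UNIV). G h)"
proof (rule sum.reindex_bij_witness[of _
      "\<lambda>h. \<lambda>p\<in>S \<times> UNIV. if snd p then snd (h (fst p)) else fst (h (fst p))"
      "\<lambda>y. \<lambda>i\<in>S. (y (i, False), y (i, True))"])
  fix y :: "'s \<times> bool \<Rightarrow> 'i" assume y: "y \<in> PiE (S \<times> UNIV) (\<lambda>_. UNIV)"
  show "(\<lambda>p\<in>S \<times> UNIV. if snd p then snd ((\<lambda>i\<in>S. (y (i, False), y (i, True))) (fst p))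
     else fst ((\<lambda>i\<in>S. (y (i, False), y (i, True))) (fst p))) = y"
    using y by (auto simp: fun_eq_iff PiE_iff extensional_def restrict_def)
  show "(\<lambda>i\<in>S. (y (i, False), y (i, True))) \<in> PiE S (\<lambda>_. UNIV)" by auto
  show "G (\<lambda>i\<in>S. (y (i, False), y (i, True))) = G (\<lambda>i. (y (i, False), y (i, True)))"
    by (rule assms) simp
next
  fix h :: "'s \<Rightarrow> 'i \<times> 'i" assume h: "h \<in> PiE S (\<lambda>_. UNIV)"
  show "(\<lambda>p\<in>S \<times> UNIV. if snd p then snd (h (fst p)) else fst (h (fst p))) \<in> PiE (S \<times> UNIV) (\<lambda>_. UNIV)" by auto
  show "(\<lambda>i\<in>S. ((\<lambda>p\<in>S \<times> UNIV. if snd p then snd (h (fst p)) else fst (h (fst p))) (i, False),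
     (\<lambda>p\<in>S \<times> UNIV. if snd p then snd (h (fst p)) else fst (h (fst p))) (i, True))) = h"
    using h by (auto simp: fun_eq_iff PiE_iff extensional_def restrict_def)
qed

definition p_gen_wedge :: "nat \<Rightarrow> (nat \<Rightarrow> ('n::finite + 'n) \<times> ('n + 'n)) \<Rightarrow> ('n + 'n) cmat ext"
  where "p_gen_wedge k h = wedge (map (\<lambda>i. p_gen (fst (h i)) (snd (h i))) [0..<k])"

definition p_gen_dual_wedge :: "nat \<Rightarrow> (nat \<Rightarrow> ('n::finite + 'n) \<times> ('n + 'n)) \<Rightarrow> ('n + 'n) cmat ext"
  where "p_gen_dual_wedge k h = wedge (map (\<lambda>i. p_gen_dual (fst (h i)) (snd (h i))) [0..<k])"

lemma p_gen_wedge_cong: "(\<And>i. i < k \<Longrightarrow> h i = h' i) \<Longrightarrow> p_gen_wedge k h = p_gen_wedge k h'"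
  "(\<And>i. i < k \<Longrightarrow> h i = h' i) \<Longrightarrow> p_gen_dual_wedge k h = p_gen_dual_wedge k h'"
  unfolding p_gen_wedge_def p_gen_dual_wedge_def by (auto intro!: arg_cong[of _ _ wedge])

abbreviation pair_at :: "(nat \<times> bool \<Rightarrow> 'i) \<Rightarrow> nat \<Rightarrow> 'i \<times> 'i"
  where "pair_at x \<equiv> \<lambda>i. (x (i, False), x (i, True))"

definition slots :: "nat \<Rightarrow> (nat \<times> bool) slots"
  where "slots k = map (\<lambda>i. ((i, False), (i, True), 0)) [0..<k]"

lemma slots_positions: "set (slot_positions (slots k)) = {..<k} \<times> UNIV" "distinct (slot_positions (slots k))"
proof -
  show s: "set (slot_positions (slots k)) = {..<k} \<times> UNIV" for k
    by (auto simp: slot_positions_def slots_def UNIV_bool)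
  show "distinct (slot_positions (slots k))"
  proof (induction k)
    case (Suc k)
    have "slots (Suc k) = slots k @ [((k, False), (k, True), 0)]" by (simp add: slots_def)
    then show ?case using Suc s[of k] by auto
  qed (simp add: slots_def)
qed

lemma slot_prod_slots: "slot_prod (slots k) x = p_gen_wedge k (pair_at x)"
  by (simp add: slot_prod_def slots_def p_gen_wedge_def wedge_def o_def gen_mat_def)

lemma p_gen_dual_wedge_Ad:
  assumes g: "g \<in> (Sp_group :: ('n::finite + 'n) cmat set)"
  shows "ext_map (Ad (map_matrix cnj g)) (p_gen_dual_wedge k (pair_at x)) =
    (\<Sum>y\<in>PiE ({..<k} \<times> UNIV) (\<lambda>_. UNIV). (\<Prod>t\<in>{..<k} \<times> UNIV. g $ y t $ x t) *\<^sub>C p_gen_dual_wedge k (pair_at y))"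
proof -
  interpret e: Vector_Spaces.linear scaleC scaleC ext_inc by (rule linear_ext_inc)
  define c where "c i p = g $ fst p $ x (i, False) * g $ snd p $ x (i, True)" for i and p :: "('n + 'n) \<times> ('n + 'n)"
  have "ext_inc (Ad (map_matrix cnj g) (p_gen_dual (x (i, False)) (x (i, True)))) =
    (\<Sum>p\<in>UNIV. c i p *\<^sub>C ext_inc (p_gen_dual (fst p) (snd p)))" for i
    unfolding Ad_p_gen_dual[OF Sp_group_cnj[OF g]] e.sum e.scale c_def
    by (simp add: sum.cartesian_product case_prod_beta UNIV_Times_UNIV[symmetric] map_matrix_def del: UNIV_Times_UNIV)
  then have "ext_map (Ad (map_matrix cnj g)) (p_gen_dual_wedge k (pair_at x)) =
     prod_list (map (\<lambda>i. \<Sum>p\<in>UNIV. c i p *\<^sub>C ext_inc (p_gen_dual (fst p) (snd p))) [0..<k])"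
    unfolding p_gen_dual_wedge_def ext_map_wedge[OF linear_Ad] by (simp add: wedge_def o_def)
  also have "\<dots> = (\<Sum>h\<in>PiE {..<k} (\<lambda>_. UNIV). (\<Prod>i<k. c i (h i)) *\<^sub>C p_gen_dual_wedge k h)"
    by (subst prod_list_sum_expand) (simp_all add: p_gen_dual_wedge_def wedge_def o_def atLeast0LessThan)
  also have "\<dots> = (\<Sum>y\<in>PiE ({..<k} \<times> UNIV) (\<lambda>_. UNIV). (\<Prod>i<k. c i (pair_at y i)) *\<^sub>C p_gen_dual_wedge k (pair_at y))"
    by (rule sum_PiE_bool[symmetric])
       (auto intro!: arg_cong2[of _ _ _ _ scaleC] prod.cong p_gen_wedge_cong)
  also have "\<dots> = (\<Sum>y\<in>PiE ({..<k} \<times> UNIV) (\<lambda>_. UNIV). (\<Prod>t\<in>{..<k} \<times> UNIV. g $ y t $ x t) *\<^sub>C p_gen_dual_wedge k (pair_at y))"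
  proof (rule sum.cong[OF refl])
    fix y :: "nat \<times> bool \<Rightarrow> 'n + 'n"
    have "(\<Prod>t\<in>{..<k} \<times> UNIV. g $ y t $ x t) = (\<Prod>i<k. \<Prod>b\<in>UNIV. g $ y (i, b) $ x (i, b))"
      by (simp add: prod.cartesian_product)
    also have "\<dots> = (\<Prod>i<k. c i (pair_at y i))" by (simp add: UNIV_bool c_def mult.commute)
    finally show "(\<Prod>i<k. c i (pair_at y i)) *\<^sub>C p_gen_dual_wedge k (pair_at y) =
      (\<Prod>t\<in>{..<k} \<times> UNIV. g $ y t $ x t) *\<^sub>C p_gen_dual_wedge k (pair_at y)" by simp
  qed
  finally show ?thesis .
qed

text \<open>The coefficients \<open>f\<close> of \<open>T\<close> with respect to the dual generators inherit the invariance of \<open>T\<close>, so by the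
first fundamental theorem they are pairing tensors; expanding \<open>Tk\<close> in the dual families contracts them with
products of generators.\<close>

lemma homogeneous_part_in_trace_span:
  fixes T :: "('n::finite + 'n) cmat ext"
  assumes inv: "\<And>g. g \<in> Sp_squares \<Longrightarrow> ext_map (Ad g) T = T"
    and Tk: "Tk \<in> ext_power p_space k"
    and part: "\<And>y. y \<in> ext_power p_space k \<Longrightarrow> ext_form trace_form T y = ext_form trace_form Tk y"
  shows "Tk \<in> trace_span"
proof -
  let ?D = "{..<k} \<times> (UNIV :: bool set)"
  define f where "f x = ext_form trace_form T (p_gen_dual_wedge k (pair_at x))" for x
  have D: "finite ?D" by simp
  have dep: "depends_on ?D f"
    unfolding depends_on_def f_def
    by (intro allI impI arg_cong[of _ _ "ext_form trace_form T"] p_gen_wedge_cong) auto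
  have "sp_invariant ?D f"
  proof (rule invariant_under_squares_imp_sp_invariant[OF D dep])
    fix g :: "('n + 'n) cmat" and x :: "nat \<times> bool \<Rightarrow> 'n + 'n" assume g: "g \<in> Sp_squares"
    then have g': "map_matrix cnj g \<in> Sp_squares" by (rule Sp_squares_cnj)
    then have g'': "map_matrix cnj g \<in> Sp_group" and gS: "g \<in> Sp_group" using g Sp_squares_subset by auto
    have "f x = ext_form trace_form (ext_map (Ad (map_matrix cnj g)) T) (ext_map (Ad (map_matrix cnj g)) (p_gen_dual_wedge k (pair_at x)))"
      unfolding f_def by (rule tf.form_ext_map[symmetric, OF linear_Ad trace_form_Ad[OF g'']])
    also have "\<dots> = (\<Sum>y\<in>PiE ?D (\<lambda>_. UNIV). (\<Prod>t\<in>?D. g $ y t $ x t) * f y)"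
      unfolding inv[OF g'] p_gen_dual_wedge_Ad[OF gS] tf.form_sum_right tf.form_scale_right f_def ..
    finally show "(\<Sum>y\<in>PiE ?D (\<lambda>_. UNIV). (\<Prod>t\<in>?D. g $ y t $ x t) * f y) = f x" ..
  qed
  then have "pairing_span ?D f" by (intro first_fundamental_theorem_Sp D dep)
  then have "(\<Sum>x\<in>PiE ?D (\<lambda>_. UNIV). f x *\<^sub>C slot_prod (slots k) x) \<in> trace_span"
    by (intro contraction_in_trace_span D) (simp_all add: slots_positions)
  moreover have "(\<Sum>x\<in>PiE ?D (\<lambda>_. UNIV). f x *\<^sub>C slot_prod (slots k) x) =
      (\<Sum>h\<in>PiE {..<k} (\<lambda>_. UNIV). ext_form trace_form T (p_gen_dual_wedge k h) *\<^sub>C p_gen_wedge k h)"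
    unfolding f_def slot_prod_slots
    by (rule sum_PiE_bool[of "{..<k}" "\<lambda>h. ext_form trace_form T (p_gen_dual_wedge k h) *\<^sub>C p_gen_wedge k h"])
       (auto intro!: arg_cong2[of _ _ _ _ scaleC] arg_cong[of _ _ "ext_form trace_form T"] p_gen_wedge_cong)
  ultimately have in_span: "(\<Sum>h\<in>PiE {..<k} (\<lambda>_. UNIV). ext_form trace_form T (p_gen_dual_wedge k h) *\<^sub>C p_gen_wedge k h) \<in> trace_span"
    by simp
  have dual_pow: "p_gen_dual_wedge k h \<in> ext_power p_space k" for h :: "nat \<Rightarrow> ('n + 'n) \<times> ('n + 'n)"
    unfolding p_gen_dual_wedge_def by (rule wedge_in_ext_power) (auto intro: p_gen_in_p)
  interpret e: Vector_Spaces.linear scaleC scaleC ext_inc by (rule linear_ext_inc)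
  have w4: "wedge (map (\<lambda>i. (1/4) *\<^sub>C p_gen (fst (h i)) (snd (h i))) [0..<k]) = (1/4)^k *\<^sub>C p_gen_wedge k h"
    for h :: "nat \<Rightarrow> ('n + 'n) \<times> ('n + 'n)"
  proof -
    have "wedge (map (\<lambda>i. (1/4) *\<^sub>C X i) is) = (1/4)^length is *\<^sub>C wedge (map X is)"
      for X :: "nat \<Rightarrow> ('n + 'n) cmat" and "is"
      by (induction "is") (simp_all add: e.scale mult_scaleC_left mult_scaleC_right scaleC_scaleC scaleC_one)
    then show ?thesis by (simp add: p_gen_wedge_def)
  qed
  have "of_nat (fact k) *\<^sub>C Tk = (\<Sum>h\<in>PiE {..<k} (\<lambda>_. UNIV).
      ext_form trace_form Tk (p_gen_dual_wedge k h) *\<^sub>C wedge (map (\<lambda>i. (1/4) *\<^sub>C p_gen (fst (h i)) (snd (h i))) [0..<k]))"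
    using tf.reconstruct[OF _ p_dual_expansion Tk] unfolding p_gen_dual_wedge_def by simp
  also have "\<dots> = (1/4)^k *\<^sub>C (\<Sum>h\<in>PiE {..<k} (\<lambda>_. UNIV). ext_form trace_form T (p_gen_dual_wedge k h) *\<^sub>C p_gen_wedge k h)"
    unfolding w4 part[OF dual_pow] by (simp add: sum_scaleC_right scaleC_scaleC mult.commute)
  finally have "(1 / of_nat (fact k)) *\<^sub>C of_nat (fact k) *\<^sub>C Tk \<in> trace_span"
    using in_span by (simp add: cvs.subspace_scale[OF trace_span_subspace])
  then show ?thesis by (simp add: scaleC_scaleC scaleC_one)
qed

theorem invariants_in_trace_span:
  fixes T :: "('n::finite + 'n) cmat ext"
  assumes inv: "\<And>g. g \<in> Sp_squares \<Longrightarrow> ext_map (Ad g) T = T"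
    and T: "T \<in> ext_algebra p_space"
  shows "T \<in> trace_span"
proof -
  obtain X N where X: "\<And>k. X k \<in> ext_power p_space k" "\<And>k. k \<ge> N \<Longrightarrow> X k = 0" "T = (\<Sum>k<N. X k)"
    using ext_algebra_decompose[OF T] by blast
  have "X k \<in> trace_span" if "k < N" for k
  proof (rule homogeneous_part_in_trace_span[OF inv X(1)])
    fix y :: "('n + 'n) cmat ext" assume y: "y \<in> ext_power p_space k"
    have "ext_form trace_form T y = (\<Sum>j<N. if j = k then ext_form trace_form (X j) y else 0)"
      unfolding X(3) tf.form_sum_left using tf.form_degree[OF X(1) y] by (intro sum.cong) auto
    then show "ext_form trace_form T y = ext_form trace_form (X k) y" using that by simp
  qed
  then show ?thesis unfolding X(3) by (intro cvs.subspace_sum[OF trace_span_subspace]) auto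
qed

section \<open>The top exterior power\<close>

lemma herm_basisD:
  assumes "herm_basis (bs :: ('n::finite + 'n) cmat list)"
  shows "length bs = CARD('n) * (2 * CARD('n) - 1)" "set bs \<subseteq> p_space"
    "\<And>b. b \<in> set bs \<Longrightarrow> conj_transpose b = b"
    "\<And>i j. i < length bs \<Longrightarrow> j < length bs \<Longrightarrow> trace_form (bs ! i) (bs ! j) = (if i = j then 1 else 0)"
    "\<And>y. y \<in> p_space \<Longrightarrow> (\<Sum>i<length bs. trace_form y (bs ! i) *\<^sub>C bs ! i) = y"
  using assms unfolding herm_basis_def herm_p_def by auto

lemma top_in_power: "herm_basis bs \<Longrightarrow> wedge bs \<in> ext_power p_space (length bs)"
  by (rule wedge_in_ext_power) (auto dest: herm_basisD)

lemma top_form: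
  assumes "herm_basis bs"
  shows "ext_form trace_form (wedge bs) (wedge bs) = 1"
proof -
  let ?n = "length bs"
  have "(\<Prod>i<?n. trace_form (bs ! i) (bs ! p i)) = (if p = id then 1 else 0)" if p: "p permutes {..<?n}" for p
  proof (cases "p = id")
    case True
    then show ?thesis using herm_basisD(4)[OF assms] by simp
  next
    case False
    then obtain i where i: "p i \<noteq> i" by (auto simp: fun_eq_iff)
    then have "i < ?n" using p by (auto simp: permutes_def)
    then have "trace_form (bs ! i) (bs ! p i) = 0"
      using herm_basisD(4)[OF assms, of i "p i"] i permutes_in_image[OF p, of i] by simp
    then show ?thesis using False \<open>i < ?n\<close> by (auto intro!: prod_zero)
  qed
  then have "ext_form trace_form (wedge bs) (wedge bs) =
      (\<Sum>p | p permutes {..<?n}. if p = id then 1 else 0)"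
    unfolding tf.form_wedge gram_det_def by (auto intro!: sum.cong)
  also have "\<dots> = 1" using finite_permutations[of "{..<?n}"] by (simp add: permutes_id)
  finally show ?thesis .
qed

text \<open>In the expansion of \<open>x\<close> the tuples with a repetition contribute nothing, and the others are permutations of
the basis.\<close>

lemma top_spans:
  assumes bs: "herm_basis (bs :: ('n::finite + 'n) cmat list)" and x: "x \<in> ext_power p_space (length bs)"
  shows "\<exists>c. x = c *\<^sub>C wedge bs"
proof -
  let ?n = "length bs"
  note sub = cvs.subspace_span
  have w: "wedge (map (\<lambda>i. bs ! h i) [0..<?n]) \<in> cvs.span {wedge bs}" if h: "h \<in> PiE {..<?n} (\<lambda>_. {..<?n})" for h
  proof (cases "inj_on h {..<?n}")
    case True
    define p where "p i = (if i < ?n then h i else i)" for i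
    have "h ` {..<?n} \<subseteq> {..<?n}" using h by auto
    then have "bij_betw h {..<?n} {..<?n}"
      using True by (simp add: bij_betw_def endo_inj_surj)
    then have "bij_betw p {..<?n} {..<?n}" by (rule bij_betw_cong[THEN iffD1, rotated]) (simp add: p_def)
    then have "p permutes {..<?n}" by (rule bij_imp_permutes) (simp add: p_def)
    then have "wedge (map (\<lambda>i. bs ! p i) [0..<?n]) = of_int (sign p) *\<^sub>C wedge bs"
      using wedge_permute[of p ?n "(!) bs"] by (simp add: map_nth)
    moreover have "map (\<lambda>i. bs ! p i) [0..<?n] = map (\<lambda>i. bs ! h i) [0..<?n]" by (simp add: p_def)
    ultimately show ?thesis by (simp add: cvs.span_scale cvs.span_base)
  next
    case False
    then obtain a b where "a < ?n" "b < ?n" "a \<noteq> b" "h a = h b" by (auto simp: inj_on_def)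
    then have "wedge (map (\<lambda>i. bs ! h i) [0..<?n]) = 0"
      by (intro wedge_repeated[of a ?n b]) auto
    then show ?thesis by (simp add: cvs.span_zero)
  qed
  have "(\<Sum>h\<in>PiE {..<?n} (\<lambda>_. {..<?n}). ext_form trace_form x (wedge (map (\<lambda>i. bs ! h i) [0..<?n])) *\<^sub>C
      wedge (map (\<lambda>i. bs ! h i) [0..<?n])) = of_nat (fact ?n) *\<^sub>C x"
    by (rule tf.reconstruct[OF _ herm_basisD(5)[OF bs] x]) auto
  moreover have "(\<Sum>h\<in>PiE {..<?n} (\<lambda>_. {..<?n}). ext_form trace_form x (wedge (map (\<lambda>i. bs ! h i) [0..<?n])) *\<^sub>C
      wedge (map (\<lambda>i. bs ! h i) [0..<?n])) \<in> cvs.span {wedge bs}"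
    by (intro cvs.span_sum cvs.span_scale w)
  ultimately have "of_nat (fact ?n) *\<^sub>C x \<in> cvs.span {wedge bs}" by (simp only:)
  then have "(1 / of_nat (fact ?n)) *\<^sub>C of_nat (fact ?n) *\<^sub>C x \<in> cvs.span {wedge bs}"
    by (rule cvs.span_scale)
  then have "x \<in> cvs.span {wedge bs}" by (simp add: scaleC_scaleC scaleC_one)
  then show ?thesis by (auto simp: cvs.span_singleton)
qed

text \<open>A group element \<open>h\<close> multiplies the top wedge by some \<open>c\<close>, and \<open>c\<^sup>2 = 1\<close> because it preserves the form; its
square therefore acts by \<open>1\<close>.\<close>

lemma top_invariant:
  assumes bs: "herm_basis (bs :: ('n::finite + 'n) cmat list)" and g: "g \<in> Sp_squares"
  shows "ext_map (Ad g) (wedge bs) = wedge bs"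
proof -
  obtain h where h: "h \<in> Sp_group" "g = h ** h" using g by (auto simp: Sp_squares_def)
  note r = ext_map_rules[OF linear_Ad]
  have "ext_map (Ad h) (wedge bs) \<in> ext_power (Ad h ` p_space) (length bs)"
    by (rule ext_map_power[OF linear_Ad top_in_power[OF bs]])
  then have "ext_map (Ad h) (wedge bs) \<in> ext_power p_space (length bs)"
    using ext_power_mono[of "Ad h ` p_space" p_space] Ad_p_space[OF h(1)] by blast
  then obtain c where c: "ext_map (Ad h) (wedge bs) = c *\<^sub>C wedge bs" using top_spans[OF bs] by blast
  have "1 = ext_form trace_form (ext_map (Ad h) (wedge bs)) (ext_map (Ad h) (wedge bs))"
    unfolding tf.form_ext_map[OF linear_Ad trace_form_Ad[OF h(1)]] top_form[OF bs] ..
  also have "\<dots> = c * c" unfolding c tf.form_scale_left tf.form_scale_right top_form[OF bs] by simp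
  finally have cc: "c * c = 1" ..
  have Ad2: "Ad g X = Ad h (Ad h X)" for X
  proof -
    have "matrix_inv g = matrix_inv h ** matrix_inv h"
      using Sp_groupD(3)[OF h(1)] Sp_groupD(3)[OF Sp_group_mult[OF h(1) h(1)]]
      by (simp add: h(2) conj_transpose_mult)
    then show ?thesis unfolding Ad_def h(2) by (simp add: matrix_mul_assoc)
  qed
  have "ext_map (Ad g) (wedge bs) = ext_map (Ad h) (ext_map (Ad h) (wedge bs))"
    unfolding ext_map_wedge[OF linear_Ad] map_map
    by (intro arg_cong[of _ _ wedge] map_cong) (simp_all add: Ad2)
  also have "\<dots> = (c * c) *\<^sub>C wedge bs" unfolding c r(5) scaleC_scaleC ..
  finally show ?thesis by (simp add: cc scaleC_one)
qed

lemma top_in_trace_span: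
  assumes bs: "herm_basis (bs :: ('n::finite + 'n) cmat list)"
  shows "wedge bs \<in> trace_span"
  using invariants_in_trace_span[OF top_invariant[OF bs]] top_in_power[OF bs] ext_power_in_algebra by blast

section \<open>Nilpotency from vanishing power traces\<close>

primrec mpow :: "'r::comm_ring_1^'i^'i \<Rightarrow> nat \<Rightarrow> 'r^'i^'i::finite" where
  "mpow Y 0 = mat 1"
| "mpow Y (Suc k) = mpow Y k ** Y"

lemma mpow_add: "mpow Y (j + k) = mpow Y j ** mpow Y k"
  by (induction k) (simp_all add: matrix_mul_assoc)

text \<open>Splitting each permutation into cycles shows what this is: the signed sum over all permutations of the products
of traces of the matrices \<open>M s\<close> multiplied along the cycles.\<close>

definition cyc_sum :: "nat set \<Rightarrow> (nat \<Rightarrow> 'r::comm_ring_1^'i^'i::finite) \<Rightarrow> 'r"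
  where "cyc_sum D M = (\<Sum>x\<in>PiE D (\<lambda>_. UNIV). \<Sum>p | p permutes D.
    of_int (sign p) * (\<Prod>s\<in>D. M s $ x s $ x (p s)))"

lemma cyc_sum_empty: "cyc_sum {} M = 1"
  by (simp add: cyc_sum_def)

text \<open>Take \<open>b\<close> out of its cycle. If it is a fixed point it contributes a trace; otherwise \<open>M b\<close> is absorbed by the
predecessor \<open>s\<close> of \<open>b\<close> on its cycle, at the cost of a sign.\<close>

lemma cyc_sum_insert:
  fixes M :: "nat \<Rightarrow> 'r::comm_ring_1^'i^'i::finite"
  assumes D: "finite D" and b: "b \<notin> D"
  shows "cyc_sum (insert b D) M =
    trace (M b) * cyc_sum D M - (\<Sum>s\<in>D. cyc_sum D (M(s := M s ** M b)))"
proof -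
  define T where "T x p = of_int (sign p) * (\<Prod>s\<in>insert b D. M s $ x s $ x (p s))" for x :: "nat \<Rightarrow> 'i" and p
  define S where "S M x q = of_int (sign q) * (\<Prod>s\<in>D. M s $ x s $ x (q s))" for M :: "nat \<Rightarrow> 'r^'i^'i" and x :: "nat \<Rightarrow> 'i" and q
  have t1: "T (x(b := i)) q = M b $ i $ i * S M x q" if q: "q permutes D" for x i q
  proof -
    have "q b = b" using q b by (auto simp: permutes_def)
    moreover have "(\<Prod>s\<in>D. M s $ (x(b := i)) s $ (x(b := i)) (q s)) = (\<Prod>s\<in>D. M s $ x s $ x (q s))"
    proof (rule prod.cong[OF refl])
      fix s assume "s \<in> D"
      then have "s \<noteq> b" "q s \<noteq> b" using b permutes_in_image[OF q, of s] by auto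
      then show "M s $ (x(b := i)) s $ (x(b := i)) (q s) = M s $ x s $ x (q s)" by simp
    qed
    ultimately show ?thesis using D b by (simp add: T_def S_def mult_ac)
  qed
  have t2: "(\<Sum>i\<in>UNIV. T (x(b := i)) (Transposition.transpose b c \<circ> q)) =
      - S (M(inv q c := M (inv q c) ** M b)) x q"
    if q: "q permutes D" and c: "c \<in> D" for x q c
  proof -
    define s0 where "s0 = inv q c"
    have s0: "s0 \<in> D" "q s0 = c"
      using permutes_in_image[OF permutes_inv[OF q]] c permutes_inverses(1)[OF q] by (auto simp: s0_def)
    have bc: "b \<noteq> c" using b c by auto
    have qb: "q b = b" using q b by (auto simp: permutes_def)
    have sg: "sign (Transposition.transpose b c \<circ> q) = - sign q"
      using bc q D by (subst sign_compose) (auto simp: sign_swap_id permutation_swap_id intro: permutation_permutes[THEN iffD2])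
    have "T (x(b := i)) (Transposition.transpose b c \<circ> q) =
       - (of_int (sign q) * (M s0 $ x s0 $ i * M b $ i $ x c) * (\<Prod>s\<in>D - {s0}. M s $ x s $ x (q s)))" for i
    proof -
      have "(\<Prod>s\<in>D - {s0}. M s $ (x(b := i)) s $ (x(b := i)) ((Transposition.transpose b c \<circ> q) s)) =
         (\<Prod>s\<in>D - {s0}. M s $ x s $ x (q s))"
      proof (rule prod.cong[OF refl])
        fix s assume s: "s \<in> D - {s0}"
        then have "q s \<in> D" "s \<noteq> b" using permutes_in_image[OF q, of s] b by auto
        moreover have "q s \<noteq> c" using s s0(2) permutes_inj[OF q] by (auto dest: injD)
        ultimately have "Transposition.transpose b c (q s) = q s" "q s \<noteq> b" "s \<noteq> b" using b
          by (auto intro: transpose_apply_other)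
        then show "M s $ (x(b := i)) s $ (x(b := i)) ((Transposition.transpose b c \<circ> q) s) = M s $ x s $ x (q s)" by simp
      qed
      moreover have "s0 \<noteq> b" using s0(1) b by auto
      ultimately show ?thesis
        unfolding T_def sg using D b s0 bc qb
        by (simp add: prod.remove[OF D s0(1)] mult_ac)
    qed
    then have "(\<Sum>i\<in>UNIV. T (x(b := i)) (Transposition.transpose b c \<circ> q)) =
      - (of_int (sign q) * (M s0 ** M b) $ x s0 $ x c * (\<Prod>s\<in>D - {s0}. M s $ x s $ x (q s)))"
      by (simp add: sum_negf matrix_matrix_mult_def sum_distrib_left sum_distrib_right)
    also have "of_int (sign q) * (M s0 ** M b) $ x s0 $ x c * (\<Prod>s\<in>D - {s0}. M s $ x s $ x (q s)) =
      S (M(s0 := M s0 ** M b)) x q"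
      unfolding S_def by (subst prod.remove[OF D s0(1)]) (simp add: s0(2) mult_ac)
    finally show ?thesis by (simp only: s0_def)
  qed
  have x: "(\<Sum>i\<in>UNIV. \<Sum>p | p permutes insert b D. T (x(b := i)) p) =
     trace (M b) * (\<Sum>q | q permutes D. S M x q) - (\<Sum>q | q permutes D. \<Sum>s\<in>D. S (M(s := M s ** M b)) x q)" for x
  proof -
    have "(\<Sum>i\<in>UNIV. \<Sum>p | p permutes insert b D. T (x(b := i)) p) =
      (\<Sum>i\<in>UNIV. \<Sum>c\<in>insert b D. \<Sum>q | q permutes D. T (x(b := i)) (Transposition.transpose b c \<circ> q))"
      by (rule sum.cong[OF refl], rule sum_over_permutations_insert[OF D b])
    also have "\<dots> = (\<Sum>q | q permutes D. \<Sum>i\<in>UNIV. \<Sum>c\<in>insert b D. T (x(b := i)) (Transposition.transpose b c \<circ> q))"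
      by (rule sum_rotate3)
    also have "\<dots> = (\<Sum>q | q permutes D. trace (M b) * S M x q - (\<Sum>s\<in>D. S (M(s := M s ** M b)) x q))"
    proof (rule sum.cong[OF refl])
      fix q assume "q \<in> {q. q permutes D}"
      then have q: "q permutes D" by simp
      have "(\<Sum>i\<in>UNIV. \<Sum>c\<in>insert b D. T (x(b := i)) (Transposition.transpose b c \<circ> q)) =
         (\<Sum>i\<in>UNIV. T (x(b := i)) q) + (\<Sum>c\<in>D. \<Sum>i\<in>UNIV. T (x(b := i)) (Transposition.transpose b c \<circ> q))"
        using D b by (simp add: sum.distrib) (rule sum.swap)
      also have "(\<Sum>i\<in>UNIV. T (x(b := i)) q) = trace (M b) * S M x q"
        by (simp add: t1[OF q] trace_def sum_distrib_right)
      also have "(\<Sum>c\<in>D. \<Sum>i\<in>UNIV. T (x(b := i)) (Transposition.transpose b c \<circ> q)) =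
         - (\<Sum>c\<in>D. S (M(inv q c := M (inv q c) ** M b)) x q)"
        by (simp add: t2[OF q] sum_negf)
      also have "(\<Sum>c\<in>D. S (M(inv q c := M (inv q c) ** M b)) x q) = (\<Sum>s\<in>D. S (M(s := M s ** M b)) x q)"
        using sum.permute[OF q, of "\<lambda>c. S (M(inv q c := M (inv q c) ** M b)) x q"]
        by (simp add: o_def permutes_inverses[OF q])
      finally show "(\<Sum>i\<in>UNIV. \<Sum>c\<in>insert b D. T (x(b := i)) (Transposition.transpose b c \<circ> q)) =
        trace (M b) * S M x q - (\<Sum>s\<in>D. S (M(s := M s ** M b)) x q)"
        by (simp only: diff_conv_add_uminus)
    qed
    finally show ?thesis by (simp add: sum_subtractf sum_distrib_left)
  qed
  have "cyc_sum (insert b D) M = (\<Sum>x\<in>PiE D (\<lambda>_. UNIV). \<Sum>i\<in>UNIV. \<Sum>p | p permutes insert b D. T (x(b := i)) p)"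
    unfolding cyc_sum_def T_def by (rule sum_PiE_insert[OF b D])
  also have "\<dots> = trace (M b) * cyc_sum D M -
      (\<Sum>x\<in>PiE D (\<lambda>_. UNIV). \<Sum>q | q permutes D. \<Sum>s\<in>D. S (M(s := M s ** M b)) x q)"
    unfolding x sum_subtractf cyc_sum_def S_def by (simp add: sum_distrib_left)
  also have "(\<Sum>x\<in>PiE D (\<lambda>_. UNIV). \<Sum>q | q permutes D. \<Sum>s\<in>D. S (M(s := M s ** M b)) x q) =
      (\<Sum>s\<in>D. cyc_sum D (M(s := M s ** M b)))"
    unfolding cyc_sum_def S_def by (rule sum_rotate3)
  finally show ?thesis .
qed

text \<open>With more positions than indices two positions carry the same index, and exchanging them reverses the sign.\<close>

lemma cyc_sum_zero:
  fixes M :: "nat \<Rightarrow> 'r::comm_ring_1^'i^'i::finite"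
  assumes no2: "\<And>z :: 'r. z = - z \<Longrightarrow> z = 0" and D: "finite D" "card D > CARD('i)"
  shows "cyc_sum D M = 0"
proof -
  have "(\<Sum>p | p permutes D. of_int (sign p) * (\<Prod>s\<in>D. M s $ x s $ x (p s))) = 0" (is "sum ?f _ = 0") for x :: "nat \<Rightarrow> 'i"
  proof -
    have "card (x ` D) \<le> CARD('i)" by (rule card_mono) auto
    then have "card (x ` D) < card D" using D by simp
    then have "\<not> inj_on x D" using card_image by fastforce
    then obtain a b where ab: "a \<in> D" "b \<in> D" "a \<noteq> b" "x a = x b" by (auto simp: inj_on_def)
    let ?t = "Transposition.transpose a b"
    have t: "?t permutes D" using ab by (intro permutes_swap_id) auto
    have xt: "x (?t s) = x s" for s using ab(4) by (auto simp: Transposition.transpose_def)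
    have "sum ?f {p. p permutes D} = (\<Sum>p | p permutes D. ?f (?t \<circ> p))"
      by (rule setum_permutations_compose_left[OF t])
    also have "\<dots> = (\<Sum>p | p permutes D. - ?f p)"
    proof (rule sum.cong[OF refl])
      fix p assume "p \<in> {p. p permutes D}"
      then have "sign (?t \<circ> p) = - sign p"
        using ab D by (subst sign_compose) (auto simp: sign_swap_id permutation_swap_id intro: permutation_permutes[THEN iffD2])
      then show "?f (?t \<circ> p) = - ?f p" by (simp add: xt)
    qed
    also have "\<dots> = - sum ?f {p. p permutes D}" by (rule sum_negf)
    finally show ?thesis by (rule no2)
  qed
  then show ?thesis by (simp add: cyc_sum_def)
qed

text \<open>When the power traces of \<open>Y\<close> vanish, only the cycles of full length survive, and each of the \<open>(card D)!\<close> of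
them gives the same trace.\<close>

lemma cyc_sum_powers:
  fixes Y Z :: "'r::comm_ring_1^'i^'i::finite"
  assumes tr: "\<And>k. k \<ge> 1 \<Longrightarrow> trace (mpow Y k) = 0"
    and "finite D" "a \<notin> D" "\<forall>s\<in>D. e s \<ge> 1"
  shows "cyc_sum (insert a D) (\<lambda>s. if s = a then Z ** mpow Y (e s) else mpow Y (e s)) =
    (- 1) ^ card D * of_nat (fact (card D)) * trace (Z ** mpow Y (\<Sum>s\<in>insert a D. e s))"
  using assms(2-)
proof (induction D arbitrary: e rule: finite_induct)
  case empty
  then show ?case using cyc_sum_insert[of "{}" a "\<lambda>s. if s = a then Z ** mpow Y (e s) else mpow Y (e s)"] by (simp add: cyc_sum_empty)
next
  case (insert b D)
  define M where "M e s = (if s = a then Z ** mpow Y (e s) else mpow Y (e s))" for e :: "nat \<Rightarrow> nat" and s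
  have ab: "a \<noteq> b" "a \<notin> D" using insert.prems by auto
  let ?D = "insert a D"
  have eq: "insert a (insert b D) = insert b ?D" by auto
  have bD: "b \<notin> ?D" using insert.hyps ab by auto
  have Mb: "M e b = mpow Y (e b)" using ab by (simp add: M_def)
  have upd: "(M e)(s := M e s ** M e b) = M (e(s := e s + e b))" for s
    unfolding Mb by (auto simp: M_def fun_eq_iff mpow_add matrix_mul_assoc)
  have IH: "cyc_sum ?D (M (e(s := e s + e b))) =
      (- 1) ^ card D * of_nat (fact (card D)) * trace (Z ** mpow Y (\<Sum>s\<in>insert b ?D. e s))" if s: "s \<in> ?D" for s
  proof -
    have sumeq: "(\<Sum>u\<in>?D. (e(s := e s + e b)) u) = (\<Sum>u\<in>insert b ?D. e u)"
    proof -
      have "(\<Sum>u\<in>?D. (e(s := e s + e b)) u) = (e s + e b) + (\<Sum>u\<in>?D - {s}. e u)"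
        using s insert.hyps by (subst sum.remove[of _ s]) auto
      also have "\<dots> = e b + (\<Sum>u\<in>?D. e u)"
        using s insert.hyps sum.remove[of ?D s e] by simp
      finally show ?thesis using bD insert.hyps by simp
    qed
    have "cyc_sum ?D (M (e(s := e s + e b))) =
      (- 1) ^ card D * of_nat (fact (card D)) * trace (Z ** mpow Y (\<Sum>u\<in>?D. (e(s := e s + e b)) u))"
      unfolding M_def using insert.IH[of "e(s := e s + e b)"] insert.prems ab by auto
    then show ?thesis unfolding sumeq .
  qed
  have "cyc_sum (insert b ?D) (M e) = trace (M e b) * cyc_sum ?D (M e) - (\<Sum>s\<in>?D. cyc_sum ?D ((M e)(s := M e s ** M e b)))"
    by (rule cyc_sum_insert) (use insert.hyps bD in auto)
  also have "trace (M e b) = 0" unfolding Mb using insert.prems by (intro tr) auto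
  also have "(\<Sum>s\<in>?D. cyc_sum ?D ((M e)(s := M e s ** M e b))) =
     of_nat (card ?D) * ((- 1) ^ card D * of_nat (fact (card D)) * trace (Z ** mpow Y (\<Sum>s\<in>insert b ?D. e s)))"
    unfolding upd by (simp add: IH)
  also have "card ?D = Suc (card D)" using insert.hyps ab by simp
  finally have "cyc_sum (insert b ?D) (M e) =
    (- 1) ^ Suc (card D) * of_nat (fact (Suc (card D))) * trace (Z ** mpow Y (\<Sum>s\<in>insert b ?D. e s))"
    by (simp add: algebra_simps)
  then show ?case using insert.hyps unfolding eq M_def by simp
qed

text \<open>For one more position than there are indices the sum over cycles is zero by \<open>cyc_sum_zero\<close>, and by
\<open>cyc_sum_powers\<close> it is a multiple of the trace of \<open>Z\<close> times the power of \<open>Y\<close>. Matrix units \<open>Z\<close> then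
pick out the entries.\<close>

theorem power_traces_zero_imp_nilpotent:
  fixes Y :: "'r::comm_ring_1^'i^'i::finite"
  assumes tr: "\<And>k. k \<ge> 1 \<Longrightarrow> trace (mpow Y k) = 0"
    and tf: "\<And>m (z :: 'r). m > 0 \<Longrightarrow> of_nat m * z = 0 \<Longrightarrow> z = 0"
  shows "mpow Y CARD('i) = 0"
proof -
  let ?N = "CARD('i)"
  have no2: "z = 0" if "z = - z" for z :: 'r
  proof -
    have "of_nat 2 * z = z + z" unfolding of_nat_numeral by (rule mult_2)
    also have "\<dots> = 0" using that by (metis add.right_inverse)
    finally show ?thesis by (rule tf[rotated]) simp
  qed
  have tr0: "trace (Z ** mpow Y ?N) = 0" for Z :: "'r^'i^'i"
  proof -
    \<comment> \<open>Position \<open>0\<close> carries \<open>Z\<close> alone, each of the other \<open>N\<close> positions one factor \<open>Y\<close>.\<close>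
    define e :: "nat \<Rightarrow> nat" where "e s = (if s = 0 then 0 else 1)" for s
    let ?D = "{1..?N}"
    have "cyc_sum (insert 0 ?D) (\<lambda>s. if s = 0 then Z ** mpow Y (e s) else mpow Y (e s)) =
      (- 1) ^ card ?D * of_nat (fact (card ?D)) * trace (Z ** mpow Y (\<Sum>s\<in>insert 0 ?D. e s))"
      by (rule cyc_sum_powers[OF tr]) (auto simp: e_def)
    moreover have "(\<Sum>s\<in>insert 0 ?D. e s) = ?N" by (simp add: e_def)
    moreover have "cyc_sum (insert 0 ?D) (\<lambda>s. if s = 0 then Z ** mpow Y (e s) else mpow Y (e s)) = 0"
      by (rule cyc_sum_zero[OF no2]) auto
    ultimately have "(- 1) ^ ?N * (of_nat (fact ?N) * trace (Z ** mpow Y ?N)) = 0" by (simp add: mult.assoc)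
    then have "of_nat (fact ?N) * trace (Z ** mpow Y ?N) = 0"
      by (cases "even ?N") simp_all
    then show ?thesis by (rule tf[rotated]) simp
  qed
  have "mpow Y ?N $ a $ b = 0" for a b
  proof -
    define Z :: "'r^'i^'i" where "Z = (\<chi> i j. if i = b \<and> j = a then 1 else 0)"
    have "trace (Z ** mpow Y ?N) = (\<Sum>i\<in>UNIV. \<Sum>k\<in>UNIV. if i = b then (if k = a then mpow Y ?N $ k $ i else 0) else 0)"
      unfolding trace_def matrix_matrix_mult_def Z_def by (auto intro!: sum.cong)
    also have "\<dots> = (\<Sum>i\<in>UNIV. if i = b then mpow Y ?N $ a $ i else 0)"
      by (rule sum.cong[OF refl]) simp
    also have "\<dots> = mpow Y ?N $ a $ b" by simp
    finally show ?thesis using tr0 by simp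
  qed
  then show ?thesis by (simp add: vec_eq_iff)
qed

section \<open>The commutative even part\<close>

text \<open>Elements of even degree commute with each other. The type \<open>even_ext\<close> below turns them into a commutative ring,
as the previous section requires.\<close>

definition even_part :: "'v::complex_vector ext set"
  where "even_part = cvs.span {wedge xs | xs. even (length xs)}"

lemma even_part_subspace: "cvs.subspace even_part"
  unfolding even_part_def by (rule cvs.subspace_span)

lemma even_part_induct [consumes 1, case_names zero wedge add scale]:
  assumes "x \<in> even_part" and "P 0" and "\<And>xs. even (length xs) \<Longrightarrow> P (wedge xs)"
    and "\<And>x y. P x \<Longrightarrow> P y \<Longrightarrow> P (x + y)" and "\<And>c x. P x \<Longrightarrow> P (c *\<^sub>C x)"
  shows "P x"
proof -
  have "x \<in> Collect P"
    by (rule cvs.span_induct[OF assms(1)[unfolded even_part_def]])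
      (use assms in \<open>auto simp: cvs.subspace_def\<close>)
  then show ?thesis by simp
qed

lemma wedge_in_even_part: "even (length xs) \<Longrightarrow> wedge xs \<in> even_part"
  unfolding even_part_def by (rule cvs.span_base) auto

lemma even_part_mult:
  assumes "x \<in> even_part" "y \<in> even_part"
  shows "x * y \<in> even_part"
  using assms(1)
proof (induction rule: even_part_induct)
  case (wedge xs)
  show ?case using assms(2)
  proof (induction rule: even_part_induct)
    case (wedge ys)
    then show ?case using \<open>even (length xs)\<close> by (simp add: wedge_append[symmetric] wedge_in_even_part)
  qed (simp_all add: distrib_left mult_scaleC_right cvs.subspace_add[OF even_part_subspace]
      cvs.subspace_scale[OF even_part_subspace] cvs.subspace_0[OF even_part_subspace])
qed (simp_all add: distrib_right mult_scaleC_left cvs.subspace_add[OF even_part_subspace]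
      cvs.subspace_scale[OF even_part_subspace] cvs.subspace_0[OF even_part_subspace])

lemma even_part_commute:
  assumes "x \<in> even_part" "y \<in> even_part"
  shows "x * y = y * x"
  using assms(1)
proof (induction rule: even_part_induct)
  case (wedge xs)
  show ?case using assms(2)
  proof (induction rule: even_part_induct)
    case (wedge ys)
    then show ?case using wedge_commute[of xs ys] by simp
  qed (simp_all add: distrib_left distrib_right mult_scaleC_right mult_scaleC_left)
qed (simp_all add: distrib_left distrib_right mult_scaleC_right mult_scaleC_left)

lemma even_power_in_even_part: "x \<in> ext_power V k \<Longrightarrow> even k \<Longrightarrow> x \<in> even_part"
  by (induction rule: ext_power_induct)
    (auto simp: wedge_in_even_part cvs.subspace_add[OF even_part_subspace]
      cvs.subspace_scale[OF even_part_subspace] cvs.subspace_0[OF even_part_subspace])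

typedef (overloaded) 'v even_ext = "even_part :: 'v::complex_vector ext set"
  using cvs.subspace_0[OF even_part_subspace] by blast

instantiation even_ext :: (complex_vector) comm_ring_1
begin
definition "0 = Abs_even_ext 0"
definition "1 = Abs_even_ext 1"
definition "x + y = Abs_even_ext (Rep_even_ext x + Rep_even_ext y)"
definition "x - y = Abs_even_ext (Rep_even_ext x - Rep_even_ext y)"
definition "- x = Abs_even_ext (- Rep_even_ext x)"
definition "x * y = Abs_even_ext (Rep_even_ext x * Rep_even_ext y)"

lemma Rep_even_ext_simps:
  "Rep_even_ext (0 :: 'a even_ext) = 0" "Rep_even_ext (1 :: 'a even_ext) = 1"
  "Rep_even_ext (x + y) = Rep_even_ext x + Rep_even_ext y"
  "Rep_even_ext (x - y) = Rep_even_ext x - Rep_even_ext y"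
  "Rep_even_ext (- x) = - Rep_even_ext (x :: 'a even_ext)"
  "Rep_even_ext (x * y) = Rep_even_ext x * Rep_even_ext y"
proof -
  note sub = even_part_subspace and R = Rep_even_ext
  have one: "(1 :: 'a ext) \<in> even_part" using wedge_in_even_part[of "[]"] by simp
  show "Rep_even_ext (0 :: 'a even_ext) = 0"
    unfolding zero_even_ext_def by (rule Abs_even_ext_inverse) (rule cvs.subspace_0[OF sub])
  show "Rep_even_ext (1 :: 'a even_ext) = 1"
    unfolding one_even_ext_def by (rule Abs_even_ext_inverse) (rule one)
  show "Rep_even_ext (x + y) = Rep_even_ext x + Rep_even_ext y"
    unfolding plus_even_ext_def by (rule Abs_even_ext_inverse) (intro cvs.subspace_add[OF sub] R)
  show "Rep_even_ext (x - y) = Rep_even_ext x - Rep_even_ext y"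
    unfolding minus_even_ext_def by (rule Abs_even_ext_inverse) (intro cvs.subspace_diff[OF sub] R)
  show "Rep_even_ext (- x) = - Rep_even_ext x"
    unfolding uminus_even_ext_def by (rule Abs_even_ext_inverse) (intro cvs.subspace_neg[OF sub] R)
  show "Rep_even_ext (x * y) = Rep_even_ext x * Rep_even_ext y"
    unfolding times_even_ext_def by (rule Abs_even_ext_inverse) (intro even_part_mult R)
qed

instance
  by standard
    (simp_all add: Rep_even_ext_inject[symmetric] Rep_even_ext_simps algebra_simps
      even_part_commute[OF Rep_even_ext Rep_even_ext])
end

section \<open>The Amitsur-Levitzki identity\<close>

lemma J_ext_trace: "(\<Sum>a\<in>UNIV. (M ** J_ext) $ a $ a) = (\<Sum>a\<in>UNIV. \<Sum>b\<in>UNIV. J_mat $ b $ a *\<^sub>C M $ a $ b)"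
  by (simp add: mult_scalar_mat_nth)

text \<open>Rosset's argument: the entries of \<open>X\<^sup>2\<close> are even, and the traces of its powers are traces of even powers of
\<open>X\<close>, which vanish by cyclicity. So the power of \<open>X\<^sup>2\<close> with exponent \<open>2n\<close>, the size of the matrix, is zero.\<close>

lemma gen_power_vanish: "gen_power (4 * CARD('n) - 1) = (0 :: ('n::finite + 'n) extmat)"
proof -
  let ?E = "\<lambda>A :: (('n + 'n) cmat even_ext)^('n + 'n)^('n + 'n). map_matrix Rep_even_ext A"
  have hom: "?E (A ** B) = ?E A ** ?E B" for A B
  proof -
    have "Rep_even_ext (\<Sum>i\<in>I. F i) = (\<Sum>i\<in>I. Rep_even_ext (F i))" for I and F :: "'n + 'n \<Rightarrow> ('n + 'n) cmat even_ext"
      by (induction I rule: infinite_finite_induct) (simp_all add: Rep_even_ext_simps)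
    then show ?thesis
      by (simp add: vec_eq_iff map_matrix_def matrix_matrix_mult_def Rep_even_ext_simps)
  qed
  define Q :: "('n + 'n) extmat" where "Q = gen_power 1 ** J_ext"
  have Q_even: "Q $ a $ b \<in> even_part" for a b
    unfolding Q_def mult_scalar_mat_nth
    by (intro cvs.subspace_sum[OF even_part_subspace] cvs.subspace_scale[OF even_part_subspace]
        even_power_in_even_part[OF gen_power_degree]) simp
  define Y :: "(('n + 'n) cmat even_ext)^('n + 'n)^('n + 'n)" where "Y = (\<chi> a b. Abs_even_ext (Q $ a $ b))"
  have EY: "?E Y = Q" by (simp add: vec_eq_iff map_matrix_def Y_def Abs_even_ext_inverse Q_even)
  have pow: "?E (mpow Y (Suc k)) = gen_power (2 * k + 1) ** J_ext" for k
  proof (induction k)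
    case 0
    have "?E (mat 1 ** Y) = Q" by (simp add: EY)
    then show ?case by (simp add: Q_def)
  next
    case (Suc k)
    have "?E (mpow Y (Suc (Suc k))) = gen_power (2 * k + 1) ** J_ext ** (gen_power 1 ** J_ext)"
      unfolding mpow.simps(2)[of Y "Suc k"] hom Suc EY Q_def ..
    also have "\<dots> = (gen_power (2 * k + 1) ** J_ext ** gen_power 1) ** J_ext" by (simp only: matrix_mul_assoc)
    also have "\<dots> = gen_power (2 * Suc k + 1) ** J_ext" unfolding gen_power_mult by simp
    finally show ?case .
  qed
  have tr: "trace (mpow Y k) = 0" if k: "k \<ge> 1" for k
  proof -
    from k obtain j where j: "k = Suc j" by (cases k) auto
    have "Rep_even_ext (trace (mpow Y k)) = (\<Sum>a\<in>UNIV. ?E (mpow Y k) $ a $ a)"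
    proof -
      have "Rep_even_ext (\<Sum>i\<in>I. F i) = (\<Sum>i\<in>I. Rep_even_ext (F i))" for I and F :: "'n + 'n \<Rightarrow> ('n + 'n) cmat even_ext"
        by (induction I rule: infinite_finite_induct) (simp_all add: Rep_even_ext_simps)
      then show ?thesis by (simp add: trace_def map_matrix_def)
    qed
    also have "\<dots> = (\<Sum>b\<in>UNIV. \<Sum>a\<in>UNIV. J_mat $ b $ a *\<^sub>C gen_power (2 * j + 1) $ a $ b)"
      unfolding j pow J_ext_trace by (rule sum.swap)
    also have "\<dots> = 0" unfolding power_trace_swapped by (simp add: power_trace_odd)
    finally show ?thesis by (metis Rep_even_ext_inject Rep_even_ext_simps(1))
  qed
  have tfree: "z = 0" if "m > 0" "of_nat m * z = 0" for m and z :: "('n + 'n) cmat even_ext"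
  proof -
    have Rn: "Rep_even_ext (of_nat m * z) = of_nat m *\<^sub>C Rep_even_ext z" for m
      by (induction m) (simp_all add: Rep_even_ext_simps cvs.scale_zero_left scaleC_add_left scaleC_one distrib_right)
    have "of_nat m *\<^sub>C Rep_even_ext z = 0" using Rn[of m] that(2) by (simp add: Rep_even_ext_simps)
    then have "(1 / of_nat m) *\<^sub>C of_nat m *\<^sub>C Rep_even_ext z = 0" by (metis scaleC_eq_0)
    then have "Rep_even_ext z = 0" using that(1) by (simp add: scaleC_scaleC scaleC_one)
    then show ?thesis by (metis Rep_even_ext_inject Rep_even_ext_simps(1))
  qed
  have "mpow Y CARD('n + 'n) = 0" by (rule power_traces_zero_imp_nilpotent[OF tr tfree])
  then have "mpow Y (2 * CARD('n)) = 0" by (simp add: mult_2)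
  moreover obtain m where m: "2 * CARD('n) = Suc m" using zero_less_card_finite[where 'a = 'n] by (metis gr0_implies_Suc nat_0_less_mult_iff zero_less_numeral)
  ultimately have "?E (mpow Y (Suc m)) = 0"
    by (simp add: vec_eq_iff map_matrix_def Rep_even_ext_simps del: mpow.simps)
  then have "gen_power (2 * m + 1) ** J_ext ** J_ext = (0 :: ('n + 'n) extmat) ** J_ext" unfolding pow by (simp only:)
  moreover have "J_ext ** J_ext = (scalar_mat (- mat 1) :: ('n + 'n) extmat)" by (simp add: scalar_mat_mult J_mat_mult_J_mat)
  ultimately have z: "gen_power (2 * m + 1) ** scalar_mat (- mat 1) = (0 :: ('n + 'n) extmat)"
    by (simp add: matrix_mul_assoc[symmetric])
  have "(M ** scalar_mat (- mat 1)) $ a $ b = - M $ a $ b" for M :: "('n + 'n) extmat" and a b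
  proof -
    have "(M ** scalar_mat (- mat 1)) $ a $ b = (\<Sum>k\<in>UNIV. if k = b then - M $ a $ k else 0)"
      unfolding mult_scalar_mat_nth by (intro sum.cong refl) (simp add: mat_def cvs.scale_minus_left scaleC_one cvs.scale_zero_left)
    then show ?thesis by simp
  qed
  then have "gen_power (2 * m + 1) = (0 :: ('n + 'n) extmat)" using z by (simp add: vec_eq_iff)
  moreover have "2 * m + 1 = 4 * CARD('n) - 1" using m by simp
  ultimately show ?thesis by (simp only:)
qed

lemma power_trace_vanish:
  assumes "k \<ge> 4 * CARD('n)"
  shows "power_trace k = (0 :: ('n::finite + 'n) cmat ext)"
proof -
  have "gen_power (4 * CARD('n) - 1 + j) = (0 :: ('n + 'n) extmat)" for j
  proof (induction j)
    case 0
    then show ?case using gen_power_vanish by simp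
  next
    case (Suc j)
    have "gen_power (4 * CARD('n) - 1 + Suc j) = (gen_power (4 * CARD('n) - 1 + j) :: ('n + 'n) extmat) ** J_ext ** gen_mat"
      by (simp only: add_Suc_right gen_power.simps)
    then show ?case unfolding Suc by (simp add: matrix_matrix_mult_def vec_eq_iff)
  qed
  from this[of "k - (4 * CARD('n) - 1)"] have "gen_power k = (0 :: ('n + 'n) extmat)" using assms by simp
  then show ?thesis by (simp add: power_trace_def)
qed

section \<open>The power traces are real\<close>

inductive_set real_ext :: "('n::finite + 'n) cmat ext set" where
  wedge: "set xs \<subseteq> herm_p \<Longrightarrow> of_real r *\<^sub>C wedge xs \<in> real_ext"
| add: "x \<in> real_ext \<Longrightarrow> y \<in> real_ext \<Longrightarrow> x + y \<in> real_ext"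

lemma real_ext_scale: "x \<in> real_ext \<Longrightarrow> of_real r *\<^sub>C x \<in> real_ext"
proof (induction rule: real_ext.induct)
  case (wedge xs s)
  then show ?case using real_ext.wedge[of xs "r * s"] by (simp add: scaleC_scaleC)
qed (simp add: scaleC_add_right real_ext.add)

lemma real_ext_diff: "x \<in> real_ext \<Longrightarrow> y \<in> real_ext \<Longrightarrow> x - y \<in> real_ext"
  using real_ext.add[of x "of_real (- 1) *\<^sub>C y"] real_ext_scale[of y "- 1"]
  by (simp add: cvs.scale_minus_left scaleC_one)

lemma real_ext_0: "0 \<in> real_ext" and real_ext_1: "1 \<in> real_ext"
  using real_ext.wedge[of "[]" 0] real_ext.wedge[of "[]" 1] by (simp_all add: scaleC_one cvs.scale_zero_left)

lemma real_ext_mult: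
  assumes "x \<in> real_ext" "y \<in> real_ext" shows "x * y \<in> real_ext"
  using assms(1)
proof (induction rule: real_ext.induct)
  case (wedge xs r)
  show ?case using assms(2)
  proof (induction rule: real_ext.induct)
    case (wedge ys s)
    then show ?case using real_ext.wedge[of "xs @ ys" "r * s"] \<open>set xs \<subseteq> herm_p\<close>
      by (simp add: wedge_append mult_scaleC_left mult_scaleC_right scaleC_scaleC mult.commute)
  qed (simp add: distrib_left real_ext.add)
qed (simp add: distrib_right real_ext.add)

lemma real_ext_form:
  assumes "x \<in> real_ext" "set ys \<subseteq> herm_p"
  shows "ext_form trace_form x (wedge ys) \<in> \<real>"
  using assms(1)
proof (induction rule: real_ext.induct)
  case (wedge xs r)
  have "trace_form x y \<in> \<real>" if "x \<in> herm_p" "y \<in> herm_p" for x y :: "('a + 'a) cmat"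
    using trace_form_herm[of x y] that by (simp add: herm_p_def)
  note r = this
  have "gram_det trace_form xs ys \<in> \<real>"
  proof (cases "length xs = length ys")
    case True
    have "trace_form (xs ! i) (ys ! p i) \<in> \<real>" if p: "p permutes {..<length ys}" and i: "i < length ys" for p i
    proof (rule r)
      have "p i < length ys" using permutes_in_image[OF p, of i] i by simp
      then show "ys ! p i \<in> herm_p" using assms(2) nth_mem by blast
      show "xs ! i \<in> herm_p" using wedge True i nth_mem[of i xs] by auto
    qed
    then show ?thesis unfolding gram_det_def
      by (auto intro!: sum_in_Reals Reals_mult Reals_of_int prod_in_Reals)
  qed (simp add: gram_det_def)
  then show ?case by (simp add: tf.form_scale_left tf.form_wedge)
qed (simp add: tf.form_add_left)

text \<open>Complex conjugation with respect to the real form. Taken as a relation it is compatible with sums and products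
directly from the definition.\<close>

definition conj_pair :: "('n::finite + 'n) cmat ext \<Rightarrow> ('n + 'n) cmat ext \<Rightarrow> bool"
  where "conj_pair x y \<longleftrightarrow> (\<exists>u\<in>real_ext. \<exists>v\<in>real_ext. x = u + \<i> *\<^sub>C v \<and> y = u - \<i> *\<^sub>C v)"

lemma conj_pair_add: "conj_pair x y \<Longrightarrow> conj_pair x' y' \<Longrightarrow> conj_pair (x + x') (y + y')"
proof -
  assume "conj_pair x y" "conj_pair x' y'"
  then obtain u v u' v' where *: "u \<in> real_ext" "v \<in> real_ext" "u' \<in> real_ext" "v' \<in> real_ext"
     "x = u + \<i> *\<^sub>C v" "y = u - \<i> *\<^sub>C v" "x' = u' + \<i> *\<^sub>C v'" "y' = u' - \<i> *\<^sub>C v'"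
    unfolding conj_pair_def by blast
  show ?thesis unfolding conj_pair_def
    by (rule bexI[of _ "u + u'"], rule bexI[of _ "v + v'"])
       (use * in \<open>auto simp: scaleC_add_right real_ext.add\<close>)
qed

lemma conj_pair_scale: "conj_pair x y \<Longrightarrow> conj_pair (of_real r *\<^sub>C x) (of_real r *\<^sub>C y)"
proof -
  assume "conj_pair x y"
  then obtain u v where *: "u \<in> real_ext" "v \<in> real_ext" "x = u + \<i> *\<^sub>C v" "y = u - \<i> *\<^sub>C v"
    unfolding conj_pair_def by blast
  show ?thesis unfolding conj_pair_def
    by (rule bexI[of _ "of_real r *\<^sub>C u"], rule bexI[of _ "of_real r *\<^sub>C v"])
       (use * in \<open>auto simp: scaleC_add_right cvs.scale_right_diff_distrib scaleC_scaleC mult.commute real_ext_scale\<close>)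
qed

lemma conj_pair_mult: "conj_pair x y \<Longrightarrow> conj_pair x' y' \<Longrightarrow> conj_pair (x * x') (y * y')"
proof -
  assume "conj_pair x y" "conj_pair x' y'"
  then obtain u v u' v' where *: "u \<in> real_ext" "v \<in> real_ext" "u' \<in> real_ext" "v' \<in> real_ext"
     "x = u + \<i> *\<^sub>C v" "y = u - \<i> *\<^sub>C v" "x' = u' + \<i> *\<^sub>C v'" "y' = u' - \<i> *\<^sub>C v'"
    unfolding conj_pair_def by blast
  have ii: "\<i> *\<^sub>C \<i> *\<^sub>C z = - z" for z :: "('a + 'a) cmat ext"
    by (simp add: scaleC_scaleC cvs.scale_minus_left scaleC_one)
  show ?thesis unfolding conj_pair_def
    by (rule bexI[of _ "u * u' - v * v'"], rule bexI[of _ "u * v' + v * u'"])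
       (use * in \<open>auto simp: algebra_simps mult_scaleC_left mult_scaleC_right scaleC_add_right ii
          intro!: real_ext.add real_ext_mult real_ext_diff\<close>)
qed

lemma conj_pair_sum: "(\<And>i. i \<in> I \<Longrightarrow> conj_pair (f i) (g i)) \<Longrightarrow> conj_pair (\<Sum>i\<in>I. f i) (\<Sum>i\<in>I. g i)"
proof (induction I rule: infinite_finite_induct)
  case (insert i I)
  then show ?case by (simp add: conj_pair_add)
qed (auto simp: conj_pair_def intro!: bexI[of _ 0] real_ext_0)

lemma conj_pair_self: "conj_pair x x \<Longrightarrow> x \<in> real_ext"
proof -
  assume "conj_pair x x"
  then obtain u v where *: "u \<in> real_ext" "v \<in> real_ext" "x = u + \<i> *\<^sub>C v" "x = u - \<i> *\<^sub>C v"
    unfolding conj_pair_def by blast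
  then have "\<i> *\<^sub>C v = - (\<i> *\<^sub>C v)" by (metis add_left_cancel diff_conv_add_uminus)
  then have "\<i> *\<^sub>C v = 0" by (rule double_eq_0_ext)
  then show ?thesis using * by simp
qed

lemma conj_pair_ext_inc:
  assumes "Z \<in> (p_space :: ('n::finite + 'n) cmat set)"
  shows "conj_pair (ext_inc Z) (ext_inc (conj_transpose Z))"
proof -
  interpret e: Vector_Spaces.linear scaleC scaleC ext_inc by (rule linear_ext_inc)
  obtain h k where hk: "h \<in> herm_p" "k \<in> herm_p" "Z = h + \<i> *\<^sub>C k" by (rule herm_p_complexify[OF assms])
  then have "conj_transpose Z = h - \<i> *\<^sub>C k"
    by (simp add: conj_transpose_add conj_transpose_scaleC herm_p_def cvs.scale_minus_left)
  moreover have "ext_inc h \<in> real_ext" if "h \<in> herm_p" for h :: "('n + 'n) cmat"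
    using real_ext.wedge[of "[h]" 1] that by (simp add: scaleC_one)
  ultimately show ?thesis
    unfolding conj_pair_def using hk
    by (intro bexI[of _ "ext_inc h"] bexI[of _ "ext_inc k"]) (auto simp: e.add e.diff e.scale)
qed

lemma conj_transpose_p_gen: "conj_transpose (p_gen a b) = (eps a * eps b) *\<^sub>C p_gen (hat a) (hat b)"
  by (simp add: vec_eq_iff p_gen_def mult_J_nth munit_nth hat_eq_iff)

lemma J_mat_hat: "J_mat $ c $ d * (eps c * eps d) = J_mat $ hat c $ hat d"
  by (auto simp: J_nth hat_eq_iff)

lemma J_mat_real: "J_mat $ c $ d = of_real (Re (J_mat $ c $ d))"
  by (cases c; cases d) (auto simp: J_mat_def)

lemma sum_hat2: "(\<Sum>c\<in>UNIV. \<Sum>d\<in>UNIV. F (hat c) (hat d)) = (\<Sum>c\<in>UNIV. \<Sum>d\<in>UNIV. F (c :: 'n::finite + 'n) (d :: 'n + 'n))"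
  unfolding sum_hat[of "\<lambda>d. F (hat _) d"] by (rule sum_hat)

text \<open>Conjugation changes both indices by \<open>hat\<close> and is multiplicative, so the case of \<open>gen_mat\<close> propagates; the
signs of the inner indices are absorbed by \<open>J\<close>.\<close>

lemma gen_power_conj: "conj_pair (gen_power k $ a $ b) ((eps a * eps b) *\<^sub>C gen_power k $ hat a $ hat b)"
proof (induction k arbitrary: a b)
  case 0
  interpret e: Vector_Spaces.linear scaleC scaleC ext_inc by (rule linear_ext_inc)
  show ?case using conj_pair_ext_inc[OF p_gen_in_p(1)[of a b]]
    by (simp add: gen_mat_def conj_transpose_p_gen e.scale)
next
  case (Suc k)
  have Y: "conj_pair (gen_mat $ d $ b) ((eps d * eps b) *\<^sub>C gen_mat $ hat d $ hat b)" for d b :: "'a + 'a"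
  proof -
    interpret e: Vector_Spaces.linear scaleC scaleC ext_inc by (rule linear_ext_inc)
    show ?thesis using conj_pair_ext_inc[OF p_gen_in_p(1)[of d b]]
      by (simp add: gen_mat_def conj_transpose_p_gen e.scale)
  qed
  have "conj_pair (gen_power (Suc k) $ a $ b)
    (\<Sum>c\<in>UNIV. \<Sum>d\<in>UNIV. J_mat $ c $ d *\<^sub>C (((eps a * eps c) *\<^sub>C gen_power k $ hat a $ hat c) * ((eps d * eps b) *\<^sub>C gen_mat $ hat d $ hat b)))"
    unfolding gen_power.simps triple_nth
    by (intro conj_pair_sum, subst (1 2) J_mat_real, intro conj_pair_scale conj_pair_mult Suc Y)
  also have "(\<Sum>c\<in>UNIV. \<Sum>d\<in>UNIV. J_mat $ c $ d *\<^sub>C (((eps a * eps c) *\<^sub>C gen_power k $ hat a $ hat c) * ((eps d * eps b) *\<^sub>C gen_mat $ hat d $ hat b)))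
     = (\<Sum>c\<in>UNIV. \<Sum>d\<in>UNIV. (eps a * eps b) *\<^sub>C (J_mat $ hat c $ hat d *\<^sub>C (gen_power k $ hat a $ hat c * gen_mat $ hat d $ hat b)))"
    unfolding J_mat_hat[symmetric]
    by (intro sum.cong refl) (simp add: mult_scaleC_left mult_scaleC_right scaleC_scaleC mult_ac)
  also have "\<dots> = (\<Sum>c\<in>UNIV. \<Sum>d\<in>UNIV. (eps a * eps b) *\<^sub>C (J_mat $ c $ d *\<^sub>C (gen_power k $ hat a $ c * gen_mat $ d $ hat b)))"
    by (rule sum_hat2)
  also have "\<dots> = (eps a * eps b) *\<^sub>C gen_power (Suc k) $ hat a $ hat b"
    unfolding gen_power.simps triple_nth sum_scaleC_right ..
  finally show ?case .
qed

lemma power_trace_real: "power_trace k \<in> real_ext"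
proof (rule conj_pair_self)
  have "conj_pair (power_trace k) (\<Sum>a\<in>UNIV. \<Sum>b\<in>UNIV. J_mat $ a $ b *\<^sub>C ((eps a * eps b) *\<^sub>C gen_power k $ hat a $ hat b))"
    unfolding power_trace_def by (intro conj_pair_sum, subst (1 2) J_mat_real, intro conj_pair_scale gen_power_conj)
  also have "(\<Sum>a\<in>UNIV. \<Sum>b\<in>UNIV. J_mat $ a $ b *\<^sub>C ((eps a * eps b) *\<^sub>C gen_power k $ hat a $ hat b)) =
      (\<Sum>a\<in>UNIV. \<Sum>b\<in>UNIV. J_mat $ hat a $ hat b *\<^sub>C gen_power k $ hat a $ hat b)"
    unfolding scaleC_scaleC J_mat_hat ..
  also have "\<dots> = power_trace k" unfolding power_trace_def by (rule sum_hat2)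
  finally show "conj_pair (power_trace k) (power_trace k)" .
qed

section \<open>Definiteness of the form on real subspaces\<close>

definition coord :: "('n::finite + 'n) cmat list \<Rightarrow> nat \<Rightarrow> ('n + 'n) cmat ext \<Rightarrow> (nat \<Rightarrow> nat) \<Rightarrow> complex"
  where "coord bs k x h = ext_form trace_form x (wedge (map (\<lambda>i. bs ! h i) [0..<k]))"

abbreviation tuples :: "('n::finite + 'n) cmat list \<Rightarrow> nat \<Rightarrow> (nat \<Rightarrow> nat) set"
  where "tuples bs k \<equiv> PiE {..<k} (\<lambda>_. {..<length bs})"

lemma coord_expand:
  assumes "herm_basis bs" "y \<in> ext_power p_space k"
  shows "(\<Sum>h\<in>tuples bs k. coord bs k y h *\<^sub>C wedge (map (\<lambda>i. bs ! h i) [0..<k])) = of_nat (fact k) *\<^sub>C y"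
  unfolding coord_def by (rule tf.reconstruct[OF _ herm_basisD(5)[OF assms(1)] assms(2)]) auto

lemma coord_form:
  assumes "herm_basis bs" "y \<in> ext_power p_space k"
  shows "(\<Sum>h\<in>tuples bs k. coord bs k x h * coord bs k y h) = of_nat (fact k) * ext_form trace_form x y"
proof -
  have "of_nat (fact k) * ext_form trace_form x y = ext_form trace_form x (of_nat (fact k) *\<^sub>C y)"
    by (simp add: tf.form_scale_right)
  also have "\<dots> = (\<Sum>h\<in>tuples bs k. coord bs k x h * coord bs k y h)"
    unfolding coord_expand[OF assms, symmetric] tf.form_sum_right tf.form_scale_right
    by (simp add: coord_def mult.commute)
  finally show ?thesis ..
qed

lemma coord_real:
  assumes bs: "herm_basis bs" and "x \<in> real_ext" "h \<in> tuples bs k"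
  shows "cnj (coord bs k x h) = coord bs k x h"
proof -
  have "h i < length bs" if "i < k" for i using assms(3) that by auto
  then have "set (map (\<lambda>i. bs ! h i) [0..<k]) \<subseteq> herm_p"
    using bs by (auto simp: herm_basis_def)
  then show ?thesis using real_ext_form[OF assms(2)] unfolding coord_def by (metis Reals_cnj_iff)
qed

lemma coord_add: "coord bs k (x + y) h = coord bs k x h + coord bs k y h"
  and coord_scale: "coord bs k (c *\<^sub>C x) h = c * coord bs k x h"
  and coord_zero: "coord bs k 0 h = 0"
  by (simp_all add: coord_def tf.form_add_left tf.form_scale_left)

text \<open>Orthogonal projection for the Hermitian product of coordinates: against a real element, whose coordinates are
real, that product is \<open>k!\<close> times the bilinear form.\<close>

lemma real_span_projection_exists:
  fixes G :: "('n::finite + 'n) cmat ext set"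
  assumes G: "G \<subseteq> real_ext \<inter> ext_power p_space k"
  shows "\<exists>d\<in>cvs.span G. \<forall>y\<in>G. ext_form trace_form (t - d) y = 0"
proof -
  obtain bs :: "('n + 'n) cmat list" where bs: "herm_basis bs" using herm_basis_exists by blast
  define P where "P g \<longleftrightarrow> (\<exists>y\<in>cvs.span G. g = coord bs k y)" for g
  have "\<exists>b. P b \<and> (\<forall>g. P g \<longrightarrow> (\<Sum>w\<in>tuples bs k. (coord bs k t w - b w) * cnj (g w)) = 0)"
  proof (rule orthogonal_projection_exists)
    show "finite (tuples bs k)" by (intro finite_PiE) auto
    show "P (\<lambda>x. 0)" unfolding P_def by (intro bexI[of _ 0]) (auto simp: coord_zero cvs.span_zero)
    show "P (\<lambda>x. f x + g x)" if fg: "P f" "P g" for f g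
    proof -
      from fg obtain y z where "y \<in> cvs.span G" "z \<in> cvs.span G" "f = coord bs k y" "g = coord bs k z"
        unfolding P_def by blast
      then show ?thesis unfolding P_def by (intro bexI[of _ "y + z"]) (auto simp: coord_add cvs.span_add)
    qed
    show "P (\<lambda>x. c * f x)" if f: "P f" for c f
    proof -
      from f obtain y where "y \<in> cvs.span G" "f = coord bs k y" unfolding P_def by blast
      then show ?thesis unfolding P_def by (intro bexI[of _ "c *\<^sub>C y"]) (auto simp: coord_scale cvs.span_scale)
    qed
  qed
  then obtain d where d: "d \<in> cvs.span G"
     "\<And>y. y \<in> cvs.span G \<Longrightarrow> (\<Sum>w\<in>tuples bs k. (coord bs k t w - coord bs k d w) * cnj (coord bs k y w)) = 0"
    unfolding P_def by blast
  have "ext_form trace_form (t - d) y = 0" if y: "y \<in> G" for y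
  proof -
    have yG: "y \<in> real_ext" "y \<in> ext_power p_space k" using y G by auto
    have "of_nat (fact k) * ext_form trace_form (t - d) y = (\<Sum>h\<in>tuples bs k. coord bs k (t - d) h * coord bs k y h)"
      by (rule coord_form[OF bs yG(2), symmetric])
    also have "\<dots> = (\<Sum>w\<in>tuples bs k. (coord bs k t w - coord bs k d w) * cnj (coord bs k y w))"
      by (intro sum.cong refl) (simp add: coord_real[OF bs yG(1)], simp add: coord_def tf.form_diff_left)
    also have "\<dots> = 0" by (rule d(2)[OF cvs.span_base[OF y]])
    finally show ?thesis by simp
  qed
  then show ?thesis using d(1) by blast
qed

text \<open>The coordinates of the members of \<open>G\<close> are real, so \<open>s\<close> is orthogonal to \<open>G\<close> also for the Hermitian product of
coordinates, which is positive. Hence it is orthogonal to itself, and \<open>reconstruct\<close> recovers it from its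
coordinates.\<close>

lemma form_nondegenerate_on_real_span:
  fixes G :: "('n::finite + 'n) cmat ext set"
  assumes G: "G \<subseteq> real_ext \<inter> ext_power p_space k" and s: "s \<in> cvs.span G"
    and orth: "\<And>y. y \<in> G \<Longrightarrow> ext_form trace_form s y = 0"
  shows "s = 0"
proof -
  obtain bs :: "('n + 'n) cmat list" where bs: "herm_basis bs" using herm_basis_exists by blast
  have fin: "finite (tuples bs k)" by (intro finite_PiE) auto
  let ?P = "\<lambda>z. (\<Sum>h\<in>tuples bs k. coord bs k s h * cnj (coord bs k z h)) = 0"
  have sub: "cvs.subspace {z. ?P z}"
    unfolding cvs.subspace_def
    by (auto simp: coord_zero coord_add coord_scale distrib_left sum.distrib mult.left_commute
        sum_distrib_left[symmetric])
  have base: "?P y" if "y \<in> G" for y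
  proof -
    have yG: "y \<in> real_ext" "y \<in> ext_power p_space k" using that G by auto
    have "(\<Sum>h\<in>tuples bs k. coord bs k s h * cnj (coord bs k y h)) = (\<Sum>h\<in>tuples bs k. coord bs k s h * coord bs k y h)"
      by (intro sum.cong refl) (simp add: coord_real[OF bs yG(1)])
    also have "\<dots> = 0" by (simp add: coord_form[OF bs yG(2)] orth[OF that])
    finally show ?thesis .
  qed
  have "?P s" by (rule cvs.span_induct[OF s sub base])
  then have "complex_of_real (\<Sum>h\<in>tuples bs k. (cmod (coord bs k s h))\<^sup>2) = 0"
    by (simp only: of_real_sum complex_norm_square)
  then have "(\<Sum>h\<in>tuples bs k. (cmod (coord bs k s h))\<^sup>2) = 0" by (simp only: of_real_eq_0_iff)
  then have z: "coord bs k s h = 0" if "h \<in> tuples bs k" for h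
    using that fin by (simp add: sum_nonneg_eq_0_iff)
  have "G \<subseteq> ext_power p_space k" using G by blast
  then have "s \<in> ext_power p_space k" using s cvs.span_minimal[OF _ ext_power_subspace] by blast
  then have "of_nat (fact k) *\<^sub>C s = 0"
    using coord_expand[OF bs, of s k] z by (simp add: cvs.scale_zero_left)
  then have "(1 / of_nat (fact k)) *\<^sub>C of_nat (fact k) *\<^sub>C s = 0" by (simp only: scaleC_eq_0)
  then show ?thesis by (simp add: scaleC_scaleC scaleC_one)
qed

section \<open>Anticommuting families\<close>

lemma span_image_expand:
  assumes "finite I" "x \<in> cvs.span (f ` I)"
  shows "\<exists>c. x = (\<Sum>i\<in>I. c i *\<^sub>C (f i :: 'a::complex_vector))"
  using assms
proof (induction I arbitrary: x rule: finite_induct)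
  case empty
  then show ?case by simp
next
  case (insert i I)
  then obtain k where "x - k *\<^sub>C f i \<in> cvs.span (f ` I)" using cvs.span_breakdown_eq[of x "f i" "f ` I"] by auto
  then obtain c where c: "x - k *\<^sub>C f i = (\<Sum>i\<in>I. c i *\<^sub>C f i)" using insert.IH by blast
  have "(\<Sum>j\<in>I. (c(i := k)) j *\<^sub>C f j) = (\<Sum>i\<in>I. c i *\<^sub>C f i)"
    using insert.hyps by (intro sum.cong) auto
  then have "x = (\<Sum>j\<in>insert i I. (c(i := k)) j *\<^sub>C f j)"
    using insert.hyps c by (simp add: algebra_simps del: fun_upd_apply) (simp add: algebra_simps)
  then show ?case by blast
qed

text \<open>The squares of the \<open>a i\<close> vanish as well. The instances are families of odd elements in an exterior algebra.\<close>

locale anticommuting_family =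
  fixes a :: "nat \<Rightarrow> 'a::complex_algebra_1" and n :: nat
  assumes anticommute: "i \<in> {1..n} \<Longrightarrow> j \<in> {1..n} \<Longrightarrow> a i * a j = - (a j * a i)"
begin

lemma square_zero: "i \<in> {1..n} \<Longrightarrow> a i * a i = 0"
  using anticommute[of i i] double_eq_0_ext by auto

definition aprod :: "nat set \<Rightarrow> 'a"
  where "aprod S = prod_list (map a (sorted_list_of_set S))"

definition alg :: "'a set" where "alg = cvs.span (aprod ` Pow {1..n})"

lemma aprod_empty [simp]: "aprod {} = 1" by (simp add: aprod_def)
lemma aprod_singleton [simp]: "aprod {i} = a i" by (simp add: aprod_def)

lemma mult_insort:
  "i \<in> {1..n} \<Longrightarrow> set xs \<subseteq> {1..n} \<Longrightarrow>
    \<exists>c\<in>{1, - 1}. a i * prod_list (map a xs) = c *\<^sub>C prod_list (map a (insort i xs))"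
proof (induction xs)
  case (Cons x xs)
  then have "\<exists>c\<in>{1, - 1}. a i * prod_list (map a xs) = c *\<^sub>C prod_list (map a (insort i xs))"
    by simp
  then obtain c where c: "c \<in> {1, - 1}" "a i * prod_list (map a xs) = c *\<^sub>C prod_list (map a (insort i xs))"
    by blast
  show ?case
  proof (cases "i \<le> x")
    case True
    then show ?thesis by (auto simp: scaleC_one)
  next
    case False
    have "a i * prod_list (map a (x # xs)) = - (a x * (a i * prod_list (map a xs)))"
      using anticommute[of i x] Cons.prems by (simp add: mult.assoc[symmetric])
    also have "\<dots> = (- c) *\<^sub>C prod_list (map a (insort i (x # xs)))"
      unfolding c(2) using False by (simp add: mult_scaleC_right cvs.scale_minus_left)
    finally have "a i * prod_list (map a (x # xs)) = (- c) *\<^sub>C prod_list (map a (insort i (x # xs)))" .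
    moreover have "- c \<in> {1, - 1}" using c(1) by auto
    ultimately show ?thesis by blast
  qed
qed (auto simp: scaleC_one)

lemma mult_member_zero:
  "i \<in> set xs \<Longrightarrow> set xs \<subseteq> {1..n} \<Longrightarrow> a i * prod_list (map a xs) = 0"
proof (induction xs)
  case (Cons x xs)
  show ?case
  proof (cases "i = x")
    case True
    then show ?thesis using square_zero[of x] Cons.prems by (simp add: mult.assoc[symmetric])
  next
    case False
    then have "a i * prod_list (map a (x # xs)) = - (a x * (a i * prod_list (map a xs)))"
      using anticommute[of i x] Cons.prems by (auto simp: mult.assoc[symmetric])
    then show ?thesis using Cons False by simp
  qed
qed simp

lemma aprod_insert:
  assumes "i \<in> {1..n}" "S \<subseteq> {1..n}" "i \<notin> S"
  shows "\<exists>c\<in>{1, - 1}. a i * aprod S = c *\<^sub>C aprod (insert i S)"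
proof -
  have "finite S" using assms(2) finite_subset by blast
  then show ?thesis using mult_insort[OF assms(1), of "sorted_list_of_set S"] assms(2,3)
    by (simp add: aprod_def sorted_list_of_set_insert)
qed

lemma aprod_member: "i \<in> S \<Longrightarrow> S \<subseteq> {1..n} \<Longrightarrow> a i * aprod S = 0"
  unfolding aprod_def using finite_subset[of S "{1..n}"] by (intro mult_member_zero) auto

lemma prod_list_aprod:
  "set xs \<subseteq> {1..n} \<Longrightarrow> (\<not> distinct xs \<longrightarrow> prod_list (map a xs) = 0) \<and>
    (distinct xs \<longrightarrow> (\<exists>c\<in>{1, - 1}. prod_list (map a xs) = c *\<^sub>C aprod (set xs)))"
proof (induction xs)
  case (Cons x xs)
  then have x: "x \<in> {1..n}" "set xs \<subseteq> {1..n}" by auto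
  note IH = Cons.IH[OF x(2)]
  show ?case
  proof (cases "distinct xs")
    case False
    then show ?thesis using IH by simp
  next
    case True
    then obtain c where c: "c \<in> {1, - 1}" "prod_list (map a xs) = c *\<^sub>C aprod (set xs)" using IH by blast
    show ?thesis
    proof (cases "x \<in> set xs")
      case True
      then show ?thesis using c aprod_member[OF True x(2)] by (simp add: mult_scaleC_right)
    next
      case False
      obtain d where "d \<in> {1, - 1}" "a x * aprod (set xs) = d *\<^sub>C aprod (insert x (set xs))"
        using aprod_insert[OF x False] by blast
      then have "c * d \<in> {1, - 1}" "prod_list (map a (x # xs)) = (c * d) *\<^sub>C aprod (set (x # xs))"
        using c by (auto simp: mult_scaleC_right scaleC_scaleC)
      then show ?thesis using \<open>distinct xs\<close> False by auto
    qed
  qed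
qed (auto simp: scaleC_one)

lemma aprod_mult:
  assumes "S \<subseteq> {1..n}" "T \<subseteq> {1..n}"
  shows "S \<inter> T \<noteq> {} \<Longrightarrow> aprod S * aprod T = 0"
    and "S \<inter> T = {} \<Longrightarrow> \<exists>c\<in>{1, - 1}. aprod S * aprod T = c *\<^sub>C aprod (S \<union> T)"
proof -
  have fin: "finite S" "finite T" using assms finite_subset by blast+
  let ?xs = "sorted_list_of_set S @ sorted_list_of_set T"
  have "aprod S * aprod T = prod_list (map a ?xs)" by (simp add: aprod_def)
  moreover have "set ?xs = S \<union> T" "distinct ?xs \<longleftrightarrow> S \<inter> T = {}" using fin by auto
  moreover have "set ?xs \<subseteq> {1..n}" using fin assms by auto
  ultimately show "S \<inter> T \<noteq> {} \<Longrightarrow> aprod S * aprod T = 0"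
    and "S \<inter> T = {} \<Longrightarrow> \<exists>c\<in>{1, - 1}. aprod S * aprod T = c *\<^sub>C aprod (S \<union> T)"
    using prod_list_aprod[of ?xs] by auto
qed

lemma aprod_in_alg: "S \<subseteq> {1..n} \<Longrightarrow> aprod S \<in> alg"
  unfolding alg_def by (rule cvs.span_base) auto

lemma alg_subspace: "cvs.subspace alg" unfolding alg_def by (rule cvs.subspace_span)

lemma one_in_alg: "1 \<in> alg" using aprod_in_alg[of "{}"] by simp

lemma gen_in_alg: "i \<in> {1..n} \<Longrightarrow> a i \<in> alg" using aprod_in_alg[of "{i}"] by simp

lemma alg_minimal: "cvs.subspace V \<Longrightarrow> (\<And>S. S \<subseteq> {1..n} \<Longrightarrow> aprod S \<in> V) \<Longrightarrow> alg \<subseteq> V"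
  unfolding alg_def by (rule cvs.span_minimal) auto

lemma alg_mult: "x \<in> alg \<Longrightarrow> y \<in> alg \<Longrightarrow> x * y \<in> alg"
proof -
  assume x: "x \<in> alg" and y: "y \<in> alg"
  have 1: "aprod S * aprod T \<in> alg" if st: "S \<subseteq> {1..n}" "T \<subseteq> {1..n}" for S T
  proof (cases "S \<inter> T = {}")
    case True
    then obtain c where "aprod S * aprod T = c *\<^sub>C aprod (S \<union> T)" using aprod_mult(2)[OF st] by blast
    then show ?thesis using st by (simp add: cvs.subspace_scale[OF alg_subspace] aprod_in_alg)
  next
    case False
    then show ?thesis using aprod_mult(1)[OF st] by (simp add: cvs.subspace_0[OF alg_subspace])
  qed
  have 2: "alg \<subseteq> {y. aprod S * y \<in> alg}" if "S \<subseteq> {1..n}" for S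
    using 1[OF that] by (intro alg_minimal)
      (auto simp: cvs.subspace_def distrib_left mult_scaleC_right cvs.subspace_0[OF alg_subspace]
        cvs.subspace_add[OF alg_subspace] cvs.subspace_scale[OF alg_subspace])
  have "alg \<subseteq> {x. x * y \<in> alg}"
    using 2 y by (intro alg_minimal)
      (auto simp: cvs.subspace_def distrib_right mult_scaleC_left cvs.subspace_0[OF alg_subspace]
        cvs.subspace_add[OF alg_subspace] cvs.subspace_scale[OF alg_subspace])
  then show ?thesis using x by blast
qed

lemma prod_list_in_alg: "(\<And>x. x \<in> set xs \<Longrightarrow> x \<in> alg) \<Longrightarrow> prod_list xs \<in> alg"
  by (induction xs) (auto simp: one_in_alg alg_mult)

lemma alg_expand:
  assumes "x \<in> alg"
  obtains c where "x = (\<Sum>S\<in>Pow {1..n}. c S *\<^sub>C aprod S)"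
  using span_image_expand[of "Pow {1..n}" x aprod] assms unfolding alg_def by auto

text \<open>Let \<open>S0\<close> be a set of least size with a nonzero coefficient and multiply the relation by the product over the
complement of \<open>S0\<close>. Any other \<open>S\<close> with a nonzero coefficient meets this complement, so only the product of all
generators is left.\<close>

lemma aprod_independent:
  assumes full: "aprod {1..n} \<noteq> 0" and sum0: "(\<Sum>S\<in>Pow {1..n}. c S *\<^sub>C aprod S) = 0"
    and T: "T \<subseteq> {1..n}"
  shows "c T = 0"
proof (rule ccontr)
  assume "c T \<noteq> 0"
  then have "\<exists>S. (S \<subseteq> {1..n} \<and> c S \<noteq> 0) \<and> (\<forall>S'. S' \<subseteq> {1..n} \<and> c S' \<noteq> 0 \<longrightarrow> card S \<le> card S')"
    using T by (intro ex_has_least_nat) auto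
  then obtain S0 where S0: "S0 \<subseteq> {1..n}" "c S0 \<noteq> 0" "\<And>S'. S' \<subseteq> {1..n} \<Longrightarrow> c S' \<noteq> 0 \<Longrightarrow> card S0 \<le> card S'"
    by blast
  let ?C = "{1..n} - S0"
  have "\<exists>d\<in>{1, - 1}. aprod S0 * aprod ?C = d *\<^sub>C aprod (S0 \<union> ?C)"
    by (rule aprod_mult(2)) (use S0 in auto)
  then obtain d where d: "d \<in> {1, - 1}" "aprod S0 * aprod ?C = d *\<^sub>C aprod (S0 \<union> ?C)" by blast
  have un: "S0 \<union> ?C = {1..n}" using S0(1) by auto
  have "0 = (\<Sum>S\<in>Pow {1..n}. c S *\<^sub>C aprod S) * aprod ?C" unfolding sum0 by simp
  also have "\<dots> = (\<Sum>S\<in>Pow {1..n}. c S *\<^sub>C (aprod S * aprod ?C))"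
    by (simp add: sum_distrib_right mult_scaleC_left)
  also have "\<dots> = (\<Sum>S\<in>{S0}. c S *\<^sub>C (aprod S * aprod ?C))"
  proof (rule sum.mono_neutral_right)
    show "\<forall>S\<in>Pow {1..n} - {S0}. c S *\<^sub>C (aprod S * aprod ?C) = 0"
    proof
      fix S assume S: "S \<in> Pow {1..n} - {S0}"
      show "c S *\<^sub>C (aprod S * aprod ?C) = 0"
      proof (cases "c S = 0")
        case True
        then show ?thesis by (simp add: cvs.scale_zero_left)
      next
        case False
        then have "card S0 \<le> card S" using S0(3)[of S] S by auto
        have "\<not> S \<subseteq> S0"
        proof
          assume "S \<subseteq> S0"
          then have "S = S0" using \<open>card S0 \<le> card S\<close> S0(1) by (intro card_seteq) (auto intro: finite_subset)
          then show False using S by blast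
        qed
        then have "S \<inter> ?C \<noteq> {}" using S by auto
        then show ?thesis using aprod_mult(1)[of S ?C] S by simp
      qed
    qed
  qed (use S0 in auto)
  also have "\<dots> = (c S0 * d) *\<^sub>C aprod {1..n}" using d un by (simp add: scaleC_scaleC)
  finally have "(c S0 * d) *\<^sub>C aprod {1..n} = 0" ..
  then show False using S0(2) d(1) full by (auto simp: cvs.scale_eq_0_iff)
qed

end

section \<open>The algebra of invariants\<close>

definition degree_sum :: "nat set \<Rightarrow> nat" where "degree_sum S = (\<Sum>i\<in>S. 4 * i - 3)"

lemma degree_sum_full: "degree_sum {1..n} = n * (2 * n - 1)"
proof (induction n)
  case (Suc n)
  have "degree_sum {1..Suc n} = degree_sum {1..n} + (4 * Suc n - 3)" by (simp add: degree_sum_def)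
  also have "\<dots> = Suc n * (2 * Suc n - 1)" using Suc by (cases n) (auto simp: algebra_simps)
  finally show ?case .
qed (simp add: degree_sum_def)

locale odd_generators =
  fixes a :: "nat \<Rightarrow> ('n::finite + 'n) cmat ext"
  assumes degree: "i \<in> {1..CARD('n)} \<Longrightarrow> a i \<in> ext_power p_space (4 * i - 3)"
begin

sublocale anticommuting_family a "CARD('n)"
proof
  fix i j assume i: "i \<in> {1..CARD('n)}" and j: "j \<in> {1..CARD('n)}"
  have "odd (4 * i - 3)" "odd (4 * j - 3)" using i j by auto
  then show "a i * a j = - (a j * a i)"
    using ext_power_commute[OF degree[OF i] degree[OF j]] by simp
qed

lemma aprod_degree: "S \<subseteq> {1..CARD('n)} \<Longrightarrow> aprod S \<in> ext_power p_space (degree_sum S)"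
proof -
  assume S: "S \<subseteq> {1..CARD('n)}"
  then have fin: "finite S" using finite_subset by blast
  have "prod_list (map a xs) \<in> ext_power p_space (sum_list (map (\<lambda>i. 4 * i - 3) xs))"
    if "set xs \<subseteq> {1..CARD('n)}" for xs
    using that
  proof (induction xs)
    case (Cons x xs)
    then show ?case using ext_power_mult[OF degree Cons.IH] by simp
  qed (simp add: one_in_ext_power)
  from this[of "sorted_list_of_set S"] show ?thesis
    using S fin by (simp add: aprod_def degree_sum_def sum_list_distinct_conv_sum_set)
qed

end

lemma ext_p_inv_subspace: "cvs.subspace (ext_p_inv :: ('n::finite + 'n) cmat ext set)"
  unfolding cvs.subspace_def ext_p_inv_def ext_algebra_def
  by (auto simp: ext_map_rules[OF linear_Ad] ext_map_zero[OF linear_Ad]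
      intro: cvs.span_zero cvs.span_add cvs.span_scale)

lemma ext_algebra_mult:
  assumes "x \<in> ext_algebra V" "y \<in> ext_algebra V" shows "x * y \<in> ext_algebra V"
proof -
  let ?W = "{wedge xs |xs. set xs \<subseteq> V}"
  have 1: "u * v \<in> cvs.span ?W" if uv: "u \<in> ?W" "v \<in> ?W" for u v
  proof -
    from uv obtain xs ys where "u = wedge xs" "v = wedge ys" "set xs \<subseteq> V" "set ys \<subseteq> V" by blast
    then have "u * v = wedge (xs @ ys)" "set (xs @ ys) \<subseteq> V" by (auto simp: wedge_append)
    then show ?thesis by (intro cvs.span_base) blast
  qed
  have 2: "u * y \<in> cvs.span ?W" if u: "u \<in> ?W" for u
    by (rule cvs.span_induct[OF assms(2)[unfolded ext_algebra_def]])
      (use 1[OF u] in \<open>auto simp: cvs.subspace_def distrib_left mult_scaleC_right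
         intro: cvs.span_zero cvs.span_add cvs.span_scale\<close>)
  have "x * y \<in> cvs.span ?W"
    by (rule cvs.span_induct[OF assms(1)[unfolded ext_algebra_def]])
      (use 2 in \<open>auto simp: cvs.subspace_def distrib_right mult_scaleC_left
         intro: cvs.span_zero cvs.span_add cvs.span_scale\<close>)
  then show ?thesis by (simp add: ext_algebra_def)
qed

lemma ext_p_inv_mult: "x \<in> ext_p_inv \<Longrightarrow> y \<in> ext_p_inv \<Longrightarrow> x * y \<in> (ext_p_inv :: ('n::finite + 'n) cmat ext set)"
  by (auto simp: ext_p_inv_def ext_algebra_mult ext_map_rules[OF linear_Ad])

lemma ext_p_inv_one: "1 \<in> (ext_p_inv :: ('n::finite + 'n) cmat ext set)"
  using one_in_ext_power[of "p_space :: ('n + 'n) cmat set"] ext_power_in_algebra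
  by (auto simp: ext_p_inv_def ext_map_rules[OF linear_Ad])

lemma power_trace_in_inv: "power_trace k \<in> (ext_p_inv :: ('n::finite + 'n) cmat ext set)"
  using power_trace_degree[of k] ext_power_in_algebra power_trace_invariant by (auto simp: ext_p_inv_def)

lemma form_one_one: "ext_form trace_form 1 1 = (1::complex)"
  using tf.form_wedge[of "[]" "[]"] by (simp add: gram_det_def permutes_id)

text \<open>The algebra of invariants is used with two systems of generators, first the power traces and later their
corrections in \<open>P_wedge\<close>. What follows holds for both, since it depends only on the degrees.\<close>

locale inv_generators = odd_generators a for a :: "nat \<Rightarrow> ('n::finite + 'n) cmat ext" +
  assumes alg_inv: "alg = ext_p_inv"
begin

lemma gen_inv: "S \<subseteq> {1..CARD('n)} \<Longrightarrow> aprod S \<in> ext_p_inv"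
  using aprod_in_alg alg_inv by simp

text \<open>The top wedge \<open>wedge bs\<close> is a combination of the products \<open>aprod S\<close>. It pairs to a nonzero number with
itself, but to zero with every \<open>aprod S\<close> of smaller degree, and only the full product has the same degree.\<close>

lemma aprod_full_nonzero: "aprod {1..CARD('n)} \<noteq> 0"
proof
  assume z: "aprod {1..CARD('n)} = 0"
  obtain bs :: "('n + 'n) cmat list" where bs: "herm_basis bs" using herm_basis_exists by blast
  have len: "length bs = degree_sum {1..CARD('n)}" using herm_basisD(1)[OF bs] by (simp only: degree_sum_full)
  have "trace_span \<subseteq> (ext_p_inv :: ('n + 'n) cmat ext set)"
    unfolding trace_span_def
  proof (rule cvs.span_minimal[OF _ ext_p_inv_subspace], safe)
    fix ks :: "nat list"
    show "prod_list (map power_trace ks) \<in> (ext_p_inv :: ('n + 'n) cmat ext set)"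
      by (induction ks) (auto intro: ext_p_inv_one ext_p_inv_mult power_trace_in_inv)
  qed
  then have "wedge bs \<in> alg" using top_in_trace_span[OF bs] alg_inv by blast
  then obtain c where c: "wedge bs = (\<Sum>S\<in>Pow {1..CARD('n)}. c S *\<^sub>C aprod S)" by (rule alg_expand)
  have zero: "ext_form trace_form (aprod S) (wedge bs) = 0" if S: "S \<subseteq> {1..CARD('n)}" for S
  proof (cases "S = {1..CARD('n)}")
    case True
    then show ?thesis by (simp add: z del: One_nat_def)
  next
    case False
    then obtain j where j: "j \<in> {1..CARD('n)} - S" using S by blast
    have "degree_sum S \<le> degree_sum ({1..CARD('n)} - {j})"
      unfolding degree_sum_def using S j by (intro sum_mono2) auto
    also have "\<dots> < degree_sum {1..CARD('n)}"
      using sum.remove[of "{1..CARD('n)}" j "\<lambda>i. 4 * i - 3"] j by (auto simp: degree_sum_def)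
    finally have "degree_sum S \<noteq> length bs" using len by simp
    then show ?thesis using tf.form_degree[OF aprod_degree[OF S] top_in_power[OF bs]] by blast
  qed
  have "1 = ext_form trace_form (wedge bs) (wedge bs)" by (rule top_form[OF bs, symmetric])
  also have "\<dots> = (\<Sum>S\<in>Pow {1..CARD('n)}. c S * ext_form trace_form (aprod S) (wedge bs))"
    by (subst c) (simp add: tf.form_sum_left tf.form_scale_left)
  also have "\<dots> = 0" using zero by (intro sum.neutral) auto
  finally show False by simp
qed

lemmas aprod_indep = aprod_independent[OF aprod_full_nonzero]

lemma degree_sum_pos: "S \<subseteq> {1..CARD('n)} \<Longrightarrow> S \<noteq> {} \<Longrightarrow> degree_sum S \<ge> 1"
proof -
  assume S: "S \<subseteq> {1..CARD('n)}" "S \<noteq> {}"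
  then obtain i where i: "i \<in> S" by blast
  have "finite S" using S finite_subset by blast
  then have "4 * i - 3 \<le> degree_sum S" unfolding degree_sum_def using i by (intro member_le_sum) auto
  moreover have "i \<ge> 1" using i S by auto
  ultimately show ?thesis by linarith
qed

lemma inv_plus_eq: "ext_p_inv_plus = cvs.span (aprod ` {S. S \<subseteq> {1..CARD('n)} \<and> S \<noteq> {}})"
proof
  show "cvs.span (aprod ` {S. S \<subseteq> {1..CARD('n)} \<and> S \<noteq> {}}) \<subseteq> ext_p_inv_plus"
    unfolding ext_p_inv_plus_def
  proof (rule cvs.span_mono, rule image_subsetI)
    fix S assume "S \<in> {S. S \<subseteq> {1..CARD('n)} \<and> S \<noteq> {}}"
    then have "S \<subseteq> {1..CARD('n)}" "S \<noteq> {}" by blast+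
    then show "aprod S \<in> (\<Union>k\<in>{1..}. ext_p_inv \<inter> ext_power p_space k)"
      using gen_inv aprod_degree degree_sum_pos by (intro UN_I[of "degree_sum S"]) auto
  qed
  show "ext_p_inv_plus \<subseteq> cvs.span (aprod ` {S. S \<subseteq> {1..CARD('n)} \<and> S \<noteq> {}})"
    unfolding ext_p_inv_plus_def
  proof (rule cvs.span_minimal[OF _ cvs.subspace_span], rule subsetI)
    fix x :: "('n + 'n) cmat ext" assume "x \<in> (\<Union>k\<in>{1..}. ext_p_inv \<inter> ext_power p_space k)"
    then obtain k where k: "k \<ge> 1" and x: "x \<in> ext_p_inv" "x \<in> ext_power p_space k" by auto
    have "x \<in> alg" using x alg_inv by simp
    then obtain c where c: "x = (\<Sum>S\<in>Pow {1..CARD('n)}. c S *\<^sub>C aprod S)" by (rule alg_expand)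
    have "0 = ext_form trace_form x 1"
      using tf.form_degree[OF x(2) one_in_ext_power[of p_space]] k by simp
    also have "\<dots> = (\<Sum>S\<in>Pow {1..CARD('n)}. if S = {} then c S else 0)"
      unfolding c tf.form_sum_left tf.form_scale_left
    proof (rule sum.cong[OF refl])
      fix S assume S: "S \<in> Pow {1..CARD('n)}"
      show "c S * ext_form trace_form (aprod S) 1 = (if S = {} then c S else 0)"
      proof (cases "S = {}")
        case False
        then have "degree_sum S \<noteq> 0" using S degree_sum_pos[of S] by auto
        then show ?thesis using S False tf.form_degree[OF aprod_degree one_in_ext_power[of p_space]] by simp
      qed (simp add: form_one_one)
    qed
    also have "\<dots> = c {}" by simp
    finally have c0: "c {} = 0" by simp
    show "x \<in> cvs.span (aprod ` {S. S \<subseteq> {1..CARD('n)} \<and> S \<noteq> {}})"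
      unfolding c
    proof (rule cvs.span_sum)
      fix S assume S: "S \<in> Pow {1..CARD('n)}"
      show "c S *\<^sub>C aprod S \<in> cvs.span (aprod ` {S. S \<subseteq> {1..CARD('n)} \<and> S \<noteq> {}})"
      proof (cases "S = {}")
        case True
        then show ?thesis by (simp add: c0 cvs.scale_zero_left cvs.span_zero)
      next
        case False
        then show ?thesis using S by (intro cvs.span_scale cvs.span_base imageI) blast
      qed
    qed
  qed
qed

text \<open>A product of two nonempty products of generators is zero or, up to sign, a product of at least two.\<close>

lemma inv_plus_sq_eq: "ext_p_inv_plus_sq = cvs.span (aprod ` {S. S \<subseteq> {1..CARD('n)} \<and> card S \<ge> 2})"
proof
  let ?B = "cvs.span (aprod ` {S. S \<subseteq> {1..CARD('n)} \<and> card S \<ge> 2})"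
  show "?B \<subseteq> ext_p_inv_plus_sq"
    unfolding ext_p_inv_plus_sq_def
  proof (rule cvs.span_minimal[OF _ cvs.subspace_span], safe)
    fix S assume S: "S \<subseteq> {1..CARD('n)}" "2 \<le> card S"
    then have fin: "finite S" using finite_subset by blast
    obtain i where i: "i \<in> S" using S by fastforce
    have ne: "S - {i} \<noteq> {}"
    proof
      assume "S - {i} = {}"
      then have "S \<subseteq> {i}" by blast
      then have "card S \<le> 1" using card_mono[of "{i}" S] by simp
      then show False using S by simp
    qed
    have "\<exists>c\<in>{1, - 1}. aprod {i} * aprod (S - {i}) = c *\<^sub>C aprod ({i} \<union> (S - {i}))"
      by (rule aprod_mult(2)) (use S i in auto)
    moreover have "{i} \<union> (S - {i}) = S" using i by blast
    ultimately have "\<exists>c\<in>{1, - 1}. aprod {i} * aprod (S - {i}) = c *\<^sub>C aprod S" by (simp only:)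
    then obtain c where c: "c \<in> {1, - 1}" "aprod {i} * aprod (S - {i}) = c *\<^sub>C aprod S" by blast
    then have eq: "aprod S = c *\<^sub>C (aprod {i} * aprod (S - {i}))" by (auto simp: scaleC_scaleC scaleC_one)
    have "aprod {i} \<in> ext_p_inv_plus" "aprod (S - {i}) \<in> ext_p_inv_plus"
      unfolding inv_plus_eq using S i ne by (auto intro!: cvs.span_base imageI simp del: aprod_singleton)
    then show "aprod S \<in> cvs.span {x * y |x y. x \<in> ext_p_inv_plus \<and> y \<in> ext_p_inv_plus}"
      unfolding eq by (intro cvs.span_scale cvs.span_base) blast
  qed
  show "ext_p_inv_plus_sq \<subseteq> ?B"
    unfolding ext_p_inv_plus_sq_def
  proof (rule cvs.span_minimal[OF _ cvs.subspace_span], safe)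
    fix x y :: "('n + 'n) cmat ext" assume x: "x \<in> ext_p_inv_plus" and y: "y \<in> ext_p_inv_plus"
    have 1: "aprod S * aprod T \<in> ?B"
      if st: "S \<subseteq> {1..CARD('n)}" "S \<noteq> {}" "T \<subseteq> {1..CARD('n)}" "T \<noteq> {}" for S T
    proof (cases "S \<inter> T = {}")
      case True
      have fin: "finite S" "finite T" using st finite_subset by blast+
      obtain c where c: "aprod S * aprod T = c *\<^sub>C aprod (S \<union> T)" using aprod_mult(2)[OF st(1,3) True] by blast
      have "card (S \<union> T) = card S + card T" using card_Un_disjoint[OF fin True] .
      moreover have "card S > 0" "card T > 0" using fin st by (simp_all add: card_gt_0_iff)
      ultimately have "card (S \<union> T) \<ge> 2" by linarith
      then show ?thesis unfolding c using st by (intro cvs.span_scale cvs.span_base) auto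
    next
      case False
      then show ?thesis using aprod_mult(1)[OF st(1,3)] by (simp add: cvs.span_zero)
    qed
    have 2: "aprod S * y \<in> ?B" if S: "S \<subseteq> {1..CARD('n)}" "S \<noteq> {}" for S
      by (rule cvs.span_induct[OF y[unfolded inv_plus_eq]])
        (use 1[OF S] in \<open>auto simp: cvs.subspace_def distrib_left mult_scaleC_right
           intro: cvs.span_zero cvs.span_add cvs.span_scale\<close>)
    show "x * y \<in> ?B"
      by (rule cvs.span_induct[OF x[unfolded inv_plus_eq]])
        (use 2 in \<open>auto simp: cvs.subspace_def distrib_right mult_scaleC_left
           intro: cvs.span_zero cvs.span_add cvs.span_scale\<close>)
  qed
qed

end

section \<open>Primitive invariants\<close>

text \<open>The index is shifted such that \<open>trace_gen i\<close> has degree \<open>4i - 3\<close>.\<close>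

definition trace_gen :: "nat \<Rightarrow> ('n::finite + 'n) cmat ext"
  where "trace_gen i = power_trace (4 * (i - 1))"

interpretation tg: inv_generators "trace_gen :: nat \<Rightarrow> ('n::finite + 'n) cmat ext"
proof -
  interpret o: odd_generators "trace_gen :: nat \<Rightarrow> ('n + 'n) cmat ext"
  proof
    fix i assume "i \<in> {1..CARD('n)}"
    then have "Suc (4 * (i - 1)) = 4 * i - 3" by auto
    then show "trace_gen i \<in> ext_power (p_space :: ('n + 'n) cmat set) (4 * i - 3)"
      using power_trace_degree[of "4 * (i - 1)"] unfolding trace_gen_def by metis
  qed
  have power_trace_alg: "power_trace k \<in> o.alg" for k
  proof (cases "k mod 4 = 0 \<and> k < 4 * CARD('n)")
    case True
    then have "k div 4 + 1 \<in> {1..CARD('n)}" "trace_gen (k div 4 + 1) = (power_trace k :: ('n + 'n) cmat ext)"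
      by (auto simp: trace_gen_def)
    then show ?thesis using o.gen_in_alg by metis
  next
    case False
    then have "power_trace k = (0 :: ('n + 'n) cmat ext)" using power_trace_zero power_trace_vanish by (metis not_less)
    then show ?thesis by (simp add: cvs.subspace_0[OF o.alg_subspace])
  qed
  have "trace_span \<subseteq> o.alg"
    unfolding trace_span_def
    by (rule cvs.span_minimal[OF _ o.alg_subspace]) (auto intro!: o.prod_list_in_alg power_trace_alg)
  moreover have "ext_p_inv \<subseteq> (trace_span :: ('n + 'n) cmat ext set)"
    using invariants_in_trace_span Sp_squares_subset unfolding ext_p_inv_def by blast
  moreover have "o.alg \<subseteq> ext_p_inv"
  proof (rule o.alg_minimal[OF ext_p_inv_subspace])
    fix S :: "nat set"
    have "prod_list (map trace_gen xs) \<in> (ext_p_inv :: ('n + 'n) cmat ext set)" for xs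
      by (induction xs) (auto simp: trace_gen_def intro: ext_p_inv_one ext_p_inv_mult power_trace_in_inv)
    then show "o.aprod S \<in> ext_p_inv" unfolding o.aprod_def .
  qed
  ultimately have "o.alg = ext_p_inv" by blast
  then show "inv_generators (trace_gen :: nat \<Rightarrow> ('n + 'n) cmat ext)"
    by unfold_locales
qed

lemma aprod_trace_gen_real: "tg.aprod S \<in> (real_ext :: ('n::finite + 'n) cmat ext set)"
proof -
  have "prod_list (map trace_gen xs) \<in> (real_ext :: ('n + 'n) cmat ext set)" for xs
    by (induction xs) (auto simp: trace_gen_def intro: real_ext_1 real_ext_mult power_trace_real)
  then show ?thesis unfolding tg.aprod_def .
qed

text \<open>A spanning set for the decomposable invariants of degree \<open>k\<close>.\<close>

definition decomp_set :: "nat \<Rightarrow> ('n::finite + 'n) cmat ext set"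
  where "decomp_set k = tg.aprod ` {S. S \<subseteq> {1..CARD('n)} \<and> card S \<ge> 2 \<and> degree_sum S = k}"

lemma decomp_set_real: "decomp_set k \<subseteq> real_ext \<inter> ext_power p_space k"
  unfolding decomp_set_def using aprod_trace_gen_real tg.aprod_degree by auto

text \<open>The generator minus its orthogonal projection to the decomposable invariants of its degree.\<close>

definition primitive :: "nat \<Rightarrow> ('n::finite + 'n) cmat ext"
  where "primitive i = trace_gen i - (SOME d. d \<in> cvs.span (decomp_set (4 * i - 3)) \<and>
     (\<forall>y\<in>decomp_set (4 * i - 3). ext_form trace_form (trace_gen i - d) y = 0))"

lemma primitive_props:
  obtains d where "primitive i = trace_gen i - (d :: ('n::finite + 'n) cmat ext)" "d \<in> cvs.span (decomp_set (4 * i - 3))"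
    "\<And>y :: ('n + 'n) cmat ext. y \<in> decomp_set (4 * i - 3) \<Longrightarrow> ext_form trace_form (primitive i) y = 0"
proof -
  let ?P = "\<lambda>d :: ('n + 'n) cmat ext. d \<in> cvs.span (decomp_set (4 * i - 3)) \<and>
     (\<forall>y\<in>decomp_set (4 * i - 3). ext_form trace_form (trace_gen i - d) y = 0)"
  have "\<exists>d. ?P d" using real_span_projection_exists[OF decomp_set_real] by blast
  then have P: "?P (SOME d. ?P d)" by (rule someI_ex)
  have eq: "primitive i = trace_gen i - (SOME d. ?P d)" by (rule primitive_def)
  show thesis
    by (rule that[OF eq conjunct1[OF P]]) (use P[THEN conjunct2] in \<open>unfold eq, blast\<close>)
qed

lemma primitive_degree: "i \<in> {1..CARD('n)} \<Longrightarrow> primitive i \<in> ext_power (p_space :: ('n::finite + 'n) cmat set) (4 * i - 3)"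
proof -
  assume i: "i \<in> {1..CARD('n)}"
  obtain d :: "('n + 'n) cmat ext" where d: "primitive i = trace_gen i - d" "d \<in> cvs.span (decomp_set (4 * i - 3))"
    by (rule primitive_props)
  have "cvs.span (decomp_set (4 * i - 3)) \<subseteq> ext_power (p_space :: ('n + 'n) cmat set) (4 * i - 3)"
    using decomp_set_real by (intro cvs.span_minimal ext_power_subspace) auto
  then show ?thesis using d tg.degree[OF i] by (auto intro: cvs.subspace_diff[OF ext_power_subspace])
qed

text \<open>The decomposable correction of \<open>trace_gen i\<close> involves only generators of smaller degree, so by induction on
\<open>i\<close> the primitive elements generate the same algebra.\<close>

interpretation pg: inv_generators "primitive :: nat \<Rightarrow> ('n::finite + 'n) cmat ext"
proof -
  interpret o: odd_generators "primitive :: nat \<Rightarrow> ('n + 'n) cmat ext"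
    by unfold_locales (rule primitive_degree)
  have tin: "trace_gen i \<in> o.alg" if "i \<in> {1..CARD('n)}" for i
    using that
  proof (induction i rule: less_induct)
    case (less i)
    obtain d :: "('n + 'n) cmat ext" where d: "primitive i = trace_gen i - d" "d \<in> cvs.span (decomp_set (4 * i - 3))"
      by (rule primitive_props)
    have "decomp_set (4 * i - 3) \<subseteq> o.alg"
      unfolding decomp_set_def
    proof safe
      fix S assume S: "S \<subseteq> {1..CARD('n)}" "2 \<le> card S" "degree_sum S = 4 * i - 3"
      then have fin: "finite S" using finite_subset by blast
      have lt: "j < i" if j: "j \<in> S" for j
      proof -
        have "S - {j} \<noteq> {}"
        proof
          assume "S - {j} = {}"
          then have "S \<subseteq> {j}" by blast
          then have "card S \<le> 1" using card_mono[of "{j}" S] by simp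
          then show False using S by simp
        qed
        then have "degree_sum (S - {j}) \<ge> 1" using S by (intro tg.degree_sum_pos) auto
        moreover have "degree_sum S = (4 * j - 3) + degree_sum (S - {j})"
          unfolding degree_sum_def using sum.remove[OF fin j] by simp
        moreover have "j \<ge> 1" using S j by auto
        ultimately show ?thesis using S(3) less.prems by auto
      qed
      have "prod_list (map trace_gen (sorted_list_of_set S)) \<in> o.alg"
        by (rule o.prod_list_in_alg) (use less.IH lt S fin in auto)
      then show "tg.aprod S \<in> o.alg" by (simp add: tg.aprod_def)
    qed
    then have "d \<in> o.alg" using d(2) cvs.span_minimal[OF _ o.alg_subspace] by blast
    then have "primitive i + d \<in> o.alg" using o.gen_in_alg[OF less.prems] by (intro cvs.subspace_add[OF o.alg_subspace])
    then show ?case by (simp add: d(1))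
  qed
  have "tg.alg \<subseteq> o.alg"
  proof (rule tg.alg_minimal[OF o.alg_subspace])
    fix S assume "S \<subseteq> {1..CARD('n)}"
    then show "tg.aprod S \<in> o.alg" unfolding tg.aprod_def using tin finite_subset[of S "{1..CARD('n)}"]
      by (intro o.prod_list_in_alg) auto
  qed
  moreover have "o.alg \<subseteq> ext_p_inv"
  proof (rule o.alg_minimal[OF ext_p_inv_subspace])
    have pin: "primitive i \<in> (ext_p_inv :: ('n + 'n) cmat ext set)" if i: "i \<in> {1..CARD('n)}" for i
    proof -
      obtain d :: "('n + 'n) cmat ext" where d: "primitive i = trace_gen i - d" "d \<in> cvs.span (decomp_set (4 * i - 3))"
        by (rule primitive_props)
      have "decomp_set (4 * i - 3) \<subseteq> (ext_p_inv :: ('n + 'n) cmat ext set)"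
        unfolding decomp_set_def using tg.gen_inv by auto
      then have "d \<in> ext_p_inv" using d(2) cvs.span_minimal[OF _ ext_p_inv_subspace] by blast
      moreover have "trace_gen i \<in> (ext_p_inv :: ('n + 'n) cmat ext set)" by (simp add: trace_gen_def power_trace_in_inv)
      ultimately show ?thesis unfolding d(1) by (intro cvs.subspace_diff[OF ext_p_inv_subspace])
    qed
    fix S assume S: "S \<subseteq> {1..CARD('n)}"
    have "prod_list (map primitive xs) \<in> (ext_p_inv :: ('n + 'n) cmat ext set)" if "set xs \<subseteq> {1..CARD('n)}" for xs
      using that
    proof (induction xs)
      case (Cons x xs)
      then show ?case using ext_p_inv_mult[OF pin[of x] Cons.IH] by simp
    qed (simp add: ext_p_inv_one)
    from this[of "sorted_list_of_set S"] show "o.aprod S \<in> ext_p_inv"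
      unfolding o.aprod_def using S finite_subset[of S "{1..CARD('n)}"] by auto
  qed
  ultimately have "o.alg = ext_p_inv" using tg.alg_inv by blast
  then show "inv_generators (primitive :: nat \<Rightarrow> ('n + 'n) cmat ext)"
    by unfold_locales
qed

lemma P_wedge_subspace: "cvs.subspace (P_wedge :: ('n::finite + 'n) cmat ext set)"
  unfolding cvs.subspace_def P_wedge_def ext_p_inv_plus_def
  by (auto simp: tf.form_add_left tf.form_scale_left intro: cvs.span_zero cvs.span_add cvs.span_scale)

text \<open>Elements of different degree are orthogonal, so the hypothesis passes to the homogeneous parts of \<open>s\<close>, where
the form is nondegenerate because the power traces are real.\<close>

lemma sq_form_zero_imp_zero:
  fixes s :: "('n::finite + 'n) cmat ext"
  assumes s: "s \<in> ext_p_inv_plus_sq" and orth: "\<And>y. y \<in> ext_p_inv_plus_sq \<Longrightarrow> ext_form trace_form s y = 0"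
  shows "s = 0"
proof -
  let ?I = "{S. S \<subseteq> {1..CARD('n)} \<and> card S \<ge> 2}"
  have finI: "finite ?I" by (rule finite_subset[of _ "Pow {1..CARD('n)}"]) auto
  have "s \<in> cvs.span (tg.aprod ` ?I)" using s by (simp only: tg.inv_plus_sq_eq)
  then obtain c where c: "s = (\<Sum>S\<in>?I. c S *\<^sub>C tg.aprod S)" using span_image_expand[OF finI] by blast
  define part where "part k = (\<Sum>S\<in>{S\<in>?I. degree_sum S = k}. c S *\<^sub>C (tg.aprod S :: ('n + 'n) cmat ext))" for k
  have split: "s = (\<Sum>k\<in>degree_sum ` ?I. part k)"
    unfolding c part_def by (rule sum.image_gen[OF finI])
  have part_span: "part k \<in> cvs.span (decomp_set k)" for k
    unfolding part_def decomp_set_def by (intro cvs.span_sum cvs.span_scale cvs.span_base) auto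
  have "cvs.span (decomp_set k) \<subseteq> ext_power (p_space :: ('n + 'n) cmat set) k" for k
    using decomp_set_real by (intro cvs.span_minimal ext_power_subspace) auto
  then have part_pow: "part k \<in> ext_power p_space k" for k using part_span by blast
  have "part k = 0" if k: "k \<in> degree_sum ` ?I" for k
  proof (rule form_nondegenerate_on_real_span[OF decomp_set_real part_span])
    fix y :: "('n + 'n) cmat ext" assume y: "y \<in> decomp_set k"
    then have yk: "y \<in> ext_power p_space k" using decomp_set_real by blast
    have "y \<in> ext_p_inv_plus_sq" using y unfolding tg.inv_plus_sq_eq decomp_set_def by (auto intro: cvs.span_base)
    then have "0 = ext_form trace_form s y" using orth by simp
    also have "\<dots> = (\<Sum>j\<in>degree_sum ` ?I. if j = k then ext_form trace_form (part j) y else 0)"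
      unfolding split tf.form_sum_left using tf.form_degree[OF part_pow yk] by (intro sum.cong) auto
    also have "\<dots> = ext_form trace_form (part k) y" using k finI by simp
    finally show "ext_form trace_form (part k) y = 0" ..
  qed
  then show ?thesis unfolding split by simp
qed

lemma primitive_in_P: "i \<in> {1..CARD('n)} \<Longrightarrow> primitive i \<in> (P_wedge :: ('n::finite + 'n) cmat ext set)"
proof -
  assume i: "i \<in> {1..CARD('n)}"
  obtain d :: "('n + 'n) cmat ext" where d: "\<And>y :: ('n + 'n) cmat ext. y \<in> decomp_set (4 * i - 3) \<Longrightarrow> ext_form trace_form (primitive i) y = 0"
    by (rule primitive_props) blast
  have base: "ext_form trace_form (primitive i) y = 0" if y: "y \<in> tg.aprod ` {S. S \<subseteq> {1..CARD('n)} \<and> card S \<ge> 2}" for y :: "('n + 'n) cmat ext"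
  proof -
    from y obtain S where S: "S \<subseteq> {1..CARD('n)}" "card S \<ge> 2" "y = tg.aprod S" by blast
    show ?thesis
    proof (cases "degree_sum S = 4 * i - 3")
      case True
      then show ?thesis using S by (intro d) (auto simp: decomp_set_def)
    next
      case False
      then show ?thesis using tf.form_degree[OF primitive_degree[OF i] tg.aprod_degree[OF S(1)]] S by auto
    qed
  qed
  have orth: "ext_form trace_form (primitive i) y = 0" if y: "y \<in> ext_p_inv_plus_sq" for y :: "('n + 'n) cmat ext"
    by (rule cvs.span_induct[OF y[unfolded tg.inv_plus_sq_eq] _ base])
       (auto simp: cvs.subspace_def tf.form_add_right tf.form_scale_right)
  have "pg.aprod {i} \<in> (ext_p_inv_plus :: ('n + 'n) cmat ext set)"
    unfolding pg.inv_plus_eq using i by (intro cvs.span_base imageI) auto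
  then show ?thesis using orth by (simp add: P_wedge_def)
qed

text \<open>Modulo the square of the augmentation ideal every invariant of positive degree is a combination of the primitive
elements, and for a member of \<open>P_wedge\<close> the difference lies in the square and is orthogonal to it.\<close>

lemma P_wedge_eq: "P_wedge = cvs.span (primitive ` {1..CARD('n)} :: ('n::finite + 'n) cmat ext set)"
proof
  let ?B = "primitive ` {1..CARD('n)} :: ('n + 'n) cmat ext set"
  show "cvs.span ?B \<subseteq> P_wedge"
    by (rule cvs.span_minimal[OF _ P_wedge_subspace]) (auto intro: primitive_in_P)
  show "P_wedge \<subseteq> cvs.span ?B"
  proof
    fix x :: "('n + 'n) cmat ext" assume x: "x \<in> P_wedge"
    have sq_sub: "cvs.subspace (ext_p_inv_plus_sq :: ('n + 'n) cmat ext set)"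
      unfolding ext_p_inv_plus_sq_def by (rule cvs.subspace_span)
    let ?T = "{x. \<exists>y\<in>cvs.span ?B. x - y \<in> ext_p_inv_plus_sq}"
    have "cvs.subspace ?T"
      unfolding cvs.subspace_def mem_Collect_eq
    proof (intro conjI allI ballI)
      show "\<exists>y\<in>cvs.span ?B. 0 - y \<in> ext_p_inv_plus_sq"
        by (intro bexI[of _ 0]) (auto simp: cvs.span_zero cvs.subspace_0[OF sq_sub])
    next
      fix u v assume "u \<in> ?T" "v \<in> ?T"
      then obtain y z where yz: "y \<in> cvs.span ?B" "z \<in> cvs.span ?B" "u - y \<in> ext_p_inv_plus_sq" "v - z \<in> ext_p_inv_plus_sq" by blast
      have "u + v - (y + z) \<in> ext_p_inv_plus_sq"
        unfolding add_diff_add by (rule cvs.subspace_add[OF sq_sub yz(3,4)])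
      then show "\<exists>w\<in>cvs.span ?B. u + v - w \<in> ext_p_inv_plus_sq"
        using cvs.span_add[OF yz(1,2)] by blast
    next
      fix c u assume "u \<in> ?T"
      then obtain y where y: "y \<in> cvs.span ?B" "u - y \<in> ext_p_inv_plus_sq" by blast
      have "c *\<^sub>C u - c *\<^sub>C y \<in> ext_p_inv_plus_sq"
        unfolding cvs.scale_right_diff_distrib[symmetric] by (rule cvs.subspace_scale[OF sq_sub y(2)])
      then show "\<exists>w\<in>cvs.span ?B. c *\<^sub>C u - w \<in> ext_p_inv_plus_sq"
        using cvs.span_scale[OF y(1)] by blast
    qed
    moreover have "pg.aprod ` {S. S \<subseteq> {1..CARD('n)} \<and> S \<noteq> {}} \<subseteq> ?T"
    proof (rule image_subsetI, unfold mem_Collect_eq)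
      fix S assume S: "S \<subseteq> {1..CARD('n)} \<and> S \<noteq> {}"
      then have fin: "finite S" using finite_subset by blast
      show "\<exists>y\<in>cvs.span ?B. pg.aprod S - y \<in> ext_p_inv_plus_sq"
      proof (cases "card S \<ge> 2")
        case True
        then have "pg.aprod S \<in> (ext_p_inv_plus_sq :: ('n + 'n) cmat ext set)" unfolding pg.inv_plus_sq_eq using S by (intro cvs.span_base) auto
        then show ?thesis by (intro bexI[of _ 0]) (auto simp: cvs.span_zero)
      next
        case False
        then have "card S = 1" using S fin card_gt_0_iff[of S] by linarith
        then obtain i where "S = {i}" using card_1_singletonE by blast
        then show ?thesis using S
          by (intro bexI[of _ "primitive i"]) (auto intro: cvs.span_base cvs.subspace_0[OF sq_sub])
      qed
    qed
    ultimately have "ext_p_inv_plus \<subseteq> ?T" unfolding pg.inv_plus_eq by (intro cvs.span_minimal)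
    moreover have "x \<in> ext_p_inv_plus" using x by (simp add: P_wedge_def)
    ultimately obtain y where y: "y \<in> cvs.span ?B" "x - y \<in> ext_p_inv_plus_sq" by blast
    have "y \<in> P_wedge" using y(1) \<open>cvs.span ?B \<subseteq> P_wedge\<close> by blast
    then have "x - y \<in> P_wedge" using x by (intro cvs.subspace_diff[OF P_wedge_subspace])
    then have "x - y = 0" using y(2) by (intro sq_form_zero_imp_zero) (auto simp: P_wedge_def)
    then show "x \<in> cvs.span ?B" using y(1) by simp
  qed
qed

section \<open>Bases and isomorphisms\<close>

lemma independent_family:
  fixes f :: "'i \<Rightarrow> 'a::complex_vector"
  assumes fin: "finite I" and ind: "\<And>c. (\<Sum>i\<in>I. c i *\<^sub>C f i) = 0 \<Longrightarrow> (\<forall>i\<in>I. c i = 0)"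
  shows "inj_on f I" "cvs.independent (f ` I)"
proof -
  show inj: "inj_on f I"
  proof (rule inj_onI, rule ccontr)
    fix i j assume ij: "i \<in> I" "j \<in> I" "f i = f j" "i \<noteq> j"
    let ?c = "\<lambda>k. if k = i then 1 else if k = j then - 1 else 0 :: complex"
    have "(\<Sum>k\<in>I. ?c k *\<^sub>C f k) = (\<Sum>k\<in>I. (if k = i then f k else 0) - (if k = j then f k else 0))"
      using ij(4) by (intro sum.cong) (auto simp: scaleC_one cvs.scale_minus_left cvs.scale_zero_left)
    also have "\<dots> = 0" using ij fin by (simp add: sum_subtractf)
    finally have "?c i = 0" using ind[of ?c] ij(1) by blast
    then show False by simp
  qed
  show "cvs.independent (f ` I)"
  proof
    assume "cvs.dependent (f ` I)"
    then obtain u where u: "\<exists>v\<in>f ` I. u v \<noteq> 0" "(\<Sum>v\<in>f ` I. u v *\<^sub>C v) = 0"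
      using cvs.dependent_finite[of "f ` I"] fin by auto
    then have "(\<Sum>i\<in>I. u (f i) *\<^sub>C f i) = 0" by (simp add: sum.reindex[OF inj])
    then show False using ind[of "\<lambda>i. u (f i)"] u(1) by auto
  qed
qed

lemma vs_iso_of_bases:
  fixes f :: "'i \<Rightarrow> 'a::complex_vector" and g :: "'i \<Rightarrow> 'b::complex_vector"
  assumes fin: "finite I"
    and f: "\<And>c. (\<Sum>i\<in>I. c i *\<^sub>C f i) = 0 \<Longrightarrow> (\<forall>i\<in>I. c i = 0)"
    and g: "\<And>c. (\<Sum>i\<in>I. c i *\<^sub>C g i) = 0 \<Longrightarrow> (\<forall>i\<in>I. c i = 0)"
  shows "\<exists>\<psi>. vs_iso_on (cvs.span (f ` I)) (cvs.span (g ` I)) \<psi>"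
proof -
  interpret vp: vector_space_pair "scaleC :: complex \<Rightarrow> 'a \<Rightarrow> 'a" "scaleC :: complex \<Rightarrow> 'b \<Rightarrow> 'b" ..
  note fi = independent_family[where f = f, OF fin f]
  define \<psi> where "\<psi> = vp.construct (f ` I) (g \<circ> inv_into I f)"
  have lin: "Vector_Spaces.linear scaleC scaleC \<psi>"
    unfolding \<psi>_def by (rule vp.linear_construct[OF fi(2)])
  interpret psi: Vector_Spaces.linear scaleC scaleC \<psi> by (rule lin)
  have pf: "\<psi> (f i) = g i" if "i \<in> I" for i
    unfolding \<psi>_def using vp.construct_basis[OF fi(2) imageI[OF that]] that fi(1) by simp
  have psum: "\<psi> (\<Sum>i\<in>I. c i *\<^sub>C f i) = (\<Sum>i\<in>I. c i *\<^sub>C g i)" for c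
    by (simp add: psi.sum psi.scale pf)
  have "inj_on \<psi> (cvs.span (f ` I))"
  proof (rule inj_onI)
    fix x y assume "x \<in> cvs.span (f ` I)" "y \<in> cvs.span (f ` I)" and eq: "\<psi> x = \<psi> y"
    then have "x - y \<in> cvs.span (f ` I)" by (intro cvs.span_diff)
    then obtain c where c: "x - y = (\<Sum>i\<in>I. c i *\<^sub>C f i)" using span_image_expand[OF fin] by blast
    have "(\<Sum>i\<in>I. c i *\<^sub>C g i) = \<psi> (x - y)" unfolding c psum ..
    also have "\<dots> = 0" by (simp add: psi.diff eq)
    finally have "\<forall>i\<in>I. c i = 0" by (rule g)
    then have "x - y = 0" unfolding c by (simp add: cvs.scale_zero_left)
    then show "x = y" by simp
  qed
  moreover have "\<psi> ` cvs.span (f ` I) = cvs.span (g ` I)"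
  proof -
    have "\<psi> ` f ` I = g ` I" using pf by (auto simp: image_iff)
    then show ?thesis using vp.linear_span_image[OF lin, of "f ` I"] by simp
  qed
  ultimately have "vs_iso_on (cvs.span (f ` I)) (cvs.span (g ` I)) \<psi>"
    unfolding vs_iso_on_def bij_betw_def by (simp add: psi.add psi.scale)
  then show ?thesis by blast
qed

lemma primitive_coeffs_zero:
  assumes "(\<Sum>i\<in>{1..CARD('n)}. c i *\<^sub>C (primitive i :: ('n::finite + 'n) cmat ext)) = 0"
  shows "\<forall>i\<in>{1..CARD('n)}. c i = 0"
proof
  fix j assume j: "j \<in> {1..CARD('n)}"
  \<comment> \<open>A relation between the generators is a relation between all products with coefficients supported on singletons.\<close>
  define d where "d S = (if card S = 1 then c (the_elem S) else 0)" for S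
  have "(\<Sum>S\<in>Pow {1..CARD('n)}. d S *\<^sub>C (pg.aprod S :: ('n + 'n) cmat ext)) =
     (\<Sum>S\<in>(\<lambda>i. {i}) ` {1..CARD('n)}. d S *\<^sub>C pg.aprod S)"
  proof (rule sum.mono_neutral_right)
    show "\<forall>S\<in>Pow {1..CARD('n)} - (\<lambda>i. {i}) ` {1..CARD('n)}. d S *\<^sub>C (pg.aprod S :: ('n + 'n) cmat ext) = 0"
    proof
      fix S assume S: "S \<in> Pow {1..CARD('n)} - (\<lambda>i. {i}) ` {1..CARD('n)}"
      have "card S \<noteq> 1" using S by (auto simp: card_1_singleton_iff)
      then show "d S *\<^sub>C (pg.aprod S :: ('n + 'n) cmat ext) = 0" by (simp add: d_def cvs.scale_zero_left)
    qed
  qed auto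
  also have "\<dots> = (\<Sum>i\<in>{1..CARD('n)}. c i *\<^sub>C primitive i)"
    by (subst sum.reindex) (auto simp: d_def inj_on_def)
  also have "\<dots> = 0" by (rule assms)
  finally have "d {j} = 0" by (rule pg.aprod_indep) (use j in auto)
  then show "c j = 0" by (simp add: d_def)
qed

text \<open>A linear projection \<open>f\<close> onto \<open>P_wedge\<close> extends to an algebra homomorphism, since elements of \<open>P_wedge\<close>
anticommute. It maps the ordered products of the primitive elements in \<open>\<And>(P_wedge)\<close> to the ordered products in
the invariants, and the latter form a basis.\<close>

theorem exterior_algebra_iso:
  "\<exists>\<phi>. alg_iso_on (ext_algebra P_wedge) (ext_p_inv :: ('n::finite + 'n) cmat ext set) \<phi> \<and>
          (\<forall>x\<in>P_wedge. \<phi> (ext_inc x) = x)"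
proof -
  let ?I = "{1..CARD('n)}"
  let ?B = "primitive ` ?I :: ('n + 'n) cmat ext set"
  have ind: "cvs.independent ?B" by (rule independent_family(2)[OF _ primitive_coeffs_zero]) auto
  interpret vp: vector_space_pair "scaleC :: complex \<Rightarrow> ('n + 'n) cmat ext \<Rightarrow> _" "scaleC :: complex \<Rightarrow> ('n + 'n) cmat ext \<Rightarrow> _" ..
  define f where "f = vp.construct ?B id"
  have lin: "Vector_Spaces.linear scaleC scaleC f" unfolding f_def by (rule vp.linear_construct[OF ind])
  interpret f: Vector_Spaces.linear scaleC scaleC f by (rule lin)
  have fB: "f b = b" if "b \<in> ?B" for b unfolding f_def using vp.construct_basis[OF ind that] by simp
  have fspan: "f x \<in> cvs.span ?B" for x unfolding f_def using vp.construct_in_span[OF ind, of id x] by simp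
  have fid: "f x = x" if x: "x \<in> P_wedge" for x
    by (rule cvs.span_induct[OF x[unfolded P_wedge_eq]]) (auto simp: cvs.subspace_def f.add f.scale f.zero fB)
  have anti1: "x * primitive j = - (primitive j * x)" if j: "j \<in> ?I" and x: "x \<in> cvs.span ?B" for x and j
    by (rule cvs.span_induct[OF x])
       (use j in \<open>auto simp: cvs.subspace_def distrib_left distrib_right mult_scaleC_left mult_scaleC_right
          intro: pg.anticommute\<close>)
  have anti: "x * y = - (y * x)" if x: "x \<in> cvs.span ?B" and y: "y \<in> cvs.span ?B" for x y
    by (rule cvs.span_induct[OF y])
       (use anti1 x in \<open>auto simp: cvs.subspace_def distrib_left distrib_right mult_scaleC_left mult_scaleC_right\<close>)
  have fsq: "f x * f x = 0" for x using anti[OF fspan fspan] double_eq_0_ext by blast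
  define \<phi> where "\<phi> = ext_lift f"
  note rules = ext_lift_ext_inc[OF lin fsq, folded \<phi>_def] ext_lift_one[OF lin fsq, folded \<phi>_def]
    ext_lift_add[OF lin fsq, folded \<phi>_def] ext_lift_mult[OF lin fsq, folded \<phi>_def]
    ext_lift_scaleC[OF lin fsq, folded \<phi>_def]
  interpret E: anticommuting_family "\<lambda>i. ext_inc (primitive i :: ('n + 'n) cmat ext)" "CARD('n)"
    by unfold_locales (rule ext_inc_anticommute)
  interpret ei: Vector_Spaces.linear scaleC scaleC "ext_inc :: ('n + 'n) cmat ext \<Rightarrow> _" by (rule linear_ext_inc)
  have Ealg: "ext_algebra (P_wedge :: ('n + 'n) cmat ext set) = E.alg"
  proof
    have inc: "ext_inc x \<in> E.alg" if x: "x \<in> P_wedge" for x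
      by (rule cvs.span_induct[OF x[unfolded P_wedge_eq]])
        (auto simp: cvs.subspace_def ei.add ei.scale ei.zero E.gen_in_alg cvs.subspace_0[OF E.alg_subspace]
          cvs.subspace_add[OF E.alg_subspace] cvs.subspace_scale[OF E.alg_subspace])
    show "ext_algebra P_wedge \<subseteq> E.alg"
      unfolding ext_algebra_def
    proof (rule cvs.span_minimal[OF _ E.alg_subspace], safe)
      fix xs :: "('n + 'n) cmat ext list" assume "set xs \<subseteq> P_wedge"
      then show "wedge xs \<in> E.alg" unfolding wedge_def by (intro E.prod_list_in_alg) (auto intro: inc)
    qed
    show "E.alg \<subseteq> ext_algebra P_wedge"
    proof (rule E.alg_minimal)
      show "cvs.subspace (ext_algebra (P_wedge :: ('n + 'n) cmat ext set))" unfolding ext_algebra_def by (rule cvs.subspace_span)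
      fix S assume S: "S \<subseteq> ?I"
      have "E.aprod S = wedge (map primitive (sorted_list_of_set S))" by (simp add: E.aprod_def wedge_def o_def)
      moreover have "set (map primitive (sorted_list_of_set S)) \<subseteq> (P_wedge :: ('n + 'n) cmat ext set)"
      proof -
        have "primitive ` S \<subseteq> (P_wedge :: ('n + 'n) cmat ext set)" using S by (intro image_subsetI primitive_in_P) blast
        then show ?thesis using S finite_subset[of S ?I] by simp
      qed
      ultimately show "E.aprod S \<in> ext_algebra P_wedge" unfolding ext_algebra_def
        by (intro cvs.span_base) (metis (mono_tags, lifting) mem_Collect_eq)
    qed
  qed
  have phi_sum: "\<phi> (\<Sum>i\<in>A. F i) = (\<Sum>i\<in>A. \<phi> (F i))" for A :: "nat set set" and F
  proof -
    have "\<phi> 0 = 0" using rules(5)[of 0 0] by (simp add: cvs.scale_zero_left)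
    then show ?thesis by (induction A rule: infinite_finite_induct) (simp_all add: rules)
  qed
  have phi_aprod: "\<phi> (E.aprod S) = pg.aprod S" if S: "S \<subseteq> ?I" for S
  proof -
    have "\<phi> (prod_list (map (\<lambda>i. ext_inc (primitive i)) xs)) = prod_list (map primitive xs)" if "set xs \<subseteq> ?I" for xs
      using that by (induction xs) (auto simp: rules fB)
    from this[of "sorted_list_of_set S"] show ?thesis
      using S finite_subset[of S ?I] by (simp add: E.aprod_def pg.aprod_def)
  qed
  have phi_expand: "\<phi> (\<Sum>S\<in>Pow ?I. c S *\<^sub>C E.aprod S) = (\<Sum>S\<in>Pow ?I. c S *\<^sub>C pg.aprod S)" for c
    unfolding phi_sum rules(5) by (intro sum.cong) (auto simp: phi_aprod)
  have "inj_on \<phi> (ext_algebra P_wedge)"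
  proof (rule inj_onI)
    fix x y assume xy: "x \<in> ext_algebra P_wedge" "y \<in> ext_algebra P_wedge" "\<phi> x = \<phi> y"
    then have "x - y \<in> E.alg" unfolding Ealg by (intro cvs.subspace_diff[OF E.alg_subspace])
    then obtain c where c: "x - y = (\<Sum>S\<in>Pow ?I. c S *\<^sub>C E.aprod S)" by (rule E.alg_expand)
    have "\<phi> (x - y) = 0"
      using rules(3)[of "x - y" y] xy(3) by simp
    then have "(\<Sum>S\<in>Pow ?I. c S *\<^sub>C (pg.aprod S :: ('n + 'n) cmat ext)) = 0" unfolding c phi_expand .
    then have "c S = 0" if "S \<subseteq> ?I" for S using pg.aprod_indep that by blast
    then have "x - y = 0" unfolding c by (intro sum.neutral) (auto simp: cvs.scale_zero_left)
    then show "x = y" by simp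
  qed
  moreover have "\<phi> ` ext_algebra P_wedge = ext_p_inv"
  proof safe
    fix x :: "('n + 'n) cmat ext ext" assume "x \<in> ext_algebra P_wedge"
    then have "x \<in> E.alg" unfolding Ealg .
    then obtain c where c: "x = (\<Sum>S\<in>Pow ?I. c S *\<^sub>C E.aprod S)" by (rule E.alg_expand)
    show "\<phi> x \<in> ext_p_inv" unfolding c phi_expand
      by (intro cvs.subspace_sum[OF ext_p_inv_subspace] cvs.subspace_scale[OF ext_p_inv_subspace] pg.gen_inv) auto
  next
    fix y :: "('n + 'n) cmat ext" assume "y \<in> ext_p_inv"
    then have "y \<in> pg.alg" by (simp add: pg.alg_inv)
    then obtain c where c: "y = (\<Sum>S\<in>Pow ?I. c S *\<^sub>C pg.aprod S)" by (rule pg.alg_expand)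
    have "(\<Sum>S\<in>Pow ?I. c S *\<^sub>C E.aprod S) \<in> E.alg"
      by (intro cvs.subspace_sum[OF E.alg_subspace] cvs.subspace_scale[OF E.alg_subspace] E.aprod_in_alg) auto
    then show "y \<in> \<phi> ` ext_algebra P_wedge" unfolding Ealg c phi_expand[symmetric] by (rule imageI)
  qed
  ultimately have "alg_iso_on (ext_algebra P_wedge) (ext_p_inv :: ('n + 'n) cmat ext set) \<phi>"
    unfolding alg_iso_on_def vs_iso_on_def bij_betw_def by (simp add: rules)
  moreover have "\<forall>x\<in>P_wedge. \<phi> (ext_inc x) = x" by (simp add: rules fid)
  ultimately show ?thesis by blast
qed

section \<open>Joint eigenvectors\<close>

text \<open>A maximum point \<open>w\<close> of \<open>K x \<bullet> x\<close> on the unit sphere of \<open>W\<close>, with value \<open>\<mu>\<close>, is an eigenvector: the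
quadratic form \<open>\<mu> (x \<bullet> x) - K x \<bullet> x\<close> is nonnegative on \<open>W\<close> and zero at \<open>w\<close>, hence its first variation at \<open>w\<close>
vanishes in the direction \<open>u = \<mu> w - K w\<close>.\<close>

lemma self_adjoint_eigenvector:
  fixes K :: "'a::euclidean_space \<Rightarrow> 'a"
  assumes lin: "linear K" and sym: "\<And>x y. K x \<bullet> y = x \<bullet> K y"
    and W: "subspace W" "W \<noteq> {0}" and inv: "\<And>x. x \<in> W \<Longrightarrow> K x \<in> W"
  obtains w \<mu> where "w \<in> W" "w \<noteq> 0" "K w = \<mu> *\<^sub>R w"
proof -
  interpret K: linear K by (rule lin)
  let ?S = "W \<inter> sphere 0 1"
  obtain x0 where x0: "x0 \<in> W" "x0 \<noteq> 0" using W subspace_0 by blast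
  have "(1 / norm x0) *\<^sub>R x0 \<in> ?S" using x0 subspace_scale[OF W(1)] by simp
  then have ne: "?S \<noteq> {}" by blast
  have cpt: "compact ?S" by (intro closed_Int_compact closed_subspace W compact_sphere)
  have "continuous_on ?S (\<lambda>x. K x \<bullet> x)"
    by (intro continuous_intros linear_continuous_on linear_conv_bounded_linear[THEN iffD1] lin)
  then obtain w where w: "w \<in> ?S" "\<And>x. x \<in> ?S \<Longrightarrow> K x \<bullet> x \<le> K w \<bullet> w"
    using continuous_attains_sup[OF cpt ne] by blast
  define \<mu> where "\<mu> = K w \<bullet> w"
  have le: "K x \<bullet> x \<le> \<mu> * (x \<bullet> x)" if "x \<in> W" for x
  proof (cases "x = 0")
    case False
    define y where "y = (1 / norm x) *\<^sub>R x"
    have "y \<in> ?S" using that False subspace_scale[OF W(1)] by (simp add: y_def)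
    then have "K y \<bullet> y \<le> \<mu>" using w(2) \<mu>_def by blast
    moreover have "K y \<bullet> y = (K x \<bullet> x) / (x \<bullet> x)"
      by (simp add: y_def K.scale power2_eq_square[symmetric] power2_norm_eq_inner[symmetric])
    ultimately show ?thesis using False by (simp add: divide_le_eq)
  qed (simp add: K.zero)
  define u where "u = \<mu> *\<^sub>R w - K w"
  have wW: "w \<in> W" and ww: "w \<bullet> w = 1" using w(1) by (auto simp: norm_eq_1)
  have uW: "u \<in> W" unfolding u_def by (intro subspace_diff subspace_scale inv wW W(1))
  define b where "b = \<mu> * (u \<bullet> u) - K u \<bullet> u"
  have b: "b \<ge> 0" using le[OF uW] by (simp add: b_def)
  define c where "c = u \<bullet> u"
  have quad: "2 * t * c + t\<^sup>2 * b \<ge> 0" for t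
  proof -
    have le': "K (w + t *\<^sub>R u) \<bullet> (w + t *\<^sub>R u) \<le> \<mu> * ((w + t *\<^sub>R u) \<bullet> (w + t *\<^sub>R u))"
      by (intro le subspace_add subspace_scale wW uW W(1))
    have e1: "K (w + t *\<^sub>R u) \<bullet> (w + t *\<^sub>R u) = \<mu> + 2 * t * (K w \<bullet> u) + t\<^sup>2 * (K u \<bullet> u)"
      using sym[of u w] unfolding \<mu>_def
      by (simp add: K.add K.scale inner_add_left inner_add_right inner_commute power2_eq_square algebra_simps)
    have e2: "(w + t *\<^sub>R u) \<bullet> (w + t *\<^sub>R u) = 1 + 2 * t * (w \<bullet> u) + t\<^sup>2 * (u \<bullet> u)"
      using ww by (simp add: inner_add_left inner_add_right inner_commute power2_eq_square algebra_simps)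
    have e3: "c = \<mu> * (w \<bullet> u) - K w \<bullet> u" unfolding c_def by (subst (1) u_def) (simp add: inner_diff_left)
    show ?thesis using le' unfolding e1 e2 e3 b_def by (simp add: algebra_simps)
  qed
  have "c = 0"
  proof (rule ccontr)
    assume c: "c \<noteq> 0"
    define s where "s = c / (b + 1)"
    have cs: "c = s * (b + 1)" using b by (simp add: s_def)
    have "2 * (- s) * c + (- s)\<^sup>2 * b = - (s\<^sup>2 * (b + 2))"
      by (simp add: cs algebra_simps power2_eq_square)
    also have "\<dots> < 0" using c b by (simp add: s_def)
    finally show False using quad[of "- s"] by linarith
  qed
  then have "K w = \<mu> *\<^sub>R w" by (simp add: c_def u_def)
  moreover have "w \<noteq> 0" using ww by auto
  ultimately show thesis using that wW by blast
qed

lemma herm_prod_adjoint: "herm_prod (A *v x) y = herm_prod x (conj_transpose A *v y)"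
proof -
  have "herm_prod (A *v x) y = (\<Sum>i\<in>UNIV. \<Sum>j\<in>UNIV. A $ i $ j * x $ j * cnj (y $ i))"
    by (simp add: herm_prod_def matrix_vector_mult_def sum_distrib_right)
  also have "\<dots> = (\<Sum>j\<in>UNIV. \<Sum>i\<in>UNIV. A $ i $ j * x $ j * cnj (y $ i))" by (rule sum.swap)
  also have "\<dots> = herm_prod x (conj_transpose A *v y)"
    by (simp add: herm_prod_def matrix_vector_mult_def sum_distrib_left mult_ac)
  finally show ?thesis .
qed

lemma inner_herm_prod: "x \<bullet> y = Re (herm_prod x y)"
  by (simp add: herm_prod_def inner_vec_def inner_complex_def)

lemma herm_prod_scale: "herm_prod (c *s x) y = c * herm_prod x y" "herm_prod x (c *s y) = cnj c * herm_prod x y"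
  by (simp_all add: herm_prod_def sum_distrib_left mult_ac)

text \<open>In an invariant subspace of least dimension every member of \<open>T\<close> acts as a scalar, because its eigenspaces are
again invariant.\<close>

lemma joint_eigenvector:
  fixes T :: "'m::finite cmat set" and U :: "(complex^'m) set"
  assumes U: "subspace U" "U \<noteq> {0}" "\<And>c x. x \<in> U \<Longrightarrow> c *s x \<in> U"
    and inv: "\<And>H x. H \<in> T \<Longrightarrow> x \<in> U \<Longrightarrow> H *v x \<in> U"
    and skew: "\<And>H. H \<in> T \<Longrightarrow> conj_transpose H = - H"
    and comm: "\<And>H K. H \<in> T \<Longrightarrow> K \<in> T \<Longrightarrow> H ** K = K ** H"
  obtains v where "v \<in> U" "v \<noteq> 0" "\<And>H. H \<in> T \<Longrightarrow> \<exists>c. H *v v = c *s v"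
proof -
  define good where "good W \<longleftrightarrow> subspace W \<and> W \<noteq> {0} \<and> W \<subseteq> U \<and> (\<forall>c. \<forall>x\<in>W. c *s x \<in> W) \<and>
    (\<forall>H\<in>T. \<forall>x\<in>W. H *v x \<in> W)" for W
  have "good U" using U inv by (auto simp: good_def)
  then obtain W where W: "good W" "\<And>W'. good W' \<Longrightarrow> dim W \<le> dim W'"
    using ex_has_least_nat[of good U dim] by blast
  have sW: "subspace W" and W0: "W \<noteq> {0}" using W(1) by (auto simp: good_def)
  have scalar: "\<exists>c. \<forall>x\<in>W. H *v x = c *s x" if H: "H \<in> T" for H
  proof -
    \<comment> \<open>\<open>K\<close> is self-adjoint because \<open>H\<close> is skew-Hermitian.\<close>
    define K where "K x = (- \<i>) *s (H *v x)" for x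
    have lin: "linear K"
      by (rule linearI) (simp_all add: K_def vec_eq_iff algebra_simps sum.distrib
          matrix_vector_mult_def sum_distrib_left scaleR_conv_of_real[where 'a = complex])
    have sym: "K x \<bullet> y = x \<bullet> K y" for x y
    proof -
      have "herm_prod (K x) y = - \<i> * herm_prod x (conj_transpose H *v y)" by (simp only: K_def herm_prod_scale herm_prod_adjoint)
      also have "conj_transpose H *v y = (- 1) *s (H *v y)"
        unfolding skew[OF H] by (simp add: matrix_vector_mult_def vec_eq_iff sum_negf)
      also have "- \<i> * herm_prod x ((- 1) *s (H *v y)) = herm_prod x (K y)" unfolding K_def herm_prod_scale by simp
      finally show ?thesis by (simp add: inner_herm_prod)
    qed
    have Kinv: "K x \<in> W" if "x \<in> W" for x using W(1) H that unfolding good_def K_def by blast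
    obtain w \<mu> where w: "w \<in> W" "w \<noteq> 0" "K w = \<mu> *\<^sub>R w"
      by (rule self_adjoint_eigenvector[OF lin sym sW W0 Kinv])
    have "\<i> *s K w = H *v w" by (simp add: K_def vec_eq_iff)
    then have Hw: "H *v w = (\<i> * of_real \<mu>) *s w" unfolding w(3) by (simp add: vec_eq_iff scaleR_conv_of_real[where 'a = complex] flip: \<open>\<i> *s K w = H *v w\<close>)
    define c where "c = \<i> * of_real \<mu>"
    define W' where "W' = {x \<in> W. H *v x = c *s x}"
    have "good W'"
      unfolding good_def
    proof (intro conjI allI ballI)
      show "subspace W'"
        unfolding subspace_def W'_def using sW
        by (auto simp: subspace_def vec_eq_iff matrix_vector_mult_def distrib_left sum.distrib
           sum_distrib_left[symmetric] scaleR_conv_of_real[where 'a = complex] mult.left_commute)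
      show "W' \<noteq> {0}" using w Hw by (auto simp: W'_def c_def)
      show "W' \<subseteq> U" using W(1) by (auto simp: W'_def good_def)
      fix d x assume x: "x \<in> W'"
      have "H *v (d *s x) = d *s (H *v x)"
        by (simp add: vec_eq_iff matrix_vector_mult_def sum_distrib_left mult_ac)
      then show "d *s x \<in> W'" using x W(1) by (auto simp: W'_def good_def vec_eq_iff)
    next
      fix L x assume L: "L \<in> T" and x: "x \<in> W'"
      have "H *v (L *v x) = L *v (H *v x)" by (simp add: matrix_vector_mul_assoc comm[OF H L])
      also have "\<dots> = c *s (L *v x)"
        using x by (simp add: W'_def vec_eq_iff matrix_vector_mult_def sum_distrib_left mult_ac)
      finally show "L *v x \<in> W'" using x W(1) L by (auto simp: W'_def good_def)
    qed
    then have "dim W \<le> dim W'" by (rule W(2))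
    moreover have "W' \<subseteq> W" by (auto simp: W'_def)
    moreover have "subspace W'" using \<open>good W'\<close> by (simp add: good_def)
    ultimately have "W' = W" using subspace_dim_equal sW by blast
    then show ?thesis by (intro exI[of _ c]) (auto simp: W'_def)
  qed
  obtain v where "v \<in> W" "v \<noteq> 0" using W0 subspace_0[OF sW] by blast
  moreover have "v \<in> U" using W(1) \<open>v \<in> W\<close> by (auto simp: good_def)
  ultimately show thesis using that scalar by blast
qed

section \<open>Cartan subalgebras of sp(n)\<close>

lemma trace_skew_zero:
  assumes "conj_transpose Z = - Z" "trace (Z ** Z) = 0"
  shows "Z = (0 :: 'm::finite cmat)"
proof -
  have Zt: "Z $ j $ i = - cnj (Z $ i $ j)" for i j
  proof -
    have "cnj (Z $ i $ j) = (- Z) $ j $ i" unfolding assms(1)[symmetric] by simp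
    then show ?thesis by simp
  qed
  have "trace (Z ** Z) = (\<Sum>i\<in>UNIV. \<Sum>j\<in>UNIV. Z $ i $ j * Z $ j $ i)"
    by (simp add: trace_def matrix_matrix_mult_def)
  also have "\<dots> = (\<Sum>i\<in>UNIV. \<Sum>j\<in>UNIV. - (Z $ i $ j * cnj (Z $ i $ j)))"
    by (intro sum.cong refl) (subst Zt, simp)
  also have "\<dots> = - complex_of_real (\<Sum>i\<in>UNIV. \<Sum>j\<in>UNIV. (cmod (Z $ i $ j))\<^sup>2)"
    by (simp only: of_real_sum complex_norm_square sum_negf)
  finally have "(\<Sum>i\<in>UNIV. \<Sum>j\<in>UNIV. (cmod (Z $ i $ j))\<^sup>2) = 0"
    using assms(2) by (metis neg_equal_0_iff_equal of_real_eq_0_iff)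
  then have "Z $ i $ j = 0" for i j
    by (simp add: sum_nonneg_eq_0_iff sum_nonneg)
  then show ?thesis by (simp add: vec_eq_iff)
qed

lemma bracket_0 [simp]: "bracket X 0 = 0" "bracket 0 X = 0"
  by (simp_all add: bracket_def)

text \<open>If \<open>Z = [X, Y]\<close> commutes with \<open>X\<close>, then \<open>tr Z\<^sup>2 = tr [X, Y] Z = 0\<close>, and a skew-Hermitian matrix with this
property is zero. So a term of the lower central series of index at least one vanishes if the next one does.\<close>

lemma cartan_abelian:
  assumes t: "cartan_subalgebra (sp_lie :: ('n::finite + 'n) cmat set) t"
    and X: "X \<in> t" and Y: "Y \<in> t"
  shows "X ** Y = Y ** X"
proof -
  have sub: "subspace t" and br: "\<And>X Y. X \<in> t \<Longrightarrow> Y \<in> t \<Longrightarrow> bracket X Y \<in> t"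
    and sk: "\<And>X. X \<in> t \<Longrightarrow> conj_transpose X = - X"
    using t by (auto simp: cartan_subalgebra_def sp_lie_def)
  have lc: "lower_central t k \<subseteq> t" for k
  proof (induction k)
    case (Suc k)
    then have "{bracket X Y |X Y. X \<in> t \<and> Y \<in> lower_central t k} \<subseteq> t" using br by blast
    then show ?case using span_minimal[OF _ sub] by simp
  qed simp
  have descend: "lower_central t (Suc k) = {0} \<Longrightarrow> lower_central t (Suc 0) = {0}" for k
  proof (induction k)
    case (Suc k)
    have "bracket X Y = 0" if XY: "X \<in> t" "Y \<in> lower_central t k" for X Y
    proof -
      define Z where "Z = bracket X Y"
      have Yt: "Y \<in> t" using lc XY(2) by blast
      have Zt: "Z \<in> t" unfolding Z_def using br XY(1) Yt by blast
      have "Z \<in> lower_central t (Suc k)" unfolding Z_def using XY by (auto intro: span_base)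
      then have "bracket X Z \<in> lower_central t (Suc (Suc k))"
        using XY(1) unfolding lower_central.simps(2)[of t "Suc k"] by (intro span_base) blast
      then have XZ: "X ** Z = Z ** X" using Suc.prems by (simp add: bracket_def)
      have "trace (Z ** Z) = trace (X ** Y ** Z) - trace (Y ** X ** Z)"
        by (subst (1) Z_def) (simp add: bracket_def cmat_diff_mult trace_def sum_subtractf)
      also have "trace (X ** Y ** Z) = trace (Y ** Z ** X)"
        using trace_mul_sym[of X "Y ** Z"] by (simp add: matrix_mul_assoc)
      also have "Y ** Z ** X = Y ** X ** Z" by (simp add: matrix_mul_assoc[symmetric] XZ)
      finally have "trace (Z ** Z) = 0" by simp
      then have "Z = 0" using sk[OF Zt] by (intro trace_skew_zero)
      then show ?thesis by (simp add: Z_def)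
    qed
    then have "{bracket X Y |X Y. X \<in> t \<and> Y \<in> lower_central t k} \<subseteq> {0}" by blast
    from span_mono[OF this] have "lower_central t (Suc k) \<subseteq> {0}" by (simp add: span_insert_0)
    moreover have "0 \<in> lower_central t (Suc k)" by (simp add: span_zero)
    ultimately show ?case using Suc.IH by blast
  qed simp
  obtain k where k: "lower_central t k = {0}" using t by (auto simp: cartan_subalgebra_def)
  have "lower_central t (Suc k) = {0}"
  proof -
    have "{bracket X Y |X Y. X \<in> t \<and> Y \<in> lower_central t k} \<subseteq> {0}" unfolding k by auto
    from span_mono[OF this] have "lower_central t (Suc k) \<subseteq> {0}" by (simp add: span_insert_0)
    moreover have "0 \<in> lower_central t (Suc k)" by (simp add: span_zero)
    ultimately show ?thesis by blast
  qed
  then have "lower_central t (Suc 0) = {0}" by (rule descend)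
  moreover have "bracket X Y \<in> lower_central t (Suc 0)" using X Y by (auto intro: span_base)
  ultimately show ?thesis by (simp add: bracket_def)
qed

lemma mult_outer: "A ** outer u v = outer (A *v u) v"
  by (simp add: vec_eq_iff matrix_matrix_mult_def matrix_vector_mult_def sum_distrib_right
      sum_distrib_left mult_ac)

lemma outer_mult_right: "outer u v ** A = outer u (conj_transpose A *v v)"
  by (simp add: vec_eq_iff matrix_matrix_mult_def matrix_vector_mult_def sum_distrib_left mult_ac)

lemma outer_vec: "outer u v *v x = herm_prod x v *s u"
  by (simp add: vec_eq_iff matrix_vector_mult_def herm_prod_def sum_distrib_right sum_distrib_left mult_ac)

lemma outer_scale: "outer (c *s u) v = c *\<^sub>C outer u v" "outer u (c *s v) = cnj c *\<^sub>C outer u v"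
  by (simp_all add: vec_eq_iff mult_ac)

text \<open>For a unit vector \<open>v\<close>, \<open>frame_proj v\<close> is the projection to the quaternionic line of \<open>v\<close>, and \<open>frame_rot v\<close>
is the element of \<open>sp(n)\<close> with eigenvalue \<open>\<i>\<close> on \<open>v\<close> and \<open>-\<i>\<close> on \<open>jvec v\<close>.\<close>

definition frame_proj :: "complex^('n + 'n) \<Rightarrow> ('n::finite + 'n) cmat"
  where "frame_proj v = outer v v + outer (jvec v) (jvec v)"

definition frame_rot :: "complex^('n + 'n) \<Rightarrow> ('n::finite + 'n) cmat"
  where "frame_rot v = \<i> *\<^sub>C (outer v v - outer (jvec v) (jvec v))"

lemma transpose_outer: "transpose (outer u v) = map_matrix cnj (outer v u)"
  by (simp add: vec_eq_iff transpose_def map_matrix_def)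

lemma frame_rot_sp: "frame_rot v \<in> sp_lie"
proof -
  have "J_mat ** transpose (frame_rot v) = \<i> *\<^sub>C ((outer (jvec v) (jvec v) - outer v v) ** J_mat)"
    by (simp add: frame_rot_def transpose_scaleC transpose_diff transpose_outer cmat_mult_scaleC cmat_mult_diff
       J_outer outer_jvec_jvec cmat_diff_mult)
  then have "involution (frame_rot v) = frame_rot v"
    unfolding involution_eq by (simp add: cmat_scaleC_mult JJ_right frame_rot_def)
  moreover have "conj_transpose (frame_rot v) = - frame_rot v"
    by (simp add: frame_rot_def conj_transpose_scaleC conj_transpose_diff conj_transpose_outer cvs.scale_minus_left)
  ultimately show ?thesis by (simp add: sp_lie_def)
qed

lemma frame_rot_square: "herm_prod v v = 1 \<Longrightarrow> frame_rot v ** frame_rot v = - frame_proj v"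
  by (simp add: frame_rot_def frame_proj_def cmat_scaleC_mult cmat_mult_scaleC cmat_diff_mult cmat_mult_diff outer_mult
      herm_prod_jvec_jvec herm_prod_jvec_self cvs.scale_zero_left scaleC_one scaleC_scaleC cvs.scale_minus_left)
     (simp add: scaleC_add_right scaleC_scaleC cvs.scale_minus_left scaleC_one)

lemma frame_proj_p: "frame_proj v \<in> p_space"
  unfolding p_space_iff frame_proj_def
  by (simp add: transpose_add transpose_outer matrix_add_ldistrib cmat_add_mult J_outer outer_jvec_jvec add.commute)

lemma sp_lie_J:
  assumes "H \<in> sp_lie"
  shows "J_mat ** map_matrix cnj H = H ** J_mat" "conj_transpose H = - H"
proof -
  show s: "conj_transpose H = - H" using assms by (simp add: sp_lie_def)
  have "transpose H = map_matrix cnj (conj_transpose H)"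
    by (simp add: vec_eq_iff transpose_def map_matrix_def)
  also have "\<dots> = - map_matrix cnj H" unfolding s by (simp add: vec_eq_iff map_matrix_def)
  finally have t: "transpose H = - map_matrix cnj H" .
  have "J_mat ** transpose H ** J_mat = H" using assms by (simp add: sp_lie_def involution_eq)
  then have "J_mat ** transpose H ** J_mat ** J_mat = H ** J_mat" by simp
  then show "J_mat ** map_matrix cnj H = H ** J_mat" unfolding t JJ_right by (simp add: matrix_mult_neg)
qed

lemma jvec_eq: "jvec v = J_mat *v (\<chi> i. cnj (v $ i))"
  by (simp add: vec_eq_iff matrix_vector_mult_def J_nth if_distrib[of "\<lambda>z. z * _"] cong: if_cong)

lemma jvec_commute:
  assumes "H \<in> sp_lie" shows "H *v jvec v = jvec (H *v v)"
proof -
  have "H *v jvec v = (H ** J_mat) *v (\<chi> i. cnj (v $ i))" by (simp add: jvec_eq matrix_vector_mul_assoc)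
  also have "\<dots> = J_mat *v (map_matrix cnj H *v (\<chi> i. cnj (v $ i)))"
    unfolding sp_lie_J(1)[OF assms, symmetric] by (simp add: matrix_vector_mul_assoc)
  also have "map_matrix cnj H *v (\<chi> i. cnj (v $ i)) = (\<chi> i. cnj ((H *v v) $ i))"
    by (simp add: vec_eq_iff matrix_vector_mult_def map_matrix_def)
  finally show ?thesis by (simp add: jvec_eq)
qed

lemma eigen_commute:
  assumes sk: "conj_transpose H = - H" and e: "H *v v = c *s v" and u: "herm_prod v v = 1"
  shows "H ** outer v v = outer v v ** H"
proof -
  have n: "(- H) *v v = (- c) *s v" using e by (simp add: vec_eq_iff matrix_vector_mult_def sum_negf)
  have "c = herm_prod (H *v v) v" unfolding e herm_prod_scale u by simp
  also have "\<dots> = - cnj c" unfolding herm_prod_adjoint sk n herm_prod_scale u by simp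
  finally have "c = - cnj c" .
  then show ?thesis unfolding mult_outer outer_mult_right sk n e outer_scale by simp
qed

text \<open>A skew-Hermitian \<open>H\<close> in \<open>sp(n)\<close> has the eigenvector \<open>jvec v\<close> along with \<open>v\<close>.\<close>

lemma eigen_frame_rot:
  assumes H: "H \<in> sp_lie" and e: "H *v v = c *s v" and u: "herm_prod v v = 1"
  shows "frame_rot v ** H = H ** frame_rot v"
proof -
  have "H *v jvec v = cnj c *s jvec v"
    unfolding jvec_commute[OF H] e by (simp add: vec_eq_iff mult_ac)
  moreover have "herm_prod (jvec v) (jvec v) = 1" using u by (simp add: herm_prod_jvec_jvec)
  ultimately show ?thesis
    using eigen_commute[OF sp_lie_J(2)[OF H] e u] eigen_commute[OF sp_lie_J(2)[OF H], of "jvec v" "cnj c"]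
    by (simp add: frame_rot_def cmat_scaleC_mult cmat_mult_scaleC cmat_diff_mult cmat_mult_diff)
qed

lemma herm_prod_jvec_flip: "herm_prod u (jvec v) = - herm_prod v (jvec u)"
proof -
  have "herm_prod u (jvec v) = (\<Sum>i\<in>UNIV. u $ hat i * cnj (jvec v $ hat i))"
    unfolding herm_prod_def by (rule sum_hat[symmetric])
  also have "\<dots> = - herm_prod v (jvec u)"
    unfolding herm_prod_def sum_negf[symmetric] by (intro sum.cong refl) (simp add: mult_ac)
  finally show ?thesis .
qed

lemma frame_proj_mult_self: "herm_prod v v = 1 \<Longrightarrow> frame_proj v ** frame_proj v = frame_proj v"
  by (simp add: frame_proj_def cmat_add_mult matrix_add_ldistrib outer_mult herm_prod_jvec_jvec herm_prod_jvec_self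
      cvs.scale_zero_left scaleC_one)

lemma frame_proj_mult_orth: "herm_prod v w = 0 \<Longrightarrow> herm_prod v (jvec w) = 0 \<Longrightarrow> frame_proj v ** frame_proj w = 0"
proof -
  assume a: "herm_prod v w = 0" "herm_prod v (jvec w) = 0"
  have "herm_prod w v = 0" using herm_prod_cnj[of v w] a by simp
  moreover have "herm_prod (jvec w) v = 0" using herm_prod_cnj[of v "jvec w"] a by simp
  moreover have "herm_prod w (jvec v) = 0" using herm_prod_jvec_flip[of w v] a by simp
  ultimately show ?thesis using a
    by (simp add: frame_proj_def cmat_add_mult matrix_add_ldistrib outer_mult herm_prod_jvec_jvec cvs.scale_zero_left)
qed

lemma conj_transpose_frame_proj: "conj_transpose (frame_proj v) = frame_proj v"
  by (simp add: frame_proj_def conj_transpose_add conj_transpose_outer)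

lemma trace_frame_proj: "herm_prod v v = 1 \<Longrightarrow> trace (frame_proj v) = 2"
proof -
  have t: "trace (outer u u) = herm_prod u u" for u :: "complex^('a + 'a)" by (simp add: trace_def herm_prod_def)
  assume "herm_prod v v = 1"
  then show ?thesis unfolding frame_proj_def trace_add t by (simp add: herm_prod_jvec_jvec)
qed

lemma frame_proj_vec: "frame_proj w *v v = herm_prod v w *s w + herm_prod v (jvec w) *s jvec w"
  by (simp add: frame_proj_def matrix_vector_mult_add_rdistrib outer_vec)

definition cartan_frame :: "('n::finite + 'n) cmat set \<Rightarrow> (complex^('n + 'n)) list \<Rightarrow> bool"
  where "cartan_frame t vs \<longleftrightarrow> (\<forall>i<length vs. frame_rot (vs ! i) \<in> t) \<and>
    (\<forall>i<length vs. \<forall>j<length vs. herm_prod (vs ! i) (vs ! j) = (if i = j then 1 else 0) \<and> herm_prod (vs ! i) (jvec (vs ! j)) = 0)"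

text \<open>\<open>R\<close> is the orthogonal projection to the complement of the frame. Its trace is the sum of the squared absolute
values of its entries, which bounds the length of a frame and shows that a frame of length \<open>n\<close> is complete.\<close>

lemma cartan_frame_complement:
  fixes t :: "('n::finite + 'n) cmat set"
  assumes "cartan_frame t vs"
  defines "R \<equiv> mat 1 - (\<Sum>i<length vs. frame_proj (vs ! i))"
  shows "R ** R = R" "conj_transpose R = R" "\<And>j. j < length vs \<Longrightarrow> frame_proj (vs ! j) ** R = 0"
    "trace R = of_nat (2 * CARD('n)) - of_nat (2 * length vs)"
    "length vs \<le> CARD('n)" "length vs = CARD('n) \<Longrightarrow> R = 0"
proof -
  let ?E = "\<lambda>i. frame_proj (vs ! i)"
  have o: "herm_prod (vs ! i) (vs ! j) = (if i = j then 1 else 0)" "herm_prod (vs ! i) (jvec (vs ! j)) = 0"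
    if "i < length vs" "j < length vs" for i j
    using assms(1) that by (auto simp: cartan_frame_def)
  have EE: "?E i ** ?E j = (if i = j then ?E i else 0)" if "i < length vs" "j < length vs" for i j
    using o[OF that] o[OF that(1,1)] frame_proj_mult_self[of "vs ! i"] frame_proj_mult_orth[of "vs ! i" "vs ! j"] by auto
  have ES: "?E j ** (\<Sum>i<length vs. ?E i) = ?E j" if "j < length vs" for j
  proof -
    have "?E j ** (\<Sum>i<length vs. ?E i) = (\<Sum>i<length vs. if j = i then ?E j else 0)"
      unfolding cmat_mult_sum using EE that by (intro sum.cong) auto
    then show ?thesis using that by simp
  qed
  show ER: "?E j ** R = 0" if "j < length vs" for j
    using ES[OF that] by (simp add: R_def cmat_mult_diff)
  have "(\<Sum>i<length vs. ?E i) ** R = 0" unfolding cmat_sum_mult using ER by simp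
  then show RR: "R ** R = R" by (subst (1) R_def) (simp add: cmat_diff_mult)
  have cs: "conj_transpose (\<Sum>i\<in>I. F i) = (\<Sum>i\<in>I. conj_transpose (F i))" for I :: "nat set" and F :: "nat \<Rightarrow> ('n + 'n) cmat"
    by (simp add: vec_eq_iff sum_cmat_nth)
  have "conj_transpose (mat 1) = (mat 1 :: ('n + 'n) cmat)" by (auto simp: vec_eq_iff mat_def)
  then show Rh: "conj_transpose R = R"
    by (simp add: R_def conj_transpose_diff cs conj_transpose_frame_proj)
  have "trace R = trace (mat 1 :: ('n + 'n) cmat) - (\<Sum>i<length vs. trace (?E i))"
  proof -
    have "trace (\<Sum>i<length vs. ?E i) = (\<Sum>i<length vs. trace (?E i))"
      unfolding trace_def sum_cmat_nth by (rule sum.swap)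
    then show ?thesis by (simp add: R_def trace_def sum_subtractf)
  qed
  also have "\<dots> = of_nat (2 * CARD('n)) - of_nat (2 * length vs)"
  proof -
    have "(\<Sum>i<length vs. trace (?E i)) = (\<Sum>i<length vs. 2)"
      using o by (intro sum.cong) (auto intro!: trace_frame_proj)
    then show ?thesis by (simp add: trace_I)
  qed
  finally show tr: "trace R = of_nat (2 * CARD('n)) - of_nat (2 * length vs)" .
  have trn: "trace R = complex_of_real (\<Sum>i\<in>UNIV. \<Sum>j\<in>UNIV. (cmod (R $ i $ j))\<^sup>2)"
  proof -
    have Rt: "R $ j $ i = cnj (R $ i $ j)" for i j
      using Rh by (metis conj_transpose_nth)
    have "trace R = (\<Sum>i\<in>UNIV. \<Sum>j\<in>UNIV. R $ i $ j * R $ j $ i)"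
      by (subst RR[symmetric]) (simp add: trace_def matrix_matrix_mult_def)
    also have "\<dots> = (\<Sum>i\<in>UNIV. \<Sum>j\<in>UNIV. R $ i $ j * cnj (R $ i $ j))"
      by (intro sum.cong refl) (subst Rt, simp)
    finally show ?thesis by (simp only: of_real_sum complex_norm_square)
  qed
  have nn: "(\<Sum>i\<in>UNIV. \<Sum>j\<in>UNIV. (cmod (R $ i $ j))\<^sup>2) \<ge> 0" by (intro sum_nonneg) auto
  have eq: "(\<Sum>i\<in>UNIV. \<Sum>j\<in>UNIV. (cmod (R $ i $ j))\<^sup>2) = real (2 * CARD('n)) - real (2 * length vs)"
  proof -
    have "complex_of_real (\<Sum>i\<in>UNIV. \<Sum>j\<in>UNIV. (cmod (R $ i $ j))\<^sup>2) = complex_of_real (real (2 * CARD('n)) - real (2 * length vs))"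
      using tr trn by simp
    then show ?thesis by (simp only: of_real_eq_iff)
  qed
  then show "length vs \<le> CARD('n)" using nn by simp
  show "R = 0" if "length vs = CARD('n)"
  proof -
    have "(\<Sum>i\<in>UNIV. \<Sum>j\<in>UNIV. (cmod (R $ i $ j))\<^sup>2) = 0" using eq that by simp
    then have "R $ i $ j = 0" for i j by (simp add: sum_nonneg_eq_0_iff sum_nonneg)
    then show ?thesis by (simp add: vec_eq_iff)
  qed
qed

text \<open>The complement of a frame of maximal length is invariant under \<open>t\<close>. A joint unit eigenvector \<open>v\<close> in it would
extend the frame: \<open>frame_rot v\<close> commutes with \<open>t\<close>, so it belongs to \<open>t\<close>, which is its own normalizer.\<close>

lemma cartan_frame_exists:
  fixes t :: "('n::finite + 'n) cmat set"
  assumes t: "cartan_subalgebra sp_lie t"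
  obtains vs where "cartan_frame t vs" "length vs = CARD('n)"
proof -
  have tsp: "t \<subseteq> sp_lie" and norm: "\<And>X. X \<in> sp_lie \<Longrightarrow> (\<And>Y. Y \<in> t \<Longrightarrow> bracket X Y \<in> t) \<Longrightarrow> X \<in> t"
    and t0: "0 \<in> t"
    using t subspace_0 unfolding cartan_subalgebra_def by blast+
  have "cartan_frame t []" by (simp add: cartan_frame_def)
  then obtain vs where vs: "cartan_frame t vs" "\<And>ws. cartan_frame t ws \<Longrightarrow> length ws \<le> length vs"
    using ex_has_greatest_nat[of "cartan_frame t" "[]" length "CARD('n) + 1"] cartan_frame_complement(5)
    by (metis Suc_eq_plus1 le_imp_less_Suc)
  have "length vs = CARD('n)"
  proof (rule ccontr)
    assume "length vs \<noteq> CARD('n)"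
    then have lt: "length vs < CARD('n)" using cartan_frame_complement(5)[OF vs(1)] by simp
    define R where "R = mat 1 - (\<Sum>i<length vs. frame_proj (vs ! i))"
    note Rp = cartan_frame_complement[OF vs(1), folded R_def]
    have comm: "H ** R = R ** H" if H: "H \<in> t" for H
    proof -
      have "H ** frame_proj (vs ! i) = frame_proj (vs ! i) ** H" if i: "i < length vs" for i
      proof -
        have z: "frame_rot (vs ! i) \<in> t" "herm_prod (vs ! i) (vs ! i) = 1" using vs(1) i by (auto simp: cartan_frame_def)
        have c: "H ** frame_rot (vs ! i) = frame_rot (vs ! i) ** H" by (rule cartan_abelian[OF t H z(1)])
        have "H ** (frame_rot (vs ! i) ** frame_rot (vs ! i)) = (frame_rot (vs ! i) ** frame_rot (vs ! i)) ** H"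
          by (metis c matrix_mul_assoc)
        then show ?thesis unfolding frame_rot_square[OF z(2)] by (simp add: matrix_mult_neg matrix_neg_mult)
      qed
      then show ?thesis by (simp add: R_def cmat_mult_diff cmat_diff_mult cmat_mult_sum cmat_sum_mult)
    qed
    define U where "U = {x. R *v x = x}"
    have "R \<noteq> 0"
    proof
      assume "R = 0"
      then have "(0::complex) = of_nat (2 * CARD('n)) - of_nat (2 * length vs)" using Rp(4) by (simp add: trace_def)
      then have "(of_nat (2 * CARD('n)) :: complex) = of_nat (2 * length vs)" by simp
      then show False using lt by (simp only: of_nat_eq_iff)
    qed
    then obtain a b where ab: "R $ a $ b \<noteq> 0" by (auto simp: vec_eq_iff)
    have "R *v axis b 1 \<in> U" by (simp add: U_def matrix_vector_mul_assoc Rp(1))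
    moreover have "R *v axis b 1 \<noteq> 0"
    proof
      assume "R *v axis b 1 = 0"
      then have "(R *v axis b 1) $ a = 0" by simp
      moreover have "(R *v axis b 1) $ a = R $ a $ b"
        by (simp add: matrix_vector_mult_def axis_def if_distrib[of "\<lambda>z. _ * z"] cong: if_cong)
      ultimately show False using ab by simp
    qed
    ultimately have U0: "U \<noteq> {0}" by blast
    have subU: "subspace U"
      unfolding subspace_def U_def
      by (auto simp: vec_eq_iff matrix_vector_mult_def distrib_left sum.distrib
         sum_distrib_left[symmetric] scaleR_conv_of_real[where 'a = complex] mult.left_commute)
    have scU: "c *s x \<in> U" if "x \<in> U" for c x
      using that unfolding U_def
      by (simp add: vec_eq_iff matrix_vector_mult_def sum_distrib_left[symmetric] mult.left_commute)
    have invU: "H *v x \<in> U" if "H \<in> t" "x \<in> U" for H x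
    proof -
      have "R *v (H *v x) = H *v (R *v x)" by (simp add: matrix_vector_mul_assoc comm[OF that(1)])
      then show ?thesis using that(2) by (simp add: U_def)
    qed
    obtain v0 where v0: "v0 \<in> U" "v0 \<noteq> 0" "\<And>H. H \<in> t \<Longrightarrow> \<exists>c. H *v v0 = c *s v0"
      by (rule joint_eigenvector[OF subU U0 scU invU, of t])
        (use tsp sp_lie_J(2) cartan_abelian[OF t] in auto)
    define v where "v = (1 / norm v0) *\<^sub>R v0"
    have vv: "herm_prod v v = 1"
    proof -
      have "Im (herm_prod v v) = 0" using herm_prod_cnj[of v v] by (metis Reals_cnj_iff complex_is_Real_iff)
      moreover have "norm v = 1" using v0(2) by (simp add: v_def)
      then have "Re (herm_prod v v) = 1" unfolding inner_herm_prod[symmetric] by (simp add: norm_eq_1)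
      ultimately show ?thesis by (simp add: complex_eq_iff)
    qed
    have vU: "v \<in> U" unfolding v_def using v0(1) subU by (intro subspace_scale)
    have ve: "\<exists>c. H *v v = c *s v" if H: "H \<in> t" for H
    proof -
      obtain c where "H *v v0 = c *s v0" using v0(3)[OF H] by blast
      then have "H *v v = c *s v"
        by (simp add: v_def vec_eq_iff matrix_vector_mult_def scaleR_conv_of_real[where 'a = complex]
            sum_distrib_left[symmetric] sum_divide_distrib[symmetric])
      then show ?thesis ..
    qed
    have zt: "frame_rot v \<in> t"
    proof (rule norm[OF frame_rot_sp])
      fix Y assume Y: "Y \<in> t"
      then have "Y \<in> sp_lie" using tsp by blast
      then have "bracket (frame_rot v) Y = 0" using ve[OF Y] eigen_frame_rot[OF _ _ vv] by (auto simp: bracket_def)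
      then show "bracket (frame_rot v) Y \<in> t" using t0 by simp
    qed
    have orth: "herm_prod v (vs ! i) = 0 \<and> herm_prod v (jvec (vs ! i)) = 0" if i: "i < length vs" for i
    proof -
      let ?w = "vs ! i"
      have w: "herm_prod ?w ?w = 1" using vs(1) i by (auto simp: cartan_frame_def)
      have "frame_proj ?w *v v = (frame_proj ?w ** R) *v v" using vU by (simp add: U_def matrix_vector_mul_assoc[symmetric])
      then have z: "herm_prod v ?w *s ?w + herm_prod v (jvec ?w) *s jvec ?w = 0"
        unfolding Rp(3)[OF i] frame_proj_vec by simp
      have add: "herm_prod (x + y) u = herm_prod x u + herm_prod y u" for x y u :: "complex^('n + 'n)"
        by (simp add: herm_prod_def distrib_right sum.distrib)
      have "herm_prod (herm_prod v ?w *s ?w + herm_prod v (jvec ?w) *s jvec ?w) ?w = 0" unfolding z by (simp add: herm_prod_def)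
      then have "herm_prod v ?w = 0" unfolding add herm_prod_scale by (simp add: w herm_prod_jvec_self)
      moreover have "herm_prod (herm_prod v ?w *s ?w + herm_prod v (jvec ?w) *s jvec ?w) (jvec ?w) = 0" unfolding z by (simp add: herm_prod_def)
      then have "herm_prod v (jvec ?w) = 0" unfolding add herm_prod_scale by (simp add: w herm_prod_jvec_self herm_prod_jvec_jvec)
      ultimately show ?thesis by simp
    qed
    have "cartan_frame t (vs @ [v])"
    proof -
      have 1: "herm_prod (vs ! i) v = 0" "herm_prod (vs ! i) (jvec v) = 0" if "i < length vs" for i
        using orth[OF that] herm_prod_cnj[of v "vs ! i"] herm_prod_jvec_flip[of "vs ! i" v] by auto
      show ?thesis unfolding cartan_frame_def
        using vs(1)[unfolded cartan_frame_def] zt orth 1 vv herm_prod_jvec_self(1)[of v]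
        by (auto simp: nth_append less_Suc_eq)
    qed
    then have "length (vs @ [v]) \<le> length vs" by (rule vs(2))
    then show False by simp
  qed
  then show thesis using that vs(1) by blast
qed

text \<open>Membership in \<open>p\<close> gives \<open>X (jvec v) = jvec (X\<^sup>* v)\<close>, and \<open>jvec\<close> reverses the Hermitian product.\<close>

lemma herm_prod_jvec_p:
  assumes "X \<in> p_space" shows "herm_prod (X *v jvec v) (jvec v) = herm_prod (X *v v) v"
proof -
  define w where "w = (\<chi> i. cnj (v $ i))"
  have "X *v jvec v = J_mat *v (transpose X *v w)"
    using assms unfolding p_space_iff jvec_eq w_def[symmetric] by (simp only: matrix_vector_mul_assoc)
  moreover have "J_mat *v x = jvec (\<chi> i. cnj (x $ i))" for x :: "complex^('a + 'a)"
    by (simp add: jvec_eq)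
  ultimately have "herm_prod (X *v jvec v) (jvec v) = herm_prod v (\<chi> i. cnj ((transpose X *v w) $ i))"
    by (simp add: herm_prod_jvec_jvec)
  also have "\<dots> = (\<Sum>i\<in>UNIV. \<Sum>j\<in>UNIV. v $ i * (X $ j $ i * cnj (v $ j)))"
    by (simp add: herm_prod_def matrix_vector_mult_def transpose_def w_def sum_distrib_left)
  also have "\<dots> = (\<Sum>j\<in>UNIV. \<Sum>i\<in>UNIV. v $ i * (X $ j $ i * cnj (v $ j)))" by (rule sum.swap)
  also have "\<dots> = herm_prod (X *v v) v"
    by (simp add: herm_prod_def matrix_vector_mult_def sum_distrib_right sum_distrib_left mult_ac)
  finally show ?thesis .
qed

text \<open>A matrix \<open>X\<close> that commutes with every \<open>frame_rot (vs ! i)\<close> commutes with the projections to the lines of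
\<open>vs ! i\<close> and \<open>jvec (vs ! i)\<close>, so it is diagonal in the frame, and for \<open>X\<close> in \<open>p\<close> the two eigenvalues agree by
\<open>herm_prod_jvec_p\<close>.\<close>

theorem centralizer_eq:
  fixes t :: "('n::finite + 'n) cmat set"
  assumes t: "cartan_subalgebra sp_lie t" and vs: "cartan_frame t vs" "length vs = CARD('n)"
  shows "centralizer_in_p t = cvs.span ((\<lambda>i. frame_proj (vs ! (i - 1))) ` {1..CARD('n)})"
proof
  let ?G = "(\<lambda>i. frame_proj (vs ! (i - 1))) ` {1..CARD('n)}"
  have G: "?G = (\<lambda>i. frame_proj (vs ! i)) ` {..<length vs}"
    unfolding vs(2) image_Suc_lessThan[symmetric] image_image by simp
  have fr: "frame_rot (vs ! i) \<in> t" "herm_prod (vs ! i) (vs ! i) = 1" if "i < length vs" for i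
    using vs(1) that by (auto simp: cartan_frame_def)
  have lin1: "bracket (X + Y) Z = bracket X Z + bracket Y Z" "bracket (c *\<^sub>C X) Z = c *\<^sub>C bracket X Z"
    for X Y Z :: "('n + 'n) cmat" and c
    by (simp_all add: bracket_def cmat_add_mult matrix_add_ldistrib cmat_scaleC_mult cmat_mult_scaleC
        cvs.scale_right_diff_distrib)
  have lin2: "bracket Z (X + Y) = bracket Z X + bracket Z Y" "bracket Z (c *\<^sub>C X) = c *\<^sub>C bracket Z X"
    for X Y Z :: "('n + 'n) cmat" and c
    by (simp_all add: bracket_def cmat_add_mult matrix_add_ldistrib cmat_scaleC_mult cmat_mult_scaleC
        cvs.scale_right_diff_distrib)
  show "cvs.span ?G \<subseteq> centralizer_in_p t"
  proof (rule cvs.span_minimal)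
    show "cvs.subspace (centralizer_in_p t)"
      unfolding cvs.subspace_def centralizer_in_p_def
      by (auto simp: lin2 intro: cvs.subspace_0[OF p_space_subspace] cvs.subspace_add[OF p_space_subspace]
        cvs.subspace_scale[OF p_space_subspace])
    show "?G \<subseteq> centralizer_in_p t"
      unfolding G
    proof (rule image_subsetI)
      fix i assume "i \<in> {..<length vs}"
      then have i: "i < length vs" by simp
      let ?Z = "frame_rot (vs ! i)"
      have base: "bracket H (frame_proj (vs ! i)) = 0" if H: "H \<in> t" for H
      proof -
        have c: "H ** ?Z = ?Z ** H" by (rule cartan_abelian[OF t H fr(1)[OF i]])
        have "H ** (?Z ** ?Z) = (?Z ** ?Z) ** H" by (metis c matrix_mul_assoc)
        then show ?thesis unfolding frame_rot_square[OF fr(2)[OF i]] by (simp add: matrix_mult_neg matrix_neg_mult bracket_def)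
      qed
      have "bracket H (frame_proj (vs ! i)) = 0" if H: "H \<in> cvs.span t" for H
        by (rule cvs.span_induct[OF H _ base]) (auto simp: cvs.subspace_def lin1)
      then show "frame_proj (vs ! i) \<in> centralizer_in_p t" by (simp add: centralizer_in_p_def frame_proj_p)
    qed
  qed
  show "centralizer_in_p t \<subseteq> cvs.span ?G"
  proof
    fix X assume X: "X \<in> centralizer_in_p t"
    then have Xp: "X \<in> p_space" and Xc: "\<And>H. H \<in> t \<Longrightarrow> H ** X = X ** H"
      by (auto simp: centralizer_in_p_def bracket_def intro: cvs.span_base)
    have EX: "frame_proj (vs ! i) ** X = herm_prod (X *v (vs ! i)) (vs ! i) *\<^sub>C frame_proj (vs ! i)" if i: "i < length vs" for i
    proof -
      let ?v = "vs ! i" and ?Z = "frame_rot (vs ! i)"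
      have zc: "?Z ** X = X ** ?Z" by (rule Xc[OF fr(1)[OF i]])
      have "(?Z ** ?Z) ** X = X ** (?Z ** ?Z)" by (metis zc matrix_mul_assoc)
      then have ec: "frame_proj ?v ** X = X ** frame_proj ?v"
        unfolding frame_rot_square[OF fr(2)[OF i]] by (simp add: matrix_mult_neg matrix_neg_mult)
      have o1: "outer ?v ?v = (1/2) *\<^sub>C (frame_proj ?v + (- \<i>) *\<^sub>C ?Z)"
       and o2: "outer (jvec ?v) (jvec ?v) = (1/2) *\<^sub>C (frame_proj ?v + \<i> *\<^sub>C ?Z)"
        by (simp_all add: vec_eq_iff frame_proj_def frame_rot_def algebra_simps)
      have c1: "outer ?v ?v ** X = X ** outer ?v ?v"
        unfolding o1 by (simp add: cmat_scaleC_mult cmat_mult_scaleC cmat_add_mult matrix_add_ldistrib cmat_diff_mult cmat_mult_diff ec zc)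
      have c2: "outer (jvec ?v) (jvec ?v) ** X = X ** outer (jvec ?v) (jvec ?v)"
        unfolding o2 by (simp add: cmat_scaleC_mult cmat_mult_scaleC cmat_add_mult matrix_add_ldistrib cmat_diff_mult cmat_mult_diff ec zc)
      have gen: "outer u u ** X = herm_prod (X *v u) u *\<^sub>C outer u u" if u: "herm_prod u u = 1" and c: "outer u u ** X = X ** outer u u" for u
      proof -
        have "outer u u ** X = (outer u u ** outer u u) ** X" by (simp add: outer_mult u scaleC_one)
        also have "\<dots> = outer u u ** (X ** outer u u)" unfolding c[symmetric] by (simp only: matrix_mul_assoc)
        also have "\<dots> = herm_prod (X *v u) u *\<^sub>C outer u u" unfolding mult_outer[of X] outer_mult ..
        finally show ?thesis .
      qed
      have "herm_prod (jvec ?v) (jvec ?v) = 1" using fr(2)[OF i] by (simp add: herm_prod_jvec_jvec)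
      then show ?thesis
        using gen[OF fr(2)[OF i] c1] gen[OF _ c2] herm_prod_jvec_p[OF Xp, of ?v]
        by (simp add: frame_proj_def cmat_add_mult scaleC_add_right)
    qed
    have "mat 1 - (\<Sum>i<length vs. frame_proj (vs ! i)) = 0" by (rule cartan_frame_complement(6)[OF vs])
    then have one: "mat 1 = (\<Sum>i<length vs. frame_proj (vs ! i))" by simp
    have "X = mat 1 ** X" by simp
    also have "\<dots> = (\<Sum>i<length vs. herm_prod (X *v (vs ! i)) (vs ! i) *\<^sub>C frame_proj (vs ! i))"
      unfolding one cmat_sum_mult using EX by (intro sum.cong) auto
    also have "\<dots> \<in> cvs.span ?G"
      unfolding G by (intro cvs.span_sum cvs.span_scale cvs.span_base imageI) auto
    finally show "X \<in> cvs.span ?G" .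
  qed
qed

lemma frame_proj_coeffs_zero:
  fixes t :: "('n::finite + 'n) cmat set"
  assumes vs: "cartan_frame t vs" "length vs = CARD('n)"
    and s: "(\<Sum>i\<in>{1..CARD('n)}. c i *\<^sub>C frame_proj (vs ! (i - 1))) = 0"
  shows "\<forall>i\<in>{1..CARD('n)}. c i = 0"
proof
  fix j assume j: "j \<in> {1..CARD('n)}"
  let ?v = "vs ! (j - 1)"
  have fr: "herm_prod (vs ! a) (vs ! b) = (if a = b then 1 else 0)" "herm_prod (vs ! a) (jvec (vs ! b)) = 0"
    if "a < length vs" "b < length vs" for a b
    using vs(1) that by (auto simp: cartan_frame_def)
  have "0 = (\<Sum>i\<in>{1..CARD('n)}. c i *\<^sub>C frame_proj (vs ! (i - 1))) ** frame_proj ?v" unfolding s by simp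
  also have "\<dots> = (\<Sum>i\<in>{1..CARD('n)}. if i = j then c j *\<^sub>C frame_proj ?v else 0)"
    unfolding cmat_sum_mult cmat_scaleC_mult
  proof (rule sum.cong[OF refl])
    fix i assume i: "i \<in> {1..CARD('n)}"
    have lt: "i - 1 < length vs" "j - 1 < length vs" using i j vs(2) by auto
    show "c i *\<^sub>C (frame_proj (vs ! (i - 1)) ** frame_proj ?v) = (if i = j then c j *\<^sub>C frame_proj ?v else 0)"
    proof (cases "i = j")
      case True
      then show ?thesis using fr[OF lt(2,2)] by (simp add: frame_proj_mult_self)
    next
      case False
      then have "i - 1 \<noteq> j - 1" using i j by auto
      then show ?thesis using False fr[OF lt] by (simp add: frame_proj_mult_orth)
    qed
  qed
  also have "\<dots> = c j *\<^sub>C frame_proj ?v" using j by simp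
  finally have "c j *\<^sub>C frame_proj ?v = 0" ..
  then have "trace (c j *\<^sub>C frame_proj ?v) = trace (0 :: ('n + 'n) cmat)" by (rule arg_cong)
  then have "trace (c j *\<^sub>C frame_proj ?v) = 0" by (simp add: trace_def)
  moreover have "trace (c j *\<^sub>C frame_proj ?v) = c j * trace (frame_proj ?v)" by (simp add: trace_def sum_distrib_left)
  moreover have "trace (frame_proj ?v) = 2"
    using fr[of "j - 1" "j - 1"] j vs(2) by (intro trace_frame_proj) auto
  ultimately show "c j = 0" by simp
qed

section \<open>The theorem\<close>

theorem theorem4p31:
  shows
    "(\<exists>\<phi>. alg_iso_on (ext_algebra P_wedge) (ext_p_inv :: ('n::finite + 'n) cmat ext set) \<phi> \<and>
          (\<forall>x\<in>P_wedge. \<phi> (ext_inc x) = x)) \<and>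
     (\<forall>t0 :: ('n + 'n) cmat set. cartan_subalgebra sp_lie t0 \<longrightarrow>
        (\<exists>\<psi>. vs_iso_on (P_wedge :: ('n + 'n) cmat ext set) (centralizer_in_p t0) \<psi>)) \<and>
     (\<exists>e :: nat \<Rightarrow> ('n + 'n) cmat ext.
        inj_on e {1..CARD('n)} \<and> cvs.independent (e ` {1..CARD('n)}) \<and>
        cvs.span (e ` {1..CARD('n)}) = P_wedge \<and>
        (\<forall>i\<in>{1..CARD('n)}. e i \<in> ext_power p_space (4 * i - 3)))"
proof (intro conjI allI impI)
  show "\<exists>\<phi>. alg_iso_on (ext_algebra P_wedge) (ext_p_inv :: ('n + 'n) cmat ext set) \<phi> \<and>
          (\<forall>x\<in>P_wedge. \<phi> (ext_inc x) = x)"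
    by (rule exterior_algebra_iso)
next
  fix t0 :: "('n + 'n) cmat set" assume t0: "cartan_subalgebra sp_lie t0"
  obtain vs where vs: "cartan_frame t0 vs" "length vs = CARD('n)" by (rule cartan_frame_exists[OF t0])
  show "\<exists>\<psi>. vs_iso_on (P_wedge :: ('n + 'n) cmat ext set) (centralizer_in_p t0) \<psi>"
    unfolding P_wedge_eq centralizer_eq[OF t0 vs]
    by (rule vs_iso_of_bases[OF _ primitive_coeffs_zero frame_proj_coeffs_zero[OF vs]]) auto
next
  have ind: "\<And>c. (\<Sum>i\<in>{1..CARD('n)}. c i *\<^sub>C (primitive i :: ('n + 'n) cmat ext)) = 0 \<Longrightarrow> (\<forall>i\<in>{1..CARD('n)}. c i = 0)"
    by (rule primitive_coeffs_zero)
  show "\<exists>e :: nat \<Rightarrow> ('n + 'n) cmat ext.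
        inj_on e {1..CARD('n)} \<and> cvs.independent (e ` {1..CARD('n)}) \<and>
        cvs.span (e ` {1..CARD('n)}) = P_wedge \<and>
        (\<forall>i\<in>{1..CARD('n)}. e i \<in> ext_power p_space (4 * i - 3))"
    by (intro exI[of _ primitive] conjI ballI independent_family[where f = primitive, OF finite_atLeastAtMost ind]
        P_wedge_eq[symmetric] primitive_degree)
qed

end
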